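(* Let $1<p<\infty$ and let $H\in\mathscr{B}(L^p_+,L^p_-)$ be such that $$\limsup_{\delta\to0^+}\|H\chi_\delta\|_{\mathscr{B}(L^p_+,L^p_-)}<1.$$ Then the series $\sum_{k=0}^\infty\|U_k(t)\|_{\mathscr{B}(X)}$ is convergent for any $t\geq0$ and, setting $$U_H(t)=\sum_{k=0}^\infty U_k(t),\qquad t\geq0,$$ the family $(U_H(t))_{t\geq0}$ is a $C_0$-semigroup in $X=L^p(\Omega,\mu)$ with generator $(\mathcal{T}_{H,p},\mathscr{D}(\mathcal{T}_{H,p}))$.
   Context: Setting. $\mathbb{R}^N$ is endowed with a positive Radon measure $\mu$, $\Omega\subset\mathbb{R}^N$ is a sufficiently smooth open set, $\mathscr{F}:\mathbb{R}^N\to\mathbb{R}^N$ is a globally Lipschitz vector field, and $\Phi:\mathbb{R}^N\times\mathbb{R}\to\mathbb{R}^N$ is its flow: $t\mapsto\Phi(x,t)$ is the unique solution of $\dot{\mathbf X}=\mathscr{F}(\mathbf X)$, $\mathbf X(0)=x$. With $T_t=\Phi(\cdot,t)$, it is assumed that $\mu(T_tA)=\mu(A)$ for all measurable $A\subset\mathbb{R}^N$ and all $t\in\mathbb{R}$. Functions are real-valued. For $x\in\Omega$, $\tau_\pm(x)=\inf\{s>0:\Phi(x,\pm s)\notin\Omega\}$ ($\inf\varnothing=\infty$); $\Omega_\pm=\{x\in\Omega:\tau_\pm(x)<\infty\}$, $\Omega_{\pm\infty}=\Omega\setminus\Omega_\pm$; $\Gamma_\pm=\{y\in\partial\Omega:\exists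 x\in\Omega,\ \tau_\pm(x)<\infty,\ y=\Phi(x,\pm\tau_\pm(x))\}$. For $y\in\Gamma_\pm$, $\tau_\mp(y)=\inf\{s>0:\Phi(y,\mp s)\notin\Omega\}$, and $\Gamma_{\pm\infty}=\{y\in\Gamma_\pm:\tau_\mp(y)=\infty\}$. $\mu_\pm$ are the unique positive Borel measures on $\Gamma_\pm$ such that for all $h\in L^1(\Omega,\mu)$, $\int_{\Omega_\pm}h\,d\mu=\int_{\Gamma_\pm}d\mu_\pm(y)\int_0^{\tau_\mp(y)}h(\Phi(y,\mp s))\,ds$ and $\int_{\Omega_\pm\cap\Omega_{\mp\infty}}h\,d\mu=\int_{\Gamma_{\pm\infty}}d\mu_\pm(y)\int_0^\infty h(\Phi(y,\mp s))\,ds$. $L^p_\pm=L^p(\Gamma_\pm,\mu_\pm)$. Test functions: $\mathfrak{Y}$ is the set of measurable bounded $\psi:\Omega\to\mathbb{R}$ with compact support in $\Omega$ such that for any $x\in\Omega$ the map $s\in(-\tau_-(x),\tau_+(x))\mapsto\psi(\Phi(x,s))$ is $C^1$ and $x\mapsto\frac{d}{ds}\psi(\Phi(x,s))|_{s=0}$ is measurable and bounded. $\mathscr{D}(\mathcal{T}_{\max,p})$ is the set of $f\in L^p(\Omega,\mu)$ for which there is $g\in L^p(\Omega,\mu)$ with $\int_\Omega g\psi\,d\mu=\int_\Omega f(x)\frac{d}{ds}\psi(\Phi(x,s))|_{s=0}\,d\mu(x)$ for all $\psi\in\mathfrak{Y}$; then $\mathcal{T}_{\max,p}f:=g$. Traces: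 every $f\in\mathscr{D}(\mathcal{T}_{\max,p})$ has a representative $f^\sharp$ with $f^\sharp(\Phi(x,t_1))-f^\sharp(\Phi(x,t_2))=\int_{t_1}^{t_2}[\mathcal{T}_{\max,p}f](\Phi(x,s))\,ds$ for $\mu$-a.e. $x\in\Omega$ and all $-\tau_-(x)<t_1\leq t_2<\tau_+(x)$, and the limits $\mathsf{B}^\pm f(y):=\lim_{t\to0+}f^\sharp(\Phi(y,\mp t))$ exist for $\mu_\pm$-a.e. $y\in\Gamma_\pm$. $\mathcal{T}_{H,p}$ is the restriction of $\mathcal{T}_{\max,p}$ to $\mathscr{D}(\mathcal{T}_{H,p})=\{\psi\in\mathscr{D}(\mathcal{T}_{\max,p}):\mathsf{B}^+\psi\in L^p_+,\ \mathsf{B}^-\psi=H\mathsf{B}^+\psi\}$. Truncation: for $\delta>0$, $\Gamma_+^\delta=\{z\in\Gamma_+:\tau_-(z)>\delta\}$ and $\chi_\delta\in\mathscr{B}(L^p_+)$ is multiplication by the indicator function of $\Gamma_+\setminus\Gamma_+^\delta$. The operators $U_k(t)$: $U_0(t)f(x)=f(\Phi(x,-t))$ if $t<\tau_-(x)$ and $0$ otherwise. Let $\mathscr{D}_0=\{\psi\in\mathscr{D}(\mathcal{T}_{\max,p}):\mathsf{B}^-\psi=\mathsf{B}^+\psi=0\}$. For $k\geq1$, $f\in\mathscr{D}_0$, $t\ge0$, define inductively $[U_k(t)f](x)=[H\mathsf{B}^+U_{k-1}(t-\tau_-(x))f](\Phi(x,-\tau_-(x)))$ if $\tau_-(x)<t$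 and $[U_k(t)f](x)=0$ otherwise, with $U_k(0)f=0$ (for $\mu$-a.e. $x$; a jointly measurable version of $(r,y)\mapsto[H\mathsf{B}^+U_{k-1}(r)f](y)$ is used). For every $k$ one has $U_k(t)f\in\mathscr{D}(\mathcal{T}_{\max,p})$ with $t\mapsto\mathsf{B}^+U_k(t)f\in L^p_+$ continuous, so the induction makes sense, and $U_k(t)$ extends by density of $\mathscr{D}_0$ to a bounded operator on $X$, still denoted $U_k(t)$. *)

theory Defs
  imports "HOL-Analysis.Analysis"
begin

section \<open>Lebesgue spaces, bounded operators and semigroups\<close>

text \<open>
  Elements of an \<open>L\<^sup>p\<close> space are represented by measurable functions; equality in the space is
  equality almost everywhere, and an operator is a map on representatives that is
  well defined and linear up to null sets.
\<close>

definition Lp :: "real \<Rightarrow> 'a measure \<Rightarrow> ('a \<Rightarrow> real) set" where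
  "Lp p M = {f \<in> borel_measurable M. integrable M (\<lambda>x. \<bar>f x\<bar> powr p)}"

definition Lp_norm :: "real \<Rightarrow> 'a measure \<Rightarrow> ('a \<Rightarrow> real) \<Rightarrow> real" where
  "Lp_norm p M f = (LINT x|M. \<bar>f x\<bar> powr p) powr (1 / p)"

definition Lp_operator ::
  "real \<Rightarrow> 'a measure \<Rightarrow> 'b measure \<Rightarrow> (('a \<Rightarrow> real) \<Rightarrow> ('b \<Rightarrow> real)) \<Rightarrow> bool" where
  "Lp_operator p M N T \<longleftrightarrow>
     (\<forall>f\<in>Lp p M. T f \<in> Lp p N) \<and>
     (\<forall>f\<in>Lp p M. \<forall>g\<in>Lp p M. (AE x in M. f x = g x) \<longrightarrow> (AE y in N. T f y = T g y)) \<and>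
     (\<forall>f\<in>Lp p M. \<forall>g\<in>Lp p M. AE y in N. T (\<lambda>x. f x + g x) y = T f y + T g y) \<and>
     (\<forall>f\<in>Lp p M. \<forall>c. AE y in N. T (\<lambda>x. c * f x) y = c * T f y) \<and>
     (\<exists>C. \<forall>f\<in>Lp p M. Lp_norm p N (T f) \<le> C * Lp_norm p M f)"

definition Lp_opnorm ::
  "real \<Rightarrow> 'a measure \<Rightarrow> 'b measure \<Rightarrow> (('a \<Rightarrow> real) \<Rightarrow> ('b \<Rightarrow> real)) \<Rightarrow> real" where
  "Lp_opnorm p M N T = Sup {Lp_norm p N (T f) |f. f \<in> Lp p M \<and> Lp_norm p M f \<le> 1}"

definition C0_semigroup ::
  "real \<Rightarrow> 'a measure \<Rightarrow> (real \<Rightarrow> ('a \<Rightarrow> real) \<Rightarrow> ('a \<Rightarrow> real)) \<Rightarrow> bool" where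
  "C0_semigroup p M S \<longleftrightarrow>
     (\<forall>t\<ge>0. Lp_operator p M M (S t)) \<and>
     (\<forall>f\<in>Lp p M. AE x in M. S 0 f x = f x) \<and>
     (\<forall>s\<ge>0. \<forall>t\<ge>0. \<forall>f\<in>Lp p M. AE x in M. S (s + t) f x = S s (S t f) x) \<and>
     (\<forall>f\<in>Lp p M. ((\<lambda>t. Lp_norm p M (\<lambda>x. S t f x - f x)) \<longlongrightarrow> 0) (at_right 0))"

text \<open>Unbounded operators are represented by their graphs, closed under equality a.e.\<close>

definition generator_graph ::
  "real \<Rightarrow> 'a measure \<Rightarrow> (real \<Rightarrow> ('a \<Rightarrow> real) \<Rightarrow> ('a \<Rightarrow> real)) \<Rightarrow>
     (('a \<Rightarrow> real) \<times> ('a \<Rightarrow> real)) set" where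
  "generator_graph p M S = {(f, g). f \<in> Lp p M \<and> g \<in> Lp p M \<and>
     ((\<lambda>t. Lp_norm p M (\<lambda>x. (S t f x - f x) / t - g x)) \<longlongrightarrow> 0) (at_right 0)}"


section \<open>The ambient measure and the flow\<close>

text \<open>Inner regularity is in fact automatic on a Euclidean space.\<close>

definition radon_measure :: "'a::euclidean_space measure \<Rightarrow> bool" where
  "radon_measure M \<longleftrightarrow>
     sets M = sets borel \<and>
     (\<forall>K. compact K \<longrightarrow> emeasure M K < \<infinity>) \<and>
     (\<forall>A\<in>sets borel. emeasure M A = (SUP K\<in>{K. compact K \<and> K \<subseteq> A}. emeasure M K))"

definition solves_ode :: "('a::euclidean_space \<Rightarrow> 'a) \<Rightarrow> 'a \<Rightarrow> (real \<Rightarrow> 'a) \<Rightarrow> bool" where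
  "solves_ode F x X \<longleftrightarrow> X 0 = x \<and> (\<forall>t. (X has_vector_derivative F (X t)) (at t))"

definition is_flow :: "('a::euclidean_space \<Rightarrow> 'a) \<Rightarrow> ('a \<Rightarrow> real \<Rightarrow> 'a) \<Rightarrow> bool" where
  "is_flow F \<Phi> \<longleftrightarrow> (\<forall>x. solves_ode F x (\<Phi> x) \<and> (\<forall>X. solves_ode F x X \<longrightarrow> X = \<Phi> x))"


section \<open>Transport operators\<close>

text \<open>
  The sign \<open>\<sigma> = 1\<close> or \<open>\<sigma> = -1\<close> selects the \<open>+\<close> or \<open>-\<close> version of a notion.
  \<open>\<mu>p\<close> and \<open>\<mu>m\<close> are the measures on the outgoing and the incoming boundary.
\<close>

locale transport_data =
  fixes \<Omega> :: "'a::euclidean_space set"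
    and \<Phi> :: "'a \<Rightarrow> real \<Rightarrow> 'a"
    and \<mu> \<mu>p \<mu>m :: "'a measure"
    and p :: real
    and H :: "('a \<Rightarrow> real) \<Rightarrow> ('a \<Rightarrow> real)"
begin

definition tau :: "real \<Rightarrow> 'a \<Rightarrow> ereal" where
  "tau \<sigma> x = Inf {ereal s |s. 0 < s \<and> \<Phi> x (\<sigma> * s) \<notin> \<Omega>}"

definition Omega_fin :: "real \<Rightarrow> 'a set" where
  "Omega_fin \<sigma> = {x \<in> \<Omega>. tau \<sigma> x < \<infinity>}"

definition Omega_inf :: "real \<Rightarrow> 'a set" where
  "Omega_inf \<sigma> = \<Omega> - Omega_fin \<sigma>"

definition Gam :: "real \<Rightarrow> 'a set" where
  "Gam \<sigma> = {y \<in> frontier \<Omega>.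
     \<exists>x\<in>\<Omega>. tau \<sigma> x < \<infinity> \<and> y = \<Phi> x (\<sigma> * real_of_ereal (tau \<sigma> x))}"

definition Gam_inf :: "real \<Rightarrow> 'a set" where
  "Gam_inf \<sigma> = {y \<in> Gam \<sigma>. tau (-\<sigma>) y = \<infinity>}"

abbreviation \<mu>\<Omega> :: "'a measure" where
  "\<mu>\<Omega> \<equiv> restrict_space \<mu> \<Omega>"

text \<open>
  The integrability clauses express that the iterated integrals make sense. The measure
  satisfying these conditions is unique.
\<close>

definition boundary_measure :: "real \<Rightarrow> 'a measure \<Rightarrow> bool" where
  "boundary_measure \<sigma> N \<longleftrightarrow>
     space N = Gam \<sigma> \<and> sets N = sets (restrict_space borel (Gam \<sigma>)) \<and>
     (\<forall>h :: 'a \<Rightarrow> real. integrable \<mu>\<Omega> h \<longrightarrow>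
        (AE y in N. set_integrable lborel {s. 0 < s \<and> ereal s < tau (-\<sigma>) y}
           (\<lambda>s. h (\<Phi> y (- \<sigma> * s)))) \<and>
        integrable N (\<lambda>y. LINT s:{s. 0 < s \<and> ereal s < tau (-\<sigma>) y}|lborel.
           h (\<Phi> y (- \<sigma> * s))) \<and>
        (LINT x:Omega_fin \<sigma>|\<mu>. h x) =
          (LINT y|N. (LINT s:{s. 0 < s \<and> ereal s < tau (-\<sigma>) y}|lborel.
             h (\<Phi> y (- \<sigma> * s)))) \<and>
        (LINT x:Omega_fin \<sigma> \<inter> Omega_inf (-\<sigma>)|\<mu>. h x) =
          (LINT y:Gam_inf \<sigma>|N. (LINT s:{0<..}|lborel. h (\<Phi> y (- \<sigma> * s)))))"

definition flow_deriv :: "('a \<Rightarrow> real) \<Rightarrow> 'a \<Rightarrow> real" where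
  "flow_deriv \<psi> x = deriv (\<lambda>s. \<psi> (\<Phi> x s)) 0"

definition test_functions :: "('a \<Rightarrow> real) set" where
  "test_functions = {\<psi>.
     \<psi> \<in> borel_measurable (restrict_space borel \<Omega>) \<and> bounded (\<psi> ` \<Omega>) \<and>
     compact (closure {x \<in> \<Omega>. \<psi> x \<noteq> 0}) \<and> closure {x \<in> \<Omega>. \<psi> x \<noteq> 0} \<subseteq> \<Omega> \<and>
     (\<forall>x\<in>\<Omega>. (\<lambda>s. \<psi> (\<Phi> x s)) C1_differentiable_on
              {s. - tau (-1) x < ereal s \<and> ereal s < tau 1 x}) \<and>
     flow_deriv \<psi> \<in> borel_measurable (restrict_space borel \<Omega>) \<and>
     bounded (flow_deriv \<psi> ` \<Omega>)}"

definition T_max_graph :: "(('a \<Rightarrow> real) \<times> ('a \<Rightarrow> real)) set" where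
  "T_max_graph = {(f, g). f \<in> Lp p \<mu>\<Omega> \<and> g \<in> Lp p \<mu>\<Omega> \<and>
     (\<forall>\<psi>\<in>test_functions. (LINT x|\<mu>\<Omega>. g x * \<psi> x) = (LINT x|\<mu>\<Omega>. f x * flow_deriv \<psi> x))}"

definition sharp_rep :: "('a \<Rightarrow> real) \<Rightarrow> ('a \<Rightarrow> real) \<Rightarrow> bool" where
  "sharp_rep f fs \<longleftrightarrow>
     fs \<in> borel_measurable \<mu>\<Omega> \<and> (AE x in \<mu>\<Omega>. fs x = f x) \<and>
     (\<exists>g. (f, g) \<in> T_max_graph \<and>
        (AE x in \<mu>\<Omega>. \<forall>t1 t2. - tau (-1) x < ereal t1 \<and> t1 \<le> t2 \<and> ereal t2 < tau 1 x \<longrightarrow>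
           set_integrable lborel {t1..t2} (\<lambda>s. g (\<Phi> x s)) \<and>
           fs (\<Phi> x t1) - fs (\<Phi> x t2) = (LINT s:{t1..t2}|lborel. g (\<Phi> x s))))"

text \<open>
  \<open>has_trace \<sigma> N f b\<close>: the function \<open>f\<close> lies in the domain of the maximal operator and \<open>b\<close> is a
  representative of its trace, where \<open>N\<close> is the measure on \<open>Gam \<sigma>\<close>.
\<close>

definition has_trace :: "real \<Rightarrow> 'a measure \<Rightarrow> ('a \<Rightarrow> real) \<Rightarrow> ('a \<Rightarrow> real) \<Rightarrow> bool" where
  "has_trace \<sigma> N f b \<longleftrightarrow> b \<in> borel_measurable N \<and>
     (\<exists>fs. sharp_rep f fs \<and> (AE y in N. ((\<lambda>t. fs (\<Phi> y (- \<sigma> * t))) \<longlongrightarrow> b y) (at_right 0)))"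

abbreviation has_trace_plus :: "('a \<Rightarrow> real) \<Rightarrow> ('a \<Rightarrow> real) \<Rightarrow> bool" where
  "has_trace_plus \<equiv> has_trace 1 \<mu>p"

abbreviation has_trace_minus :: "('a \<Rightarrow> real) \<Rightarrow> ('a \<Rightarrow> real) \<Rightarrow> bool" where
  "has_trace_minus \<equiv> has_trace (-1) \<mu>m"

definition T_H_graph :: "(('a \<Rightarrow> real) \<times> ('a \<Rightarrow> real)) set" where
  "T_H_graph = {(f, g) \<in> T_max_graph.
     \<exists>b\<in>Lp p \<mu>p. has_trace_plus f b \<and> has_trace_minus f (H b)}"

definition chi :: "real \<Rightarrow> ('a \<Rightarrow> real) \<Rightarrow> ('a \<Rightarrow> real)" where
  "chi \<delta> f = (\<lambda>z. indicator (Gam 1 - {z \<in> Gam 1. ereal \<delta> < tau (-1) z}) z * f z)"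

definition D0 :: "('a \<Rightarrow> real) set" where
  "D0 = {f. has_trace_plus f (\<lambda>_. 0) \<and> has_trace_minus f (\<lambda>_. 0)}"

definition U_zero :: "real \<Rightarrow> ('a \<Rightarrow> real) \<Rightarrow> ('a \<Rightarrow> real)" where
  "U_zero t f = (\<lambda>x. if ereal t < tau (-1) x then f (\<Phi> x (- t)) else 0)"

text \<open>For \<open>W r\<close> standing for \<open>U\<^sub>k\<^sub>-\<^sub>1(r) f\<close>: a jointly measurable version of the
  outgoing trace mapped by \<open>H\<close>.\<close>

definition H_trace_version :: "(real \<Rightarrow> 'a \<Rightarrow> real) \<Rightarrow> (real \<Rightarrow> 'a \<Rightarrow> real) \<Rightarrow> bool" where
  "H_trace_version W V \<longleftrightarrow>
     (\<lambda>(r, y). V r y) \<in> borel_measurable (borel \<Otimes>\<^sub>M \<mu>m) \<and>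
     (\<forall>r\<ge>0. \<exists>b\<in>Lp p \<mu>p. has_trace_plus (W r) b \<and> (AE y in \<mu>m. V r y = H b y))"

text \<open>The inductive definition, meaningful for \<open>f \<in> D0\<close> and \<open>t \<ge> 0\<close>. The choice of the version
  affects the result only on a null set.\<close>

primrec U_pre :: "nat \<Rightarrow> real \<Rightarrow> ('a \<Rightarrow> real) \<Rightarrow> ('a \<Rightarrow> real)" where
  "U_pre 0 = U_zero"
| "U_pre (Suc k) = (\<lambda>t f x.
     if tau (-1) x < ereal t
     then (SOME V. H_trace_version (\<lambda>r. U_pre k r f) V)
            (t - real_of_ereal (tau (-1) x)) (\<Phi> x (- real_of_ereal (tau (-1) x)))
     else 0)"

text \<open>The bounded extension is unique up to null sets because \<open>D0\<close> is dense.\<close>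

definition U :: "nat \<Rightarrow> real \<Rightarrow> ('a \<Rightarrow> real) \<Rightarrow> ('a \<Rightarrow> real)" where
  "U k t = (if k = 0 then U_zero t
     else (SOME T. Lp_operator p \<mu>\<Omega> \<mu>\<Omega> T \<and> (\<forall>f\<in>D0. AE x in \<mu>\<Omega>. T f x = U_pre k t f x)))"

text \<open>The sum of the series in the operator norm.\<close>

definition U_H :: "real \<Rightarrow> ('a \<Rightarrow> real) \<Rightarrow> ('a \<Rightarrow> real)" where
  "U_H t = (SOME T. Lp_operator p \<mu>\<Omega> \<mu>\<Omega> T \<and>
     (\<lambda>n. Lp_opnorm p \<mu>\<Omega> \<mu>\<Omega> (\<lambda>f x. T f x - (\<Sum>k<n. U k t f x))) \<longlonglongrightarrow> 0)"

end

text \<open>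
  No boundary regularity of the open set \<open>\<Omega>\<close> is required: the sets \<open>Gam \<sigma>\<close> and the functions
  \<open>tau \<sigma>\<close> are Borel for every open \<open>\<Omega>\<close>.
\<close>

locale transport_setting = transport_data \<Omega> \<Phi> \<mu> \<mu>p \<mu>m p H
  for \<Omega> :: "'a::euclidean_space set"
    and \<Phi> :: "'a \<Rightarrow> real \<Rightarrow> 'a"
    and \<mu> \<mu>p \<mu>m :: "'a measure"
    and p :: real
    and H :: "('a \<Rightarrow> real) \<Rightarrow> ('a \<Rightarrow> real)" +
  fixes F :: "'a \<Rightarrow> 'a"
  assumes radon: "radon_measure \<mu>"
    and open_Omega: "open \<Omega>"
    and lipschitz: "\<exists>L. L-lipschitz_on UNIV F"
    and flow: "is_flow F \<Phi>"
    and invariant: "\<And>A t. A \<in> sets \<mu> \<Longrightarrow> emeasure \<mu> ((\<lambda>x. \<Phi> x t) ` A) = emeasure \<mu> A"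
    and mu_plus: "boundary_measure 1 \<mu>p"
    and mu_minus: "boundary_measure (-1) \<mu>m"

end

theory Submission
 imports Defs
begin

text \<open>Let \<open>v(r, y)\<close> be the flux entering at time \<open>r\<close> through the boundary point \<open>y\<close>, when the
 initial value \<open>f\<close> is transported and re-enters through \<open>H\<close>. It is the fixed point of
 \<open>v = H (out0 f + pass v)\<close>, where \<open>out0\<close> is the flux leaving without having met the boundary and
 \<open>pass\<close> transports the entering flux to the opposite end of its chord. In \<open>L\<^sup>p\<close> with the weight
 \<open>exp (- lam * p * r)\<close> in time, the map \<open>H \<circ> pass\<close> is a contraction for large \<open>lam\<close>: chords longer
 than \<open>\<delta>\<close> gain a factor \<open>exp (- lam * \<delta>)\<close>, and shorter ones are controlled by \<open>\<parallel>H \<chi>\<^sub>\<delta>\<parallel> < 1\<close>. The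
 iterates of this fixed-point equation are the Dyson--Phillips terms. Integration in time commutes
 with all the operators involved and turns the flux of the derivative of \<open>f\<close> into the flux of \<open>f\<close>;
 this identifies the traces of \<open>U\<^sub>k(t) f\<close> and shows that the generator extends \<open>T\<^sub>H\<close>. An explicit
 resolvent of \<open>T\<^sub>H\<close> and the absence of large eigenvalues of the generator give equality.\<close>

text \<open>The definition of \<open>U_pre (Suc k)\<close> asks for the trace of
  \<open>U_pre k r f\<close> at every single time r, which need not exist for a general element of
  Lp. The unknown is therefore the flux, a class of functions of time and boundary point that makes
  sense for all f; for f in \<open>D0\<close> it is the time primitive of another flux and so has a
  definite value at each r. Since H acts on functions of the boundary point alone and is determined
  only up to null sets, applying it at all times at once needs a jointly measurable version, the
  purpose of \<open>operator_lift\<close>. Commutation with integrals over time is built into that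
  notion, because primitives and Laplace transforms of fluxes are computed with it. A delay by the
  length l of a chord multiplies the weighted norm by \<open>exp (- lam * l)\<close>, which is the
  origin of \<open>lam\<close>. The resolvent is taken at \<open>lam * p\<close>, the exponent of
  the weight itself, so that the Laplace transform of a flux is its integral against
  \<open>\<nu>\<close>. The semigroup grows at most like \<open>exp (lam * t)\<close>, and
  \<open>lam < lam * p\<close> because p exceeds 1.\<close>

abbreviation (input) borel_functions ("\<B>") where "\<B> \<equiv> borel_measurable"

abbreviation (input) "Lp_op \<equiv> Lp_operator"

abbreviation (input) "ind \<equiv> indicator"

abbreviation (input) "lintegrable \<equiv> set_integrable lborel"

notation (input) pair_measure (infixr "\<otimes>" 80)

notation (input) tendsto (infixr "--->" 55)

abbreviation (input) seq_tendsto (infixr "---->" 60) where "X ----> L \<equiv> (X ---> L) sequentially"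

lemmas set_int_defs = set_integrable_def set_lebesgue_integral_def

section \<open>Lebesgue spaces over an arbitrary measure: norm, series, dominated
  convergence\<close>

lemma powr_convex_comb:
 fixes s x y p :: real
 assumes "1 \<le> p" "0 \<le> s" "s \<le> 1" "0 \<le> x" "0 \<le> y"
 shows "(s * x + (1 - s) * y) powr p \<le> s * x powr p + (1 - s) * y powr p"
proof -
 \<comment> \<open>\<open>powr_convex\<close> covers positive arguments only. When x or y vanishes,
   the claim reduces to \<open>t powr p \<le> t\<close> on the unit interval.\<close>
 have z: "(t * u) powr p \<le> t * u powr p" if "0 \<le> t" "t \<le> 1" "0 \<le> u" for t u :: real
 proof (cases "t = 0")
  case False
  have "t powr p \<le> t powr 1" using that assms False by (intro powr_mono') auto
  then show ?thesis using that False by (simp add: powr_mult mult_right_mono)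
 qed simp
 consider "x = 0" | "y = 0" | "x > 0" "y > 0" using assms by linarith
 then show ?thesis
 proof cases
  case 1 then show ?thesis using z[of "1 - s" y] assms by simp
 next
  case 2 then show ?thesis using z[of s x] assms by simp
 next
  case 3
  then show ?thesis using convex_onD[OF powr_convex[OF assms(1)], of "1 - s" x y] assms by (simp add: algebra_simps)
 qed
qed

text \<open>Prepares Jensen's inequality. The point x = 0 lies outside the open half-line on which
  convexity is available; there the left-hand side is \<open>(1 - p) * c powr p\<close>, which is
  not positive.\<close>

lemma powr_above_tangent:
 fixes c x p :: real
 assumes "1 \<le> p" "0 < c" "0 \<le> x" shows "c powr p + p * c powr (p - 1) * (x - c) \<le> x powr p"
proof (cases "x = 0")
 case True
 have "c powr p = c * c powr (p - 1)" using assms by (simp add: powr_diff)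
 then have "c powr p + p * c powr (p - 1) * (0 - c) = (1 - p) * c powr p" by (simp add: algebra_simps)
 also have "... \<le> 0" using assms by (simp add: mult_nonpos_nonneg)
 finally show ?thesis using True by simp
next
 case False
 have "x powr p - c powr p \<ge> (p * c powr (p - 1)) * (x - c)"
 proof (rule convex_on_imp_above_tangent[OF powr_convex[OF assms(1)]])
  show "((\<lambda>x. x powr p) has_field_derivative p * c powr (p - 1)) (at c within {0<..})"
   using assms by (auto intro!: derivative_eq_intros)
 qed (use assms False in \<open>auto simp: interior_open\<close>)
 then show ?thesis by simp
qed

lemma Lp_meas [measurable_dest]: "f \<in> Lp p M ==> f \<in> \<B> M" by (simp add: Lp_def)

abbreviation Lp_nn :: "real => 'a measure => ('a => real) => ennreal" where
 "Lp_nn p M f \<equiv> \<integral>\<^sup>+x. ennreal (\<bar>f x\<bar> powr p) \<partial>M"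

lemma Lp_iff_nn_integral: "f \<in> Lp p M \<longleftrightarrow> f \<in> \<B> M \<and> (Lp_nn p M f) < \<infinity>" by (auto simp: Lp_def integrable_iff_bounded)

lemma Lp_norm_nonneg [simp]: "0 \<le> Lp_norm p M f" by (simp add: Lp_norm_def)

lemma Lp_norm_powr: "0 < p ==> Lp_norm p M f powr p = (LINT x|M. \<bar>f x\<bar> powr p)" by (simp add: Lp_norm_def powr_powr)

lemma nn_integral_Lp_norm:
 assumes "f \<in> Lp p M" "0 < p" shows "(Lp_nn p M f) = ennreal (Lp_norm p M f powr p)"
 using assms by (simp add: Lp_norm_powr nn_integral_eq_integral Lp_def)

lemma Lp_leI:
 assumes "f \<in> \<B> M" "0 \<le> C" "0 < p" and "(Lp_nn p M f) \<le> ennreal (C powr p)" shows "f \<in> Lp p M" "Lp_norm p M f \<le> C"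
proof -
 show f: "f \<in> Lp p M" using assms by (auto simp: Lp_iff_nn_integral intro: le_less_trans)
 then have "Lp_norm p M f powr p \<le> C powr p" using assms nn_integral_Lp_norm[OF f assms(3)] by simp
 then show "Lp_norm p M f \<le> C" using powr_less_mono2[OF assms(3,2), of "Lp_norm p M f"] by force
qed

lemma Lp_cong_AE:
 assumes "f \<in> Lp p M" "AE x in M. f x = g x" "g \<in> \<B> M" shows "g \<in> Lp p M"
proof -
 have "(Lp_nn p M f) = (Lp_nn p M g)" using assms(2) by (intro nn_integral_cong_AE) (auto elim!: eventually_mono)
 then show ?thesis using assms by (simp add: Lp_iff_nn_integral)
qed

lemma Lp_norm_cong_AE:
 assumes "AE x in M. f x = g x" "f \<in> \<B> M" "g \<in> \<B> M" shows "Lp_norm p M f = Lp_norm p M g"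
 unfolding Lp_norm_def using assms by (auto intro!: arg_cong2[where f="(powr)"] integral_cong_AE)

lemma Lp_mono_AE:
 assumes "g \<in> Lp p M" "f \<in> \<B> M" "AE x in M. \<bar>f x\<bar> \<le> \<bar>g x\<bar>" "0 < p" shows "f \<in> Lp p M" "Lp_norm p M f \<le> Lp_norm p M g"
proof -
 have "(Lp_nn p M f) \<le> (Lp_nn p M g)"
  using assms(3) by (intro nn_integral_mono_AE) (auto intro!: powr_mono2 simp: assms(4) less_imp_le elim!: eventually_mono)
 then show "f \<in> Lp p M" "Lp_norm p M f \<le> Lp_norm p M g"
  using Lp_leI[OF assms(2), of "Lp_norm p M g" p] nn_integral_Lp_norm[OF assms(1,4)] assms(4) by auto
qed

lemma Lp_scale:
 assumes "f \<in> Lp p M" "0 < p" shows "(\<lambda>x. c * f x) \<in> Lp p M" "Lp_norm p M (\<lambda>x. c * f x) = \<bar>c\<bar> * Lp_norm p M f"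
 using assms by (auto simp: Lp_def Lp_norm_def abs_mult powr_mult powr_powr)

lemma Lp_zero [simp]: "(\<lambda>x. 0) \<in> Lp p M" "Lp_norm p M (\<lambda>x. 0) = 0" by (auto simp: Lp_def Lp_norm_def)

lemma Lp_norm_eq_0_iff:
 assumes "f \<in> Lp p M" "0 < p" shows "Lp_norm p M f = 0 \<longleftrightarrow> (AE x in M. f x = 0)"
proof -
 have "Lp_norm p M f = 0 \<longleftrightarrow> (LINT x|M. \<bar>f x\<bar> powr p) = 0" by (simp add: Lp_norm_def)
 also have "... \<longleftrightarrow> (AE x in M. \<bar>f x\<bar> powr p = 0)" using assms by (intro integral_nonneg_eq_0_iff_AE) (auto simp: Lp_def)
 finally show ?thesis by simp
qed

lemma Lp_norm_abs: "Lp_norm p M (\<lambda>x. \<bar>f x\<bar>) = Lp_norm p M f" by (simp add: Lp_norm_def)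

lemma Lp_abs: "f \<in> Lp p M ==> (\<lambda>x. \<bar>f x\<bar>) \<in> Lp p M" by (auto simp: Lp_def)

lemma Lp_add:
 assumes "1 \<le> p" "f \<in> Lp p M" "g \<in> Lp p M" shows "(\<lambda>x. f x + g x) \<in> Lp p M"
proof -
 have le: "\<bar>f x + g x\<bar> powr p \<le> 2 powr p * (\<bar>f x\<bar> powr p + \<bar>g x\<bar> powr p)" for x
 proof -
  have "\<bar>f x + g x\<bar> powr p \<le> (2 * max \<bar>f x\<bar> \<bar>g x\<bar>) powr p" using assms by (intro powr_mono2) auto
  also have "... = 2 powr p * max \<bar>f x\<bar> \<bar>g x\<bar> powr p" by (subst powr_mult) auto
  also have "... \<le> 2 powr p * (\<bar>f x\<bar> powr p + \<bar>g x\<bar> powr p)" by (intro mult_left_mono) (auto simp: max_def)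
  finally show ?thesis .
 qed
 have i: "integrable M (\<lambda>x. 2 powr p * (\<bar>f x\<bar> powr p + \<bar>g x\<bar> powr p))" using assms by (auto simp: Lp_def)
 have [measurable]: "f \<in> \<B> M" "g \<in> \<B> M" using assms by (auto simp: Lp_def)
 have "integrable M (\<lambda>x. \<bar>f x + g x\<bar> powr p)"
  by (rule Bochner_Integration.integrable_bound[OF i]) (measurable, simp add: le)
 then show ?thesis by (simp add: Lp_def)
qed

lemma Lp_norm_triangle:
 assumes "1 \<le> p" "f \<in> Lp p M" "g \<in> Lp p M" shows "Lp_norm p M (\<lambda>x. f x + g x) \<le> Lp_norm p M f + Lp_norm p M g"
proof -
 have m [measurable]: "f \<in> \<B> M" "g \<in> \<B> M" using assms by (auto simp: Lp_def)
 have p: "0 < p" using assms by simp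
 note fg = Lp_add[OF assms]
 let ?a = "Lp_norm p M f" and ?b = "Lp_norm p M g"
 consider "?a = 0" | "?b = 0" | "?a > 0" "?b > 0" using Lp_norm_nonneg[of p M f] Lp_norm_nonneg[of p M g] by linarith
 then show ?thesis
 proof cases
  case 1
  then have "AE x in M. f x = 0" using Lp_norm_eq_0_iff assms p by blast
  then have "Lp_norm p M (\<lambda>x. f x + g x) = Lp_norm p M g" by (intro Lp_norm_cong_AE) auto
  then show ?thesis using 1 by simp
 next
  case 2
  then have "AE x in M. g x = 0" using Lp_norm_eq_0_iff assms p by blast
  then have "Lp_norm p M (\<lambda>x. f x + g x) = Lp_norm p M f" by (intro Lp_norm_cong_AE) auto
  then show ?thesis using 2 by simp
 next
  case 3
  \<comment> \<open>With this weight, \<open>\<bar>f x + g x\<bar> / (?a + ?b)\<close> is at most a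
    convex combination of the normalised functions \<open>\<bar>f x\<bar> / ?a\<close> and
    \<open>\<bar>g x\<bar> / ?b\<close>, whose p-th powers have integral 1. The division is why
    vanishing norms are treated separately.\<close>
  let ?s = "?a / (?a + ?b)"
  have s: "0 \<le> ?s" "?s \<le> 1" "1 - ?s = ?b / (?a + ?b)" using 3 by (auto simp: field_simps)
  have le: "\<bar>f x + g x\<bar> powr p \<le> (?a + ?b) powr p * (?s * (\<bar>f x\<bar> powr p / ?a powr p) + (1 - ?s) * (\<bar>g x\<bar> powr p / ?b powr p))" for x
  proof -
   have "\<bar>f x + g x\<bar> powr p \<le> (\<bar>f x\<bar> + \<bar>g x\<bar>) powr p" using p by (intro powr_mono2) auto
   also have "\<bar>f x\<bar> + \<bar>g x\<bar> = (?a + ?b) * (?s * (\<bar>f x\<bar> / ?a) + (1 - ?s) * (\<bar>g x\<bar> / ?b))"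
    unfolding s(3) using 3 by (simp add: distrib_left)
   also have "... powr p = (?a + ?b) powr p * (?s * (\<bar>f x\<bar> / ?a) + (1 - ?s) * (\<bar>g x\<bar> / ?b)) powr p"
    by (subst powr_mult) (use s 3 in auto)
   also have "... \<le> (?a + ?b) powr p * (?s * (\<bar>f x\<bar> / ?a) powr p + (1 - ?s) * (\<bar>g x\<bar> / ?b) powr p)"
    using s assms by (intro mult_left_mono powr_convex_comb) auto
   finally show ?thesis using 3 by (simp add: powr_divide)
  qed
  have "(LINT x|M. \<bar>f x + g x\<bar> powr p) \<le> (LINT x|M. (?a + ?b) powr p * (?s * (\<bar>f x\<bar> powr p / ?a powr p) + (1 - ?s) * (\<bar>g x\<bar> powr p / ?b powr p)))"
   using le fg assms by (intro integral_mono) (auto simp: Lp_def)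
  also have "... = (?a + ?b) powr p * (?s * (?a powr p / ?a powr p) + (1 - ?s) * (?b powr p / ?b powr p))"
   using assms p by (subst Bochner_Integration.integral_mult_right | subst Bochner_Integration.integral_add | simp add: Lp_def Lp_norm_powr)+
  also have "... = (?a + ?b) powr p" using 3 by simp
  finally have "Lp_norm p M (\<lambda>x. f x + g x) powr p \<le> (?a + ?b) powr p" by (simp add: Lp_norm_powr p)
  then show ?thesis using powr_less_mono2[OF p, of "?a + ?b" "Lp_norm p M (\<lambda>x. f x + g x)"] 3 by force
 qed
qed

lemma Lp_diff:
 assumes "1 \<le> p" "f \<in> Lp p M" "g \<in> Lp p M" shows "(\<lambda>x. f x - g x) \<in> Lp p M"
 using Lp_add[OF assms(1,2) Lp_scale(1)[OF assms(3), of "-1"]] assms(1) by simp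

lemma Lp_norm_minus_commute: "Lp_norm p M (\<lambda>x. f x - g x) = Lp_norm p M (\<lambda>x. g x - f x)"
 by (simp add: Lp_norm_def abs_minus_commute)

lemma Lp_norm_triangle_diff:
 assumes "1 \<le> p" "f \<in> Lp p M" "g \<in> Lp p M" shows "Lp_norm p M (\<lambda>x. f x - g x) \<le> Lp_norm p M f + Lp_norm p M g"
 using Lp_norm_triangle[OF assms(1,2) Lp_scale(1)[OF assms(3), of "-1"]] assms
  Lp_scale(2)[OF assms(3), of "-1"] by simp

lemma Lp_norm_triangle_mid:
 assumes "1 \<le> p" "f \<in> Lp p M" "g \<in> Lp p M" "h \<in> Lp p M"
 shows "Lp_norm p M (\<lambda>x. f x - h x) \<le> Lp_norm p M (\<lambda>x. f x - g x) + Lp_norm p M (\<lambda>x. g x - h x)"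
 using Lp_norm_triangle[OF assms(1) Lp_diff[OF assms(1-3)] Lp_diff[OF assms(1,3,4)]] by simp

lemma Lp_norm_diff_le:
 assumes "1 \<le> p" "f \<in> Lp p M" "g \<in> Lp p M" shows "Lp_norm p M f - Lp_norm p M g \<le> Lp_norm p M (\<lambda>x. f x - g x)"
 using Lp_norm_triangle[OF assms(1) Lp_diff[OF assms(1-3)] assms(3)] by simp

lemma Lp_sum:
 assumes "1 \<le> p" "\<And>i. i \<in> I ==> f i \<in> Lp p M"
 shows "(\<lambda>x. \<Sum>i\<in>I. f i x) \<in> Lp p M" "Lp_norm p M (\<lambda>x. \<Sum>i\<in>I. f i x) \<le> (\<Sum>i\<in>I. Lp_norm p M (f i))"
proof -
 have "(\<lambda>x. \<Sum>i\<in>I. f i x) \<in> Lp p M \<and> Lp_norm p M (\<lambda>x. \<Sum>i\<in>I. f i x) \<le> (\<Sum>i\<in>I. Lp_norm p M (f i))"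
 proof (cases "finite I")
  case True
  then show ?thesis using assms(2)
  proof (induction I rule: finite_induct)
   case (insert i I)
   then have 1: "f i \<in> Lp p M" "(\<lambda>x. \<Sum>i\<in>I. f i x) \<in> Lp p M"
    "Lp_norm p M (\<lambda>x. \<Sum>i\<in>I. f i x) \<le> (\<Sum>i\<in>I. Lp_norm p M (f i))" by auto
   show ?case using Lp_add[OF assms(1) 1(1,2)] Lp_norm_triangle[OF assms(1) 1(1,2)] 1(3) insert(1,2) by simp
  qed simp
 qed simp
 then show "(\<lambda>x. \<Sum>i\<in>I. f i x) \<in> Lp p M" "Lp_norm p M (\<lambda>x. \<Sum>i\<in>I. f i x) \<le> (\<Sum>i\<in>I. Lp_norm p M (f i))" by auto
qed

lemma Lp_dominated:
 assumes p: "0 < p" and w: "w \<in> Lp p M" and m: "\<And>n. f n \<in> \<B> M" "g \<in> \<B> M" and lim: "AE x in M. (\<lambda>n. f n x) ----> g x"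
  and le: "\<And>n. AE x in M. \<bar>f n x - g x\<bar> \<le> \<bar>w x\<bar>" shows "(\<lambda>n. Lp_norm p M (\<lambda>x. f n x - g x)) ----> 0"
proof -
 have [measurable]: "w \<in> \<B> M" "\<And>n. f n \<in> \<B> M" "g \<in> \<B> M" using w m by (auto simp: Lp_def)
 have "(\<lambda>n. LINT x|M. \<bar>f n x - g x\<bar> powr p) ----> (LINT x|M. 0)"
 proof (rule integral_dominated_convergence[where w="\<lambda>x. \<bar>w x\<bar> powr p"])
  show "AE x in M. (\<lambda>n. \<bar>f n x - g x\<bar> powr p) ----> 0" using lim
  proof eventually_elim
   case (elim x)
   then have "(\<lambda>n. \<bar>f n x - g x\<bar>) ----> 0" by (simp add: LIM_zero tendsto_rabs_zero)
   then show ?case using p by (intro tendsto_zero_powrI[where b=p]) auto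
  qed
  show "AE x in M. norm (\<bar>f n x - g x\<bar> powr p) \<le> \<bar>w x\<bar> powr p" for n
   using le[of n] by eventually_elim (auto intro!: powr_mono2 simp: p less_imp_le)
 qed (use w in \<open>auto simp: Lp_def\<close>)
 then show ?thesis unfolding Lp_norm_def using p by (intro tendsto_zero_powrI[where b="1/p"]) auto
qed

text \<open>Riesz-Fischer in series form: the partial sums of the absolute values have bounded norm,
  so by monotone convergence the supremum of their p-th powers is integrable. This gives absolute
  summability almost everywhere and a common majorant.\<close>

lemma Lp_series:
 assumes p: "1 \<le> p" and h: "\<And>k. h k \<in> Lp p M" and sm: "summable (\<lambda>k. Lp_norm p M (h k))"
 shows "AE x in M. summable (\<lambda>k. h k x)" "AE x in M. (\<lambda>k. h k x) ----> 0" "(\<lambda>x. \<Sum>k. h k x) \<in> Lp p M"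
  "(\<lambda>n. Lp_norm p M (\<lambda>x. (\<Sum>k<n. h k x) - (\<Sum>k. h k x))) ----> 0" "Lp_norm p M (\<lambda>x. \<Sum>k. h k x) \<le> (\<Sum>k. Lp_norm p M (h k))"
proof -
 let ?s = "\<lambda>x. \<Sum>k. h k x" and ?d = "\<lambda>n x. (\<Sum>k<n. h k x) - (\<Sum>k. h k x)"
 have p0: "0 < p" using p by simp
 have [measurable]: "\<And>k. h k \<in> \<B> M" using h by (auto simp: Lp_def)
 define B where "B = (\<Sum>k. Lp_norm p M (h k))"
 have B: "0 \<le> B" unfolding B_def using sm by (intro suminf_nonneg) auto
 define S where "S n x = (\<Sum>k<n. \<bar>h k x\<bar>)" for n x
 have S0: "0 \<le> S n x" for n x unfolding S_def by (intro sum_nonneg) auto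
 have Sm [measurable]: "\<And>n. S n \<in> \<B> M" unfolding S_def by measurable
 have SL: "S n \<in> Lp p M" "Lp_norm p M (S n) \<le> B" for n
 proof -
  show "S n \<in> Lp p M" unfolding S_def using p h by (intro Lp_sum Lp_abs)
  have "Lp_norm p M (S n) \<le> (\<Sum>k<n. Lp_norm p M (\<lambda>x. \<bar>h k x\<bar>))" unfolding S_def using p h by (intro Lp_sum Lp_abs)
  also have "... \<le> B" unfolding B_def Lp_norm_abs using sm by (intro sum_le_suminf) auto
  finally show "Lp_norm p M (S n) \<le> B" .
 qed
 have inc: "S n x \<le> S (Suc n) x" for n x unfolding S_def by simp
 let ?F = "\<lambda>x. SUP n. ennreal (S n x powr p)"
 have "integral\<^sup>N M ?F = (SUP n. \<integral>\<^sup>+x. ennreal (S n x powr p) \<partial>M)"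
  using inc S0 p by (intro nn_integral_monotone_convergence_SUP) (auto intro!: incseq_SucI le_funI powr_mono2)
 also have "... \<le> ennreal (B powr p)"
 proof (rule SUP_least)
  fix n
  have "(\<integral>\<^sup>+x. ennreal (S n x powr p) \<partial>M) = ennreal (Lp_norm p M (S n) powr p)"
   using nn_integral_Lp_norm[OF SL(1)[of n] p0] S0 by simp
  also have "... \<le> ennreal (B powr p)" using SL(2) p0 by (intro ennreal_leI powr_mono2) auto
  finally show "(\<integral>\<^sup>+x. ennreal (S n x powr p) \<partial>M) \<le> ennreal (B powr p)" .
 qed
 finally have le: "integral\<^sup>N M ?F \<le> ennreal (B powr p)" .
 then have "integral\<^sup>N M ?F \<noteq> \<infinity>" by (auto simp: top_unique)
 then have "AE x in M. ?F x \<noteq> \<infinity>" by (intro nn_integral_PInf_AE) auto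
 then have abssum: "AE x in M. summable (\<lambda>k. \<bar>h k x\<bar>)"
 proof eventually_elim
  case (elim x)
  then obtain c where c: "0 \<le> c" "?F x = ennreal c" by (metis ennreal_cases infinity_ennreal_def)
  have "S n x \<le> c powr (1/p)" for n
  proof -
   have "ennreal (S n x powr p) \<le> ennreal c" unfolding c(2)[symmetric] by (rule SUP_upper) simp
   then have "(S n x powr p) powr (1/p) \<le> c powr (1/p)" using c(1) p0 by (intro powr_mono2) auto
   then show ?thesis using S0[of n x] p0 by (simp add: powr_powr)
  qed
  then show ?case unfolding S_def by (intro bounded_imp_summable[where B="c powr (1/p)"])
    (auto simp: lessThan_Suc_atMost[symmetric] simp del: sum.lessThan_Suc)
 qed
 show sumh: "AE x in M. summable (\<lambda>k. h k x)" using abssum by eventually_elim (rule summable_rabs_cancel)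
 show "AE x in M. (\<lambda>k. h k x) ----> 0" using sumh by eventually_elim (rule summable_LIMSEQ_zero)
 \<comment> \<open>The sum of the absolute values dominates every tail of the series and serves as
   the majorant for \<open>Lp_dominated\<close>.\<close>
 define W where "W x = (\<Sum>k. \<bar>h k x\<bar>)" for x
 have Wm [measurable]: "W \<in> \<B> M" unfolding W_def by measurable
 have W: "W \<in> Lp p M"
 proof (rule Lp_leI[OF _ B p0])
  have "(Lp_nn p M W) \<le> integral\<^sup>N M ?F"
  proof (rule nn_integral_mono_AE)
   show "AE x in M. ennreal (\<bar>W x\<bar> powr p) \<le> ?F x" using abssum
   proof eventually_elim
    case (elim x)
    have W0: "0 \<le> W x" unfolding W_def using elim by (intro suminf_nonneg) auto
    have "(\<lambda>n. S n x) ----> W x" unfolding S_def W_def using elim by (rule summable_LIMSEQ)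
    then have "(\<lambda>n. ennreal (S n x powr p)) ----> ennreal (W x powr p)"
     using p0 by (intro tendsto_ennrealI tendsto_powr2) (auto simp: S0)
    then have "ennreal (W x powr p) \<le> ?F x" by (rule LIMSEQ_le_const2) (intro exI[of _ 0] allI impI SUP_upper UNIV_I)
    then show ?case using W0 by simp
   qed
  qed
  then show "(Lp_nn p M W) \<le> ennreal (B powr p)" using le by (rule order_trans)
 qed simp
 have sle: "AE x in M. \<bar>(\<Sum>k<n. h k x) - (\<Sum>k. h k x)\<bar> \<le> \<bar>W x\<bar>" for n using abssum
 proof eventually_elim
  case (elim x)
  have "(\<Sum>k. h k x) = (\<Sum>k. h (k + n) x) + (\<Sum>k<n. h k x)"
   using summable_rabs_cancel[OF elim] by (rule suminf_split_initial_segment)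
  then have "\<bar>(\<Sum>k<n. h k x) - (\<Sum>k. h k x)\<bar> = \<bar>\<Sum>k. h (k + n) x\<bar>" by simp
  also have "... \<le> (\<Sum>k. \<bar>h (k + n) x\<bar>)"
   using elim by (intro summable_rabs) (simp add: summable_iff_shift[of "\<lambda>k. \<bar>h k x\<bar>"])
  also have "... \<le> W x"
  proof -
   have "W x = (\<Sum>k. \<bar>h (k + n) x\<bar>) + (\<Sum>k<n. \<bar>h k x\<bar>)" unfolding W_def using elim by (rule suminf_split_initial_segment)
   then show ?thesis by (simp add: sum_nonneg)
  qed
  finally show ?case by simp
 qed
 have sm' [measurable]: "?s \<in> \<B> M" by measurable
 show s: "?s \<in> Lp p M" using sle[of 0] by (intro Lp_mono_AE[OF W _ _ p0]) auto
 show lim: "(\<lambda>n. Lp_norm p M (?d n)) ----> 0"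
 proof (rule Lp_dominated[OF p0 W _ _ _ sle])
  show "AE x in M. (\<lambda>n. \<Sum>k<n. h k x) ----> (\<Sum>k. h k x)" using sumh by eventually_elim (rule summable_LIMSEQ)
 qed auto
 have "Lp_norm p M ?s \<le> Lp_norm p M (?d n) + B" for n
 proof -
  have 1: "(\<lambda>x. \<Sum>k<n. h k x) \<in> Lp p M" using p h by (intro Lp_sum)
  have "Lp_norm p M (\<lambda>x. \<Sum>k<n. h k x) \<le> (\<Sum>k<n. Lp_norm p M (h k))" using p h by (intro Lp_sum)
  also have "... \<le> B" unfolding B_def using sm by (intro sum_le_suminf) auto
  finally show ?thesis using Lp_norm_diff_le[OF p s 1] Lp_norm_minus_commute[of p M "\<lambda>x. \<Sum>k<n. h k x"] by simp
 qed
 then have "Lp_norm p M ?s \<le> 0 + B"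
  by (intro LIMSEQ_le_const[OF tendsto_add[OF lim tendsto_const[of B]]]) auto
 then show "Lp_norm p M ?s \<le> (\<Sum>k. Lp_norm p M (h k))" by (simp add: B_def)
qed

section \<open>Jensen's and Minkowski's integral inequalities; induction over Lp\<close>

lemma (in finite_measure) Lp_imp_integrable:
 assumes "1 \<le> p" "f \<in> Lp p M" shows "integrable M f"
proof (rule Bochner_Integration.integrable_bound)
 show "integrable M (\<lambda>x. 1 + \<bar>f x\<bar> powr p)" using assms by (auto simp: Lp_def)
 show "f \<in> \<B> M" using assms by (auto simp: Lp_def)
 have "\<bar>t\<bar> \<le> 1 + \<bar>t\<bar> powr p" for t :: real
 proof (cases "\<bar>t\<bar> \<le> 1")
  case False
  then have "\<bar>t\<bar> powr 1 \<le> \<bar>t\<bar> powr p" using assms by (intro powr_mono) auto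
  then show ?thesis using False by simp
 qed (use powr_ge_zero[of "\<bar>t\<bar>" p] in linarith)
 then show "AE x in M. norm (f x) \<le> norm (1 + \<bar>f x\<bar> powr p)" by simp
qed

text \<open>Jensen's inequality for a finite measure that is not normalised: the tangent to the p-th
  power at the mean is integrated. The power of the total mass comes from the normalisation.\<close>

lemma (in finite_measure) powr_integral_le:
 assumes "1 \<le> p" "f \<in> Lp p M"
 shows "\<bar>LINT x|M. f x\<bar> powr p \<le> measure M (space M) powr (p - 1) * (LINT x|M. \<bar>f x\<bar> powr p)"
proof -
 note i = Lp_imp_integrable[OF assms]
 have ip: "integrable M (\<lambda>x. \<bar>f x\<bar> powr p)" using assms by (simp add: Lp_def)
 let ?m = "measure M (space M)" and ?I = "LINT x|M. \<bar>f x\<bar>"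
 have absle: "\<bar>LINT x|M. f x\<bar> \<le> ?I" using integral_abs_bound[of M f] by simp
 have I0: "0 \<le> ?I" by simp
 show ?thesis
 proof (cases "?I = 0")
  case True
  then show ?thesis using absle assms by (simp add: zero_le_mult_iff)
 next
  case False
  have m: "0 < ?m"
  proof (rule ccontr)
   assume "\<not> 0 < ?m"
   then have "emeasure M (space M) = 0" using measure_nonneg[of M "space M"] by (simp add: emeasure_eq_measure)
   then have "AE x in M. False" by (intro AE_I[of _ _ "space M"]) auto
   then have "?I = (LINT x|M. 0)" using i by (intro integral_cong_AE) auto
   then show False using False by simp
  qed
  \<comment> \<open>The mean of \<open>\<bar>f\<bar>\<close>; this choice cancels the linear term of
    the integrated tangent.\<close>
  define c where "c = ?I / ?m"
  have c: "0 < c" unfolding c_def using m False I0 by (intro divide_pos_pos m) linarith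
  have "(LINT x|M. c powr p + p * c powr (p - 1) * (\<bar>f x\<bar> - c)) \<le> (LINT x|M. \<bar>f x\<bar> powr p)"
   using c assms i ip by (intro integral_mono powr_above_tangent) auto
  also have "(LINT x|M. c powr p + p * c powr (p - 1) * (\<bar>f x\<bar> - c)) = ?m * c powr p + p * c powr (p - 1) * (?I - ?m * c)"
   using i by (simp)
  also have "?I - ?m * c = 0" using m by (simp add: c_def)
  finally have *: "?m * c powr p \<le> (LINT x|M. \<bar>f x\<bar> powr p)" by simp
  have "\<bar>LINT x|M. f x\<bar> powr p \<le> ?I powr p" using absle assms by (intro powr_mono2) auto
  also have "?I = ?m * c" using m by (simp add: c_def)
  also have "(?m * c) powr p = ?m powr (p - 1) * (?m * c powr p)" using m c by (simp add: powr_mult powr_diff)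
  also have "... \<le> ?m powr (p - 1) * (LINT x|M. \<bar>f x\<bar> powr p)" using * by (intro mult_left_mono) auto
  finally show ?thesis .
 qed
qed

text \<open>The same without integrability. If the integral on the right is infinite, only a measure
  of total mass zero leaves something to check, because there the product
  \<open>0 * \<infinity>\<close> is 0.\<close>

lemma (in finite_measure) powr_integral_le_nn:
 assumes "1 \<le> p" "f \<in> \<B> M" shows "ennreal (\<bar>LINT x|M. f x\<bar> powr p)
  \<le> ennreal (measure M (space M) powr (p - 1)) * (Lp_nn p M f)"
proof (cases "(Lp_nn p M f) < \<infinity>")
 case True
 then have f: "f \<in> Lp p M" using assms by (simp add: Lp_iff_nn_integral)
 have "(Lp_nn p M f) = ennreal (LINT x|M. \<bar>f x\<bar> powr p)" using f by (intro nn_integral_eq_integral) (auto simp: Lp_def)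
 then show ?thesis using powr_integral_le[OF assms(1) f] by (simp add: ennreal_mult[symmetric])
next
 case False
 show ?thesis
 proof (cases "measure M (space M) = 0")
  case True
  then have "emeasure M (space M) = 0" by (simp add: emeasure_eq_measure)
  then have "AE x in M. False" by (intro AE_I[of _ _ "space M"]) auto
  then have "(LINT x|M. f x) = (LINT x|M. 0)" using assms by (intro integral_cong_AE) auto
  then show ?thesis using assms by simp
 next
  case m: False
  then have "ennreal (measure M (space M) powr (p - 1)) * (Lp_nn p M f) = \<infinity>"
   using False by (simp add: ennreal_mult_top less_top[symmetric])
  then show ?thesis by simp
 qed
qed

text \<open>Minkowski's integral inequality, by Jensen's inequality for the measure with density \<open>\<rho>\<close>.\<close>

lemma Lp_time_integral:
 fixes h :: "real \<times> 'a => real"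
 assumes p: "1 \<le> p" and M: "sigma_finite_measure M" and h: "h \<in> \<B> (borel \<otimes> M)"
  and \<rho> [measurable]: "\<rho> \<in> \<B> borel" and \<rho>0: "\<And>s. 0 \<le> \<rho> s"
  and m: "(\<integral>\<^sup>+s. ennreal (\<rho> s) \<partial>lborel) = ennreal m" "0 < m" and B: "0 \<le> B"
  and b: "\<And>s. 0 < \<rho> s ==> Lp_nn p M (\<lambda>x. h (s, x)) \<le> ennreal (B powr p)"
  and k: "k \<in> \<B> M" "AE x in M. k x = (LBINT s. \<rho> s * h (s, x))" shows "k \<in> Lp p M" "Lp_norm p M k \<le> m * B"
proof -
 interpret M: sigma_finite_measure M by (rule M)
 interpret P: pair_sigma_finite "lborel :: real measure" M ..
 have [measurable]: "h \<in> \<B> (lborel \<otimes> M)" using h by (subst measurable_cong_sets[OF sets_pair_measure_cong refl]) auto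
 let ?\<kappa> = "density lborel (\<lambda>s. ennreal (\<rho> s))" and ?H = "\<lambda>s x. ennreal (\<rho> s) * ennreal (\<bar>h (s, x)\<bar> powr p)"
 have mass: "emeasure ?\<kappa> (space ?\<kappa>) = ennreal m" using m by (simp add: emeasure_density)
 interpret \<kappa>: finite_measure ?\<kappa> by standard (use mass in simp)
 have mm: "measure ?\<kappa> UNIV = m" using mass m by (simp add: measure_def)
 have "Lp_nn p M k \<le> (\<integral>\<^sup>+x. ennreal (m powr (p - 1)) * (\<integral>\<^sup>+s. ?H s x \<partial>lborel) \<partial>M)"
 proof (rule nn_integral_mono_AE)
  show "AE x in M. ennreal (\<bar>k x\<bar> powr p) \<le> ennreal (m powr (p - 1)) * (\<integral>\<^sup>+s. ?H s x \<partial>lborel)" using k(2) AE_space[of M]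
  proof eventually_elim
   case (elim x)
   have [measurable]: "(\<lambda>s. h (s, x)) \<in> \<B> borel" by (rule measurable_Pair1[OF h elim(2)])
   have "k x = (LINT s|?\<kappa>. h (s, x))" using elim(1) \<rho>0 by (subst integral_density) auto
   then show ?case using \<kappa>.powr_integral_le_nn[OF p, of "\<lambda>s. h (s, x)"] by (simp add: mm nn_integral_density)
  qed
 qed
 also have "... = ennreal (m powr (p - 1)) * (\<integral>\<^sup>+x. \<integral>\<^sup>+s. ?H s x \<partial>lborel \<partial>M)"
  by (rule nn_integral_cmult) (rule lborel.borel_measurable_nn_integral, simp add: case_prod_unfold, measurable)
 also have "(\<integral>\<^sup>+x. \<integral>\<^sup>+s. ?H s x \<partial>lborel \<partial>M) = (\<integral>\<^sup>+s. \<integral>\<^sup>+x. ?H s x \<partial>M \<partial>lborel)"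
  by (rule P.Fubini') (simp add: case_prod_unfold)
 also have "... \<le> (\<integral>\<^sup>+s. ennreal (\<rho> s) * ennreal (B powr p) \<partial>lborel)"
 proof (rule nn_integral_mono)
  fix s
  show "(\<integral>\<^sup>+x. ?H s x \<partial>M) \<le> ennreal (\<rho> s) * ennreal (B powr p)"
   using b[of s] \<rho>0[of s] by (cases "\<rho> s = 0") (simp_all add: nn_integral_cmult mult_left_mono)
 qed
 also have "... = ennreal m * ennreal (B powr p)" using m by (simp add: nn_integral_multc)
 also have "ennreal (m powr (p - 1)) * \<dots> = ennreal ((m * B) powr p)"
  using m B by (simp add: ennreal_mult[symmetric] powr_mult powr_diff)
 finally have "Lp_nn p M k \<le> ennreal ((m * B) powr p)" by (simp add: mult_left_mono)
 then show "k \<in> Lp p M" "Lp_norm p M k \<le> m * B" using Lp_leI[OF k(1), of "m * B" p] m B p by auto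
qed

lemma Lp_indicator:
 assumes "A \<in> sets M" "emeasure M A < \<infinity>" shows "ind A \<in> Lp p M"
proof -
 have "Lp_nn p M (\<lambda>x. ind A x :: real) = (\<integral>\<^sup>+x. ind A x \<partial>M)" by (intro nn_integral_cong) (auto simp: indicator_def)
 then show ?thesis using assms by (simp add: Lp_iff_nn_integral)
qed

text \<open>Simple functions increase to a nonnegative function and stay below it, so the
  approximation holds in the norm and all approximants lie in Lp. The case of general sign splits
  into positive and negative parts.\<close>

lemma Lp_induct [consumes 2, case_names indicator add scale lim]:
 assumes f: "f \<in> Lp p M" and p: "1 \<le> p" and ind: "\<And>A. A \<in> sets M ==> emeasure M A < \<infinity> ==> P (ind A)"
  and add: "\<And>f g. f \<in> Lp p M ==> g \<in> Lp p M ==> P f ==> P g ==> P (\<lambda>x. f x + g x)"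
  and scale: "\<And>f c. f \<in> Lp p M ==> P f ==> P (\<lambda>x. c * f x)"
  and lim: "\<And>f g. (\<And>n. f n \<in> Lp p M) ==> (\<And>n. P (f n)) ==> g \<in> Lp p M ==>
   (\<lambda>n. Lp_norm p M (\<lambda>x. f n x - g x)) ----> 0 ==> P g" shows "P f"
proof -
 have p0: "0 < p" using p by simp
 have nonneg: "u \<in> Lp p M --> P u" if "u \<in> \<B> M" "\<And>x. 0 \<le> u x" for u using that
 proof (induct u rule: borel_measurable_induct_real)
  case (set A)
  show ?case
  proof
   assume A: "(ind A :: 'a => real) \<in> Lp p M"
   have "Lp_nn p M (\<lambda>x. ind A x :: real) = (\<integral>\<^sup>+x. ind A x \<partial>M)" by (intro nn_integral_cong) (auto simp: indicator_def)
   then show "P (ind A)" using A set by (intro ind) (auto simp: Lp_iff_nn_integral)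
  qed
 next
  case (mult u c)
  show ?case
  proof
   assume cu: "(\<lambda>x. c * u x) \<in> Lp p M"
   show "P (\<lambda>x. c * u x)"
   proof (cases "c = 0")
    case True
    \<comment> \<open>For \<open>c = 0\<close> nothing is known about u itself, so the zero function
      is obtained as a multiple of an indicator.\<close>
    have "P (\<lambda>x. 0 * ind {} x)" by (intro scale ind Lp_indicator) auto
    then show ?thesis using True by simp
   next
    case False
    then have "u \<in> Lp p M" using Lp_scale(1)[OF cu p0, of "1/c"] by simp
    then show ?thesis using mult scale by auto
   qed
  qed
 next
  case (add u v)
  show ?case
  proof
   assume s: "(\<lambda>x. v x + u x) \<in> Lp p M"
   have "u \<in> Lp p M" "v \<in> Lp p M" using add by (auto intro!: Lp_mono_AE(1)[OF s _ _ p0])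
   then show "P (\<lambda>x. v x + u x)" using add assms(4) by auto
  qed
 next
  case (seq U)
  show ?case
  proof
   assume u: "u \<in> Lp p M"
   have le: "U i x \<le> u x" if "x \<in> space M" for i x
    using seq(4) seq(5)[rule_format, OF that] by (intro incseq_le) (auto simp: incseq_def le_fun_def)
   have UL: "U i \<in> Lp p M" for i
    using seq(1,2) le by (auto intro!: Lp_mono_AE(1)[OF u _ _ p0] AE_I2 intro: order_trans[OF _ abs_ge_self])
   have u0: "0 \<le> u x" if "x \<in> space M" for x using le[OF that, of 0] seq(2)[of 0 x] by linarith
   show "P u"
   proof (rule lim[OF UL _ u])
    show "P (U n)" for n using seq(3) UL by blast
    show "(\<lambda>n. Lp_norm p M (\<lambda>x. U n x - u x)) ----> 0"
    proof (rule Lp_dominated[OF p0 u])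
     show "AE x in M. \<bar>U n x - u x\<bar> \<le> \<bar>u x\<bar>" for n
      using le u0 seq(2) by (intro AE_I2) (auto simp: abs_le_iff add_increasing2 intro: order_trans)
    qed (use seq(1,5) u in \<open>auto simp: Lp_def\<close>)
   qed
  qed
 qed
 have [measurable]: "f \<in> \<B> M" using f by (simp add: Lp_def)
 have 1: "(\<lambda>x. max 0 (f x)) \<in> Lp p M" by (rule Lp_mono_AE(1)[OF f _ _ p0]) auto
 have 2: "(\<lambda>x. max 0 (- f x)) \<in> Lp p M" by (rule Lp_mono_AE(1)[OF f _ _ p0]) auto
 have "P (\<lambda>x. max 0 (f x) + - 1 * max 0 (- f x))" using 1 2 nonneg by (intro add scale Lp_scale(1)[OF _ p0]) auto
 moreover have "(\<lambda>x. max 0 (f x) + - 1 * max 0 (- f x)) = f" by (auto simp: max_def fun_eq_iff)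
 ultimately show ?thesis by metis
qed

subsection \<open>Bounded operators\<close>

lemma Lp_op_in: "Lp_op p M N T ==> f \<in> Lp p M ==> T f \<in> Lp p N"
 and Lp_op_cong: "Lp_op p M N T ==> f \<in> Lp p M ==> g \<in> Lp p M ==> (AE x in M. f x = g x) ==> AE y in N. T f y = T g y"
 and Lp_op_add: "Lp_op p M N T ==> f \<in> Lp p M ==> g \<in> Lp p M ==> AE y in N. T (\<lambda>x. f x + g x) y = T f y + T g y"
 and Lp_op_scale: "Lp_op p M N T ==> f \<in> Lp p M ==> AE y in N. T (\<lambda>x. c * f x) y = c * T f y"
 by (auto simp: Lp_operator_def)

lemma Lp_op_bound:
 assumes "Lp_op p M N T" obtains C where "0 < C" "\<And>f. f \<in> Lp p M ==> Lp_norm p N (T f) \<le> C * Lp_norm p M f"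
proof -
 obtain C where "\<forall>f\<in>Lp p M. Lp_norm p N (T f) \<le> C * Lp_norm p M f" using assms unfolding Lp_operator_def by blast
 then have C: "\<And>f. f \<in> Lp p M ==> Lp_norm p N (T f) \<le> C * Lp_norm p M f" by blast
 have "Lp_norm p N (T f) \<le> (\<bar>C\<bar> + 1) * Lp_norm p M f" if "f \<in> Lp p M" for f
 proof -
  have "C * Lp_norm p M f \<le> (\<bar>C\<bar> + 1) * Lp_norm p M f" by (intro mult_right_mono) auto
  then show ?thesis using C[OF that] by linarith
 qed
 then show ?thesis using that[of "\<bar>C\<bar> + 1"] by auto
qed

text \<open>Compatibility with equality almost everywhere comes for free: linearity and the bound
  are applied to the difference of the two representatives, which has norm zero.\<close>

lemma Lp_opI:
 assumes p: "1 \<le> p" and i: "\<And>f. f \<in> Lp p M ==> T f \<in> Lp p N"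
  and b: "\<And>f. f \<in> Lp p M ==> Lp_norm p N (T f) \<le> C * Lp_norm p M f"
  and a: "\<And>f g. f \<in> Lp p M ==> g \<in> Lp p M ==> AE y in N. T (\<lambda>x. f x + g x) y = T f y + T g y"
  and s: "\<And>f c. f \<in> Lp p M ==> AE y in N. T (\<lambda>x. c * f x) y = c * T f y" shows "Lp_op p M N T" unfolding Lp_operator_def
proof (intro conjI ballI impI allI i a s exI[of _ C] b)
 fix f g assume f: "f \<in> Lp p M" and g: "g \<in> Lp p M" and ae: "AE x in M. f x = g x"
 have p0: "0 < p" using p by simp
 let ?h = "\<lambda>x. f x + (-1) * g x"
 have h: "?h \<in> Lp p M" using Lp_add[OF p f Lp_scale(1)[OF g p0]] .
 have "AE x in M. ?h x = 0" using ae by eventually_elim simp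
 then have "Lp_norm p M ?h = 0" using Lp_norm_eq_0_iff[OF h p0] by blast
 then have "Lp_norm p N (T ?h) \<le> 0" using b[OF h] by simp
 then have "Lp_norm p N (T ?h) = 0" using Lp_norm_nonneg[of p N "T ?h"] by linarith
 then have "AE y in N. T ?h y = 0" using Lp_norm_eq_0_iff[OF i[OF h] p0] by blast
 moreover have "AE y in N. T ?h y = T f y + T (\<lambda>x. (-1) * g x) y" by (rule a[OF f Lp_scale(1)[OF g p0]])
 moreover have "AE y in N. T (\<lambda>x. (-1) * g x) y = (-1) * T g y" by (rule s[OF g])
 ultimately show "AE y in N. T f y = T g y" by eventually_elim simp
qed

text \<open>For operators given by a pointwise formula. One estimate between nonnegative integrals
  yields both membership in Lp and the norm bound, with no integrability to be checked
  beforehand.\<close>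

lemma Lp_op_nnI:
 assumes p: "1 \<le> p" and C: "0 \<le> C" and m: "\<And>f. f \<in> \<B> M ==> T f \<in> \<B> N" and b: "\<And>f. f \<in> \<B> M ==>
   (Lp_nn p N (T f)) \<le> ennreal (C powr p) * (Lp_nn p M f)" and a: "\<And>f g y. T (\<lambda>x. f x + g x) y = T f y + T g y"
  and s: "\<And>f c y. T (\<lambda>x. c * f x) y = c * T f y" shows "Lp_op p M N T"
  and "f \<in> Lp p M ==> Lp_norm p N (T f) \<le> C * Lp_norm p M f"
proof -
 have p0: "0 < p" using p by simp
 have *: "T f \<in> Lp p N" "Lp_norm p N (T f) \<le> C * Lp_norm p M f" if f: "f \<in> Lp p M" for f
 proof -
  have fm: "f \<in> \<B> M" using f by (simp add: Lp_def)
  have "Lp_nn p N (T f) \<le> ennreal ((C * Lp_norm p M f) powr p)"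
   using b[OF fm] C by (simp add: nn_integral_Lp_norm[OF f p0] ennreal_mult[symmetric] powr_mult)
  then show "T f \<in> Lp p N" "Lp_norm p N (T f) \<le> C * Lp_norm p M f"
   using Lp_leI[OF m[OF fm], of "C * Lp_norm p M f" p] C p0 by auto
 qed
 show "Lp_op p M N T" by (rule Lp_opI[OF p *]) (auto simp: a s)
 show "f \<in> Lp p M ==> Lp_norm p N (T f) \<le> C * Lp_norm p M f" by (rule *)
qed

lemma Lp_op_lin:
 assumes "0 < p" "Lp_op p M N T" "f \<in> Lp p M" "g \<in> Lp p M"
 shows "AE y in N. T (\<lambda>x. f x + c * g x) y = T f y + c * T g y"
 using Lp_op_add[OF assms(2,3) Lp_scale(1)[OF assms(4,1)], of c] Lp_op_scale[OF assms(2,4), of c]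
 by eventually_elim simp

lemma Lp_op_diff:
 assumes "1 \<le> p" "Lp_op p M N T" "f \<in> Lp p M" "g \<in> Lp p M" shows "AE y in N. T (\<lambda>x. f x - g x) y = T f y - T g y"
 using Lp_op_lin[OF _ assms(2-4), of "-1"] assms(1) by simp

lemma Lp_op_norm_diff:
 assumes "1 \<le> p" "Lp_op p M N T" "f \<in> Lp p M" "g \<in> Lp p M"
 shows "Lp_norm p N (\<lambda>x. T f x - T g x) = Lp_norm p N (T (\<lambda>x. f x - g x))"
proof (rule Lp_norm_cong_AE)
 show "AE x in N. T f x - T g x = T (\<lambda>x. f x - g x) x" using Lp_op_diff[OF assms] by eventually_elim simp
 show "(\<lambda>x. T f x - T g x) \<in> \<B> N" using assms by (intro Lp_meas[where p=p] Lp_diff Lp_op_in[OF assms(2)])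
 show "T (\<lambda>x. f x - g x) \<in> \<B> N" using assms by (intro Lp_meas[where p=p] Lp_op_in[OF assms(2)] Lp_diff)
qed

lemma Lp_op_norm_add:
 assumes "1 \<le> p" "Lp_op p M N T" "f \<in> Lp p M" "g \<in> Lp p M"
 shows "Lp_norm p N (T (\<lambda>x. f x + g x)) \<le> Lp_norm p N (T f) + Lp_norm p N (T g)"
proof -
 note i = Lp_op_in[OF assms(2)]
 have "Lp_norm p N (T (\<lambda>x. f x + g x)) = Lp_norm p N (\<lambda>x. T f x + T g x)"
  by (rule Lp_norm_cong_AE[OF Lp_op_add[OF assms(2-4)] Lp_meas[OF i[OF Lp_add[OF assms(1,3,4)]]]
     Lp_meas[OF Lp_add[OF assms(1) i[OF assms(3)] i[OF assms(4)]]]])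
 then show ?thesis using Lp_norm_triangle[OF assms(1) i[OF assms(3)] i[OF assms(4)]] by simp
qed

lemma Lp_op_norm_scale:
 assumes "0 < p" "Lp_op p M N T" "f \<in> Lp p M" shows "Lp_norm p N (T (\<lambda>x. c * f x)) = \<bar>c\<bar> * Lp_norm p N (T f)"
proof -
 note i = Lp_op_in[OF assms(2)]
 have "Lp_norm p N (T (\<lambda>x. c * f x)) = Lp_norm p N (\<lambda>x. c * T f x)"
  by (rule Lp_norm_cong_AE[OF Lp_op_scale[OF assms(2,3)] Lp_meas[OF i[OF Lp_scale(1)[OF assms(3,1)]]]
     Lp_meas[OF Lp_scale(1)[OF i[OF assms(3)] assms(1)]]])
 then show ?thesis using Lp_scale(2)[OF i[OF assms(3)] assms(1)] by simp
qed

lemma Lp_op_id: "1 \<le> p ==> Lp_op p M M (\<lambda>f. f)" by (rule Lp_opI[where C=1]) auto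

lemma Lp_op_zero:
 assumes "0 < p" "Lp_op p M N T" shows "AE y in N. T (\<lambda>x. 0) y = 0"
 using Lp_op_scale[OF assms(2) Lp_zero(1), of 0] by simp

lemma Lp_op_lim:
 assumes "1 \<le> p" "Lp_op p M N T" "\<And>n. f n \<in> Lp p M" "g \<in> Lp p M" and "(\<lambda>n. Lp_norm p M (\<lambda>x. f n x - g x)) ----> 0"
 shows "(\<lambda>n. Lp_norm p N (\<lambda>x. T (f n) x - T g x)) ----> 0"
proof -
 obtain C where C: "\<And>f. f \<in> Lp p M ==> Lp_norm p N (T f) \<le> C * Lp_norm p M f" using Lp_op_bound[OF assms(2)] by metis
 have "(\<lambda>n. C * Lp_norm p M (\<lambda>x. f n x - g x)) ----> C * 0" by (intro tendsto_mult tendsto_const assms)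
 then have l: "(\<lambda>n. C * Lp_norm p M (\<lambda>x. f n x - g x)) ----> 0" by simp
 have "Lp_norm p N (\<lambda>x. T (f n) x - T g x) \<le> C * Lp_norm p M (\<lambda>x. f n x - g x)" for n
  unfolding Lp_op_norm_diff[OF assms(1,2,3,4)] by (intro C Lp_diff assms)
 then show ?thesis by (intro tendsto_sandwich[OF _ _ tendsto_const l]) auto
qed

lemma Lp_lim_unique:
 assumes p: "1 \<le> p" and f: "\<And>n. f n \<in> Lp p M" "g \<in> Lp p M" "h \<in> Lp p M"
  and "(\<lambda>n. Lp_norm p M (\<lambda>x. f n x - g x)) ----> 0" "(\<lambda>n. Lp_norm p M (\<lambda>x. f n x - h x)) ----> 0"
 shows "AE x in M. g x = h x"
proof -
 have p0: "0 < p" using p by simp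
 have "Lp_norm p M (\<lambda>x. g x - h x) \<le> Lp_norm p M (\<lambda>x. f n x - g x) + Lp_norm p M (\<lambda>x. f n x - h x)" for n
  using Lp_norm_triangle_mid[OF p f(2) f(1)[of n] f(3)] Lp_norm_minus_commute[of p M g "f n"] by simp
 then have "Lp_norm p M (\<lambda>x. g x - h x) \<le> 0 + 0" by (intro LIMSEQ_le_const[OF tendsto_add[OF assms(5,6)]]) auto
 then have "Lp_norm p M (\<lambda>x. g x - h x) = 0" by (simp add: antisym)
 then have "AE x in M. g x - h x = 0" using Lp_norm_eq_0_iff[OF Lp_diff[OF p f(2,3)] p0] by blast
 then show ?thesis by eventually_elim simp
qed

lemma Lp_opnorm_bdd:
 assumes "Lp_op p M N T" shows "bdd_above {Lp_norm p N (T f) |f. f \<in> Lp p M \<and> Lp_norm p M f \<le> 1}"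
proof -
 obtain C where C: "0 < C" "\<And>f. f \<in> Lp p M ==> Lp_norm p N (T f) \<le> C * Lp_norm p M f"
  using Lp_op_bound[OF assms] by metis
 then have "Lp_norm p N (T f) \<le> C" if "f \<in> Lp p M" "Lp_norm p M f \<le> 1" for f
  using C(2)[OF that(1)] mult_left_mono[OF that(2), of C] C(1) by linarith
 then show ?thesis by (intro bdd_aboveI[of _ C]) auto
qed

lemma Lp_opnorm_nonneg:
 assumes "Lp_op p M N T" shows "0 \<le> Lp_opnorm p M N T"
proof -
 have "Lp_norm p N (T (\<lambda>x. 0)) \<le> Lp_opnorm p M N T" unfolding Lp_opnorm_def
  by (rule cSup_upper[OF _ Lp_opnorm_bdd[OF assms]]) (auto intro!: exI[of _ "\<lambda>x. 0"])
 then show ?thesis using Lp_norm_nonneg[of p N "T (\<lambda>x. 0)"] by linarith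
qed

lemma Lp_opnorm_le:
 assumes "0 \<le> C" "\<And>f. f \<in> Lp p M ==> Lp_norm p N (T f) \<le> C * Lp_norm p M f" shows "Lp_opnorm p M N T \<le> C"
 unfolding Lp_opnorm_def
proof (rule cSup_least)
 show "{Lp_norm p N (T f) |f. f \<in> Lp p M \<and> Lp_norm p M f \<le> 1} \<noteq> {}" by (auto intro!: exI[of _ "\<lambda>x. 0"])
 fix r assume "r \<in> {Lp_norm p N (T f) |f. f \<in> Lp p M \<and> Lp_norm p M f \<le> 1}"
 then obtain f where "f \<in> Lp p M" "Lp_norm p M f \<le> 1" "r = Lp_norm p N (T f)" by auto
 then show "r \<le> C" using assms(2)[of f] mult_left_mono[of "Lp_norm p M f" 1 C] assms(1) by simp
qed

lemma Lp_norm_le_opnorm: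
 assumes p: "1 \<le> p" and T: "Lp_op p M N T" and f: "f \<in> Lp p M"
 shows "Lp_norm p N (T f) \<le> Lp_opnorm p M N T * Lp_norm p M f"
proof -
 have p0: "0 < p" using p by simp
 let ?n = "Lp_norm p M f"
 show ?thesis
 proof (cases "?n = 0")
  case True
  obtain C where "\<And>f. f \<in> Lp p M ==> Lp_norm p N (T f) \<le> C * Lp_norm p M f" using Lp_op_bound[OF T] by metis
  then show ?thesis using True f by fastforce
 next
  case False
  then have n: "0 < ?n" using Lp_norm_nonneg[of p M f] by linarith
  let ?g = "\<lambda>x. (1 / ?n) * f x"
  have g: "?g \<in> Lp p M" "Lp_norm p M ?g = 1" using Lp_scale[OF f p0, of "1 / ?n"] n by auto
  have "Lp_norm p N (T ?g) = Lp_norm p N (\<lambda>y. (1 / ?n) * T f y)"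
   by (rule Lp_norm_cong_AE[OF Lp_op_scale[OF T f] Lp_meas[OF Lp_op_in[OF T g(1)]]
      Lp_meas[OF Lp_scale(1)[OF Lp_op_in[OF T f] p0]]])
  also have "... = Lp_norm p N (T f) / ?n" using Lp_scale(2)[OF Lp_op_in[OF T f] p0, of "1 / ?n"] n by simp
  finally have "Lp_norm p N (T f) / ?n \<le> Lp_opnorm p M N T" unfolding Lp_opnorm_def using g
   by (intro cSup_upper[OF _ Lp_opnorm_bdd[OF T]]) (auto intro!: exI[of _ ?g])
  then show ?thesis using n by (simp add: field_simps)
 qed
qed

lemma Lp_op_compose:
 assumes p: "1 \<le> p" and T: "Lp_op p M N T" and S: "Lp_op p N K S" shows "Lp_op p M K (\<lambda>f. S (T f))"
proof -
 obtain C where C: "0 < C" "\<And>f. f \<in> Lp p M ==> Lp_norm p N (T f) \<le> C * Lp_norm p M f" using Lp_op_bound[OF T] by metis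
 obtain D where D: "0 < D" "\<And>f. f \<in> Lp p N ==> Lp_norm p K (S f) \<le> D * Lp_norm p N f" using Lp_op_bound[OF S] by metis
 have p0: "0 < p" using p by simp
 note in1 = Lp_op_in[OF T] and in2 = Lp_op_in[OF S]
 show ?thesis
 proof (rule Lp_opI[OF p, where C="D * C"])
  show "Lp_norm p K (S (T f)) \<le> D * C * Lp_norm p M f" if "f \<in> Lp p M" for f
   using order_trans[OF D(2)[OF in1[OF that]] mult_left_mono[OF C(2)[OF that] less_imp_le[OF D(1)]]]
   by (simp add: mult.assoc)
  show "AE y in K. S (T (\<lambda>x. f x + g x)) y = S (T f) y + S (T g) y" if "f \<in> Lp p M" "g \<in> Lp p M" for f g
   using Lp_op_cong[OF S in1[OF Lp_add[OF p that]] Lp_add[OF p in1[OF that(1)] in1[OF that(2)]]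
     Lp_op_add[OF T that]]
    Lp_op_add[OF S in1[OF that(1)] in1[OF that(2)]] by eventually_elim simp
  show "AE y in K. S (T (\<lambda>x. c * f x)) y = c * S (T f) y" if "f \<in> Lp p M" for f c
   using Lp_op_cong[OF S in1[OF Lp_scale(1)[OF that p0]] Lp_scale(1)[OF in1[OF that] p0]
     Lp_op_scale[OF T that, of c]]
    Lp_op_scale[OF S in1[OF that], of c] by eventually_elim simp
 qed (intro in1 in2)
qed

lemma Lp_op_plus:
 assumes p: "1 \<le> p" and T: "Lp_op p M N T" and S: "Lp_op p M N S" shows "Lp_op p M N (\<lambda>f x. T f x + S f x)"
proof -
 obtain C where C: "0 < C" "\<And>f. f \<in> Lp p M ==> Lp_norm p N (T f) \<le> C * Lp_norm p M f" using Lp_op_bound[OF T] by metis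
 obtain D where D: "0 < D" "\<And>f. f \<in> Lp p M ==> Lp_norm p N (S f) \<le> D * Lp_norm p M f" using Lp_op_bound[OF S] by metis
 note in1 = Lp_op_in[OF T] and in2 = Lp_op_in[OF S]
 show ?thesis
 proof (rule Lp_opI[OF p, where C="C + D"])
  show "Lp_norm p N (\<lambda>x. T f x + S f x) \<le> (C + D) * Lp_norm p M f" if "f \<in> Lp p M" for f
   using Lp_norm_triangle[OF p in1[OF that] in2[OF that]] C(2)[OF that] D(2)[OF that] by (simp add: algebra_simps)
  show "AE y in N. T (\<lambda>x. f x + g x) y + S (\<lambda>x. f x + g x) y = T f y + S f y + (T g y + S g y)"
   if "f \<in> Lp p M" "g \<in> Lp p M" for f g using Lp_op_add[OF T that] Lp_op_add[OF S that] by eventually_elim simp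
  show "AE y in N. T (\<lambda>x. c * f x) y + S (\<lambda>x. c * f x) y = c * (T f y + S f y)"
   if "f \<in> Lp p M" for f c using Lp_op_scale[OF T that, of c] Lp_op_scale[OF S that, of c]
   by eventually_elim (simp add: algebra_simps)
 qed (intro in1 in2 Lp_add[OF p])
qed

lemma Lp_op_scaled:
 assumes p: "1 \<le> p" and T: "Lp_op p M N T" shows "Lp_op p M N (\<lambda>f x. c * T f x)"
proof -
 have p0: "0 < p" using p by simp
 obtain C where C: "0 < C" "\<And>f. f \<in> Lp p M ==> Lp_norm p N (T f) \<le> C * Lp_norm p M f" using Lp_op_bound[OF T] by metis
 show ?thesis
 proof (rule Lp_opI[OF p, where C="\<bar>c\<bar> * C"])
  show "Lp_norm p N (\<lambda>x. c * T f x) \<le> \<bar>c\<bar> * C * Lp_norm p M f" if "f \<in> Lp p M" for f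
   using mult_left_mono[OF C(2)[OF that], of "\<bar>c\<bar>"] Lp_scale(2)[OF Lp_op_in[OF T that] p0, of c]
   by (simp add: mult.assoc)
  show "AE y in N. c * T (\<lambda>x. f x + g x) y = c * T f y + c * T g y"
   if "f \<in> Lp p M" "g \<in> Lp p M" for f g using Lp_op_add[OF T that] by eventually_elim (simp add: algebra_simps)
  show "AE y in N. c * T (\<lambda>x. d * f x) y = d * (c * T f y)" if "f \<in> Lp p M" for f d
   using Lp_op_scale[OF T that, of d] by eventually_elim simp
 qed (intro Lp_op_in[OF T] Lp_scale(1)[OF _ p0])
qed

lemma Lp_op_minus:
 assumes "1 \<le> p" "Lp_op p M N T" "Lp_op p M N S" shows "Lp_op p M N (\<lambda>f x. T f x - S f x)"
 using Lp_op_plus[OF assms(1,2) Lp_op_scaled[OF assms(1,3), of "-1"]] by simp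

lemma Lp_op_null: "1 \<le> p ==> Lp_op p M N (\<lambda>f x. 0)" by (rule Lp_opI[where C=0]) auto

lemma Lp_op_sum:
 assumes "1 \<le> p" "\<And>k. Lp_op p M N (T k)" shows "Lp_op p M N (\<lambda>f x. \<Sum>k<(n::nat). T k f x)"
 using assms by (induction n) (auto intro: Lp_op_null Lp_op_plus)

text \<open>K applied to a partial sum shifts it by one term. Hence f plus K of the partial sums and
  the partial sums themselves converge to the two sides, and limits in Lp are unique.\<close>

lemma Neumann_series:
 assumes p: "1 \<le> p" and K: "Lp_op p M M K" and q: "0 \<le> q" "q < 1"
  and b: "\<And>f. f \<in> Lp p M ==> Lp_norm p M (K f) \<le> q * Lp_norm p M f" and f: "f \<in> Lp p M"
 defines "S \<equiv> (\<lambda>f x. \<Sum>k. (K ^^ k) f x)" shows "AE x in M. S f x = f x + K (S f) x"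
proof -
 let ?P = "\<lambda>n x. \<Sum>k<n. (K ^^ k) f x" and ?n = "Lp_norm p M"
 let ?D = "\<lambda>n x. ?P (Suc n) x - (f x + K (S f) x)" and ?E = "\<lambda>n x. K (?P n) x - K (S f) x"
 have 1: "(K ^^ k) f \<in> Lp p M \<and> ?n ((K ^^ k) f) \<le> q ^ k * ?n f" for k
 proof (induction k)
  case (Suc k)
  then have i: "(K ^^ k) f \<in> Lp p M" by simp
  show ?case
   using Lp_op_in[OF K i] b[OF i] mult_left_mono[of "?n ((K ^^ k) f)" "q ^ k * ?n f" q] Suc q
   by (simp add: mult.assoc)
 qed (use f in simp)
 then have k: "(K ^^ k) f \<in> Lp p M" "?n ((K ^^ k) f) \<le> q ^ k * ?n f" for k by auto
 have gs: "summable (\<lambda>k. q ^ k * ?n f)" using q by (intro summable_mult2 summable_geometric) auto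
 have sm: "summable (\<lambda>k. ?n ((K ^^ k) f))" by (rule summable_comparison_test[OF _ gs]) (use k in auto)
 note ser = Lp_series[OF p k(1) sm]
 have S: "S f \<in> Lp p M" unfolding S_def by (rule ser)
 have lim: "(\<lambda>n. ?n (\<lambda>x. ?P n x - S f x)) ----> 0" unfolding S_def by (rule ser)
 have P: "?P n \<in> Lp p M" for n using p k by (intro Lp_sum)
 have Ksum: "AE x in M. K (?P n) x = (\<Sum>k<n. (K ^^ Suc k) f x)" for n
 proof (induction n)
  case 0 then show ?case using Lp_op_zero[OF _ K] p by simp
 next
  case (Suc n)
  show ?case using Suc Lp_op_add[OF K P[of n] k(1)[of n]] by eventually_elim simp
 qed
 have "(\<lambda>n. ?n (?E n)) ----> 0" by (rule Lp_op_lim[OF p K P S lim])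
 moreover have "?n (?E n)
   = ?n (?D n)" for n
 proof (rule Lp_norm_cong_AE)
  show "AE x in M. K (?P n) x - K (S f) x = ?P (Suc n) x - (f x + K (S f) x)"
   using Ksum[of n] by eventually_elim (subst sum.lessThan_Suc_shift, simp)
  show "(?E n) \<in> \<B> M"
   by (rule Lp_meas[OF Lp_diff[OF p Lp_op_in[OF K P] Lp_op_in[OF K S]]])
  show "(?D n) \<in> \<B> M"
   by (rule Lp_meas[OF Lp_diff[OF p P Lp_add[OF p f Lp_op_in[OF K S]]]])
 qed
 ultimately have l2: "(\<lambda>n. ?n (?D n)) ----> 0" by simp
 have l1: "(\<lambda>n. ?n (\<lambda>x. ?P (Suc n) x - S f x)) ----> 0" using LIMSEQ_Suc[OF lim] .
 show "AE x in M. S f x = f x + K (S f) x" by (rule Lp_lim_unique[OF p P S Lp_add[OF p f Lp_op_in[OF K S]] l1 l2])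
qed

lemma contraction_fixed_point_unique:
 assumes p: "1 \<le> p" and K: "Lp_op p M M K" and q: "q < 1"
  and b: "\<And>f. f \<in> Lp p M ==> Lp_norm p M (K f) \<le> q * Lp_norm p M f" and v: "v \<in> Lp p M" "AE x in M. v x = f x + K v x"
  and w: "w \<in> Lp p M" "AE x in M. w x = f x + K w x" shows "AE x in M. v x = w x"
proof -
 have p0: "0 < p" using p by simp
 have d: "(\<lambda>x. v x - w x) \<in> Lp p M" by (rule Lp_diff[OF p v(1) w(1)])
 have "Lp_norm p M (\<lambda>x. v x - w x) = Lp_norm p M (K (\<lambda>x. v x - w x))"
 proof (rule Lp_norm_cong_AE)
  show "AE x in M. v x - w x = K (\<lambda>x. v x - w x) x" using v(2) w(2) Lp_op_diff[OF p K v(1) w(1)] by eventually_elim simp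
 qed (use d Lp_op_in[OF K d] in \<open>auto simp: Lp_def\<close>)
 also have "... \<le> q * Lp_norm p M (\<lambda>x. v x - w x)" by (rule b[OF d])
 finally have "(1 - q) * Lp_norm p M (\<lambda>x. v x - w x) \<le> 0" by (simp add: algebra_simps)
 then have "Lp_norm p M (\<lambda>x. v x - w x) = 0" using q Lp_norm_nonneg[of p M "\<lambda>x. v x - w x"] by (simp add: mult_le_0_iff)
 then have "AE x in M. v x - w x = 0" using Lp_norm_eq_0_iff[OF d p0] by blast
 then show ?thesis by eventually_elim simp
qed

lemma Lp_op_suminf:
 assumes p: "1 \<le> p" and T: "\<And>k. Lp_op p M N (T k)"
  and c: "\<And>k f. f \<in> Lp p M ==> Lp_norm p N (T k f) \<le> c k * Lp_norm p M f" and sm: "summable c"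
 shows "Lp_op p M N (\<lambda>f x. \<Sum>k. T k f x)"
proof -
 have s: "summable (\<lambda>k. Lp_norm p N (T k f))" if "f \<in> Lp p M" for f
  by (rule summable_comparison_test[OF _ summable_mult2[OF sm, of "Lp_norm p M f"]]) (use c[OF that] in auto)
 note i = Lp_op_in[OF T]
 show ?thesis
 proof (rule Lp_opI[OF p, where C="suminf c"])
  show "(\<lambda>x. \<Sum>k. T k f x) \<in> Lp p N" if "f \<in> Lp p M" for f by (rule Lp_series[OF p i[OF that] s[OF that]])
  show "Lp_norm p N (\<lambda>x. \<Sum>k. T k f x) \<le> suminf c * Lp_norm p M f" if f: "f \<in> Lp p M" for f
  proof -
   have "Lp_norm p N (\<lambda>x. \<Sum>k. T k f x) \<le> (\<Sum>k. Lp_norm p N (T k f))" by (rule Lp_series[OF p i[OF that] s[OF that]])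
   also have "... \<le> (\<Sum>k. c k * Lp_norm p M f)" by (rule suminf_le[OF c[OF f] s[OF f] summable_mult2[OF sm]])
   also have "... = suminf c * Lp_norm p M f" by (rule suminf_mult2[OF sm, symmetric])
   finally show ?thesis .
  qed
  show "AE y in N. (\<Sum>k. T k (\<lambda>x. f x + g x) y) = (\<Sum>k. T k f y) + (\<Sum>k. T k g y)"
   if f: "f \<in> Lp p M" and g: "g \<in> Lp p M" for f g
  proof -
   have "AE y in N. \<forall>k. T k (\<lambda>x. f x + g x) y = T k f y + T k g y"
    using Lp_op_add[OF T f g] by (simp add: AE_all_countable)
   with Lp_series(1)[OF p i[OF f] s[OF f]] Lp_series(1)[OF p i[OF g] s[OF g]]
   show ?thesis by eventually_elim (simp add: suminf_add)
  qed
  show "AE y in N. (\<Sum>k. T k (\<lambda>x. a * f x) y) = a * (\<Sum>k. T k f y)" if f: "f \<in> Lp p M" for f a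
  proof -
   have "AE y in N. \<forall>k. T k (\<lambda>x. a * f x) y = a * T k f y"
    using Lp_op_scale[OF T f, of _ a] by (simp add: AE_all_countable)
   with Lp_series(1)[OF p i[OF f] s[OF f]]
   show ?thesis by eventually_elim (simp add: suminf_mult)
  qed
 qed
qed

subsection \<open>Lifting an operator to functions of an additional variable\<close>

text \<open>Along a subsequence with geometrically small increments the telescoped series is covered
  by \<open>Lp_series\<close>; the Cauchy property carries the limit over to the whole
  sequence.\<close>

lemma Lp_Cauchy_convergent:
 assumes p: "1 \<le> p" and f: "\<And>n. f n \<in> Lp p M" and C: "\<And>e. 0 < e ==> \<exists>N. \<forall>m\<ge>N. \<forall>n\<ge>N. Lp_norm p M (\<lambda>x. f m x - f n x) < e"
 obtains g where "g \<in> Lp p M" "(\<lambda>n. Lp_norm p M (\<lambda>x. f n x - g x)) ----> 0"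
proof -
 have "\<exists>N. \<forall>m\<ge>N. \<forall>n\<ge>N. Lp_norm p M (\<lambda>x. f m x - f n x) < (1/2)^k" for k :: nat by (rule C) simp
 then obtain N where N: "\<And>k m n. m \<ge> N k ==> n \<ge> N k ==> Lp_norm p M (\<lambda>x. f m x - f n x) < (1/2)^k" by metis
 \<comment> \<open>Summing the thresholds makes the index sequence nondecreasing while keeping it
   above each \<open>N k\<close>.\<close>
 define i where "i k = (\<Sum>j\<le>k. N j)" for k
 have i: "N k \<le> i k" "i k \<le> i (Suc k)" for k by (auto simp: i_def intro: member_le_sum)
 define h where "h k x = f (i (Suc k)) x - f (i k) x" for k x
 have h: "h k \<in> Lp p M" for k unfolding h_def using p f by (intro Lp_diff)
 have hn: "Lp_norm p M (h k) \<le> (1/2)^k" for k unfolding h_def using N[of k "i (Suc k)" "i k"] i[of k] by simp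
 have sm: "summable (\<lambda>k. Lp_norm p M (h k))"
  by (rule summable_comparison_test[OF _ summable_geometric[of "1/2"]]) (use hn in auto)
 define g where "g x = f (i 0) x + (\<Sum>k. h k x)" for x
 note ser = Lp_series[OF p h sm]
 have g: "g \<in> Lp p M" unfolding g_def by (rule Lp_add[OF p f ser(3)])
 have tel: "(\<Sum>k<n. h k x) = f (i n) x - f (i 0) x" for n x unfolding h_def by (rule sum_lessThan_telescope)
 have lim: "(\<lambda>n. Lp_norm p M (\<lambda>x. f (i n) x - g x)) ----> 0"
  using ser(4) unfolding tel g_def by (simp add: algebra_simps)
 have "(\<lambda>n. Lp_norm p M (\<lambda>x. f n x - g x)) ----> 0"
 proof (rule LIMSEQ_I)
  fix e :: real assume e: "0 < e"
  obtain k where k: "(1/2::real)^k < e/2" using real_arch_pow_inv[of "e/2" "1/2"] e by auto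
  obtain N2 where N2: "\<And>n. n \<ge> N2 ==> Lp_norm p M (\<lambda>x. f (i n) x - g x) < e/2"
   using LIMSEQ_D[OF lim, of "e/2"] e by auto
  let ?m = "max N2 k"
  have "Lp_norm p M (\<lambda>x. f n x - g x) < e" if n: "n \<ge> N k" for n
  proof -
   have "i k \<le> i ?m" by (rule lift_Suc_mono_le[of i]) (use i in auto)
   then have "Lp_norm p M (\<lambda>x. f n x - f (i ?m) x) < e/2"
    using N[of k n "i ?m"] i(1)[of k] n k by (meson le_trans less_trans)
   then show ?thesis using Lp_norm_triangle_mid[OF p f[of n] f[of "i ?m"] g] N2[of ?m] by simp
  qed
  then show "\<exists>no. \<forall>n\<ge>no. norm (Lp_norm p M (\<lambda>x. f n x - g x) - 0) < e" by auto
 qed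
 with g show ?thesis by (rule that)
qed

section \<open>Slices of functions on a product space\<close>

lemma Lp_slice:
 assumes R: "sigma_finite_measure R" and N: "sigma_finite_measure N" and p: "0 < p" and G: "G \<in> Lp p (R \<otimes> N)"
 shows "AE r in R. (\<lambda>y. G (r, y)) \<in> Lp p N" "AE y in N. (\<lambda>r. G (r, y)) \<in> Lp p R"
  "(\<lambda>r. Lp_norm p N (\<lambda>y. G (r, y))) \<in> Lp p R" "Lp_norm p R (\<lambda>r. Lp_norm p N (\<lambda>y. G (r, y))) = Lp_norm p (R \<otimes> N) G"
proof -
 let ?n = "\<lambda>r. Lp_norm p N (\<lambda>y. G (r, y))"
 interpret R: sigma_finite_measure R by fact
 interpret N: sigma_finite_measure N by fact
 interpret pair_sigma_finite R N ..
 have Gm [measurable]: "G \<in> \<B> (R \<otimes> N)" using G by (simp add: Lp_def)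
 have fin: "(Lp_nn p (R \<otimes> N) G) < \<infinity>" using G by (simp add: Lp_iff_nn_integral)
 have 1: "(\<integral>\<^sup>+r. \<integral>\<^sup>+y. ennreal (\<bar>G (r, y)\<bar> powr p) \<partial>N \<partial>R) = (Lp_nn p (R \<otimes> N) G)" by (rule N.nn_integral_fst) measurable
 have 2: "(\<integral>\<^sup>+y. \<integral>\<^sup>+r. ennreal (\<bar>G (r, y)\<bar> powr p) \<partial>R \<partial>N) = (Lp_nn p (R \<otimes> N) G)" by (rule nn_integral_snd) measurable
 have "AE r in R. (Lp_nn p N (\<lambda>y. G (r, y))) \<noteq> \<infinity>" using fin 1 by (intro nn_integral_PInf_AE) auto
 then show AE: "AE r in R. (\<lambda>y. G (r, y)) \<in> Lp p N"
  by (auto simp: Lp_iff_nn_integral less_top AE_space elim!: eventually_mono[OF eventually_conj[OF _ AE_space]])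
 have "AE y in N. (Lp_nn p R (\<lambda>r. G (r, y))) \<noteq> \<infinity>" using fin 2 by (intro nn_integral_PInf_AE) auto
 then show "AE y in N. (\<lambda>r. G (r, y)) \<in> Lp p R"
  by (auto simp: Lp_iff_nn_integral less_top AE_space elim!: eventually_mono[OF eventually_conj[OF _ AE_space]])
 have m: "?n \<in> \<B> R" unfolding Lp_norm_def by measurable
 have e: "Lp_nn p R ?n = ennreal (Lp_norm p (R \<otimes> N) G powr p)"
 proof -
  have "Lp_nn p R ?n = (\<integral>\<^sup>+r. \<integral>\<^sup>+y. ennreal (\<bar>G (r, y)\<bar> powr p) \<partial>N \<partial>R)"
   using AE by (intro nn_integral_cong_AE) (auto simp: nn_integral_Lp_norm p elim!: eventually_mono)
  then show ?thesis using 1 nn_integral_Lp_norm[OF G p] by simp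
 qed
 show L: "?n \<in> Lp p R" using Lp_leI(1)[OF m Lp_norm_nonneg[of p "R \<otimes> N" G] p] e by simp
 have "Lp_norm p R ?n powr p = Lp_norm p (R \<otimes> N) G powr p"
  using e nn_integral_Lp_norm[OF L p] by simp
 then have "(Lp_norm p R ?n powr p) powr (1/p) = (Lp_norm p (R \<otimes> N) G powr p) powr (1/p)"
  by (rule arg_cong)
 then show "Lp_norm p R ?n = Lp_norm p (R \<otimes> N) G" using p by (simp add: powr_powr)
qed

text \<open>The norm on the product is the norm of the slice norms, by Tonelli; a bound valid on
  almost every slice is therefore inherited.\<close>

lemma Lp_pair_norm_le:
 assumes "sigma_finite_measure R" "sigma_finite_measure N1" "sigma_finite_measure N2" "0 < p" "0 \<le> C"
  and "G \<in> Lp p (R \<otimes> N1)" "V \<in> Lp p (R \<otimes> N2)"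
  and "AE r in R. Lp_norm p N2 (\<lambda>y. V (r, y)) \<le> C * Lp_norm p N1 (\<lambda>y. G (r, y))"
 shows "Lp_norm p (R \<otimes> N2) V \<le> C * Lp_norm p (R \<otimes> N1) G"
proof -
 note s1 = Lp_slice[OF assms(1,2,4,6)] and s2 = Lp_slice[OF assms(1,3,4,7)]
 have "Lp_norm p R (\<lambda>r. Lp_norm p N2 (\<lambda>y. V (r, y))) \<le> Lp_norm p R (\<lambda>r. C * Lp_norm p N1 (\<lambda>y. G (r, y)))"
  using assms(8) by (intro Lp_mono_AE[OF Lp_scale(1)[OF s1(3) assms(4)] _ _ assms(4)])
   (auto simp: Lp_meas[OF s2(3)] assms(5) elim!: eventually_mono)
 also have "... = C * Lp_norm p (R \<otimes> N1) G" using Lp_scale(2)[OF s1(3) assms(4)] s1(4) assms(5) by simp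
 finally show ?thesis by (simp add: s2(4))
qed

text \<open>Plain convergence on the product would give convergence of the slices only along a
  subsequence. The geometric rate makes the slice norms summable in Lp, hence null almost
  everywhere.\<close>

lemma Lp_slice_lim:
 assumes R: "sigma_finite_measure R" and N: "sigma_finite_measure N" and p: "1 \<le> p"
  and G: "\<And>n. G n \<in> Lp p (R \<otimes> N)" "G0 \<in> Lp p (R \<otimes> N)" and le: "\<And>n. Lp_norm p (R \<otimes> N) (\<lambda>z. G n z - G0 z) \<le> (1/2)^n"
 shows "AE r in R. (\<lambda>n. Lp_norm p N (\<lambda>y. G n (r, y) - G0 (r, y))) ----> 0"
proof -
 have p0: "0 < p" using p by simp
 have d: "(\<lambda>z. G n z - G0 z) \<in> Lp p (R \<otimes> N)" for n by (rule Lp_diff[OF p G])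
 note s = Lp_slice[OF R N p0 d]
 show ?thesis by (rule Lp_series(2)[OF p s(3)]; unfold s(4))
   (rule summable_comparison_test[OF _ summable_geometric[of "1/2"]], use le in auto)
qed

text \<open>Jensen over the finite measure R bounds the p-th power of the inner integral by the
  inner integral of the p-th power; Tonelli does the rest. All integrations over time below are of
  this kind.\<close>

lemma Lp_weighted_integral_operator:
 assumes R: "finite_measure R" and N: "sigma_finite_measure N" and p: "1 \<le> p" and w: "w \<in> \<B> R" "\<And>r. \<bar>w r\<bar> \<le> (c::real)"
 shows "Lp_op p (R \<otimes> N) N (\<lambda>G y. LINT r|R. w r * G (r, y))"
  and "G \<in> Lp p (R \<otimes> N) ==> AE y in N. integrable R (\<lambda>r. w r * G (r, y))"
proof -
 let ?w = "\<lambda>G y. LINT r|R. w r * G (r, y)"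
 interpret R: finite_measure R by fact
 interpret N: sigma_finite_measure N by fact
 interpret pair_sigma_finite R N ..
 have p0: "0 < p" using p by simp
 have c: "0 \<le> c" using w(2)[of undefined] by linarith
 note [measurable] = w(1)
 define m where "m = measure R (space R) powr (p - 1) * c powr p"
 have m: "0 \<le> m" by (simp add: m_def)
 have int: "AE y in N. integrable R (\<lambda>r. w r * G (r, y))" if G: "G \<in> Lp p (R \<otimes> N)" for G
  using Lp_slice(2)[OF R.sigma_finite_measure_axioms N p0 G]
 proof eventually_elim
  case (elim y)
  then have i: "integrable R (\<lambda>r. G (r, y))" by (rule R.Lp_imp_integrable[OF p])
  have gm: "(\<lambda>r. G (r, y)) \<in> \<B> R" using i by auto
  show ?case by (rule Bochner_Integration.integrable_bound[OF integrable_mult_right[OF i, of c]])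
    (use gm w(2) c in \<open>auto simp: abs_mult intro!: mult_right_mono\<close>)
 qed
 then show "G \<in> Lp p (R \<otimes> N) ==> AE y in N. integrable R (\<lambda>r. w r * G (r, y))" by blast
 have b: "(?w G) \<in> Lp p N"
  "Lp_norm p N (?w G) \<le> m powr (1/p) * Lp_norm p (R \<otimes> N) G"
  if G: "G \<in> Lp p (R \<otimes> N)" for G
 proof -
  have Gm [measurable]: "G \<in> \<B> (R \<otimes> N)" using G by (simp add: Lp_def)
  have "(Lp_nn p N (?w G)) \<le> (\<integral>\<^sup>+y. ennreal m * (Lp_nn p R (\<lambda>r. G (r, y))) \<partial>N)"
  proof (rule nn_integral_mono)
   fix y assume [simp]: "y \<in> space N"
   have "ennreal (\<bar>LINT r|R. w r * G (r, y)\<bar> powr p)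
     \<le> ennreal (measure R (space R) powr (p - 1)) * (Lp_nn p R (\<lambda>r. w r * G (r, y)))"
    by (rule R.powr_integral_le_nn[OF p]) measurable
   also have "... \<le> ennreal (measure R (space R) powr (p - 1)) * (\<integral>\<^sup>+r. ennreal (c powr p) * ennreal (\<bar>G (r, y)\<bar> powr p) \<partial>R)"
    using w(2) c p0 by (intro mult_left_mono nn_integral_mono)
     (auto simp: ennreal_mult[symmetric] abs_mult powr_mult[symmetric] intro!: powr_mono2 mult_right_mono)
   also have "... = ennreal m * (Lp_nn p R (\<lambda>r. G (r, y)))"
    by (subst nn_integral_cmult) (auto simp: m_def ennreal_mult mult.assoc)
   finally show "ennreal (\<bar>LINT r|R. w r * G (r, y)\<bar> powr p) \<le> ennreal m * (Lp_nn p R (\<lambda>r. G (r, y)))" .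
  qed
  also have "... = ennreal m * (\<integral>\<^sup>+y. \<integral>\<^sup>+r. ennreal (\<bar>G (r, y)\<bar> powr p) \<partial>R \<partial>N)" by (rule nn_integral_cmult) measurable
  also have "(\<integral>\<^sup>+y. \<integral>\<^sup>+r. ennreal (\<bar>G (r, y)\<bar> powr p) \<partial>R \<partial>N) = ennreal (Lp_norm p (R \<otimes> N) G powr p)"
   unfolding nn_integral_Lp_norm[OF G p0, symmetric] by (rule nn_integral_snd) measurable
  also have "ennreal m * ennreal (Lp_norm p (R \<otimes> N) G powr p) = ennreal ((m powr (1/p) * Lp_norm p (R \<otimes> N) G) powr p)"
   using m p0 by (simp add: ennreal_mult[symmetric] powr_mult powr_powr)
  finally have le: "(Lp_nn p N (?w G))
   \<le> ennreal ((m powr (1/p) * Lp_norm p (R \<otimes> N) G) powr p)" .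
  have mm: "(?w G) \<in> \<B> N" by measurable
  show "(?w G) \<in> Lp p N"
   "Lp_norm p N (?w G) \<le> m powr (1/p) * Lp_norm p (R \<otimes> N) G" using Lp_leI[OF mm _ p0 le] by auto
 qed
 show "Lp_op p (R \<otimes> N) N (\<lambda>G y. LINT r|R. w r * G (r, y))"
 proof (rule Lp_opI[OF p b])
  show "AE y in N. (LINT r|R. w r * (f (r, y) + g (r, y))) = (LINT r|R. w r * f (r, y)) + (LINT r|R. w r * g (r, y))"
   if "f \<in> Lp p (R \<otimes> N)" "g \<in> Lp p (R \<otimes> N)" for f g
   using int[OF that(1)] int[OF that(2)] by eventually_elim (simp add: distrib_left)
  show "AE y in N. (LINT r|R. w r * (d * f (r, y))) = d * (LINT r|R. w r * f (r, y))" for f d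
   by (simp add: mult.left_commute[of _ d])
 qed
qed

locale operator_lift =
 R: finite_measure R + N1: sigma_finite_measure N1 + N2: sigma_finite_measure N2
 for R :: "'r measure" and N1 :: "'a measure" and N2 :: "'b measure" +
 fixes p :: real and K :: "('a => real) => ('b => real)"
 assumes p: "1 \<le> p" and K: "Lp_op p N1 N2 K"
begin

lemma p0: "0 < p" using p by simp

sublocale P1: pair_sigma_finite R N1 ..
sublocale P2: pair_sigma_finite R N2 ..

abbreviation "X1 \<equiv> Lp p (R \<otimes> N1)"
abbreviation "X2 \<equiv> Lp p (R \<otimes> N2)"
abbreviation "n1 \<equiv> Lp_norm p (R \<otimes> N1)"
abbreviation "n2 \<equiv> Lp_norm p (R \<otimes> N2)"

lemmas slice1 = Lp_slice[OF R.sigma_finite_measure_axioms N1.sigma_finite_measure_axioms p0]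
lemmas slice2 = Lp_slice[OF R.sigma_finite_measure_axioms N2.sigma_finite_measure_axioms p0]
lemmas wint1 = Lp_weighted_integral_operator[OF R.finite_measure_axioms N1.sigma_finite_measure_axioms p]
lemmas wint2 = Lp_weighted_integral_operator[OF R.finite_measure_axioms N2.sigma_finite_measure_axioms p]

text \<open>Applying K slice by slice need not produce a measurable function of both variables,
  since each value is fixed only up to a null set. The last conjunct, commutation with weighted
  integrals over R, is carried along because it holds on rectangles and survives linear combinations
  and limits.\<close>

definition is_lift :: "('r \<times> 'a => real) => ('r \<times> 'b => real) => bool" where "is_lift G V \<longleftrightarrow> G \<in> X1 \<and> V \<in> X2 \<and>
  (AE r in R. AE y in N2. V (r, y) = K (\<lambda>y. G (r, y)) y) \<and> (\<forall>w c. w \<in> \<B> R --> (\<forall>r. \<bar>w r\<bar> \<le> c) -->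
    (AE y in N2. (LINT r|R. w r * V (r, y)) = K (\<lambda>y. LINT r|R. w r * G (r, y)) y))"

lemma is_liftD:
 assumes "is_lift G V" shows "G \<in> X1" "V \<in> X2" "AE r in R. AE y in N2. V (r, y) = K (\<lambda>y. G (r, y)) y"
  "w \<in> \<B> R ==> (\<And>r. \<bar>w r\<bar> \<le> c) ==> AE y in N2. (LINT r|R. w r * V (r, y)) = K (\<lambda>y. LINT r|R. w r * G (r, y)) y"
 using assms by (auto simp: is_lift_def)

lemma is_lift_norm_le:
 assumes C: "0 \<le> C" "\<And>f. f \<in> Lp p N1 ==> Lp_norm p N2 (K f) \<le> C * Lp_norm p N1 f" and L: "is_lift G V"
 shows "n2 V \<le> C * n1 G"
proof (rule Lp_pair_norm_le[OF R.sigma_finite_measure_axioms N1.sigma_finite_measure_axioms N2.sigma_finite_measure_axioms p0 C(1)])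
 show "AE r in R. Lp_norm p N2 (\<lambda>y. V (r, y)) \<le> C * Lp_norm p N1 (\<lambda>y. G (r, y))"
  using slice1(1)[OF is_liftD(1)[OF L]] slice2(1)[OF is_liftD(2)[OF L]] is_liftD(3)[OF L]
 proof eventually_elim
  case (elim r)
  have "Lp_norm p N2 (\<lambda>y. V (r, y)) = Lp_norm p N2 (K (\<lambda>y. G (r, y)))"
   using elim Lp_op_in[OF K elim(1)] by (intro Lp_norm_cong_AE) (auto simp: Lp_def)
  then show ?case using C(2)[OF elim(1)] by simp
 qed
qed (fact is_liftD[OF L])+

lemma is_lift_lin:
 assumes L: "is_lift G V" and L': "is_lift G' V'" shows "is_lift (\<lambda>z. G z + d * G' z) (\<lambda>z. V z + d * V' z)"
 unfolding is_lift_def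
proof (intro conjI allI impI)
 note D = is_liftD[OF L] and D' = is_liftD[OF L']
 show "(\<lambda>z. G z + d * G' z) \<in> X1" "(\<lambda>z. V z + d * V' z) \<in> X2"
  by (intro Lp_add[OF p] Lp_scale(1)[OF _ p0] D(1,2) D'(1,2))+
 show "AE r in R. AE y in N2. V (r, y) + d * V' (r, y) = K (\<lambda>y. G (r, y) + d * G' (r, y)) y"
  using slice1(1)[OF D(1)] slice1(1)[OF D'(1)] D(3) D'(3)
 proof eventually_elim
  case (elim r)
  show ?case using Lp_op_lin[OF p0 K elim(1,2), of d] elim(3,4) by eventually_elim simp
 qed
 fix u :: "'r => real" and c :: real assume u: "u \<in> \<B> R" "\<forall>r. \<bar>u r\<bar> \<le> c"
 then have u': "\<And>r. \<bar>u r\<bar> \<le> c" by auto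
 note W1 = wint1(1)[OF u(1) u'] and W2 = wint2(1)[OF u(1) u']
 note W = Lp_op_in[OF W1 D(1)] Lp_op_in[OF W1 D'(1)]
 have "AE y in N2. K (\<lambda>y. LINT r|R. u r * (G (r, y) + d * G' (r, y))) y
   = K (\<lambda>y. (LINT r|R. u r * G (r, y)) + d * (LINT r|R. u r * G' (r, y))) y"
  by (intro Lp_op_cong[OF K Lp_op_in[OF W1]] Lp_add[OF p] Lp_scale(1)[OF _ p0] W D D' Lp_op_lin[OF p0 W1])
 then show "AE y in N2. (LINT r|R. u r * (V (r, y) + d * V' (r, y))) = K (\<lambda>y. LINT r|R. u r * (G (r, y) + d * G' (r, y))) y"
  using Lp_op_lin[OF p0 K W, of d] Lp_op_lin[OF p0 W2 D(2) D'(2), of d] D(4)[OF u(1) u'] D'(4)[OF u(1) u']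
  by eventually_elim simp
qed

lemma is_lift_zero: "is_lift (\<lambda>z. 0) (\<lambda>z. 0)"
 unfolding is_lift_def using Lp_op_zero[OF p0 K] by (auto elim: eventually_mono)

lemma is_lift_scale: "is_lift G V ==> is_lift (\<lambda>z. d * G z) (\<lambda>z. d * V z)"
 using is_lift_lin[OF is_lift_zero, of G V d] by simp

lemma is_lift_add: "is_lift G V ==> is_lift G' V' ==> is_lift (\<lambda>z. G z + G' z) (\<lambda>z. V z + V' z)"
 using is_lift_lin[of G V G' V' 1] by simp

lemma is_lift_diff: "is_lift G V ==> is_lift G' V' ==> is_lift (\<lambda>z. G z - G' z) (\<lambda>z. V z - V' z)"
 using is_lift_lin[of G V G' V' "-1"] by simp

text \<open>The bound on K makes the lifts a Cauchy sequence. The integral identity passes to the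
  limit by continuity of the operators involved, and the slicewise identity along a fast subsequence
  on which almost all slices converge.\<close>

lemma is_lift_lim:
 assumes L: "\<And>n. \<exists>V. is_lift (G n) V" and G: "G0 \<in> X1" and lim: "(\<lambda>n. n1 (\<lambda>z. G n z - G0 z)) ----> 0"
 shows "\<exists>V. is_lift G0 V"
proof -
 let ?g = "\<lambda>n z. G n z - G0 z"
 obtain V where L: "\<And>n. is_lift (G n) (V n)" using L by metis
 have Gn: "G n \<in> X1" and Vn: "V n \<in> X2" for n using L[of n] by (auto simp: is_lift_def)
 obtain C where C: "0 < C" "\<And>f. f \<in> Lp p N1 ==> Lp_norm p N2 (K f) \<le> C * Lp_norm p N1 f"
  using Lp_op_bound[OF K] by metis
 obtain V0 where V0: "V0 \<in> X2" and limV: "(\<lambda>n. n2 (\<lambda>z. V n z - V0 z)) ----> 0"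
 proof (rule Lp_Cauchy_convergent[OF p Vn])
  fix e :: real assume e: "0 < e"
  then have "0 < e / (2 * C)" using C by simp
  then obtain M where M: "\<And>n. n \<ge> M ==> n1 (?g n) < e / (2 * C)" using LIMSEQ_D[OF lim] by force
  have "n2 (\<lambda>z. V m z - V n z) < e" if "m \<ge> M" "n \<ge> M" for m n
  proof -
   have "n2 (\<lambda>z. V m z - V n z) \<le> C * n1 (\<lambda>z. G m z - G n z)"
    by (rule is_lift_norm_le[OF less_imp_le[OF C(1)] C(2) is_lift_diff[OF L L]])
   also have "n1 (\<lambda>z. G m z - G n z) \<le> n1 (\<lambda>z. G m z - G0 z) + n1 (?g n)"
    using Lp_norm_triangle_mid[OF p Gn[of m] G Gn[of n]] Lp_norm_minus_commute[of p _ G0 "G n"] by simp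
   also have "... < e / (2 * C) + e / (2 * C)" using M that by (intro add_strict_mono) auto
   finally show ?thesis using C(1) by (simp add: field_simps)
  qed
  then show "\<exists>N. \<forall>m\<ge>N. \<forall>n\<ge>N. n2 (\<lambda>z. V m z - V n z) < e" by blast
 qed
 let ?v = "\<lambda>n z. V n z - V0 z"
 have "is_lift G0 V0" unfolding is_lift_def
 proof (intro conjI allI impI G V0)
  have s: "(\<lambda>n. n1 (?g n) + n2 (?v n)) ----> 0" using tendsto_add[OF lim limV] by simp
  \<comment> \<open>One index makes both the arguments and their lifts geometrically close to the
    limits, as \<open>Lp_slice_lim\<close> requires.\<close>
  have "\<exists>i. n1 (?g i) + n2 (?v i) < (1/2)^n" for n :: nat
   using LIMSEQ_D[OF s, of "(1/2)^n"] by force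
  then obtain i where i: "\<And>n. n1 (?g (i n)) + n2 (?v (i n)) < (1/2)^n" by metis
  have a1: "n1 (?g (i n)) \<le> (1/2)^n" and a2: "n2 (?v (i n)) \<le> (1/2)^n" for n
   using i[of n] Lp_norm_nonneg[of p "R \<otimes> N1" "?g (i n)"]
    Lp_norm_nonneg[of p "R \<otimes> N2" "?v (i n)"] by linarith+
  have "AE r in R. \<forall>n. AE y in N2. V (i n) (r, y) = K (\<lambda>y. G (i n) (r, y)) y"
   using L by (auto simp: is_lift_def AE_all_countable)
  moreover have "AE r in R. \<forall>n. (\<lambda>y. G (i n) (r, y)) \<in> Lp p N1 \<and> (\<lambda>y. V (i n) (r, y)) \<in> Lp p N2"
   using slice1(1)[OF Gn] slice2(1)[OF Vn] by (simp add: AE_all_countable)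
  ultimately show "AE r in R. AE y in N2. V0 (r, y) = K (\<lambda>y. G0 (r, y)) y" using slice1(1)[OF G] slice2(1)[OF V0]
    Lp_slice_lim[OF R.sigma_finite_measure_axioms N1.sigma_finite_measure_axioms p Gn G a1]
    Lp_slice_lim[OF R.sigma_finite_measure_axioms N2.sigma_finite_measure_axioms p Vn V0 a2]
  proof eventually_elim
   case (elim r)
   have k: "K (\<lambda>y. G (i n) (r, y)) \<in> Lp p N2" for n using elim(2) by (intro Lp_op_in[OF K]) auto
   have "(\<lambda>n. Lp_norm p N2 (\<lambda>y. K (\<lambda>y. G (i n) (r, y)) y - K (\<lambda>y. G0 (r, y)) y)) ----> 0"
    using elim by (intro Lp_op_lim[OF p K]) auto
   moreover have "Lp_norm p N2 (\<lambda>y. K (\<lambda>y. G (i n) (r, y)) y - V0 (r, y)) = Lp_norm p N2 (\<lambda>y. V (i n) (r, y) - V0 (r, y))" for n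
   proof (rule Lp_norm_cong_AE)
    show "AE y in N2. K (\<lambda>y. G (i n) (r, y)) y - V0 (r, y) = V (i n) (r, y) - V0 (r, y)"
     using spec[OF elim(1), of n] by eventually_elim simp
   qed (use k[of n] elim in \<open>auto simp: Lp_def intro!: borel_measurable_diff\<close>)
   then have "(\<lambda>n. Lp_norm p N2 (\<lambda>y. K (\<lambda>y. G (i n) (r, y)) y - V0 (r, y))) ----> 0" using elim by simp
   ultimately show ?case by (rule Lp_lim_unique[OF p k elim(4) Lp_op_in[OF K elim(3)], rotated])
  qed
  fix u :: "'r => real" and c :: real assume u: "u \<in> \<B> R" "\<forall>r. \<bar>u r\<bar> \<le> c"
  then have u': "\<And>r. \<bar>u r\<bar> \<le> c" by auto
  let ?K = "\<lambda>G. K (\<lambda>y. LINT r|R. u r * G (r, y))" and ?V = "\<lambda>n y. LINT r|R. u r * V n (r, y)" and ?W = "\<lambda>y. LINT r|R. u r * V0 (r, y)"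
  note W1 = wint1(1)[OF u(1) u'] and W2 = wint2(1)[OF u(1) u']
  note KW = Lp_op_compose[OF p W1 K]
  have 1: "(\<lambda>n. Lp_norm p N2 (\<lambda>y. ?K (G n) y - ?K G0 y)) ----> 0"
   by (rule Lp_op_lim[OF p KW Gn G lim])
  have 2: "(\<lambda>n. Lp_norm p N2 (\<lambda>y. ?V n y - ?W y)) ----> 0"
   by (rule Lp_op_lim[OF p W2 Vn V0 limV])
  have 3: "Lp_norm p N2 (\<lambda>y. ?K (G n) y - ?W y)
   = Lp_norm p N2 (\<lambda>y. ?V n y - ?W y)" for n
  proof (rule Lp_norm_cong_AE)
   have "AE y in N2. ?V n y = ?K (G n) y"
    using L[of n] u by (auto simp: is_lift_def)
   then show "AE y in N2. ?K (G n) y - ?W y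
    = ?V n y - ?W y" by eventually_elim simp
  qed (intro borel_measurable_diff Lp_meas[OF Lp_op_in[OF KW Gn]] Lp_meas[OF Lp_op_in[OF W2]] Vn V0)+
  show "AE y in N2. ?W y = ?K G0 y"
   using Lp_lim_unique[OF p Lp_op_in[OF KW Gn] Lp_op_in[OF W2 V0] Lp_op_in[OF KW G] _ 1]
    2[folded 3] by blast
 qed
 then show ?thesis by blast
qed

lemma is_lift_rectangle:
 assumes a: "a \<in> sets R" and b: "b \<in> sets N1" "emeasure N1 b < \<infinity>"
 shows "is_lift (ind (a \<times> b)) (\<lambda>(r, y). ind a r * K (ind b) y)"
proof -
 have ib: "ind b \<in> Lp p N1" by (rule Lp_indicator[OF b])
 note Kb = Lp_op_in[OF K ib]
 have [measurable]: "a \<in> sets R" "b \<in> sets N1" "K (ind b) \<in> \<B> N2" using a b Kb by (auto simp: Lp_def)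
 show ?thesis unfolding is_lift_def
 proof (intro conjI allI impI)
  have "emeasure (R \<otimes> N1) (a \<times> b) = emeasure R a * emeasure N1 b" by (rule N1.emeasure_pair_measure_Times[OF a b(1)])
  also have "... < \<infinity>" using b(2) by (simp add: ennreal_mult_less_top R.emeasure_eq_measure)
  finally show "ind (a \<times> b) \<in> X1" by (intro Lp_indicator) auto
  have "(Lp_nn p (R \<otimes> N2) (\<lambda>z. case z of (r, y) => ind a r * K (ind b) y))
    = (\<integral>\<^sup>+r. \<integral>\<^sup>+y. ennreal (\<bar>ind a r * K (ind b) y\<bar> powr p) \<partial>N2 \<partial>R)" by (subst N2.nn_integral_fst[symmetric]) auto
  also have "... = (\<integral>\<^sup>+r. ind a r * (Lp_nn p N2 (\<lambda>y. K (ind b) y)) \<partial>R)"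
   by (intro nn_integral_cong) (auto simp: indicator_def)
  also have "... = emeasure R a * (Lp_nn p N2 (\<lambda>y. K (ind b) y))" by (subst nn_integral_multc) auto
  also have "... < \<infinity>" using Kb by (simp add: Lp_iff_nn_integral ennreal_mult_less_top R.emeasure_eq_measure)
  finally show "(\<lambda>(r, y). ind a r * K (ind b) y) \<in> X2" by (simp add: Lp_iff_nn_integral)
  have e: "ind (a \<times> b) (r, y) = (ind a r * ind b y :: real)" for r y by (simp add: indicator_times)
  show "AE r in R. AE y in N2. (case (r, y) of (r, y) => ind a r * K (ind b) y) = K (\<lambda>y. ind (a \<times> b) (r, y)) y"
   unfolding e
  proof (rule AE_I2)
   fix r
   show "AE y in N2. (case (r, y) of (r, y) => ind a r * K (ind b) y) = K (\<lambda>y. ind a r * ind b y) y"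
    using Lp_op_scale[OF K ib, of "ind a r"] by eventually_elim simp
  qed
  fix u :: "'r => real" and c :: real assume u: "u \<in> \<B> R" "\<forall>r. \<bar>u r\<bar> \<le> c"
  have m: "u r * (ind a r * x) = (u r * ind a r) * x" for r x by simp
  show "AE y in N2. (LINT r|R. u r * (case (r, y) of (r, y) => ind a r * K (ind b) y)) = K (\<lambda>y. LINT r|R. u r * ind (a \<times> b) (r, y)) y"
   unfolding e prod.case m integral_mult_left_zero
   using Lp_op_scale[OF K ib, of "LINT r|R. u r * ind a r"] by eventually_elim simp
 qed
qed

text \<open>Dynkin's argument starting from rectangles, which are stable under intersection. Inside
  a strip of finite measure the complement is a difference of two functions of Lp, so linearity
  handles it.\<close>

lemma is_lift_indicator_strip:
 assumes B: "B \<in> sets N1" "emeasure N1 B < \<infinity>" and A: "A \<in> sets (R \<otimes> N1)" shows "\<exists>V. is_lift (ind (A \<inter> (space R \<times> B))) V"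
proof -
 let ?B = "space R \<times> B"
 have A: "A \<in> sigma_sets (space R \<times> space N1) {a \<times> b | a b. a \<in> sets R \<and> b \<in> sets N1}"
  using A by (simp add: sets_pair_measure)
 have fin: "emeasure (R \<otimes> N1) ?B < \<infinity>" using N1.emeasure_pair_measure_Times[OF sets.top[of R] B(1)] B(2)
  by (simp add: ennreal_mult_less_top R.emeasure_eq_measure)
 have BI: "(ind ?B :: _ => real) \<in> X1" using fin B by (intro Lp_indicator) auto
 have Bsub: "B \<subseteq> space N1" by (rule sets.sets_into_space[OF B(1)])
 show ?thesis using Int_stable_pair_measure_generator pair_measure_closed A
 proof (induction A rule: sigma_sets_induct_disjoint)
  case (basic A)
  then obtain a b where ab: "A = a \<times> b" "a \<in> sets R" "b \<in> sets N1" by auto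
  have "A \<inter> ?B = a \<times> (b \<inter> B)" using ab sets.sets_into_space[OF ab(2)] by auto
  moreover have "emeasure N1 (b \<inter> B) < \<infinity>" using B ab emeasure_mono[of "b \<inter> B" B N1] by (auto intro: le_less_trans)
  ultimately show ?case using is_lift_rectangle[OF ab(2), of "b \<inter> B"] ab B by auto
 next
  case empty
  show ?case using is_lift_zero by (auto simp: indicator_def[abs_def])
 next
  case (compl A)
  then obtain V where V: "is_lift (ind (A \<inter> ?B)) V" by blast
  have "ind ((space R \<times> space N1 - A) \<inter> ?B) = (\<lambda>z. ind ?B z - ind (A \<inter> ?B) z :: real)"
   using Bsub by (auto simp: fun_eq_iff indicator_def)
  then show ?case using is_lift_diff[OF is_lift_rectangle[OF sets.top B] V] by auto
 next
  case (union A)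
  then have Am: "A i \<in> sets (R \<otimes> N1)" for i by (auto simp: sets_pair_measure)
  let ?U = "\<lambda>n. (\<Union>i<n. A i) \<inter> ?B"
  have UL: "(ind (\<Union>(range A) \<inter> ?B) :: _ => real) \<in> X1"
   using Am B by (intro Lp_mono_AE(1)[OF BI _ _ p0]) (auto simp: indicator_def)
  have S: "\<exists>V. is_lift (\<lambda>z. \<Sum>i<n. ind (A i \<inter> ?B) z) V" for n :: nat
  proof (induction n)
   case 0
   show ?case using is_lift_zero by auto
  next
   case (Suc n)
   then show ?case using union(3)[of n] is_lift_add by (fastforce simp: sum.lessThan_Suc)
  qed
  have ind: "(\<Sum>i<n. ind (A i \<inter> ?B) z) = (ind (?U n) z :: real)" for n z
  proof -
   have "(\<Sum>i<n. ind (A i \<inter> ?B) z) = (ind (\<Union>i\<in>{..<n}. A i \<inter> ?B) z :: real)"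
    using union(1) by (intro indicator_UN_disjoint[symmetric]) (auto simp: disjoint_family_on_def)
   also have "(\<Union>i\<in>{..<n}. A i \<inter> ?B) = (\<Union>i<n. A i) \<inter> ?B" by auto
   finally show ?thesis .
  qed
  show ?case
  proof (rule is_lift_lim[OF S UL])
   show "(\<lambda>n. n1 (\<lambda>z. (\<Sum>i<n. ind (A i \<inter> ?B) z) - ind (\<Union>(range A) \<inter> ?B) z)) ----> 0" unfolding ind
   proof (rule Lp_dominated[OF p0 BI])
    show "AE z in R \<otimes> N1. (\<lambda>n. ind (?U n) z) ----> (ind (\<Union>(range A) \<inter> ?B) z :: real)"
    proof (rule AE_I2)
     fix z
     show "(\<lambda>n. ind (?U n) z) ----> (ind (\<Union>(range A) \<inter> ?B) z :: real)"
     proof (cases "z \<in> \<Union>(range A) \<inter> ?B")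
      case True
      then obtain i where i: "z \<in> A i" "z \<in> ?B" by auto
      have "eventually (\<lambda>n. ind (?U n) z = (1::real)) sequentially"
       using eventually_gt_at_top[of i] by eventually_elim (use i in \<open>auto simp: indicator_def\<close>)
      then show ?thesis using True by (simp add: tendsto_eventually)
     next
      case False
      then have "ind (?U n) z = (0::real)" for n by (auto simp: indicator_def)
      then show ?thesis using False by simp
     qed
    qed
    show "(\<lambda>z. ind (?U n) z :: real) \<in> \<B> (R \<otimes> N1)" for n
     using Am B by (intro borel_measurable_indicator) auto
   qed (use Am B UL in \<open>auto simp: indicator_def Lp_def\<close>)
  qed
 qed
qed

text \<open>Indicators of sets of finite measure are limits of their parts in an increasing sequence
  of strips; the rest is the induction over Lp.\<close>

lemma is_lift_exists:
 assumes "G \<in> X1" shows "\<exists>V. is_lift G V" using assms p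
proof (induction G rule: Lp_induct)
 case (indicator A)
 obtain B :: "nat => 'a set" where B: "range B \<subseteq> sets N1" "(\<Union>i. B i) = space N1" "\<And>i. emeasure N1 (B i) \<noteq> \<infinity>" "incseq B"
  using N1.sigma_finite_incseq by metis
 have Bs: "B i \<in> sets N1" "emeasure N1 (B i) < \<infinity>" for i using B by (auto simp: less_top)
 let ?A = "\<lambda>n. A \<inter> (space R \<times> B n)"
 have AI: "(ind A :: _ => real) \<in> X1" by (rule Lp_indicator[OF indicator])
 show ?case
 proof (rule is_lift_lim[OF is_lift_indicator_strip[OF Bs indicator(1)] AI])
  show "(\<lambda>n. n1 (\<lambda>z. ind (?A n) z - ind A z)) ----> 0"
  proof (rule Lp_dominated[OF p0 AI])
   show "AE z in R \<otimes> N1. (\<lambda>n. ind (?A n) z) ----> (ind A z :: real)"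
   proof (rule AE_I2)
    fix z assume z: "z \<in> space (R \<otimes> N1)"
    then have "snd z \<in> (\<Union>i. B i)" unfolding B(2) by (auto simp: space_pair_measure)
    then obtain i where i: "snd z \<in> B i" by blast
    have "eventually (\<lambda>n. ind (?A n) z = (ind A z :: real)) sequentially"
     using eventually_ge_at_top[of i]
     by eventually_elim (use i z B(4) in \<open>force simp: indicator_def incseq_def space_pair_measure\<close>)
    then show "(\<lambda>n. ind (?A n) z) ----> (ind A z :: real)" by (rule tendsto_eventually)
   qed
   show "(\<lambda>z. ind (?A n) z :: real) \<in> \<B> (R \<otimes> N1)" for n
    using indicator Bs by (intro borel_measurable_indicator) auto
  qed (use indicator Bs in \<open>auto simp: indicator_def\<close>)
 qed
next
 case (add f g) then show ?case using is_lift_add by blast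
next
 case (scale f c) then show ?case using is_lift_scale by blast
next
 case (lim f g) then show ?case using is_lift_lim by blast
qed

definition lift :: "('r \<times> 'a => real) => ('r \<times> 'b => real)" where "lift G = (SOME V. is_lift G V)"

lemma lift: "G \<in> X1 ==> is_lift G (lift G)" unfolding lift_def using is_lift_exists by (rule someI_ex)

lemma lift_AE: "G \<in> X1 ==> AE r in R. AE y in N2. lift G (r, y) = K (\<lambda>y. G (r, y)) y"
 using lift by (auto simp: is_lift_def)

lemma lift_integral: "G \<in> X1 ==> w \<in> \<B> R ==> (\<And>r. \<bar>w r\<bar> \<le> c) ==>
  AE y in N2. (LINT r|R. w r * lift G (r, y)) = K (\<lambda>y. LINT r|R. w r * G (r, y)) y"
 using lift by (auto simp: is_lift_def)

text \<open>The working description of \<open>lift\<close>, which is itself a mere choice: any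
  jointly measurable function with the right slices is the lift.\<close>

lemma lift_unique:
 assumes "G \<in> X1" "V \<in> \<B> (R \<otimes> N2)" "AE r in R. AE y in N2. V (r, y) = K (\<lambda>y. G (r, y)) y"
 shows "AE z in R \<otimes> N2. V z = lift G z"
proof -
 have [measurable]: "V \<in> \<B> (R \<otimes> N2)" "lift G \<in> \<B> (R \<otimes> N2)"
  using assms lift[OF assms(1)] by (auto simp: is_lift_def Lp_def)
 have "AE r in R. AE y in N2. V (r, y) = lift G (r, y)" using lift_AE[OF assms(1)] assms(3) by eventually_elim auto
 then show ?thesis by (intro P2.AE_pair_measure) auto
qed

lemma lift_operator: "Lp_op p (R \<otimes> N1) (R \<otimes> N2) lift"
proof -
 obtain C where C: "0 < C" "\<And>f. f \<in> Lp p N1 ==> Lp_norm p N2 (K f) \<le> C * Lp_norm p N1 f"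
  using Lp_op_bound[OF K] by metis
 have u: "AE z in R \<otimes> N2. lift G z = V z" if "is_lift G V" for G V
  using lift_unique[OF is_liftD(1)[OF that] Lp_meas[OF is_liftD(2)[OF that]] is_liftD(3)[OF that]] by eventually_elim simp
 show ?thesis by (rule Lp_opI[OF p is_liftD(2)[OF lift] is_lift_norm_le[OF less_imp_le[OF C(1)] C(2) lift]])
   (assumption | intro u is_lift_add is_lift_scale lift)+
qed

end

subsection \<open>The flow\<close>

context transport_setting
begin

lemma flow_0 [simp]: "\<Phi> x 0 = x" and flow_vderiv: "(\<Phi> x has_vector_derivative F (\<Phi> x t)) (at t)"
 and flow_unique: "solves_ode F x X ==> X = \<Phi> x" using flow by (auto simp: is_flow_def solves_ode_def)

lemma flow_add: "\<Phi> (\<Phi> x s) t = \<Phi> x (s + t)"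
proof -
 have "solves_ode F (\<Phi> x s) (\<lambda>t. \<Phi> x (s + t))" unfolding solves_ode_def
 proof (intro conjI allI)
  fix t
  have "((\<Phi> x \<circ> (+) s) has_vector_derivative 1 *\<^sub>R F (\<Phi> x (s + t))) (at t)"
   by (rule vector_diff_chain_at[OF _ flow_vderiv]) (auto intro!: derivative_eq_intros simp: has_vector_derivative_def)
  then show "((\<lambda>t. \<Phi> x (s + t)) has_vector_derivative F (\<Phi> x (s + t))) (at t)" by (simp add: o_def)
 qed simp
 from flow_unique[OF this] show ?thesis by metis
qed

text \<open>Gronwall's argument for the squared distance, which unlike the distance is
  differentiable where it vanishes: it is nonincreasing after multiplication by
  \<open>exp (- 2 * L * t)\<close> for positive times, and nondecreasing after multiplication by
  \<open>exp (2 * L * t)\<close> for negative ones.\<close>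

lemma flow_lipschitz_dist:
 obtains L where "0 \<le> L" "\<And>x y t. norm (\<Phi> x t - \<Phi> y t) \<le> norm (x - y) * exp (L * \<bar>t\<bar>)"
proof -
 obtain L where L: "L-lipschitz_on UNIV F" using lipschitz by blast
 have L0: "0 \<le> L" using L by (rule lipschitz_on_nonneg)
 have le: "norm (F a - F b) \<le> L * norm (a - b)" for a b using lipschitz_onD[OF L, of a b] by (simp add: dist_norm)
 have "norm (\<Phi> x t - \<Phi> y t) \<le> norm (x - y) * exp (L * \<bar>t\<bar>)" for x y t
 proof -
  define d where "d s = \<Phi> x s - \<Phi> y s" for s
  define d' where "d' s = F (\<Phi> x s) - F (\<Phi> y s)" for s
  have dd: "(d has_vector_derivative d' s) (at s)" for s unfolding d_def d'_def by (intro derivative_intros flow_vderiv)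
  have der: "((\<lambda>s. (d s \<bullet> d s) * exp (c * s)) has_real_derivative
    (2 * (d s \<bullet> d' s) + c * (d s \<bullet> d s)) * exp (c * s)) (at s)" for c s
  proof -
   have "((\<lambda>s. d s \<bullet> d s) has_derivative (\<lambda>h. d s \<bullet> (h *\<^sub>R d' s) + (h *\<^sub>R d' s) \<bullet> d s)) (at s)"
    using dd[of s] unfolding has_vector_derivative_def by (intro has_derivative_inner)
   then have "((\<lambda>s. d s \<bullet> d s) has_real_derivative 2 * (d s \<bullet> d' s)) (at s)"
    by (rule has_derivative_imp_has_field_derivative) (simp add: inner_commute)
   then show ?thesis by (auto intro!: derivative_eq_intros simp: algebra_simps)
  qed
  have cs: "\<bar>d s \<bullet> d' s\<bar> \<le> L * (d s \<bullet> d s)" for s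
  proof -
   have "\<bar>d s \<bullet> d' s\<bar> \<le> norm (d s) * norm (d' s)" by (rule Cauchy_Schwarz_ineq2)
   also have "... \<le> norm (d s) * (L * norm (d s))" using le by (intro mult_left_mono) (auto simp: d_def d'_def)
   finally show ?thesis by (simp add: dot_square_norm power2_eq_square mult_ac)
  qed
  have key: "(d t \<bullet> d t) * exp (- 2 * L * \<bar>t\<bar>) \<le> d 0 \<bullet> d 0"
  proof (cases "0 \<le> t")
   case True
   have "(d t \<bullet> d t) * exp ((- 2 * L) * t) \<le> (d 0 \<bullet> d 0) * exp ((- 2 * L) * 0)"
   proof (rule DERIV_nonpos_imp_nonincreasing[OF True])
    show "\<exists>y. ((\<lambda>s. (d s \<bullet> d s) * exp ((- 2 * L) * s)) has_real_derivative y) (at s) \<and> y \<le> 0" for s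
     using der[of "- 2 * L" s] cs[of s] by (intro exI conjI) (auto intro!: mult_nonpos_nonneg)
   qed
   then show ?thesis using True by simp
  next
   case False
   then have "(d t \<bullet> d t) * exp ((2 * L) * t) \<le> (d 0 \<bullet> d 0) * exp ((2 * L) * 0)"
   proof (intro DERIV_nonneg_imp_nondecreasing[where f="\<lambda>s. (d s \<bullet> d s) * exp ((2 * L) * s)"])
    show "\<exists>y. ((\<lambda>s. (d s \<bullet> d s) * exp ((2 * L) * s)) has_real_derivative y) (at s) \<and> 0 \<le> y" for s
     using der[of "2 * L" s] cs[of s] by (intro exI conjI) (auto intro!: mult_nonneg_nonneg)
   qed simp
   then show ?thesis using False by simp
  qed
  have "(norm (d t))\<^sup>2 \<le> (norm (d 0) * exp (L * \<bar>t\<bar>))\<^sup>2" using mult_right_mono[OF key, of "exp (2 * L * \<bar>t\<bar>)"]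
   by (simp add: mult.assoc exp_add[symmetric] dot_square_norm power_mult_distrib exp_double[symmetric])
  then show ?thesis by (auto simp: d_def dest!: power2_le_imp_le)
 qed
 with L0 show ?thesis by (rule that)
qed

lemma flow_continuous_time: "continuous_on A (\<Phi> x)"
 by (meson continuous_at_imp_continuous_on flow_vderiv has_vector_derivative_continuous)

lemma flow_continuous: "continuous_on UNIV (\<lambda>(x, t). \<Phi> x t)"
proof -
 obtain L where L: "0 \<le> L" "\<And>x y t. norm (\<Phi> x t - \<Phi> y t) \<le> norm (x - y) * exp (L * \<bar>t\<bar>)"
  by (rule flow_lipschitz_dist) blast
 have "((\<lambda>(x, t). \<Phi> x t) ---> \<Phi> y s) (at (y, s))" for y s
 proof -
  have fl: "((\<lambda>z. fst z) ---> y) (at (y, s))" "((\<lambda>z. snd z) ---> s) (at (y, s))" by (auto intro!: tendsto_eq_intros)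
  have 1: "((\<lambda>z. norm (fst z - y) * exp (L * \<bar>snd z\<bar>)) ---> norm (y - y) * exp (L * \<bar>s\<bar>)) (at (y, s))"
   by (intro tendsto_intros fl)
  have "isCont (\<Phi> y) s" using flow_continuous_time[of UNIV y] by (simp add: continuous_on_eq_continuous_at)
  then have 2: "((\<lambda>z. norm (\<Phi> y (snd z) - \<Phi> y s)) ---> norm (\<Phi> y s - \<Phi> y s)) (at (y, s))"
   by (intro tendsto_intros isCont_tendsto_compose[OF _ fl(2)])
  have "((\<lambda>z. \<Phi> (fst z) (snd z) - \<Phi> y s) ---> 0) (at (y, s))"
  proof (rule Lim_null_comparison)
   have "norm (\<Phi> a b - \<Phi> y s) \<le> norm (a - y) * exp (L * \<bar>b\<bar>) + norm (\<Phi> y b - \<Phi> y s)" for a b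
    using L(2)[of a b y] norm_triangle_ineq[of "\<Phi> a b - \<Phi> y b" "\<Phi> y b - \<Phi> y s"] by simp
   then show "\<forall>\<^sub>F z in at (y, s). norm (\<Phi> (fst z) (snd z) - \<Phi> y s)
     \<le> norm (fst z - y) * exp (L * \<bar>snd z\<bar>) + norm (\<Phi> y (snd z) - \<Phi> y s)" by simp
   show "((\<lambda>z. norm (fst z - y) * exp (L * \<bar>snd z\<bar>) + norm (\<Phi> y (snd z) - \<Phi> y s)) ---> 0) (at (y, s))"
    using tendsto_add[OF 1 2] by simp
  qed
  then show ?thesis by (simp add: case_prod_unfold LIM_zero_iff)
 qed
 then show ?thesis by (auto simp: continuous_on_def case_prod_unfold intro: tendsto_within_subset)
qed

lemma flow_continuous_on [continuous_intros]:
 assumes "continuous_on A f" "continuous_on A g" shows "continuous_on A (\<lambda>x. \<Phi> (f x) (g x))"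
 using continuous_on_compose2[OF flow_continuous continuous_on_Pair[OF assms]] by simp

lemma flow_measurable [measurable]:
 assumes "f \<in> M \<rightarrow>\<^sub>M borel" "g \<in> \<B> M" shows "(\<lambda>x. \<Phi> (f x) (g x)) \<in> M \<rightarrow>\<^sub>M borel"
proof -
 have "(\<lambda>x. case (f x, g x) of (x, t) => \<Phi> x t) \<in> M \<rightarrow>\<^sub>M borel"
  by (rule measurable_compose[of "\<lambda>x. (f x, g x)" M "borel \<otimes> borel"])
   (use assms borel_measurable_continuous_onI[OF flow_continuous] in \<open>auto simp: borel_prod\<close>)
 then show ?thesis by simp
qed

section \<open>Invariance of the measure under the flow\<close>

lemma sets_mu [measurable_cong, simp]: "sets \<mu> = sets borel" using radon by (simp add: radon_measure_def)

lemma space_mu [simp]: "space \<mu> = UNIV" using sets_eq_imp_space_eq[OF sets_mu] by simp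

lemma mu_compact: "compact K ==> emeasure \<mu> K < \<infinity>" using radon by (simp add: radon_measure_def)

sublocale mu: sigma_finite_measure \<mu>
proof
 show "\<exists>A. countable A \<and> A \<subseteq> sets \<mu> \<and> \<Union>A = space \<mu> \<and> (\<forall>a\<in>A. emeasure \<mu> a \<noteq> \<infinity>)"
 proof (intro exI[of _ "range (\<lambda>n::nat. cball 0 (real n))"] conjI)
  have "x \<in> (\<Union>n::nat. cball 0 (real n))" for x :: 'a using real_arch_simple[of "norm x"] by (auto simp: dist_norm)
  then show "\<Union> (range (\<lambda>n::nat. cball (0::'a) (real n))) = space \<mu>" by auto
  show "\<forall>a\<in>range (\<lambda>n::nat. cball (0::'a) (real n)). emeasure \<mu> a \<noteq> \<infinity>"
   using mu_compact[OF compact_cball] by (auto simp: less_top)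
 qed auto
qed

text \<open>\<open>invariant\<close> speaks of images, a pushforward of preimages; the preimage at
  time t is the image at time -t.\<close>

lemma flow_distr: "distr \<mu> borel (\<lambda>x. \<Phi> x t) = \<mu>"
proof (rule measure_eqI)
 fix A assume "A \<in> sets (distr \<mu> borel (\<lambda>x. \<Phi> x t))"
 then have A: "A \<in> sets borel" by simp
 have "(\<lambda>x. \<Phi> x t) -` A \<inter> space \<mu> = (\<lambda>x. \<Phi> x (- t)) ` A"
 proof (intro set_eqI iffI)
  fix x assume "x \<in> (\<lambda>x. \<Phi> x t) -` A \<inter> space \<mu>"
  then have "x = \<Phi> (\<Phi> x t) (- t)" "\<Phi> x t \<in> A" by (auto simp: flow_add)
  then show "x \<in> (\<lambda>x. \<Phi> x (- t)) ` A" by blast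
 qed (auto simp: flow_add)
 then show "emeasure (distr \<mu> borel (\<lambda>x. \<Phi> x t)) A = emeasure \<mu> A"
  using A invariant[of A "- t"] by (simp add: emeasure_distr)
qed simp

lemma nn_integral_flow:
 assumes "h \<in> \<B> borel" shows "(\<integral>\<^sup>+x. h (\<Phi> x t) \<partial>\<mu>) = (\<integral>\<^sup>+x. h x \<partial>\<mu>)"
 using assms by (subst (2) flow_distr[of t, symmetric], subst nn_integral_distr) auto

lemma AE_flow:
 assumes "AE x in \<mu>. P x" shows "AE x in \<mu>. P (\<Phi> x t)"
proof -
 obtain N where N: "{x. \<not> P x} \<subseteq> N" "emeasure \<mu> N = 0" "N \<in> sets borel" using assms by (elim AE_E) auto
 have "emeasure \<mu> {x. \<Phi> x t \<in> N} = emeasure (distr \<mu> borel (\<lambda>x. \<Phi> x t)) N"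
  using N(3) by (subst emeasure_distr) (auto simp: vimage_def)
 then have "emeasure \<mu> {x. \<Phi> x t \<in> N} = 0" using N(2) by (simp add: flow_distr)
 moreover have "{x. \<Phi> x t \<in> N} \<in> sets \<mu>" using N(3) by measurable
 ultimately show ?thesis using N(1) by (intro AE_I[of _ _ "{x. \<Phi> x t \<in> N}"]) auto
qed

subsection \<open>Hitting times\<close>

lemma tau_nonneg: "0 \<le> tau \<sigma> x" unfolding tau_def by (rule Inf_greatest) auto

lemma tau_inside: "0 < s ==> ereal s < tau \<sigma> x ==> \<Phi> x (\<sigma> * s) \<in> \<Omega>"
 unfolding tau_def using Inf_lower[of "ereal s" "{ereal s |s. 0 < s \<and> \<Phi> x (\<sigma> * s) \<notin> \<Omega>}"] by force

lemma tau_geI: "(\<And>s. 0 < s ==> ereal s < a ==> \<Phi> x (\<sigma> * s) \<in> \<Omega>) ==> a \<le> tau \<sigma> x"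
 unfolding tau_def by (rule Inf_greatest) (auto simp: not_less[symmetric])

lemma tau_le: "0 < s ==> \<Phi> x (\<sigma> * s) \<notin> \<Omega> ==> tau \<sigma> x \<le> ereal s" unfolding tau_def by (rule Inf_lower) auto

lemma tau_eqI:
 assumes "0 < r" "\<And>s. 0 < s ==> s < r ==> \<Phi> x (\<sigma> * s) \<in> \<Omega>" "\<Phi> x (\<sigma> * r) \<notin> \<Omega>" shows "tau \<sigma> x = ereal r"
 using assms by (intro antisym tau_le tau_geI) auto

lemma flow_stays:
 assumes "\<Phi> x (\<sigma> * r) \<in> \<Omega>" obtains e where "0 < e" "\<And>s. \<bar>s - r\<bar> < e ==> \<Phi> x (\<sigma> * s) \<in> \<Omega>"
proof -
 have "open ((\<lambda>s. \<Phi> x (\<sigma> * s)) -` \<Omega>)" by (intro open_vimage open_Omega continuous_intros)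
 then obtain e where "0 < e" "ball r e \<subseteq> (\<lambda>s. \<Phi> x (\<sigma> * s)) -` \<Omega>" using assms open_contains_ball by (metis vimageI2)
 then show ?thesis by (intro that[of e]) (auto simp: dist_real_def abs_minus_commute subset_iff)
qed

text \<open>The infimum is attained because \<Omega> is open: an orbit still inside at time r would
  remain inside a little longer.\<close>

lemma tau_outside:
 assumes "tau \<sigma> x = ereal r" shows "\<Phi> x (\<sigma> * r) \<notin> \<Omega>"
proof
 assume "\<Phi> x (\<sigma> * r) \<in> \<Omega>"
 then obtain e where e: "0 < e" "\<And>s. \<bar>s - r\<bar> < e ==> \<Phi> x (\<sigma> * s) \<in> \<Omega>" by (rule flow_stays) blast
 have "ereal (r + e) \<le> tau \<sigma> x"
 proof (rule tau_geI)
  fix s assume "0 < s" "ereal s < ereal (r + e)"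
  then show "\<Phi> x (\<sigma> * s) \<in> \<Omega>" using tau_inside[of s \<sigma> x] e assms by (cases "s < r") auto
 qed
 then show False using assms e by simp
qed

lemma tau_pos: "x \<in> \<Omega> ==> 0 < tau \<sigma> x"
proof -
 assume "x \<in> \<Omega>"
 then have "\<Phi> x (\<sigma> * 0) \<in> \<Omega>" by simp
 then obtain e where e: "0 < e" "\<And>s. \<bar>s - 0\<bar> < e ==> \<Phi> x (\<sigma> * s) \<in> \<Omega>" by (rule flow_stays) blast
 then have "ereal e \<le> tau \<sigma> x" by (intro tau_geI) auto
 then show ?thesis using e(1) by (metis ereal_less(2) less_le_trans)
qed

text \<open>The base point is arbitrary, so this serves boundary points as well;
  \<open>tau_orbit\<close> is the version for base points in \<Omega> that also admits negative
  times.\<close>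

lemma tau_shift:
 assumes "0 \<le> t" "ereal t < tau \<sigma> x" shows "tau \<sigma> (\<Phi> x (\<sigma> * t)) = tau \<sigma> x - ereal t"
proof (rule antisym)
 show "tau \<sigma> (\<Phi> x (\<sigma> * t)) \<le> tau \<sigma> x - ereal t"
 proof (cases "tau \<sigma> x")
  case (real r)
  have "\<Phi> (\<Phi> x (\<sigma> * t)) (\<sigma> * (r - t)) \<notin> \<Omega>" using tau_outside[OF real] by (simp add: flow_add algebra_simps)
  then show ?thesis using tau_le[of "r - t" "\<Phi> x (\<sigma> * t)" \<sigma>] assms real by simp
 qed (use tau_nonneg[of \<sigma> x] in auto)
 show "tau \<sigma> x - ereal t \<le> tau \<sigma> (\<Phi> x (\<sigma> * t))"
 proof (rule tau_geI)
  fix s assume "0 < s" "ereal s < tau \<sigma> x - ereal t"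
  then have "ereal (t + s) < tau \<sigma> x" by (cases "tau \<sigma> x") auto
  then show "\<Phi> (\<Phi> x (\<sigma> * t)) (\<sigma> * s) \<in> \<Omega>"
   using tau_inside[of "t + s" \<sigma> x] assms \<open>0 < s\<close> by (simp add: flow_add algebra_simps)
 qed
qed

lemma orbit_inside:
 assumes "x \<in> \<Omega>" "- tau (- \<sigma>) x < ereal t" "ereal t < tau \<sigma> x" shows "\<Phi> x (\<sigma> * t) \<in> \<Omega>"
proof -
 consider "t > 0" | "t = 0" | "t < 0" by linarith
 then show ?thesis
 proof cases
  case 3
  then have "\<Phi> x (- \<sigma> * (- t)) \<in> \<Omega>" using assms by (intro tau_inside) (auto simp: ereal_uminus_less_reorder)
  then show ?thesis by simp
 qed (use assms tau_inside in auto)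
qed

lemma tau_orbit:
 assumes x: "x \<in> \<Omega>" and t: "- tau (- \<sigma>) x < ereal t" "ereal t < tau \<sigma> x" shows "tau \<sigma> (\<Phi> x (\<sigma> * t)) = tau \<sigma> x - ereal t"
proof (rule antisym)
 show "tau \<sigma> (\<Phi> x (\<sigma> * t)) \<le> tau \<sigma> x - ereal t"
 proof (cases "tau \<sigma> x")
  case (real r)
  have "\<Phi> (\<Phi> x (\<sigma> * t)) (\<sigma> * (r - t)) \<notin> \<Omega>" using tau_outside[OF real] by (simp add: flow_add algebra_simps)
  then show ?thesis using tau_le[of "r - t" "\<Phi> x (\<sigma> * t)" \<sigma>] t real by simp
 qed (use tau_nonneg[of \<sigma> x] in auto)
 show "tau \<sigma> x - ereal t \<le> tau \<sigma> (\<Phi> x (\<sigma> * t))"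
 proof (rule tau_geI)
  fix s assume s: "0 < s" "ereal s < tau \<sigma> x - ereal t"
  then have "ereal (t + s) < tau \<sigma> x" by (cases "tau \<sigma> x") auto
  moreover have "- tau (- \<sigma>) x < ereal (t + s)" using t(1) s(1) by (cases "tau (-\<sigma>) x") auto
  ultimately show "\<Phi> (\<Phi> x (\<sigma> * t)) (\<sigma> * s) \<in> \<Omega>"
   using orbit_inside[OF x, of \<sigma> "t + s"] by (simp add: flow_add algebra_simps)
 qed
qed

abbreviation rtau :: "real => 'a => real" where "rtau \<sigma> x \<equiv> real_of_ereal (tau \<sigma> x)"

text \<open>If \<open>tau \<sigma> x\<close> is infinite, \<open>real_of_ereal\<close> yields 0 and
  this is x itself. Where a boundary point is needed, the uses are guarded by finiteness of
  \<open>tau\<close>.\<close>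

definition exit :: "real => 'a => 'a" where "exit \<sigma> x = \<Phi> x (\<sigma> * rtau \<sigma> x)"

lemma exit_in_Gam:
 assumes x: "x \<in> \<Omega>" and r: "tau \<sigma> x = ereal r" shows "exit \<sigma> x \<in> Gam \<sigma>"
proof -
 have r0: "0 < r" using tau_pos[OF x, of \<sigma>] r by simp
 let ?y = "\<Phi> x (\<sigma> * r)"
 have "?y \<in> closure \<Omega>" unfolding closure_approachable
 proof (intro allI impI)
  fix e :: real assume "0 < e"
  have "isCont (\<lambda>s. \<Phi> x (\<sigma> * s)) r" by (rule continuous_on_interior[of UNIV]) (auto intro!: continuous_intros)
  then obtain d where d: "0 < d" "\<And>s. dist s r < d ==> dist (\<Phi> x (\<sigma> * s)) ?y < e"
   using \<open>0 < e\<close> unfolding continuous_at_eps_delta by metis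
  let ?s = "max (r - d / 2) (r / 2)"
  have "\<Phi> x (\<sigma> * ?s) \<in> \<Omega>" using d r0 r by (intro tau_inside) auto
  moreover have "dist ?s r < d" using d r0 by (auto simp: dist_real_def)
  ultimately show "\<exists>y\<in>\<Omega>. dist y ?y < e" using d(2) by blast
 qed
 moreover have "?y \<notin> \<Omega>" by (rule tau_outside[OF r])
 ultimately have "?y \<in> frontier \<Omega>" by (simp add: frontier_def interior_open[OF open_Omega])
 then show ?thesis using x r unfolding Gam_def exit_def by force
qed

lemma Gam_not_Omega: "y \<in> Gam \<sigma> ==> y \<notin> \<Omega>" using open_Omega by (auto simp: Gam_def frontier_def interior_open)

lemma Gam_tau_pos:
 assumes "y \<in> Gam \<sigma>" shows "0 < tau (- \<sigma>) y"
proof -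
 obtain x where x: "x \<in> \<Omega>" "tau \<sigma> x < \<infinity>" "y = \<Phi> x (\<sigma> * rtau \<sigma> x)" using assms by (auto simp: Gam_def)
 then obtain r where r: "tau \<sigma> x = ereal r" using tau_nonneg[of \<sigma> x] by (cases "tau \<sigma> x") auto
 have r0: "0 < r" using tau_pos[OF x(1), of \<sigma>] r by simp
 have "ereal r \<le> tau (- \<sigma>) y"
 proof (rule tau_geI)
  fix s assume "0 < s" "ereal s < ereal r"
  then show "\<Phi> y (- \<sigma> * s) \<in> \<Omega>" using tau_inside[of "r - s" \<sigma> x] r x(3) by (simp add: flow_add algebra_simps)
 qed
 then show ?thesis using r0 by (metis ereal_less(2) less_le_trans)
qed

text \<open>Shows that distance s and boundary point y are coordinates on the chords: both are
  recovered from the interior point as its exit time and exit point.\<close>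

lemma Gam_orbit:
 assumes y: "y \<in> Gam \<sigma>" and s: "0 < s" "ereal s < tau (- \<sigma>) y"
 shows "\<Phi> y (- \<sigma> * s) \<in> \<Omega>" "tau \<sigma> (\<Phi> y (- \<sigma> * s)) = ereal s" "exit \<sigma> (\<Phi> y (- \<sigma> * s)) = y"
  "tau (- \<sigma>) (\<Phi> y (- \<sigma> * s)) = tau (- \<sigma>) y - ereal s"
proof -
 show "\<Phi> y (- \<sigma> * s) \<in> \<Omega>" by (rule tau_inside[OF s])
 show t: "tau \<sigma> (\<Phi> y (- \<sigma> * s)) = ereal s"
 proof (rule tau_eqI[OF s(1)])
  fix s' assume "0 < s'" "s' < s"
  then have "\<Phi> y (- \<sigma> * (s - s')) \<in> \<Omega>" using s by (intro tau_inside) (auto intro: le_less_trans[OF _ s(2)])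
  then show "\<Phi> (\<Phi> y (- \<sigma> * s)) (\<sigma> * s') \<in> \<Omega>" by (simp add: flow_add algebra_simps)
 qed (use Gam_not_Omega[OF y] in \<open>simp add: flow_add\<close>)
 show "exit \<sigma> (\<Phi> y (- \<sigma> * s)) = y" unfolding exit_def t by (simp add: flow_add)
 show "tau (- \<sigma>) (\<Phi> y (- \<sigma> * s)) = tau (- \<sigma>) y - ereal s" using tau_shift[of s "- \<sigma>" y] s by simp
qed

lemma Gam_opposite:
 assumes z: "z \<in> Gam \<sigma>" and l: "tau (- \<sigma>) z = ereal l"
 shows "exit (- \<sigma>) z \<in> Gam (- \<sigma>)" "tau \<sigma> (exit (- \<sigma>) z) = ereal l" "0 < l"
proof -
 show l0: "0 < l" using Gam_tau_pos[OF z] l by simp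
 \<comment> \<open>The midpoint of the chord is the interior point that witnesses membership of the
   opposite end in \<open>Gam\<close>.\<close>
 let ?w = "\<Phi> z (- \<sigma> * (l / 2))"
 have w: "?w \<in> \<Omega>" "tau (- \<sigma>) ?w = ereal (l / 2)" using Gam_orbit[OF z, of "l/2"] l l0 by auto
 have "exit (- \<sigma>) ?w = exit (- \<sigma>) z" unfolding exit_def w(2) l by (simp add: flow_add)
 then show "exit (- \<sigma>) z \<in> Gam (- \<sigma>)" using exit_in_Gam[OF w] by simp
 show "tau \<sigma> (exit (- \<sigma>) z) = ereal l"
 proof (rule tau_eqI[OF l0])
  fix s assume "0 < s" "s < l"
  then show "\<Phi> (exit (- \<sigma>) z) (\<sigma> * s) \<in> \<Omega>"
   using tau_inside[of "l - s" "- \<sigma>" z] l by (simp add: exit_def flow_add algebra_simps)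
 qed (use Gam_not_Omega[OF z] l in \<open>simp add: exit_def flow_add\<close>)
qed

text \<open>The complement is the projection along the compact time set of a closed set, hence
  closed.\<close>

lemma open_stay_compact:
 assumes "compact C" shows "open {x. \<forall>s\<in>C. \<Phi> x (\<sigma> * s) \<in> \<Omega>}"
proof -
 have "closed {x. \<exists>s. s \<in> C \<and> (s, x) \<in> (\<lambda>(s, x). \<Phi> x (\<sigma> * s)) -` (- \<Omega>)}" by (rule closed_compact_projection[OF assms])
   (auto intro!: closed_vimage continuous_intros simp: open_Omega closed_Compl case_prod_unfold)
 moreover have "{x. \<forall>s\<in>C. \<Phi> x (\<sigma> * s) \<in> \<Omega>} = - {x. \<exists>s. s \<in> C \<and> (s, x) \<in> (\<lambda>(s, x). \<Phi> x (\<sigma> * s)) -` (- \<Omega>)}" by auto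
 ultimately show ?thesis by auto
qed

text \<open>\<open>ereal r \<le> tau \<sigma> x\<close> says that the orbit is in \<Omega> on the
  open interval from 0 to r. That interval is a countable union of compact ones, and each of these
  gives an open condition on x.\<close>

lemma tau_measurable [measurable]: "tau \<sigma> \<in> \<B> borel"
proof -
 have r: "{x. ereal r \<le> tau \<sigma> x} \<in> sets borel" for r
 proof -
  let ?A = "\<lambda>n::nat. {x. \<forall>s\<in>{1 / (real n + 1) .. r - 1 / (real n + 1)}. \<Phi> x (\<sigma> * s) \<in> \<Omega>}"
  have "{x. ereal r \<le> tau \<sigma> x} = (\<Inter>n. ?A n)"
  proof (intro set_eqI iffI)
   fix x assume "x \<in> {x. ereal r \<le> tau \<sigma> x}"
   then have "ereal r \<le> tau \<sigma> x" by simp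
   then have "\<Phi> x (\<sigma> * s) \<in> \<Omega>" if "0 < s" "s < r" for s
    using that by (intro tau_inside) (auto intro: less_le_trans[of _ "ereal r"])
   moreover have "0 < s \<and> s < r" if "s \<in> {1 / (real n + 1) .. r - 1 / (real n + 1)}" for s n
   proof -
    have "0 < 1 / (real n + 1)" by simp
    moreover have "1 / (real n + 1) \<le> s" "s \<le> r - 1 / (real n + 1)" using that by auto
    ultimately show ?thesis by linarith
   qed
   ultimately show "x \<in> (\<Inter>n. ?A n)" by blast
  next
   fix x assume x: "x \<in> (\<Inter>n. ?A n)"
   have "ereal r \<le> tau \<sigma> x"
   proof (rule tau_geI)
    fix s assume s: "0 < s" "ereal s < ereal r"
    then obtain n :: nat where "inverse (real (Suc n)) < min s (r - s)"
     using reals_Archimedean[of "min s (r - s)"] by auto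
    then have "s \<in> {1 / (real n + 1) .. r - 1 / (real n + 1)}" by (auto simp: inverse_eq_divide add.commute)
    then show "\<Phi> x (\<sigma> * s) \<in> \<Omega>" using x by blast
   qed
   then show "x \<in> {x. ereal r \<le> tau \<sigma> x}" by simp
  qed
  then show ?thesis using open_stay_compact[OF compact_Icc] by (auto intro!: sets.countable_INT)
 qed
 show ?thesis
 proof (rule borel_measurableI_ge)
  fix a :: ereal
  show "{x \<in> space borel. a \<le> tau \<sigma> x} \<in> sets borel"
  proof (cases a)
   case (real r) then show ?thesis using r by simp
  next
   case PInf
   have "{x. \<infinity> \<le> tau \<sigma> x} = (\<Inter>n::nat. {x. ereal (real n) \<le> tau \<sigma> x})"
   proof (intro set_eqI iffI)
    fix x assume x: "x \<in> (\<Inter>n::nat. {x. ereal (real n) \<le> tau \<sigma> x})"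
    have "ereal B \<le> tau \<sigma> x" for B
    proof -
     obtain n :: nat where "B \<le> real n" using real_arch_simple by blast
     then have "ereal B \<le> ereal (real n)" by simp
     also have "... \<le> tau \<sigma> x" using x by blast
     finally show ?thesis .
    qed
    then show "x \<in> {x. \<infinity> \<le> tau \<sigma> x}" using ereal_top by simp
   qed auto
   then show ?thesis using r PInf by (auto intro!: sets.countable_INT)
  qed simp
 qed
qed

lemma exit_measurable [measurable]: "exit \<sigma> \<in> borel \<rightarrow>\<^sub>M borel" unfolding exit_def by measurable

subsection \<open>The boundary measures\<close>

lemma Omega_borel [measurable, simp]: "\<Omega> \<in> sets borel" using open_Omega by simp

lemma AE_Omega_iff: "(AE x in \<mu>\<Omega>. P x) \<longleftrightarrow> (AE x in \<mu>. x \<in> \<Omega> --> P x)" by (rule AE_restrict_space_iff) simp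

lemma nn_integral_Omega: "(\<integral>\<^sup>+x. h x \<partial>\<mu>\<Omega>) = (\<integral>\<^sup>+x. h x * ind \<Omega> x \<partial>\<mu>)" by (rule nn_integral_restrict_space) simp

lemma space_Omega [simp]: "space \<mu>\<Omega> = \<Omega>" by (simp add: space_restrict_space)

text \<open>Extension by zero, because the flow acts on the whole space and only there preserves
  \<mu>.\<close>

definition ext :: "('a => 'c) => 'a => 'c::zero" where "ext f x = (if x \<in> \<Omega> then f x else 0)"

lemma ext_measurable [measurable]: "f \<in> \<B> \<mu>\<Omega> ==> ext f \<in> \<B> borel"
 for f :: "'a => 'c::{topological_space, zero}"
proof -
 assume "f \<in> \<B> \<mu>\<Omega>"
 then show ?thesis unfolding ext_def by (subst measurable_If_restrict_space_iff) auto
qed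

lemma measurable_from_Omega: "f \<in> borel \<rightarrow>\<^sub>M K ==> f \<in> \<mu>\<Omega> \<rightarrow>\<^sub>M K"
 by (rule measurable_restrict_space1) (simp cong: measurable_cong_sets)

lemma measurable_mu: "f \<in> borel \<rightarrow>\<^sub>M K ==> f \<in> \<mu> \<rightarrow>\<^sub>M K" by (simp cong: measurable_cong_sets)

lemma id_Omega_borel [measurable]: "(\<lambda>x. x) \<in> \<mu>\<Omega> \<rightarrow>\<^sub>M borel" by (rule measurable_from_Omega) simp

lemma snd_Omega_borel [measurable]: "snd \<in> R \<otimes> \<mu>\<Omega> \<rightarrow>\<^sub>M borel"
 by (rule measurable_compose[OF measurable_snd id_Omega_borel])

lemma sets_Omega_fin [measurable, simp]: "Omega_fin \<sigma> \<in> sets borel"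
proof -
 have "Omega_fin \<sigma> = \<Omega> \<inter> {x. tau \<sigma> x < \<infinity>}" by (auto simp: Omega_fin_def)
 moreover have "{x \<in> space borel. tau \<sigma> x < \<infinity>} \<in> sets borel" by measurable
 ultimately show ?thesis by simp
qed

lemma ereal_less_tau_measurable [measurable]:
 assumes [measurable]: "f \<in> \<B> M" "g \<in> M \<rightarrow>\<^sub>M borel"
 shows "Measurable.pred M (\<lambda>x. ereal (f x) < tau \<sigma> (g x))" "Measurable.pred M (\<lambda>x. tau \<sigma> (g x) < ereal (f x))"
  "Measurable.pred M (\<lambda>x. tau \<sigma> (g x) < \<infinity>)" by measurable

lemma Gam_space:
 assumes "boundary_measure \<sigma> N" shows "space N = Gam \<sigma>" "sets N = sets (restrict_space borel (Gam \<sigma>))"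
  "(\<lambda>y. y) \<in> N \<rightarrow>\<^sub>M borel" "snd \<in> R \<otimes> N \<rightarrow>\<^sub>M borel"
proof -
 show "space N = Gam \<sigma>" and s: "sets N = sets (restrict_space borel (Gam \<sigma>))"
  using assms by (auto simp: boundary_measure_def)
 show i: "(\<lambda>y. y) \<in> N \<rightarrow>\<^sub>M borel" by (subst measurable_cong_sets[OF s refl]) (simp add: measurable_restrict_space1)
 show "snd \<in> R \<otimes> N \<rightarrow>\<^sub>M borel" by (rule measurable_compose[OF measurable_snd i])
qed

abbreviation chord :: "real => 'a => real set" where "chord \<sigma> y \<equiv> {s. 0 < s \<and> ereal s < tau (- \<sigma>) y}"

lemma inner_measurable:
 assumes N: "boundary_measure \<sigma> N" and h [measurable]: "h \<in> \<B> borel"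
 shows "(\<lambda>y. \<integral>\<^sup>+s. ind (chord \<sigma> y) s * (h (\<Phi> y (- \<sigma> * s)) :: ennreal) \<partial>lborel) \<in> \<B> N"
proof -
 note [measurable] = Gam_space(3)[OF N]
 show ?thesis by (rule lborel.borel_measurable_nn_integral) (simp add: indicator_def case_prod_unfold, measurable)
qed

text \<open>\<open>boundary_measure\<close> is phrased with Bochner integrals of integrable
  functions. Rewriting it for nonnegative integrals is the entry to monotone approximation.\<close>

lemma boundary_nn_integrable:
 assumes N: "boundary_measure \<sigma> N" and h [measurable]: "h \<in> \<B> borel" and h0: "\<And>x. 0 \<le> h x" and i: "integrable \<mu>\<Omega> h"
 shows "(\<integral>\<^sup>+x. ind (Omega_fin \<sigma>) x * ennreal (h x) \<partial>\<mu>) =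
  (\<integral>\<^sup>+y. \<integral>\<^sup>+s. ind (chord \<sigma> y) s * ennreal (h (\<Phi> y (- \<sigma> * s))) \<partial>lborel \<partial>N)"
proof -
 let ?h = "\<lambda>y s. h (\<Phi> y (- \<sigma> * s))"
 have b: "AE y in N. lintegrable (chord \<sigma> y) (?h y)"
  "integrable N (\<lambda>y. LBINT s:chord \<sigma> y. ?h y s)"
  "(LINT x:Omega_fin \<sigma>|\<mu>. h x) = (LINT y|N. (LBINT s:chord \<sigma> y. ?h y s))"
  using N i unfolding boundary_measure_def by blast+
 have i2: "integrable \<mu> (\<lambda>x. ind \<Omega> x *\<^sub>R h x)" using i by (subst (asm) integrable_restrict_space) auto
 have i3: "integrable \<mu> (\<lambda>x. ind (Omega_fin \<sigma>) x *\<^sub>R h x)"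
 proof -
  have "ind (Omega_fin \<sigma>) x *\<^sub>R h x = ind (Omega_fin \<sigma>) x *\<^sub>R (ind \<Omega> x *\<^sub>R h x)" for x
   by (auto simp: indicator_def Omega_fin_def)
  then show ?thesis using integrable_mult_indicator[of "Omega_fin \<sigma>", OF _ i2] by (simp only:) simp
 qed
 have "(\<integral>\<^sup>+x. ind (Omega_fin \<sigma>) x * ennreal (h x) \<partial>\<mu>) = (\<integral>\<^sup>+x. ennreal (ind (Omega_fin \<sigma>) x *\<^sub>R h x) \<partial>\<mu>)"
  by (intro nn_integral_cong) (auto simp: indicator_def)
 also have "... = ennreal (LINT x:Omega_fin \<sigma>|\<mu>. h x)"
  unfolding set_lebesgue_integral_def using i3 h0 by (intro nn_integral_eq_integral) auto
 also have "... = (\<integral>\<^sup>+y. ennreal (LBINT s:chord \<sigma> y. ?h y s) \<partial>N)" unfolding b(3) using b(2) h0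
  by (intro nn_integral_eq_integral[symmetric]) (auto simp: set_lebesgue_integral_def intro!: integral_nonneg_AE)
 also have "... = (\<integral>\<^sup>+y. \<integral>\<^sup>+s. ind (chord \<sigma> y) s * ennreal (?h y s) \<partial>lborel \<partial>N)"
 proof (rule nn_integral_cong_AE)
  show "AE y in N. ennreal (LBINT s:chord \<sigma> y. ?h y s)
   = (\<integral>\<^sup>+s. ind (chord \<sigma> y) s * ennreal (?h y s) \<partial>lborel)" using b(1)
  proof eventually_elim
   case (elim y)
   have "(\<integral>\<^sup>+s. ind (chord \<sigma> y) s * ennreal (?h y s) \<partial>lborel)
    = (\<integral>\<^sup>+s. ennreal (ind (chord \<sigma> y) s *\<^sub>R ?h y s) \<partial>lborel)"
    by (intro nn_integral_cong) (auto simp: indicator_def)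
   also have "... = ennreal (LBINT s:chord \<sigma> y. ?h y s)" unfolding set_lebesgue_integral_def
    using elim h0 by (intro nn_integral_eq_integral) (auto simp: set_integrable_def)
   finally show ?case by simp
  qed
 qed
 finally show ?thesis .
qed

lemma positive_integrable_function:
 obtains w :: "'a => real" where "w \<in> \<B> borel" "\<And>x. 0 < w x" "integrable \<mu> w"
proof -
 obtain h where h: "h \<in> \<B> \<mu>" "integral\<^sup>N \<mu> h \<noteq> \<infinity>" "\<And>x. 0 < h x" "\<And>x. h x < \<infinity>"
  using mu.Ex_finite_integrable_function by auto
 define w where "w x = enn2real (h x)" for x
 have hw: "h x = ennreal (w x)" for x using h(4) by (simp add: w_def)
 have "w \<in> \<B> \<mu>" unfolding w_def using h(1) by measurable
 then have wm: "w \<in> \<B> borel" by (simp cong: measurable_cong_sets)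
 have w0: "0 < w x" for x using h(3)[of x] unfolding hw by (simp add: ennreal_less_zero_iff)
 have "integrable \<mu> w" using h(2) w0 wm unfolding hw[abs_def]
  by (auto simp: integrable_iff_bounded less_imp_le less_top cong: measurable_cong_sets)
 with wm w0 show ?thesis by (intro that)
qed

text \<open>Integrate a strictly positive \<mu>-integrable function w over the chords. The result W
  has finite integral by the defining formula and is positive, since every chord has positive
  length; so the sets where \<open>1 \<le> n * W y\<close> have finite measure and exhaust the
  boundary.\<close>

lemma boundary_sigma_finite:
 assumes N: "boundary_measure \<sigma> N" shows "sigma_finite_measure N"
proof -
 obtain w :: "'a => real" where w: "w \<in> \<B> borel" "\<And>x. 0 < w x" "integrable \<mu> w"
  using positive_integrable_function by blast
 have wi: "integrable \<mu>\<Omega> w" using integrable_mult_indicator[OF _ w(3), of \<Omega>] by (subst integrable_restrict_space) auto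
 define W where "W y = (\<integral>\<^sup>+s. ind (chord \<sigma> y) s * ennreal (w (\<Phi> y (- \<sigma> * s))) \<partial>lborel)" for y
 note [measurable] = Gam_space(3)[OF N] w(1)
 have Wm [measurable]: "W \<in> \<B> N" unfolding W_def by (rule inner_measurable[OF N, of "\<lambda>x. ennreal (w x)"]) measurable
 have "(\<integral>\<^sup>+y. W y \<partial>N) = (\<integral>\<^sup>+x. ind (Omega_fin \<sigma>) x * ennreal (w x) \<partial>\<mu>)"
  unfolding W_def by (rule boundary_nn_integrable[OF N w(1) less_imp_le[OF w(2)] wi, symmetric])
 also have "... \<le> (\<integral>\<^sup>+x. ennreal (w x) \<partial>\<mu>)" by (intro nn_integral_mono) (auto simp: indicator_def)
 also have "... < \<infinity>" using w(2,3) by (auto simp: integrable_iff_bounded less_imp_le)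
 finally have fin: "(\<integral>\<^sup>+y. W y \<partial>N) < \<infinity>" .
 have W0: "0 < W y" if yG: "y \<in> Gam \<sigma>" for y
 proof (rule ccontr)
  assume "\<not> 0 < W y"
  then have "W y = 0" by simp
  then have "AE s in lborel. ind (chord \<sigma> y) s * ennreal (w (\<Phi> y (- \<sigma> * s))) = 0"
   unfolding W_def by (subst (asm) nn_integral_0_iff_AE) (auto simp: indicator_def)
  then have "AE s in lborel. \<not> (0 < s \<and> ereal s < tau (- \<sigma>) y)"
   by eventually_elim (use w(2) in \<open>auto simp: indicator_def ennreal_eq_0_iff linorder_not_less[symmetric] split: if_splits\<close>)
  moreover obtain e where e: "0 < e" "ereal e < tau (- \<sigma>) y"
   using Gam_tau_pos[OF yG] ereal_dense2[of 0 "tau (-\<sigma>) y"] by (auto simp: zero_ereal_def)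
  ultimately have "AE s in lborel. s \<notin> {0<..<e}" by (auto elim!: eventually_mono intro: less_trans[of _ "ereal e"])
  then have "emeasure lborel {0<..<e} = 0" by (subst (asm) AE_iff_measurable[of "{0<..<e}"]) auto
  then show False using e by simp
 qed
 show ?thesis
 proof
  define A where "A n = {y \<in> space N. 1 \<le> ennreal (real n) * W y}" for n :: nat
  have As: "A n \<in> sets N" for n unfolding A_def by measurable
  have "emeasure N (A n) \<noteq> \<infinity>" for n
  proof -
   have "emeasure N (A n) \<le> ennreal (real n) * (\<integral>\<^sup>+y. W y * ind (space N) y \<partial>N)"
    unfolding A_def by (rule nn_integral_Markov_inequality) auto
   also have "(\<integral>\<^sup>+y. W y * ind (space N) y \<partial>N) = (\<integral>\<^sup>+y. W y \<partial>N)" by (intro nn_integral_cong) auto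
   also have "ennreal (real n) * (\<integral>\<^sup>+y. W y \<partial>N) < \<infinity>" using fin by (simp add: ennreal_mult_less_top)
   finally show ?thesis by simp
  qed
  moreover have "(\<Union>n. A n) = space N"
  proof (intro equalityI subsetI)
   fix y assume y: "y \<in> space N"
   then have "0 < W y" using W0 Gam_space(1)[OF N] by auto
   then obtain c where c: "0 < c" "ennreal c \<le> W y"
    by (metis dense ennreal_cases ennreal_less_zero_iff less_imp_le less_top_ennreal top_neq_ennreal order_le_less_trans
      infinity_ennreal_def less_le_trans top_greatest not_less order.strict_trans1 ennreal_zero_less_top leD)
   obtain n :: nat where n: "1 / c \<le> real n" using real_arch_simple by blast
   then have "1 \<le> real n * c" using c by (simp add: field_simps)
   then have "1 \<le> ennreal (real n) * ennreal c" by (simp add: ennreal_mult[symmetric] c(1) less_imp_le)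
   also have "... \<le> ennreal (real n) * W y" using c(2) by (rule mult_left_mono) simp
   finally show "y \<in> (\<Union>n. A n)" using y by (auto simp: A_def)
  qed (auto simp: A_def)
  ultimately show "\<exists>A. countable A \<and> A \<subseteq> sets N \<and> \<Union>A = space N \<and> (\<forall>a\<in>A. emeasure N a \<noteq> \<infinity>)"
   using As by (intro exI[of _ "range A"]) auto
 qed
qed

text \<open>Monotone convergence removes integrability: every nonnegative measurable function is an
  increasing limit of integrable ones, as \<mu> is sigma-finite.\<close>

lemma boundary_nn:
 assumes N: "boundary_measure \<sigma> N" and h [measurable]: "h \<in> \<B> borel"
 shows "(\<integral>\<^sup>+x. ind (Omega_fin \<sigma>) x * (h x :: ennreal) \<partial>\<mu>) =
  (\<integral>\<^sup>+y. \<integral>\<^sup>+s. ind (chord \<sigma> y) s * h (\<Phi> y (- \<sigma> * s)) \<partial>lborel \<partial>N)"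
proof -
 obtain w :: "'a => real" where w: "w \<in> \<B> borel" "\<And>x. 0 < w x" "integrable \<mu> w"
  using positive_integrable_function by blast
 note [measurable] = Gam_space(3)[OF N] w(1)
 \<comment> \<open>Truncation at \<open>n * w\<close> rather than at a constant, which would not be
   integrable. The cut is inactive for large n because w is strictly positive.\<close>
 define k where "k n x = enn2real (min (h x) (ennreal (real n * w x)))" for n x
 have kh: "ennreal (k n x) = min (h x) (ennreal (real n * w x))" for n x
  unfolding k_def by (simp add: ennreal_enn2real_if min_def top_unique)
 have km [measurable]: "k n \<in> \<B> borel" for n unfolding k_def by measurable
 have k0: "0 \<le> k n x" for n x by (simp add: k_def)
 let ?l = "\<lambda>n x. ind (Omega_fin \<sigma>) x * ennreal (k n x)" and ?r = "\<lambda>n y s. ind (chord \<sigma> y) s * ennreal (k n (\<Phi> y (- \<sigma> * s)))"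
 have ki: "integrable \<mu>\<Omega> (k n)" for n
 proof -
  have "integrable \<mu> (k n)"
  proof (rule Bochner_Integration.integrable_bound[OF integrable_mult_right[OF w(3), of "real n"]])
   have "k n x \<le> real n * w x" for x
   proof -
    have "ennreal (k n x) \<le> ennreal (real n * w x)" unfolding kh by simp
    then show ?thesis using w(2)[of x] by (simp add: less_imp_le)
   qed
   then show "AE x in \<mu>. norm (k n x) \<le> norm (real n * w x)" using k0 by (auto intro: order_trans[OF _ abs_ge_self])
  qed (simp cong: measurable_cong_sets)
  then show ?thesis using integrable_mult_indicator[of \<Omega> \<mu> "k n"] by (subst integrable_restrict_space) auto
 qed
 have kinc: "ennreal (k n x) \<le> ennreal (k (Suc n) x)" for n x
  unfolding kh using w(2)[of x] by (intro min.mono ennreal_leI) (auto intro!: mult_right_mono)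
 have ksup: "h x = (SUP n. ennreal (k n x))" for x
 proof (rule antisym)
  show "h x \<le> (SUP n. ennreal (k n x))"
  proof (rule dense_le)
   fix y assume y: "y < h x"
   then obtain c where c: "y = ennreal c" by (cases y) auto
   obtain n :: nat where "c / w x \<le> real n" using real_arch_simple by blast
   then have "c \<le> real n * w x" using w(2)[of x] by (simp add: field_simps)
   then have "y \<le> ennreal (k n x)" unfolding kh using y c by (simp add: ennreal_leI less_imp_le)
   then show "y \<le> (SUP n. ennreal (k n x))" by (rule SUP_upper2[OF UNIV_I])
  qed
  show "(SUP n. ennreal (k n x)) \<le> h x" by (rule SUP_least) (simp add: kh)
 qed
 have "(\<integral>\<^sup>+x. ind (Omega_fin \<sigma>) x * h x \<partial>\<mu>) = (\<integral>\<^sup>+x. (SUP n. ?l n x) \<partial>\<mu>)"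
  unfolding ksup by (simp add: SUP_mult_left_ennreal)
 also have "... = (SUP n. \<integral>\<^sup>+x. ?l n x \<partial>\<mu>)"
 proof (intro nn_integral_monotone_convergence_SUP measurable_mu)
  show "(\<lambda>x. ?l n x) \<in> \<B> borel" for n by measurable
 qed (use kinc in \<open>auto intro!: incseq_SucI le_funI mult_left_mono\<close>)
 also have "... = (SUP n. \<integral>\<^sup>+y. \<integral>\<^sup>+s. ?r n y s \<partial>lborel \<partial>N)"
  by (intro SUP_cong refl boundary_nn_integrable[OF N km k0 ki])
 also have "... = (\<integral>\<^sup>+y. (SUP n. \<integral>\<^sup>+s. ?r n y s \<partial>lborel) \<partial>N)"
  using kinc by (intro nn_integral_monotone_convergence_SUP[symmetric] inner_measurable[OF N, of "\<lambda>x. ennreal (k _ x)"])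
   (auto intro!: incseq_SucI le_funI mult_left_mono nn_integral_mono)
 also have "... = (\<integral>\<^sup>+y. \<integral>\<^sup>+s. (SUP n. ?r n y s) \<partial>lborel \<partial>N)"
 proof (intro nn_integral_cong nn_integral_monotone_convergence_SUP[symmetric])
  fix y n
  show "(\<lambda>s. ?r n y s) \<in> \<B> lborel" unfolding indicator_def by measurable
 qed (use kinc in \<open>auto intro!: incseq_SucI le_funI mult_left_mono\<close>)
 also have "... = (\<integral>\<^sup>+y. \<integral>\<^sup>+s. ind (chord \<sigma> y) s * h (\<Phi> y (- \<sigma> * s)) \<partial>lborel \<partial>N)"
  unfolding ksup by (simp add: SUP_mult_left_ennreal)
 finally show ?thesis .
qed

text \<open>\<open>boundary_nn\<close> applied to the indicator of a null set: almost every chord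
  meets it in a null set of times.\<close>

lemma AE_Gam_of_AE_Omega:
 assumes N: "boundary_measure \<sigma> N" and P: "AE x in \<mu>\<Omega>. P x"
 shows "AE y in N. AE s in lborel. 0 < s --> ereal s < tau (- \<sigma>) y --> P (\<Phi> y (- \<sigma> * s))"
proof -
 note [measurable] = Gam_space(3)[OF N]
 obtain Z where Z: "{x \<in> space \<mu>. \<not> (x \<in> \<Omega> --> P x)} \<subseteq> Z" "emeasure \<mu> Z = 0" "Z \<in> sets \<mu>"
  using P unfolding AE_Omega_iff by (rule AE_E)
 have Zs [measurable]: "Z \<in> sets borel" using Z by simp
 have "(\<integral>\<^sup>+x. ind (Omega_fin \<sigma>) x * ind Z x \<partial>\<mu>) \<le> (\<integral>\<^sup>+x. ind Z x \<partial>\<mu>)"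
  by (intro nn_integral_mono) (auto simp: indicator_def)
 also have "... = 0" using Z by simp
 finally have "(\<integral>\<^sup>+x. ind (Omega_fin \<sigma>) x * ind Z x \<partial>\<mu>) = 0" by simp
 then have "(\<integral>\<^sup>+y. \<integral>\<^sup>+s. ind (chord \<sigma> y) s * (ind Z (\<Phi> y (- \<sigma> * s)) :: ennreal) \<partial>lborel \<partial>N) = 0"
  by (subst (asm) boundary_nn[OF N]) auto
 then have "AE y in N. (\<integral>\<^sup>+s. ind (chord \<sigma> y) s * (ind Z (\<Phi> y (- \<sigma> * s)) :: ennreal) \<partial>lborel) = 0"
  by (subst (asm) nn_integral_0_iff_AE) (auto intro!: inner_measurable[OF N, of "ind Z"])
 then show ?thesis
 proof eventually_elim
  case (elim y)
  then have "AE s in lborel. ind (chord \<sigma> y) s * (ind Z (\<Phi> y (- \<sigma> * s)) :: ennreal) = 0"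
   by (subst (asm) nn_integral_0_iff_AE) (auto simp: indicator_def)
  then show ?case
  proof eventually_elim
   case (elim s)
   show ?case
   proof (intro impI)
    assume s: "0 < s" "ereal s < tau (- \<sigma>) y"
    then have "\<Phi> y (- \<sigma> * s) \<notin> Z" "\<Phi> y (- \<sigma> * s) \<in> \<Omega>" using elim tau_inside[OF s]
     by (auto simp: indicator_def split: if_splits)
    then show "P (\<Phi> y (- \<sigma> * s))" using Z(1) by auto
   qed
  qed
 qed
qed

text \<open>Functions on the boundary are measurable for the trace sigma-algebra on
  \<open>Gam\<close> only, so they can be composed with \<open>exit\<close> only on the set where
  \<open>exit\<close> takes values there; the conditional glues the pieces.\<close>

lemma exit_If_measurable:
 fixes v :: "real \<times> 'a => 'c::topological_space"
 assumes N: "boundary_measure \<sigma> N" and v: "v \<in> \<B> (borel \<otimes> N)"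
  and g [measurable]: "g \<in> M \<rightarrow>\<^sub>M borel" and r [measurable]: "r \<in> \<B> M" and P [measurable]: "Measurable.pred M P"
  and PG: "\<And>x. x \<in> space M ==> P x ==> exit \<sigma> (g x) \<in> Gam \<sigma>"
 shows "(\<lambda>x. if P x then v (r x, exit \<sigma> (g x)) else c) \<in> \<B> M"
proof -
 have Ps: "{x \<in> space M. P x} \<in> sets M" by measurable
 have e: "(\<lambda>x. exit \<sigma> (g x)) \<in> restrict_space M {x. P x} \<rightarrow>\<^sub>M N"
  unfolding measurable_cong_sets[OF refl Gam_space(2)[OF N]]
 proof (rule measurable_restrict_space2)
  show "(\<lambda>x. exit \<sigma> (g x)) \<in> space (restrict_space M {x. P x}) \<rightarrow> Gam \<sigma>" using PG by (auto simp: space_restrict_space)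
  show "(\<lambda>x. exit \<sigma> (g x)) \<in> restrict_space M {x. P x} \<rightarrow>\<^sub>M borel" by (rule measurable_restrict_space1) measurable
 qed
 have "(\<lambda>x. (r x, exit \<sigma> (g x))) \<in> restrict_space M {x. P x} \<rightarrow>\<^sub>M borel \<otimes> N"
  by (rule measurable_Pair[OF measurable_restrict_space1[OF r] e])
 from measurable_compose[OF this v]
 show ?thesis by (subst measurable_If_restrict_space_iff[OF Ps]) auto
qed

lemma exit_in_Gam': "x \<in> \<Omega> ==> tau \<sigma> x < \<infinity> ==> exit \<sigma> x \<in> Gam \<sigma>"
 using exit_in_Gam[of x \<sigma> "rtau \<sigma> x"] tau_nonneg[of \<sigma> x] by (cases "tau \<sigma> x") auto

lemma exit_in_Gam_opposite: "z \<in> Gam \<sigma> ==> tau (- \<sigma>) z < \<infinity> ==> exit (- \<sigma>) z \<in> Gam (- \<sigma>)"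
 using Gam_opposite(1)[of z \<sigma> "rtau (- \<sigma>) z"] tau_nonneg[of "- \<sigma>" z] by (cases "tau (- \<sigma>) z") auto

text \<open>The change of variables from points of \<Omega> with finite exit time to pairs of
  distance and boundary point: along a chord the integrand depends on the coordinates alone.\<close>

lemma boundary_coordinates:
 fixes q :: "real \<times> 'a => ennreal"
 assumes N: "boundary_measure \<sigma> N" and q: "q \<in> \<B> (borel \<otimes> N)"
 shows "(\<integral>\<^sup>+x. (if tau \<sigma> x < \<infinity> then q (rtau \<sigma> x, exit \<sigma> x) else 0) \<partial>\<mu>\<Omega>) =
  (\<integral>\<^sup>+y. \<integral>\<^sup>+s. ind (chord \<sigma> y) s * q (s, y) \<partial>lborel \<partial>N)"
proof -
 define h where "h = ext (\<lambda>x. if tau \<sigma> x < \<infinity> then q (rtau \<sigma> x, exit \<sigma> x) else 0)"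
 have h [measurable]: "h \<in> \<B> borel" unfolding h_def
 proof (rule ext_measurable, rule exit_If_measurable[OF N q])
  show "(\<lambda>x. rtau \<sigma> x) \<in> \<B> \<mu>\<Omega>" by (rule measurable_from_Omega) measurable
 qed (auto simp: exit_in_Gam')
 have "(\<integral>\<^sup>+x. (if tau \<sigma> x < \<infinity> then q (rtau \<sigma> x, exit \<sigma> x) else 0) \<partial>\<mu>\<Omega>)
   = (\<integral>\<^sup>+x. ind (Omega_fin \<sigma>) x * h x \<partial>\<mu>)"
  unfolding nn_integral_Omega by (intro nn_integral_cong) (auto simp: h_def ext_def indicator_def Omega_fin_def)
 also have "... = (\<integral>\<^sup>+y. \<integral>\<^sup>+s. ind (chord \<sigma> y) s * h (\<Phi> y (- \<sigma> * s)) \<partial>lborel \<partial>N)" by (rule boundary_nn[OF N h])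
 also have "... = (\<integral>\<^sup>+y. \<integral>\<^sup>+s. ind (chord \<sigma> y) s * q (s, y) \<partial>lborel \<partial>N)"
 proof (intro nn_integral_cong)
  fix y s assume "y \<in> space N"
  then have y: "y \<in> Gam \<sigma>" using Gam_space(1)[OF N] by simp
  show "ind (chord \<sigma> y) s * h (\<Phi> y (- \<sigma> * s)) = ind (chord \<sigma> y) s * q (s, y)"
   using Gam_orbit[OF y, of s] by (auto simp: indicator_def h_def ext_def)
 qed
 finally show ?thesis .
qed

text \<open>The converse transfer: the chords that end in a null set of the boundary fill a null set
  of \<Omega>.\<close>

lemma AE_Omega_of_AE_Gam:
 assumes N: "boundary_measure \<sigma> N" and P: "AE y in N. P y" shows "AE x in \<mu>\<Omega>. tau \<sigma> x < \<infinity> --> P (exit \<sigma> x)"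
proof -
 obtain Z where Z: "{y \<in> space N. \<not> P y} \<subseteq> Z" "emeasure N Z = 0" "Z \<in> sets N" using P by (rule AE_E)
 note [measurable] = Z(3)
 have q: "(\<lambda>z. ind Z (snd z) :: ennreal) \<in> \<B> (borel \<otimes> N)" by measurable
 have m: "(\<lambda>x. if tau \<sigma> x < \<infinity> then (ind Z (snd (rtau \<sigma> x, exit \<sigma> x)) :: ennreal) else 0) \<in> \<B> \<mu>\<Omega>"
 proof (rule exit_If_measurable[OF N q])
  show "(\<lambda>x. rtau \<sigma> x) \<in> \<B> \<mu>\<Omega>" by (rule measurable_from_Omega) measurable
 qed (auto simp: exit_in_Gam')
 have "(\<integral>\<^sup>+y. \<integral>\<^sup>+s. ind (chord \<sigma> y) s * ind Z (snd (s, y)) \<partial>lborel \<partial>N) = (\<integral>\<^sup>+y. 0 \<partial>N)"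
 proof (rule nn_integral_cong_AE)
  have "AE y in N. y \<notin> Z" using Z by (intro AE_not_in) (auto simp: null_sets_def)
  then show "AE y in N. (\<integral>\<^sup>+s. ind (chord \<sigma> y) s * ind Z (snd (s, y)) \<partial>lborel) = (0::ennreal)" by eventually_elim simp
 qed
 then have "(\<integral>\<^sup>+x. (if tau \<sigma> x < \<infinity> then (ind Z (snd (rtau \<sigma> x, exit \<sigma> x)) :: ennreal) else 0) \<partial>\<mu>\<Omega>) = 0"
  using boundary_coordinates[OF N q] by simp
 then have "AE x in \<mu>\<Omega>. (if tau \<sigma> x < \<infinity> then (ind Z (snd (rtau \<sigma> x, exit \<sigma> x)) :: ennreal) else 0) = 0"
  by (subst (asm) nn_integral_0_iff_AE[OF m])
 then show ?thesis using AE_space[of \<mu>\<Omega>]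
 proof eventually_elim
  case (elim x)
  then show ?case using Z(1) exit_in_Gam'[of x \<sigma>] Gam_space(1)[OF N] by (auto simp: indicator_def split: if_splits)
 qed
qed

text \<open>Integrating \<open>q(\<ell>, entry) / \<ell>\<close> over the orbits of finite length \<open>\<ell>\<close> in two ways, from the
 outgoing and from the incoming boundary, shows that the passage between the two preserves
 the boundary measures.\<close>

lemma boundary_passage:
 fixes q :: "real \<times> 'a => ennreal"
 assumes q: "q \<in> \<B> (borel \<otimes> \<mu>m)"
 shows "(\<integral>\<^sup>+z. (if tau (-1) z < \<infinity> then q (rtau (-1) z, exit (-1) z) else 0) \<partial>\<mu>p) =
  (\<integral>\<^sup>+y. (if tau 1 y < \<infinity> then q (rtau 1 y, y) else 0) \<partial>\<mu>m)"
proof -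
 let ?p = "\<lambda>z. if tau (-1) z < \<infinity> then q (rtau (-1) z, exit (-1) z) else 0" and ?m = "\<lambda>y. if tau 1 y < \<infinity> then q (rtau 1 y, y) else 0"
 define l where "l x = rtau 1 x + rtau (-1) x" for x
 have lm [measurable]: "l \<in> \<B> borel" unfolding l_def by measurable
 define q' where "q' z = q z * ennreal (1 / fst z)" for z
 have q' [measurable]: "q' \<in> \<B> (borel \<otimes> \<mu>m)" unfolding q'_def using q by measurable
 define h where "h = ext (\<lambda>x. if tau 1 x < \<infinity> \<and> tau (-1) x < \<infinity> then q' (l x, exit (-1) x) else 0)"
 have h [measurable]: "h \<in> \<B> borel" unfolding h_def
 proof (rule ext_measurable, rule exit_If_measurable[OF mu_minus q'])
  show "l \<in> \<B> \<mu>\<Omega>" by (rule measurable_from_Omega) measurable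
 qed (auto simp: exit_in_Gam')
 have ll: "(\<integral>\<^sup>+s. ind {s. 0 < s \<and> ereal s < ereal L} s * (b * ennreal (1 / L)) \<partial>lborel) = (b::ennreal)" if "0 < L" for L b
 proof -
  have "(\<integral>\<^sup>+s. ind {s. 0 < s \<and> ereal s < ereal L} s * (b * ennreal (1 / L)) \<partial>lborel)
    = (\<integral>\<^sup>+s. (b * ennreal (1 / L)) * ind {0<..<L} s \<partial>lborel)" by (intro nn_integral_cong) (auto simp: indicator_def)
  also have "... = (b * ennreal (1 / L)) * ennreal L" using that by (subst nn_integral_cmult_indicator) auto
  also have "... = b" using that by (simp add: mult.assoc ennreal_mult[symmetric])
  finally show ?thesis .
 qed
 have aux: "(\<integral>\<^sup>+s. ind (chord \<sigma> y) s * h (\<Phi> y (- \<sigma> * s)) \<partial>lborel) =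
   (if tau (- \<sigma>) y < \<infinity> then q (rtau (- \<sigma>) y, e) else 0)"
  if y: "y \<in> Gam \<sigma>" and \<sigma>: "\<sigma> = 1 \<or> \<sigma> = - 1"
   and e: "\<And>s L. tau (- \<sigma>) y = ereal L ==> 0 < s ==> s < L ==> exit (-1) (\<Phi> y (- \<sigma> * s)) = e" for y \<sigma> e
 proof (cases "tau (- \<sigma>) y")
  case (real L)
  then have L: "0 < L" using Gam_tau_pos[OF y] by simp
  have "ind (chord \<sigma> y) s * h (\<Phi> y (- \<sigma> * s)) =
   ind {s. 0 < s \<and> ereal s < ereal L} s * (q (L, e) * ennreal (1 / L))" for s
  proof (cases "0 < s \<and> s < L")
   case True
   then have o: "\<Phi> y (- \<sigma> * s) \<in> \<Omega>" "tau \<sigma> (\<Phi> y (- \<sigma> * s)) = ereal s" "tau (- \<sigma>) (\<Phi> y (- \<sigma> * s)) = ereal (L - s)"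
    using Gam_orbit[OF y, of s] real by auto
   then have "h (\<Phi> y (- \<sigma> * s)) = q' (L, e)" unfolding h_def ext_def l_def using \<sigma> e[OF real, of s] True by auto
   then show ?thesis by (simp add: q'_def real)
  qed (auto simp: real indicator_def)
  then show ?thesis using ll[OF L, of "q (L, e)"] real by simp
 next
  case PInf
  have "ind (chord \<sigma> y) s * h (\<Phi> y (- \<sigma> * s)) = 0" for s
   using Gam_orbit(4)[OF y, of s] PInf \<sigma> by (auto simp: indicator_def h_def ext_def)
  then show ?thesis using PInf by (simp only: nn_integral_const) simp
 qed (use tau_nonneg[of "- \<sigma>" y] in auto)
 have "(\<integral>\<^sup>+z. ?p z \<partial>\<mu>p)
  = (\<integral>\<^sup>+z. \<integral>\<^sup>+s. ind (chord 1 z) s * h (\<Phi> z (- 1 * s)) \<partial>lborel \<partial>\<mu>p)"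
 proof (rule nn_integral_cong)
  fix z assume "z \<in> space \<mu>p"
  then have z: "z \<in> Gam 1" using Gam_space(1)[OF mu_plus] by simp
  show "?p z =
   (\<integral>\<^sup>+s. ind (chord 1 z) s * h (\<Phi> z (- 1 * s)) \<partial>lborel)"
  proof (rule aux[OF z, symmetric])
   fix s L assume L: "tau (- 1) z = ereal L" "0 < s" "s < L"
   then have "tau (- 1) (\<Phi> z (- 1 * s)) = ereal (L - s)" using Gam_orbit(4)[OF z, of s] by simp
   then show "exit (-1) (\<Phi> z (- 1 * s)) = exit (-1) z" unfolding exit_def L by (simp add: flow_add)
  qed simp
 qed
 also have "... = (\<integral>\<^sup>+x. ind (Omega_fin 1) x * h x \<partial>\<mu>)" by (rule boundary_nn[OF mu_plus h, symmetric])
 \<comment> \<open>h vanishes unless both exit times are finite, so the two domains of integration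
   give the same value. This is where one boundary is exchanged for the other.\<close>
 also have "... = (\<integral>\<^sup>+x. ind (Omega_fin (-1)) x * h x \<partial>\<mu>)"
  by (intro nn_integral_cong) (auto simp: h_def ext_def indicator_def Omega_fin_def)
 also have "... = (\<integral>\<^sup>+y. \<integral>\<^sup>+s. ind (chord (- 1) y) s * h (\<Phi> y (- (- 1) * s)) \<partial>lborel \<partial>\<mu>m)"
  by (rule boundary_nn[OF mu_minus h])
 also have "... = (\<integral>\<^sup>+y. ?m y \<partial>\<mu>m)"
 proof (rule nn_integral_cong)
  fix y assume "y \<in> space \<mu>m"
  then have y: "y \<in> Gam (-1)" using Gam_space(1)[OF mu_minus] by simp
  show "(\<integral>\<^sup>+s. ind (chord (- 1) y) s * h (\<Phi> y (- (- 1) * s)) \<partial>lborel) =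
   ?m y" using aux[OF y, of y] Gam_orbit(3)[OF y] by simp
 qed
 finally show ?thesis .
qed

end

subsection \<open>Absolutely continuous functions on intervals\<close>

text \<open>P is absolutely continuous with derivative \<open>- D\<close>. The sign is that of
  \<open>sharp_rep\<close>: the transport operator is minus the derivative along the flow.\<close>

definition decreases_by :: "(real => real) => (real => real) => real => real => bool" where
 "decreases_by P D a b \<longleftrightarrow> lintegrable {a..b} D \<and> P a - P b = (LBINT s:{a..b}. D s)"

lemma set_integral_Icc_combine:
 fixes h :: "real => real"
 assumes "a \<le> b" "b \<le> c" "lintegrable {a..b} h" "lintegrable {b..c} h"
 shows "lintegrable {a..c} h"
  "(LBINT s:{a..c}. h s) = (LBINT s:{a..b}. h s) + (LBINT s:{b..c}. h s)"
proof -
 have u: "{a..c} = {a..b} \<union> {b..c}" using assms by auto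
 show i: "lintegrable {a..c} h" unfolding u using assms by (intro set_integrable_Un) auto
 have ae: "AE s in lborel. ind {a..c} s *\<^sub>R h s = ind {a..b} s *\<^sub>R h s + ind {b..c} s *\<^sub>R h s"
  using AE_lborel_singleton[of b] by eventually_elim (use assms in \<open>auto simp: indicator_def\<close>)
 have "(LBINT s:{a..c}. h s) = (LBINT s. ind {a..b} s *\<^sub>R h s + ind {b..c} s *\<^sub>R h s)"
  unfolding set_lebesgue_integral_def
  by (rule integral_cong_AE[OF _ _ ae]) (use i assms in \<open>auto simp: set_integrable_def\<close>)
 also have "... = (LBINT s:{a..b}. h s) + (LBINT s:{b..c}. h s)"
  unfolding set_lebesgue_integral_def using assms
  by (intro Bochner_Integration.integral_add) (auto simp: set_integrable_def)
 finally show "(LBINT s:{a..c}. h s) = (LBINT s:{a..b}. h s) + (LBINT s:{b..c}. h s)" .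
qed

lemma set_integral_shift:
 fixes h :: "real => real" shows "lintegrable {s. s + c \<in> A} (\<lambda>s. h (s + c)) \<longleftrightarrow> lintegrable A h"
  "(LBINT s:{s. s + c \<in> A}. h (s + c)) = (LBINT s:A. h s)"
proof -
 have e: "ind {s. s + c \<in> A} s *\<^sub>R h (s + c) = (\<lambda>s. ind A s *\<^sub>R h s) (c + 1 * s)" for s
  by (simp add: indicator_def add.commute)
 show "lintegrable {s. s + c \<in> A} (\<lambda>s. h (s + c)) \<longleftrightarrow> lintegrable A h"
  unfolding set_integrable_def e by (rule lborel_integrable_real_affine_iff) simp
 show "(LBINT s:{s. s + c \<in> A}. h (s + c)) = (LBINT s:A. h s)" unfolding set_lebesgue_integral_def e
  using lborel_integral_real_affine[of 1 "\<lambda>s. ind A s *\<^sub>R h s" c] by simp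
qed

lemma set_integral_reflect:
 fixes h :: "real => real" shows "lintegrable {s. c - s \<in> A} (\<lambda>s. h (c - s)) \<longleftrightarrow> lintegrable A h"
  "(LBINT s:{s. c - s \<in> A}. h (c - s)) = (LBINT s:A. h s)"
proof -
 have e: "ind {s. c - s \<in> A} s *\<^sub>R h (c - s) = (\<lambda>s. ind A s *\<^sub>R h s) (c + (-1) * s)" for s
  by (simp add: indicator_def add.commute)
 show "lintegrable {s. c - s \<in> A} (\<lambda>s. h (c - s)) \<longleftrightarrow> lintegrable A h"
  unfolding set_integrable_def e by (rule lborel_integrable_real_affine_iff) simp
 show "(LBINT s:{s. c - s \<in> A}. h (c - s)) = (LBINT s:A. h s)" unfolding set_lebesgue_integral_def e
  using lborel_integral_real_affine[of "-1" "\<lambda>s. ind A s *\<^sub>R h s" c] by simp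
qed

lemma decreases_by_trans: "decreases_by P D a b ==> decreases_by P D b c ==> a \<le> b ==> b \<le> c ==> decreases_by P D a c"
 unfolding decreases_by_def using set_integral_Icc_combine[of a b c D] by auto

lemma decreases_by_shift: "decreases_by (\<lambda>s. P (s + c)) (\<lambda>s. D (s + c)) a b \<longleftrightarrow> decreases_by P D (a + c) (b + c)"
proof -
 have "{s. s + c \<in> {a + c..b + c}} = {a..b}" by auto
 then show ?thesis unfolding decreases_by_def using set_integral_shift[where h=D and c=c and A="{a+c..b+c}"] by simp
qed

lemma decreases_by_reflect:
 "decreases_by (\<lambda>s. P (c - s)) (\<lambda>s. D (c - s)) a b \<longleftrightarrow> decreases_by (\<lambda>s. - P s) D (c - b) (c - a)"
proof -
 have "{s. c - s \<in> {c - b..c - a}} = {a..b}" by auto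
 then show ?thesis unfolding decreases_by_def using set_integral_reflect[where h=D and c=c and A="{c-b..c-a}"] by auto
qed

lemma decreases_by_cong: "a \<le> b ==> (\<And>s. a \<le> s ==> s \<le> b ==> P s = P' s) ==> (\<And>s. a \<le> s ==> s \<le> b ==> D s = D' s) ==>
  decreases_by P D a b \<longleftrightarrow> decreases_by P' D' a b"
proof -
 assume "a \<le> b" and P: "\<And>s. a \<le> s ==> s \<le> b ==> P s = P' s" and D: "\<And>s. a \<le> s ==> s \<le> b ==> D s = D' s"
 have "ind {a..b} s *\<^sub>R D s = ind {a..b} s *\<^sub>R D' s" for s using D by (auto simp: indicator_def)
 then show ?thesis unfolding decreases_by_def set_int_defs using P[of a] P[of b] \<open>a \<le> b\<close> by (simp only: order_refl)
qed

lemma set_integral_Ioo_combine: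
 fixes h :: "real => real"
 assumes i: "lintegrable {a<..<b} h" "lintegrable {b<..<c} h" and abc: "a < b" "b < c"
 shows "lintegrable {a<..<c} h"
  "(LBINT s:{a<..<c}. h s) = (LBINT s:{a<..<b}. h s) + (LBINT s:{b<..<c}. h s)"
proof -
 have e: "ind {a<..<c} s *\<^sub>R h s = ind {a<..<b} s *\<^sub>R h s + ind {b<..<c} s *\<^sub>R h s + ind {b} s * h b" for s
  using abc by (auto simp: indicator_def)
 with i show "lintegrable {a<..<c} h"
  "(LBINT s:{a<..<c}. h s) = (LBINT s:{a<..<b}. h s) + (LBINT s:{b<..<c}. h s)"
  unfolding set_int_defs e by auto
qed

lemma set_integral_Icc_Ioo:
 fixes h :: "real => real"
 assumes ab: "a < b" shows "lintegrable {a<..<b} h \<longleftrightarrow> lintegrable {a..b} h"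
  "(LBINT s:{a<..<b}. h s) = (LBINT s:{a..b}. h s)"
proof -
 have e: "ind {a..b} s *\<^sub>R h s = ind {a<..<b} s *\<^sub>R h s + (ind {a} s * h a + ind {b} s * h b)" for s
  using ab by (auto simp: indicator_def)
 have i: "integrable lborel (\<lambda>s. ind {c} s * h c)" for c by (intro integrable_mult_left) simp
 have 1: "lintegrable {a..b} h" if "lintegrable {a<..<b} h"
  using that i unfolding set_integrable_def e by simp
 moreover have "lintegrable {a<..<b} h" if "lintegrable {a..b} h"
  by (rule set_integrable_subset[OF that]) auto
 ultimately show I: "lintegrable {a<..<b} h \<longleftrightarrow> lintegrable {a..b} h" by blast
 show "(LBINT s:{a<..<b}. h s) = (LBINT s:{a..b}. h s)"
 proof (cases "lintegrable {a<..<b} h")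
  case True
  then show ?thesis using i unfolding set_int_defs e by simp
 next
  case False
  then show ?thesis using I unfolding set_int_defs by (simp add: not_integrable_integral_eq)
 qed
qed

lemma set_integral_right_continuous:
 fixes v :: "real => real"
 assumes i: "lintegrable {0<..<T + e} v" and e: "0 < e"
 shows "((\<lambda>s. LBINT r:{0<..<T + s}. v r) ---> (LBINT r:{0<..<T}. v r)) (at_right 0)"
proof (cases "0 \<le> T")
 case True
 have "v integrable_on {0..T + e}"
  using set_borel_integral_eq_integral(1)[OF i] by (simp add: integrable_on_Icc_iff_Ioo)
 then have "continuous_on {0..T + e} (\<lambda>x. integral {0..x} v)" by (rule indefinite_integral_continuous_1)
 then have "((\<lambda>x. integral {0..x} v) ---> integral {0..T} v) (at T within {0..T + e})"
  using True e by (simp add: continuous_on_def)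
 moreover have "filterlim (\<lambda>s. T + s) (at T within {0..T + e}) (at_right 0)"
  unfolding filterlim_at eventually_at_right_field using e True
  by (intro conjI exI[of _ e]) (auto intro!: tendsto_eq_intros)
 ultimately have l: "((\<lambda>s. integral {0..T + s} v) ---> integral {0..T} v) (at_right 0)" by (rule filterlim_compose)
 have E: "integral {0..x} v = (LBINT r:{0<..<x}. v r)" if "x \<le> T + e" for x
 proof -
  have "lintegrable {0<..<x} v" by (rule set_integrable_subset[OF i]) (use that in auto)
  from set_borel_integral_eq_integral(2)[OF this] show ?thesis by (simp add: integral_open_interval_real)
 qed
 have "\<forall>\<^sub>F s in at_right 0. integral {0..T + s} v = (LBINT r:{0<..<T + s}. v r)"
  unfolding eventually_at_right_field using e E by (intro exI[of _ e]) auto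
 then show ?thesis using Lim_transform_eventually[OF l] E[of T] e by simp
next
 case False
 then have "\<forall>\<^sub>F s in at_right 0. (LBINT r:{0<..<T + s}. v r) = (LBINT r:{0<..<T}. v r)"
  unfolding eventually_at_right_field by (intro exI[of _ "- T"]) (auto simp: set_lebesgue_integral_def)
 then show ?thesis by (rule tendsto_eventually)
qed

text \<open>The left end a may be negative: the primitive vanishes at nonpositive arguments, and the
  cut-off derivative matches. This describes a quantity that is switched on when a front reaches the
  orbit.\<close>

lemma primitive_decreases_by:
 fixes h :: "real => real"
 assumes i: "lintegrable {0<..b} h" and ab: "a \<le> b"
 shows "decreases_by (\<lambda>r. - (LBINT s:{0<..<r}. h s)) (\<lambda>r. if 0 < r then h r else 0) a b"
proof -
 let ?A = "{0<..b} \<inter> {a..b}"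
 have e: "ind {a..b} r *\<^sub>R (if 0 < r then h r else 0) = ind ?A r *\<^sub>R h r" for r by (auto simp: indicator_def)
 have IA: "lintegrable ?A h" by (rule set_integrable_subset[OF i]) auto
 have Ib: "lintegrable {0<..<b} h" by (rule set_integrable_subset[OF i]) auto
 have Ia: "lintegrable {0<..<a} h" by (rule set_integrable_subset[OF i]) (use ab in auto)
 have "(LBINT s:{0<..<b}. h s) - (LBINT s:{0<..<a}. h s)
  = (LBINT r. ind {0<..<b} r *\<^sub>R h r - ind {0<..<a} r *\<^sub>R h r)" unfolding set_lebesgue_integral_def using Ia Ib
  by (intro Bochner_Integration.integral_diff[symmetric]) (auto simp: set_integrable_def)
 also have "... = (LBINT r:?A. h r)" unfolding set_lebesgue_integral_def
 proof (rule integral_cong_AE)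
  show "(\<lambda>r. ind {0<..<b} r *\<^sub>R h r - ind {0<..<a} r *\<^sub>R h r) \<in> \<B> lborel"
   using Ia Ib unfolding set_integrable_def by (intro borel_measurable_diff borel_measurable_integrable)
  show "(\<lambda>r. ind ?A r *\<^sub>R h r) \<in> \<B> lborel" using IA unfolding set_integrable_def by (rule borel_measurable_integrable)
  show "AE r in lborel. ind {0<..<b} r *\<^sub>R h r - ind {0<..<a} r *\<^sub>R h r = ind ?A r *\<^sub>R h r"
   using AE_lborel_singleton[of b] by eventually_elim (use ab in \<open>auto simp: indicator_def\<close>)
 qed
 finally show ?thesis using IA unfolding decreases_by_def set_int_defs e by simp
qed

text \<open>Integration by parts when one factor is only absolutely continuous: the function
  \<open>a s * \<phi>' t\<close> on the triangle \<open>s \<le> t\<close> is integrated in both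
  orders.\<close>

lemma decreases_by_product:
 fixes A a \<phi> \<phi>' :: "real => real"
 assumes t: "t1 \<le> t2" and A: "\<And>t. t1 \<le> t ==> t \<le> t2 ==> decreases_by A a t1 t"
  and der: "\<And>t. t1 \<le> t ==> t \<le> t2 ==> (\<phi> has_real_derivative \<phi>' t) (at t)" and cont: "continuous_on {t1..t2} \<phi>'"
 shows "decreases_by (\<lambda>s. A s * \<phi> s) (\<lambda>s. a s * \<phi> s - A s * \<phi>' s) t1 t2"
proof -
 define a0 where "a0 s = ind {t1..t2} s * a s" for s
 define d where "d s = ind {t1..t2} s * \<phi>' s" for s
 define f0 where "f0 s = ind {t1..t2} s * \<phi> s" for s
 have ai: "integrable lborel a0" using A[OF t order_refl] by (simp add: decreases_by_def set_integrable_def a0_def[abs_def])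
 then have [measurable]: "a0 \<in> \<B> lborel" by auto
 have contf: "continuous_on {t1..t2} \<phi>" using der by (meson DERIV_isCont atLeastAtMost_iff continuous_at_imp_continuous_on)
 have dm [measurable]: "d \<in> \<B> borel" and fm [measurable]: "f0 \<in> \<B> borel"
  using borel_measurable_continuous_on_indicator[OF _ cont] borel_measurable_continuous_on_indicator[OF _ contf]
  by (simp_all add: d_def[abs_def] f0_def[abs_def])
 obtain B where B: "\<And>s. \<bar>f0 s\<bar> \<le> B" "0 \<le> B"
 proof -
  have "bounded (\<phi> ` {t1..t2})" by (intro compact_imp_bounded compact_continuous_image contf) simp
  then obtain B where "0 < B" "\<And>s. s \<in> {t1..t2} ==> \<bar>\<phi> s\<bar> \<le> B" by (auto simp: bounded_pos)
  then show ?thesis by (intro that[of B]) (auto simp: f0_def indicator_def)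
 qed
 have di: "integrable lborel d"
  using borel_integrable_atLeastAtMost'[OF cont] by (simp add: set_integrable_def d_def[abs_def])
 have afi: "integrable lborel (\<lambda>s. a0 s * f0 s)"
 proof (rule Bochner_Integration.integrable_bound[OF integrable_mult_right[OF ai, of B]])
  show "AE s in lborel. norm (a0 s * f0 s) \<le> norm (B * a0 s)"
  proof (rule AE_I2)
   fix s show "norm (a0 s * f0 s) \<le> norm (B * a0 s)"
    using mult_right_mono[OF B(1)[of s], of "\<bar>a0 s\<bar>"] B(2) by (simp add: abs_mult mult.commute)
  qed
 qed simp
 define K where "K s t = d t * (if s \<le> t then a0 s else 0)" for s t
 have Ki: "integrable (lborel \<otimes> lborel) (case_prod K)"
 proof (rule Bochner_Integration.integrable_bound)
  show "integrable (lborel \<otimes> lborel) (\<lambda>z. a0 (fst z) * d (snd z))"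
   by (rule lborel_pair.Fubini_integrable) (use ai di in \<open>auto simp: abs_mult\<close>)
  show "case_prod K \<in> \<B> (lborel \<otimes> lborel)" unfolding K_def case_prod_unfold by measurable
 qed (auto simp: K_def abs_mult)
 have in1: "(LBINT s. K s t) = d t * (A t1 - A t)" for t
 proof (cases "t \<in> {t1..t2}")
  case True
  have "K s t = d t * (ind {t1..t} s *\<^sub>R a s)" for s using True by (auto simp: K_def a0_def indicator_def)
  then have "(LBINT s. K s t) = d t * (LBINT s:{t1..t}. a s)" by (simp add: set_lebesgue_integral_def)
  then show ?thesis using A[of t] True by (simp add: decreases_by_def)
 qed (simp add: K_def d_def)
 have FTC: "(LBINT t. ind {s..t2} t *\<^sub>R \<phi>' t) = \<phi> t2 - \<phi> s" if "t1 \<le> s" "s \<le> t2" for s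
  using that der cont by (intro integral_FTC_atLeastAtMost)
   (auto intro: has_vector_derivative_at_within continuous_on_subset simp: has_real_derivative_iff_has_vector_derivative)
 have in2: "(LBINT t. K s t) = a0 s * (\<phi> t2 - \<phi> s)" for s
 proof (cases "s \<in> {t1..t2}")
  case True
  have "K s t = a s * (ind {s..t2} t *\<^sub>R \<phi>' t)" for t using True by (auto simp: K_def a0_def d_def indicator_def)
  then have "(LBINT t. K s t) = a s * (LBINT t. ind {s..t2} t *\<^sub>R \<phi>' t)" by simp
  also have "(LBINT t. ind {s..t2} t *\<^sub>R \<phi>' t) = \<phi> t2 - \<phi> s" using True by (intro FTC) auto
  finally show ?thesis using True by (simp add: a0_def)
 next
  case False
  then have "a0 s = 0" by (simp add: a0_def)
  then have "K s t = 0" for t by (simp add: K_def)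
  then show ?thesis using \<open>a0 s = 0\<close> by simp
 qed
 have "(LBINT t. LBINT s. K s t) = (LBINT s. LBINT t. K s t)"
  using lborel_pair.Fubini_integral[OF Ki] .
 then have F: "(LBINT t. d t * (A t1 - A t)) = (LBINT s. a0 s * (\<phi> t2 - \<phi> s))" unfolding in1 in2 .
 have i1: "integrable lborel (\<lambda>t. d t * (A t1 - A t))" using lborel_pair.integrable_snd[OF Ki] unfolding in1 .
 have e2: "a0 s * (\<phi> t2 - \<phi> s) = \<phi> t2 * a0 s - a0 s * f0 s" for s by (simp add: f0_def a0_def indicator_def algebra_simps)
 have "(LBINT s. a0 s * (\<phi> t2 - \<phi> s)) = \<phi> t2 * (A t1 - A t2) - (LBINT s. a0 s * f0 s)"
  unfolding e2 using ai afi A[OF t order_refl] by (simp add: decreases_by_def a0_def[abs_def] set_lebesgue_integral_def)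
 note F = F[unfolded this]
 have dint: "(LBINT s. d s) = \<phi> t2 - \<phi> t1" using FTC[of t1] t by (simp add: d_def[abs_def])
 have e3: "ind {t1..t2} s *\<^sub>R (a s * \<phi> s - A s * \<phi>' s) = a0 s * f0 s + d s * (A t1 - A s) - A t1 * d s" for s
  by (simp add: a0_def f0_def d_def indicator_def algebra_simps)
 have "(LBINT s. a0 s * f0 s + d s * (A t1 - A s) - A t1 * d s) = A t1 * \<phi> t1 - A t2 * \<phi> t2"
  using afi i1 di by (simp add: F dint) (simp add: algebra_simps)
 then show ?thesis unfolding decreases_by_def set_int_defs e3 using afi i1 di by simp
qed

subsection \<open>Mild and weak derivatives along the flow\<close>

context transport_setting
begin

definition stay :: "'a => real set" where "stay x = {t. - tau (-1) x < ereal t \<and> ereal t < tau 1 x}"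

text \<open>The pointwise form of the relation between f and its image g under the maximal operator,
  along the orbit through x.\<close>

definition mild_at :: "('a => real) => ('a => real) => 'a => bool" where
 "mild_at f g x \<longleftrightarrow> (\<forall>t1 t2. t1 \<in> stay x --> t2 \<in> stay x --> t1 \<le> t2 -->
  decreases_by (\<lambda>s. f (\<Phi> x s)) (\<lambda>s. g (\<Phi> x s)) t1 t2)"

definition mild :: "('a => real) => ('a => real) => bool" where "mild f g \<longleftrightarrow> (AE x in \<mu>\<Omega>. mild_at f g x)"

lemma mild_at_iff: "mild_at f g x \<longleftrightarrow> (\<forall>t1 t2. - tau (-1) x < ereal t1 \<and> t1 \<le> t2 \<and> ereal t2 < tau 1 x -->
  lintegrable {t1..t2} (\<lambda>s. g (\<Phi> x s)) \<and> f (\<Phi> x t1) - f (\<Phi> x t2) = (LBINT s:{t1..t2}. g (\<Phi> x s)))"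
proof -
 have "t1 \<in> stay x \<and> t2 \<in> stay x \<and> t1 \<le> t2 \<longleftrightarrow> - tau (-1) x < ereal t1 \<and> t1 \<le> t2 \<and> ereal t2 < tau 1 x" for t1 t2
  unfolding stay_def by (auto intro: less_le_trans le_less_trans[of "ereal t1" "ereal t2"])
 then show ?thesis unfolding mild_at_def decreases_by_def by blast
qed

lemma sharp_rep_iff: "sharp_rep f fs \<longleftrightarrow> fs \<in> \<B> \<mu>\<Omega> \<and> (AE x in \<mu>\<Omega>. fs x = f x) \<and> (\<exists>g. (f, g) \<in> T_max_graph \<and> mild fs g)"
 unfolding sharp_rep_def mild_def mild_at_iff ..

lemma orbit_in_Omega: "x \<in> \<Omega> ==> t \<in> stay x ==> \<Phi> x t \<in> \<Omega>"
 using orbit_inside[of x 1 t] by (simp add: stay_def)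

lemma zero_in_stay: "x \<in> \<Omega> ==> 0 \<in> stay x"
 using tau_pos[of x 1] tau_pos[of x "-1"] by (simp add: stay_def ereal_uminus_less_reorder zero_ereal_def[symmetric])

lemma stay_interval: "a \<in> stay x ==> b \<in> stay x ==> a \<le> t ==> t \<le> b ==> t \<in> stay x"
 unfolding stay_def by (auto intro: less_le_trans le_less_trans[of "ereal t" "ereal b"])

lemma tau_flow:
 assumes "x \<in> \<Omega>" "t \<in> stay x" shows "tau 1 (\<Phi> x t) = tau 1 x - ereal t" "tau (-1) (\<Phi> x t) = tau (-1) x + ereal t"
proof -
 show "tau 1 (\<Phi> x t) = tau 1 x - ereal t" using tau_orbit[of x 1 t] assms by (simp add: stay_def)
 have "tau (-1) (\<Phi> x (-1 * - t)) = tau (-1) x - ereal (- t)"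
  using assms by (intro tau_orbit) (auto simp: stay_def ereal_uminus_less_reorder)
 then show "tau (-1) (\<Phi> x t) = tau (-1) x + ereal t" by (cases "tau (-1) x") auto
qed

text \<open>Moves the base point along an orbit segment. Almost-everywhere statements are available
  at countably many base points on each orbit, and this reaches the times around them.\<close>

lemma stay_ball:
 assumes "\<And>s. \<bar>s - s0\<bar> < e ==> \<Phi> x s \<in> \<Omega>" "\<bar>q - s0\<bar> < e" "\<bar>s - s0\<bar> < e" shows "s - q \<in> stay (\<Phi> x q)"
proof -
 have "ereal (s0 + e - q) \<le> tau 1 (\<Phi> x q)" using assms by (intro tau_geI) (auto simp: flow_add)
 moreover have "ereal (q - s0 + e) \<le> tau (-1) (\<Phi> x q)" using assms by (intro tau_geI) (auto simp: flow_add)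
 moreover have "s - q < s0 + e - q" "- (q - s0 + e) < s - q" using assms(3) by (auto simp: abs_less_iff)
 ultimately show ?thesis unfolding stay_def by (cases "tau 1 (\<Phi> x q)"; cases "tau (-1) (\<Phi> x q)") auto
qed

end

locale transport_p = transport_setting \<Omega> \<Phi> \<mu> \<mu>p \<mu>m p H F
 for \<Omega> :: "'a::euclidean_space set" and \<Phi> \<mu> \<mu>p \<mu>m p H F +
 assumes p_gt_1: "1 < p"
begin

lemma p1: "1 \<le> p" and p0: "0 < p" using p_gt_1 by auto

lemma test_function_props:
 assumes "\<psi> \<in> test_functions" obtains K where "compact K" "K \<subseteq> \<Omega>"
  "\<And>x. x \<notin> K ==> ext \<psi> x = 0" "\<And>x. x \<notin> K ==> ext (flow_deriv \<psi>) x = 0"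
  "\<And>x s. x \<in> \<Omega> ==> s \<in> stay x ==> ((\<lambda>s. \<psi> (\<Phi> x s)) has_real_derivative flow_deriv \<psi> (\<Phi> x s)) (at s)"
  "\<And>x. x \<in> \<Omega> ==> continuous_on (stay x) (\<lambda>s. flow_deriv \<psi> (\<Phi> x s))"
proof -
 let ?\<psi> = "\<lambda>x s. \<psi> (\<Phi> x s)"
 let ?K = "closure {x \<in> \<Omega>. \<psi> x \<noteq> 0}"
 have K: "compact ?K" "?K \<subseteq> \<Omega>" and C1: "\<And>x. x \<in> \<Omega> ==> (?\<psi> x) C1_differentiable_on stay x"
  using assms by (auto simp: test_functions_def stay_def)
 have z: "ext \<psi> x = 0" if "x \<notin> ?K" for x using that closure_subset[of "{x \<in> \<Omega>. \<psi> x \<noteq> 0}"] by (auto simp: ext_def)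
 have z2: "ext (flow_deriv \<psi>) x = 0" if x: "x \<notin> ?K" for x
 proof (cases "x \<in> \<Omega>")
  case True
  have "open ((\<lambda>s. \<Phi> x s) -` (\<Omega> - ?K))" using open_Omega by (intro open_vimage continuous_intros open_Diff) auto
  moreover have "0 \<in> (\<lambda>s. \<Phi> x s) -` (\<Omega> - ?K)" using x True by simp
  ultimately have "\<forall>\<^sub>F s in nhds 0. s \<in> (\<lambda>s. \<Phi> x s) -` (\<Omega> - ?K)" by (rule eventually_nhds_in_open)
  then have ev: "\<forall>\<^sub>F s in nhds 0. \<psi> (\<Phi> x s) = 0" by eventually_elim (use closure_subset[of "{x \<in> \<Omega>. \<psi> x \<noteq> 0}"] in auto)
  have "flow_deriv \<psi> x = deriv (\<lambda>s. 0) 0" unfolding flow_deriv_def by (rule deriv_cong_ev[OF ev refl])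
  then show ?thesis by (simp add: ext_def)
 qed (simp add: ext_def)
 have der: "((?\<psi> x) has_real_derivative flow_deriv \<psi> (\<Phi> x s)) (at s) \<and> D s = flow_deriv \<psi> (\<Phi> x s)"
  if D: "\<And>s. s \<in> stay x ==> ((?\<psi> x) has_vector_derivative D s) (at s)" and s: "s \<in> stay x" for x s D
 proof -
  have d: "((?\<psi> x) has_real_derivative D s) (at s)"
   using D[OF s] by (simp add: has_real_derivative_iff_has_vector_derivative)
  then have "((\<lambda>r. \<psi> (\<Phi> x (r + s))) has_real_derivative D s) (at 0)"
   using DERIV_shift[of "\<lambda>s. \<psi> (\<Phi> x s)" "D s" 0 s] by simp
  then have "flow_deriv \<psi> (\<Phi> x s) = D s"
   unfolding flow_deriv_def by (intro DERIV_imp_deriv) (simp add: flow_add add.commute)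
  then show ?thesis using d by simp
 qed
 show ?thesis
 proof (rule that[OF K z z2])
  fix x s assume x: "x \<in> \<Omega>" and s: "s \<in> stay x"
  obtain D where "\<And>s. s \<in> stay x ==> ((?\<psi> x) has_vector_derivative D s) (at s)"
   using C1[OF x] unfolding C1_differentiable_on_def by blast
  from der[OF this s] show "((?\<psi> x) has_real_derivative flow_deriv \<psi> (\<Phi> x s)) (at s)" by simp
 next
  fix x assume x: "x \<in> \<Omega>"
  obtain D where D: "\<And>s. s \<in> stay x ==> ((?\<psi> x) has_vector_derivative D s) (at s)" "continuous_on (stay x) D"
   using C1[OF x] unfolding C1_differentiable_on_def by blast
  from der[OF D(1)] have "D s = flow_deriv \<psi> (\<Phi> x s)" if "s \<in> stay x" for s using that by blast
  then show "continuous_on (stay x) (\<lambda>s. flow_deriv \<psi> (\<Phi> x s))" using D(2) by (simp cong: continuous_on_cong)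
 qed
qed

text \<open>\<open>\<bar>t\<bar> \<le> 1 + \<bar>t\<bar> powr p\<close>, and compact sets have
  finite measure, so pairings with bounded functions of compact support exist.\<close>

lemma Lp_Omega_integrable_on_compact:
 assumes f: "f \<in> Lp p \<mu>\<Omega>" and K: "compact K" "K \<subseteq> \<Omega>" and b: "b \<in> \<B> borel" "\<And>x. \<bar>b x\<bar> \<le> B" "\<And>x. x \<notin> K ==> b x = 0"
 shows "integrable \<mu> (\<lambda>x. ext f x * b x)"
proof -
 have fm: "f \<in> \<B> \<mu>\<Omega>" using f by (simp add: Lp_def)
 have [measurable]: "ext f \<in> \<B> borel" by (rule ext_measurable[OF fm])
 have Ks [measurable]: "K \<in> sets borel" using K by (simp add: compact_imp_closed)
 have B: "0 \<le> B" using b(2)[of undefined] by linarith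
 have i: "integrable \<mu> (\<lambda>x. \<bar>ext f x\<bar> powr p)"
 proof -
  have "integrable \<mu> (\<lambda>x. ind \<Omega> x *\<^sub>R (\<bar>f x\<bar> powr p))"
   using f by (subst integrable_restrict_space[symmetric]) (auto simp: Lp_def)
  moreover have "ind \<Omega> x *\<^sub>R (\<bar>f x\<bar> powr p) = \<bar>ext f x\<bar> powr p" for x by (simp add: ext_def indicator_def)
  ultimately show ?thesis by simp
 qed
 have i2: "integrable \<mu> (ind K :: _ => real)" using mu_compact[OF K(1)] Ks by (intro integrable_real_indicator) auto
 show ?thesis
 proof (rule Bochner_Integration.integrable_bound)
  show "integrable \<mu> (\<lambda>x. B * (ind K x + \<bar>ext f x\<bar> powr p))" using i i2 by simp
  show "(\<lambda>x. ext f x * b x) \<in> \<B> \<mu>" using b(1) by (intro measurable_mu) measurable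
  show "AE x in \<mu>. norm (ext f x * b x) \<le> norm (B * (ind K x + \<bar>ext f x\<bar> powr p))"
  proof (rule AE_I2)
   fix x
   have "\<bar>ext f x * b x\<bar> \<le> B * (ind K x + \<bar>ext f x\<bar> powr p)"
   proof (cases "x \<in> K")
    case True
    have "\<bar>ext f x\<bar> \<le> 1 + \<bar>ext f x\<bar> powr p"
    proof (cases "\<bar>ext f x\<bar> \<le> 1")
     case False
     then have "\<bar>ext f x\<bar> powr 1 \<le> \<bar>ext f x\<bar> powr p" using p1 by (intro powr_mono) auto
     then show ?thesis using False by simp
    qed (use powr_ge_zero[of "\<bar>ext f x\<bar>" p] in linarith)
    then have "\<bar>b x\<bar> * \<bar>ext f x\<bar> \<le> B * (1 + \<bar>ext f x\<bar> powr p)" using b(2)[of x] B by (intro mult_mono) auto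
    then show ?thesis using True by (simp add: abs_mult mult.commute)
   qed (use b(3) B in simp)
   then show "norm (ext f x * b x) \<le> norm (B * (ind K x + \<bar>ext f x\<bar> powr p))"
    by (simp add: order_trans[OF _ abs_ge_self])
  qed
 qed
qed

lemma test_function_bounds:
 assumes "\<psi> \<in> test_functions" obtains B where "ext \<psi> \<in> \<B> borel" "ext (flow_deriv \<psi>) \<in> \<B> borel"
  "\<And>x. \<bar>ext \<psi> x\<bar> \<le> B" "\<And>x. \<bar>ext (flow_deriv \<psi>) x\<bar> \<le> B"
proof -
 have "\<psi> \<in> \<B> \<mu>\<Omega>" "flow_deriv \<psi> \<in> \<B> \<mu>\<Omega>"
  using assms sets_restrict_space_cong[OF sets_mu] by (auto simp: test_functions_def cong: measurable_cong_sets)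
 moreover obtain B1 B2 where "0 < B1" "0 < B2" "\<And>x. x \<in> \<Omega> ==> \<bar>\<psi> x\<bar> \<le> B1" "\<And>x. x \<in> \<Omega> ==> \<bar>flow_deriv \<psi> x\<bar> \<le> B2"
  using assms by (auto simp: test_functions_def bounded_pos)
 ultimately show ?thesis
 proof (intro that[of "B1 + B2"] ext_measurable)
  fix x
  show "\<bar>ext \<psi> x\<bar> \<le> B1 + B2" "\<bar>ext (flow_deriv \<psi>) x\<bar> \<le> B1 + B2" using \<open>0 < B1\<close> \<open>0 < B2\<close> \<open>\<And>x. x \<in> \<Omega> ==> \<bar>\<psi> x\<bar> \<le> B1\<close>[of x]
    \<open>\<And>x. x \<in> \<Omega> ==> \<bar>flow_deriv \<psi> x\<bar> \<le> B2\<close>[of x] by (auto simp: ext_def)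
 qed auto
qed

text \<open>The product of \<open>fs\<close> and a test function, extended by zero, is absolutely continuous along
 every orbit in the whole space, and the integral of its derivative vanishes because the flow
 preserves \<open>\<mu>\<close>.\<close>

lemma mild_imp_T_max:
 assumes f: "f \<in> Lp p \<mu>\<Omega>" and g: "g \<in> Lp p \<mu>\<Omega>" and fsm: "fs \<in> \<B> \<mu>\<Omega>" and fs: "AE x in \<mu>\<Omega>. fs x = f x" and m: "mild fs g"
 shows "(f, g) \<in> T_max_graph" unfolding T_max_graph_def
proof (intro CollectI case_prodI conjI ballI f g)
 fix \<psi> assume psi: "\<psi> \<in> test_functions"
 obtain K where K: "compact K" "K \<subseteq> \<Omega>" "\<And>x. x \<notin> K ==> ext \<psi> x = 0" "\<And>x. x \<notin> K ==> ext (flow_deriv \<psi>) x = 0"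
  "\<And>x s. x \<in> \<Omega> ==> s \<in> stay x ==> ((\<lambda>s. \<psi> (\<Phi> x s)) has_real_derivative flow_deriv \<psi> (\<Phi> x s)) (at s)"
  "\<And>x. x \<in> \<Omega> ==> continuous_on (stay x) (\<lambda>s. flow_deriv \<psi> (\<Phi> x s))" using test_function_props[OF psi] by metis
 obtain B where B [measurable]: "ext \<psi> \<in> \<B> borel" "ext (flow_deriv \<psi>) \<in> \<B> borel"
  and Bb: "\<And>x. \<bar>ext \<psi> x\<bar> \<le> B" "\<And>x. \<bar>ext (flow_deriv \<psi>) x\<bar> \<le> B" using test_function_bounds[OF psi] by metis
 have fsL: "fs \<in> Lp p \<mu>\<Omega>" by (rule Lp_cong_AE[OF f _ fsm]) (use fs in eventually_elim, simp)
 have gm: "g \<in> \<B> \<mu>\<Omega>" using g by (simp add: Lp_def)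
 note [measurable] = ext_measurable[OF fsm] ext_measurable[OF gm]
 define P where "P x = ext fs x * ext \<psi> x" for x
 define D where "D x = ext g x * ext \<psi> x - ext fs x * ext (flow_deriv \<psi>) x" for x
 have Pm [measurable]: "P \<in> \<B> borel" and Dm [measurable]: "D \<in> \<B> borel" unfolding P_def D_def by measurable
 have Pi: "integrable \<mu> P" unfolding P_def by (rule Lp_Omega_integrable_on_compact[OF fsL K(1,2) B(1) Bb(1) K(3)])
 have Di1: "integrable \<mu> (\<lambda>x. ext g x * ext \<psi> x)" "integrable \<mu> (\<lambda>x. ext fs x * ext (flow_deriv \<psi>) x)"
  using Lp_Omega_integrable_on_compact[OF g K(1,2) B(1) Bb(1) K(3)]
   Lp_Omega_integrable_on_compact[OF fsL K(1,2) B(2) Bb(2) K(4)] by auto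
 then have Di: "integrable \<mu> D" unfolding D_def by simp
 \<comment> \<open>An orbit in the whole space may enter and leave \<Omega> many times. Each visit
   is an open set of times and contains a rational one, so countably many base points
   suffice.\<close>
 have AEx: "AE x in \<mu>. \<forall>q\<in>\<rat>. \<Phi> x q \<in> \<Omega> --> mild_at fs g (\<Phi> x q)"
 proof (subst AE_ball_countable[OF countable_rat], rule ballI)
  fix q :: real
  show "AE x in \<mu>. \<Phi> x q \<in> \<Omega> --> mild_at fs g (\<Phi> x q)" by (rule AE_flow[OF m[unfolded mild_def AE_Omega_iff]])
 qed
 let ?P = "\<lambda>x s. P (\<Phi> x s)" and ?D = "\<lambda>x s. D (\<Phi> x s)"
 have key: "AE x in \<mu>. decreases_by (?P x) (?D x) 0 1" using AEx
 proof eventually_elim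
  case (elim x)
  show ?case
  \<comment> \<open>Bisection: the relation is additive over adjacent intervals, and near each time
    it holds either because the orbit is inside \<Omega> or because it avoids the support of the
    test function.\<close>
  proof (rule Bolzano[where P="decreases_by (?P x) (?D x)"])
   show "(0::real) \<le> 1" by simp
  next
   fix a b c :: real
   show "decreases_by (?P x) (?D x) a b ==> decreases_by (?P x) (?D x) b c ==>
    a \<le> b ==> b \<le> c ==> decreases_by (?P x) (?D x) a c" by (rule decreases_by_trans)
  next
   fix s0 :: real
   show "\<exists>d>0. \<forall>a b. a \<le> s0 \<and> s0 \<le> b \<and> b - a < d --> decreases_by (?P x) (?D x) a b"
   proof (cases "\<Phi> x s0 \<in> \<Omega>")
    case True
    then have "\<Phi> x (1 * s0) \<in> \<Omega>" by simp
    then obtain e where e: "0 < e" "\<And>s. \<bar>s - s0\<bar> < e ==> \<Phi> x (1 * s) \<in> \<Omega>" by (rule flow_stays) blast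
    then have e': "\<And>s. \<bar>s - s0\<bar> < e ==> \<Phi> x s \<in> \<Omega>" by simp
    obtain q where q: "q \<in> \<rat>" "s0 - e < q" "q < s0 + e" using Rats_dense_in_real[of "s0 - e" "s0 + e"] e(1) by auto
    then have qe: "\<bar>q - s0\<bar> < e" by auto
    let ?w = "\<Phi> x q"
    have w: "?w \<in> \<Omega>" by (rule e'[OF qe])
    have mw: "mild_at fs g ?w" using elim q w by blast
    show ?thesis
    proof (intro exI[of _ e] conjI allI impI e(1))
     fix a b assume ab: "a \<le> s0 \<and> s0 \<le> b \<and> b - a < e"
     have I: "s - q \<in> stay ?w" if "a \<le> s" "s \<le> b" for s using stay_ball[OF e' qe, of s] that ab by auto
     have "decreases_by (\<lambda>s. fs (\<Phi> ?w s) * \<psi> (\<Phi> ?w s))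
       (\<lambda>s. g (\<Phi> ?w s) * \<psi> (\<Phi> ?w s) - fs (\<Phi> ?w s) * flow_deriv \<psi> (\<Phi> ?w s)) (a - q) (b - q)"
     proof (rule decreases_by_product)
      show "a - q \<le> b - q" using ab by simp
      show "decreases_by (\<lambda>s. fs (\<Phi> ?w s)) (\<lambda>s. g (\<Phi> ?w s)) (a - q) t" if "a - q \<le> t" "t \<le> b - q" for t
       using mw I[of a] I[of "t + q"] that ab unfolding mild_at_def by simp
      show "((\<lambda>s. \<psi> (\<Phi> ?w s)) has_real_derivative flow_deriv \<psi> (\<Phi> ?w t)) (at t)" if "a - q \<le> t" "t \<le> b - q" for t
       using K(5)[OF w, of t] I[of "t + q"] that by simp
      show "continuous_on {a - q..b - q} (\<lambda>s. flow_deriv \<psi> (\<Phi> ?w s))"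
      proof (rule continuous_on_subset[OF K(6)[OF w]])
       show "{a - q..b - q} \<subseteq> stay ?w" using I[of "_ + q"] by auto
      qed
     qed
     then have "decreases_by (?P ?w) (?D ?w) (a - q) (b - q)"
     proof (subst decreases_by_cong)
      show "a - q \<le> b - q" using ab by simp
      fix s assume "a - q \<le> s" "s \<le> b - q"
      then have "\<Phi> ?w s \<in> \<Omega>" using I[of "s + q"] orbit_in_Omega[OF w] by simp
      then show "P (\<Phi> ?w s) = fs (\<Phi> ?w s) * \<psi> (\<Phi> ?w s)"
       "D (\<Phi> ?w s) = g (\<Phi> ?w s) * \<psi> (\<Phi> ?w s) - fs (\<Phi> ?w s) * flow_deriv \<psi> (\<Phi> ?w s)" by (auto simp: P_def D_def ext_def)
     qed simp
     then show "decreases_by (?P x) (?D x) a b"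
      using decreases_by_shift[of "\<lambda>s. P (\<Phi> x s)" q "\<lambda>s. D (\<Phi> x s)" "a - q" "b - q"] by (simp add: flow_add add.commute)
    qed
   next
    case False
    then have "\<Phi> x s0 \<notin> K" using K by auto
    moreover have "open ((\<lambda>s. \<Phi> x s) -` (- K))"
     using K(1) by (intro open_vimage continuous_intros) (auto intro: compact_imp_closed)
    ultimately obtain e where e: "0 < e" "ball s0 e \<subseteq> (\<lambda>s. \<Phi> x s) -` (- K)"
     using open_contains_ball by (metis ComplI vimageI2)
    show ?thesis
    proof (intro exI[of _ e] conjI allI impI e(1))
     fix a b assume ab: "a \<le> s0 \<and> s0 \<le> b \<and> b - a < e"
     have "\<Phi> x s \<notin> K" if "a \<le> s" "s \<le> b" for s
     proof -
      have "s \<in> ball s0 e" using that ab by (auto simp: dist_real_def)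
      then show ?thesis using e(2) by auto
     qed
     then have "decreases_by (?P x) (?D x) a b \<longleftrightarrow> decreases_by (\<lambda>s. 0) (\<lambda>s. 0) a b"
      using ab by (intro decreases_by_cong) (auto simp: P_def D_def K(3,4))
     then show "decreases_by (?P x) (?D x) a b" by (simp add: decreases_by_def set_int_defs)
    qed
   qed
  qed
 qed
 interpret pair_sigma_finite \<mu> "lborel :: real measure" ..
 have flowP: "(LINT x|\<mu>. h (\<Phi> x t)) = (LINT x|\<mu>. h x)" if [measurable]: "h \<in> \<B> borel" for h :: "'a => real" and t
  by (subst (2) flow_distr[of t, symmetric], subst integral_distr) (auto intro: measurable_mu)
 have flowPi: "integrable \<mu> (\<lambda>x. h (\<Phi> x t))" if [measurable]: "h \<in> \<B> borel" and "integrable \<mu> h" for h :: "'a => real" and t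
 proof -
  have "integrable (distr \<mu> borel (\<lambda>x. \<Phi> x t)) h" using that(2) by (simp add: flow_distr)
  then show ?thesis by (subst (asm) integrable_distr_eq) (auto intro: measurable_mu)
 qed
 let ?I = "\<lambda>(x, s). ind {0..1} s *\<^sub>R D (\<Phi> x s)"
 have DPi: "integrable (\<mu> \<otimes> lborel) ?I"
 proof (rule integrableI_bounded)
  show "?I \<in> \<B> (\<mu> \<otimes> (lborel :: real measure))" unfolding case_prod_unfold by measurable
  have "(\<integral>\<^sup>+z. ennreal (norm (?I z)) \<partial>(\<mu> \<otimes> lborel))
   = (\<integral>\<^sup>+s. \<integral>\<^sup>+x. ennreal (norm (ind {0..1} s *\<^sub>R D (\<Phi> x s))) \<partial>\<mu> \<partial>lborel)"
   by (subst nn_integral_snd[symmetric]) (auto simp: case_prod_unfold)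
  also have "... = (\<integral>\<^sup>+s. ind {0..1} s * (\<integral>\<^sup>+x. ennreal (norm (D x)) \<partial>\<mu>) \<partial>(lborel::real measure))"
   using nn_integral_flow[of "\<lambda>x. ennreal (norm (D x))"] by (intro nn_integral_cong) (simp add: indicator_def)
  also have "... = (\<integral>\<^sup>+x. ennreal (norm (D x)) \<partial>\<mu>)" by (subst nn_integral_multc) auto
  also have "... < \<infinity>" using Di by (simp add: integrable_iff_bounded)
  finally show "(\<integral>\<^sup>+z. ennreal (norm (?I z)) \<partial>(\<mu> \<otimes> lborel)) < \<infinity>" .
 qed
 have "0 = (LINT x|\<mu>. P (\<Phi> x 0) - P (\<Phi> x 1))" using flowP[OF Pm, of 1] Pi flowPi[OF Pm Pi, of 1] by simp
 also have "... = (LINT x|\<mu>. LINT s|lborel. ind {0..1} s *\<^sub>R D (\<Phi> x s))"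
 proof (rule integral_cong_AE)
  show "(\<lambda>x. LBINT s. ind {0..1} s *\<^sub>R D (\<Phi> x s)) \<in> \<B> \<mu>"
   by (rule lborel.borel_measurable_lebesgue_integral) (simp add: case_prod_unfold, measurable)
  show "(\<lambda>x. P (\<Phi> x 0) - P (\<Phi> x 1)) \<in> \<B> \<mu>" by (rule measurable_mu) measurable
  show "AE x in \<mu>. P (\<Phi> x 0) - P (\<Phi> x 1) = (LBINT s. ind {0..1} s *\<^sub>R D (\<Phi> x s))"
   using key by eventually_elim (simp add: decreases_by_def set_lebesgue_integral_def)
 qed
 also have "... = (LINT s|lborel. LINT x|\<mu>. ind {0..1} s *\<^sub>R D (\<Phi> x s))" using Fubini_integral[OF DPi] by simp
 also have "... = (LINT s|(lborel :: real measure). ind {0..1} s * (LINT x|\<mu>. D x))" by (simp add: flowP[OF Dm])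
 also have "... = (LINT x|\<mu>. D x)" by simp
 also have "... = (LINT x|\<mu>. ext g x * ext \<psi> x) - (LINT x|\<mu>. ext fs x * ext (flow_deriv \<psi>) x)"
  unfolding D_def by (rule Bochner_Integration.integral_diff[OF Di1])
 also have "(LINT x|\<mu>. ext g x * ext \<psi> x) = (LINT x|\<mu>\<Omega>. g x * \<psi> x)"
  by (subst integral_restrict_space) (auto intro!: Bochner_Integration.integral_cong simp: ext_def indicator_def)
 also have "(LINT x|\<mu>. ext fs x * ext (flow_deriv \<psi>) x) = (LINT x|\<mu>\<Omega>. f x * flow_deriv \<psi> x)"
 proof -
  have "(LINT x|\<mu>\<Omega>. f x * flow_deriv \<psi> x) = (LINT x|\<mu>\<Omega>. fs x * flow_deriv \<psi> x)"
  proof (rule integral_cong_AE)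
   have "flow_deriv \<psi> \<in> \<B> \<mu>\<Omega>"
    using psi sets_restrict_space_cong[OF sets_mu] by (auto simp: test_functions_def cong: measurable_cong_sets)
   then show "(\<lambda>x. f x * flow_deriv \<psi> x) \<in> \<B> \<mu>\<Omega>" "(\<lambda>x. fs x * flow_deriv \<psi> x) \<in> \<B> \<mu>\<Omega>" using f fsm by (auto simp: Lp_def)
   show "AE x in \<mu>\<Omega>. f x * flow_deriv \<psi> x = fs x * flow_deriv \<psi> x" using fs by eventually_elim simp
  qed
  also have "... = (LINT x|\<mu>. ext fs x * ext (flow_deriv \<psi>) x)"
   by (subst integral_restrict_space) (auto intro!: Bochner_Integration.integral_cong simp: ext_def indicator_def)
  finally show ?thesis by simp
 qed
 finally show "(LINT x|\<mu>\<Omega>. g x * \<psi> x) = (LINT x|\<mu>\<Omega>. f x * flow_deriv \<psi> x)" by simp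
qed

subsection \<open>Smoothing along the flow\<close>

text \<open>Averaging a continuous function over a backward orbit segment makes it continuously
  differentiable along the flow, with the difference quotient \<open>smoothing_deriv\<close> as
  derivative. No differentiability of the flow in x is involved.\<close>

definition smoothing :: "('a => real) => real => 'a => real" where
 "smoothing u \<epsilon> x = (LBINT s:{0..\<epsilon>}. u (\<Phi> x (- s))) / \<epsilon>"

definition smoothing_deriv :: "('a => real) => real => 'a => real" where
 "smoothing_deriv u \<epsilon> x = (u x - u (\<Phi> x (- \<epsilon>))) / \<epsilon>"

lemma bounded_compact_support_Lp:
 assumes [measurable]: "h \<in> \<B> borel" and "\<And>x. \<bar>h x\<bar> \<le> B" "compact K1" "\<And>x. x \<notin> K1 ==> h x = 0" shows "h \<in> Lp p \<mu>\<Omega>"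
proof (rule Lp_mono_AE(1)[OF _ _ _ p0])
 have Ks: "K1 \<in> sets borel" using assms(3) by (simp add: compact_imp_closed)
 have "emeasure \<mu> (K1 \<inter> \<Omega>) \<le> emeasure \<mu> K1" using Ks by (intro emeasure_mono) auto
 then have "emeasure \<mu> (K1 \<inter> \<Omega>) < \<infinity>" using mu_compact[OF assms(3)] by (rule le_less_trans)
 then have "(ind (K1 \<inter> \<Omega>) :: 'a => real) \<in> Lp p \<mu>\<Omega>"
  using Ks by (intro Lp_indicator) (auto simp: sets_restrict_space emeasure_restrict_space)
 then show "(\<lambda>x. B * ind (K1 \<inter> \<Omega>) x) \<in> Lp p \<mu>\<Omega>" by (rule Lp_scale(1)[OF _ p0])
 show "h \<in> \<B> \<mu>\<Omega>" by (rule measurable_from_Omega) measurable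
 show "AE x in \<mu>\<Omega>. \<bar>h x\<bar> \<le> \<bar>B * ind (K1 \<inter> \<Omega>) x\<bar>"
 proof (rule AE_I2)
  fix x assume "x \<in> space \<mu>\<Omega>"
  then show "\<bar>h x\<bar> \<le> \<bar>B * ind (K1 \<inter> \<Omega>) x\<bar>" using assms(2)[of x] assms(4)[of x] by (cases "x \<in> K1") auto
 qed
qed

context
 fixes u :: "'a => real" and K :: "'a set"
 assumes cu: "continuous_on UNIV u" and K: "compact K" "K \<subseteq> \<Omega>" and uK: "\<And>x. x \<notin> K ==> u x = 0"
begin

lemma u_measurable: "u \<in> \<B> borel" by (rule borel_measurable_continuous_onI[OF cu])

lemma u_orbit_continuous: "continuous_on A (\<lambda>s. u (\<Phi> x s))"
 by (rule continuous_on_compose2[OF cu]) (auto intro: continuous_intros)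

lemma u_bounded: obtains B where "0 \<le> B" "\<And>x. \<bar>u x\<bar> \<le> B"
proof -
 have "bounded (u ` K)" using K(1) cu by (intro compact_imp_bounded compact_continuous_image) (auto intro: continuous_on_subset)
 then obtain B where "0 < B" "\<And>x. x \<in> K ==> \<bar>u x\<bar> \<le> B" by (auto simp: bounded_pos)
 then have "\<bar>u x\<bar> \<le> B" for x using uK[of x] by (cases "x \<in> K") auto
 with \<open>0 < B\<close> show ?thesis by (intro that[of B]) auto
qed

text \<open>One antiderivative of u along the orbit expresses all averages at once, for every length
  and every point of the orbit.\<close>

lemma smoothing_antiderivative:
 obtains A where "\<And>t. (A has_real_derivative u (\<Phi> x t)) (at t)"
  "\<And>t \<epsilon>. 0 < \<epsilon> ==> smoothing u \<epsilon> (\<Phi> x t) = (A t - A (t - \<epsilon>)) / \<epsilon>"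
proof -
 have "\<exists>F. \<forall>t. -\<infinity> < ereal t --> ereal t < \<infinity> --> (F has_vector_derivative u (\<Phi> x t)) (at t)"
  using u_orbit_continuous[of UNIV x] by (intro einterval_antiderivative) (auto simp: continuous_on_eq_continuous_at)
 then obtain A where A: "\<And>t. (A has_vector_derivative u (\<Phi> x t)) (at t)" by auto
 have "smoothing u \<epsilon> (\<Phi> x t) = (A t - A (t - \<epsilon>)) / \<epsilon>" if "0 < \<epsilon>" for t \<epsilon>
 proof -
  have s: "{s. t - s \<in> {t - \<epsilon>..t}} = {0..\<epsilon>}" by auto
  have "(LBINT s:{0..\<epsilon>}. u (\<Phi> x (t - s))) = (LBINT r:{t - \<epsilon>..t}. u (\<Phi> x r))"
   using set_integral_reflect(2)[of t "{t - \<epsilon>..t}" "\<lambda>r. u (\<Phi> x r)"] unfolding s .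
  also have "... = A t - A (t - \<epsilon>)" unfolding set_lebesgue_integral_def
   by (rule integral_FTC_atLeastAtMost[OF _ has_vector_derivative_at_within[OF A] u_orbit_continuous]) (use that in simp)
  finally show ?thesis by (simp add: smoothing_def flow_add)
 qed
 then show ?thesis using A by (intro that[of A]) (auto simp: has_real_derivative_iff_has_vector_derivative)
qed

lemma smoothing_has_derivative:
 assumes "0 < \<epsilon>" shows "((\<lambda>s. smoothing u \<epsilon> (\<Phi> x s)) has_real_derivative smoothing_deriv u \<epsilon> (\<Phi> x t)) (at t)"
proof -
 obtain A where A: "\<And>t. (A has_real_derivative u (\<Phi> x t)) (at t)"
  "\<And>t \<epsilon>. 0 < \<epsilon> ==> smoothing u \<epsilon> (\<Phi> x t) = (A t - A (t - \<epsilon>)) / \<epsilon>" using smoothing_antiderivative[of x] by metis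
 have "((\<lambda>s. (A s - A (s - \<epsilon>)) / \<epsilon>) has_real_derivative (u (\<Phi> x t) - u (\<Phi> x (t - \<epsilon>))) / \<epsilon>) (at t)"
 proof -
  have "((\<lambda>s. A (s - \<epsilon>)) has_real_derivative u (\<Phi> x (t - \<epsilon>))) (at t)"
   using DERIV_shift[of A "u (\<Phi> x (t - \<epsilon>))" t "- \<epsilon>"] A(1)[of "t - \<epsilon>"] by simp
  then show ?thesis using A(1)[of t] assms by (auto intro!: derivative_eq_intros)
 qed
 then show ?thesis using A(2)[OF assms] by (simp add: smoothing_deriv_def flow_add)
qed

lemma smoothing_lim: "(\<lambda>n. smoothing u (e / real (Suc n)) x) ----> u x" if e: "0 < e"
proof -
 obtain A where A: "\<And>t. (A has_real_derivative u (\<Phi> x t)) (at t)"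
  "\<And>t \<epsilon>. 0 < \<epsilon> ==> smoothing u \<epsilon> (\<Phi> x t) = (A t - A (t - \<epsilon>)) / \<epsilon>" using smoothing_antiderivative[of x] by metis
 have l: "((\<lambda>h. (A h - A 0) / h) ---> u x) (at 0)" using A(1)[of 0] by (simp add: has_field_derivative_iff)
 have z: "(\<lambda>n. - (e / real (Suc n))) ----> - 0"
  by (intro tendsto_minus tendsto_divide_0[OF tendsto_const] filterlim_compose[OF filterlim_real_at_infinity_sequentially filterlim_Suc])
 have "(\<lambda>n. (A (- (e / real (Suc n))) - A 0) / (- (e / real (Suc n)))) ----> u x"
  using e z by (intro tendsto_compose_eventually[OF l, of "\<lambda>n. - (e / real (Suc n))"]) (auto intro!: always_eventually)
 moreover have "smoothing u (e / real (Suc n)) x = (A (- (e / real (Suc n))) - A 0) / (- (e / real (Suc n)))" for n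
 proof -
  have q: "(a - b) / c = (b - a) / (- c)" for a b c :: real by (simp add: minus_divide_right[symmetric] diff_divide_distrib)
  have "smoothing u (e / real (Suc n)) x = (A 0 - A (- (e / real (Suc n)))) / (e / real (Suc n))"
   using A(2)[of "e / real (Suc n)" 0] e by simp
  then show ?thesis unfolding q[of "A 0"] .
 qed
 ultimately show ?thesis by simp
qed

lemma smoothing_bound:
 assumes "0 < \<epsilon>" "0 \<le> B" "\<And>x. \<bar>u x\<bar> \<le> B" shows "\<bar>smoothing u \<epsilon> x\<bar> \<le> B"
proof -
 have i: "lintegrable {0..\<epsilon>} (\<lambda>s. u (\<Phi> x (- s)))"
  by (rule borel_integrable_atLeastAtMost') (rule continuous_on_compose2[OF cu]; auto intro!: continuous_intros)
 have "\<bar>LBINT s:{0..\<epsilon>}. u (\<Phi> x (- s))\<bar> \<le> (LBINT s. B * ind {0..\<epsilon>} s)" unfolding set_lebesgue_integral_def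
 proof (rule order_trans[OF integral_abs_bound], rule integral_mono)
  show "integrable lborel (\<lambda>s. \<bar>ind {0..\<epsilon>} s *\<^sub>R u (\<Phi> x (- s))\<bar>)"
   using i unfolding set_integrable_def by (rule integrable_abs)
  show "integrable lborel (\<lambda>s. B * ind {0..\<epsilon>} s)" using assms(1) by (intro integrable_mult_right integrable_real_indicator) auto
 qed (use assms in \<open>auto simp: indicator_def\<close>)
 also have "... = B * \<epsilon>" using assms by (simp add: content_real)
 finally show ?thesis using assms by (simp add: smoothing_def field_simps)
qed

lemma smoothing_measurable: "smoothing u \<epsilon> \<in> \<B> borel" "smoothing_deriv u \<epsilon> \<in> \<B> borel"
proof -
 note [measurable] = u_measurable
 then show "smoothing u \<epsilon> \<in> \<B> borel" unfolding smoothing_def[abs_def] set_lebesgue_integral_def by measurable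
 show "smoothing_deriv u \<epsilon> \<in> \<B> borel" unfolding smoothing_deriv_def[abs_def] by measurable
qed

text \<open>A backward average over length \<epsilon> is supported in K transported forward by times
  up to \<epsilon>. For small \<epsilon> this remains in one compact subset of \<Omega>.\<close>

lemma smoothing_support:
 obtains e K1 where "0 < e" "compact K1" "K1 \<subseteq> \<Omega>" "\<And>\<epsilon> x. 0 < \<epsilon> ==> \<epsilon> \<le> e ==> x \<notin> K1 ==> smoothing u \<epsilon> x = 0"
  "\<And>\<epsilon> x. 0 < \<epsilon> ==> \<epsilon> \<le> e ==> x \<notin> K1 ==> smoothing_deriv u \<epsilon> x = 0" "K \<subseteq> K1"
proof -
 \<comment> \<open>The times at which some point of K is carried out of \<Omega> form a closed set
   that does not contain 0.\<close>
 have "closed {s. \<exists>x. x \<in> K \<and> (x, s) \<in> (\<lambda>(x, s). \<Phi> x s) -` (- \<Omega>)}" by (rule closed_compact_projection[OF K(1)])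
   (auto intro!: closed_vimage continuous_intros simp: open_Omega closed_Compl case_prod_unfold)
 then have oW: "open (- {s. \<exists>x. x \<in> K \<and> (x, s) \<in> (\<lambda>(x, s). \<Phi> x s) -` (- \<Omega>)})" by (rule open_Compl)
 define W where "W = - {s. \<exists>x. x \<in> K \<and> (x, s) \<in> (\<lambda>(x, s). \<Phi> x s) -` (- \<Omega>)}"
 have W: "open W" "\<And>s x. s \<in> W ==> x \<in> K ==> \<Phi> x s \<in> \<Omega>" "0 \<in> W" using oW K(2) by (auto simp: W_def)
 obtain e where e: "0 < e" "cball 0 e \<subseteq> W" using W(1,3) unfolding open_contains_cball by blast
 define K1 where "K1 = (\<lambda>(x, s). \<Phi> x s) ` (K \<times> {0..e})"
 have c1: "compact K1" unfolding K1_def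
  by (intro compact_continuous_image compact_Times K(1) compact_Icc continuous_on_subset[OF flow_continuous]) auto
 have c2: "K1 \<subseteq> \<Omega>"
 proof
  fix y assume "y \<in> K1"
  then obtain x s where "x \<in> K" "s \<in> {0..e}" "y = \<Phi> x s" by (auto simp: K1_def)
  moreover have "s \<in> cball 0 e" using \<open>s \<in> {0..e}\<close> by (auto simp: dist_real_def)
  ultimately show "y \<in> \<Omega>" using e(2) W(2) by blast
 qed
 have z: "u (\<Phi> x (- s)) = 0" if "x \<notin> K1" "0 \<le> s" "s \<le> e" for x s
 proof (rule uK, rule notI)
  assume "\<Phi> x (- s) \<in> K"
  then have "\<Phi> (\<Phi> x (- s)) s \<in> K1" using that unfolding K1_def by (intro image_eqI[of _ _ "(\<Phi> x (- s), s)"]) auto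
  then show False using that(1) by (simp add: flow_add)
 qed
 have c3: "smoothing u \<epsilon> x = 0" if "0 < \<epsilon>" "\<epsilon> \<le> e" "x \<notin> K1" for \<epsilon> x
 proof -
  have "ind {0..\<epsilon>} s *\<^sub>R u (\<Phi> x (- s)) = 0" for s using z[OF that(3), of s] that by (auto simp: indicator_def)
  then show ?thesis unfolding smoothing_def set_lebesgue_integral_def by (simp only:) simp
 qed
 have c4: "smoothing_deriv u \<epsilon> x = 0" if "0 < \<epsilon>" "\<epsilon> \<le> e" "x \<notin> K1" for \<epsilon> x
  using z[OF that(3), of 0] z[OF that(3), of \<epsilon>] that e by (simp add: smoothing_deriv_def)
 have c5: "K \<subseteq> K1"
 proof
  fix x assume "x \<in> K" then show "x \<in> K1" unfolding K1_def using e by (intro image_eqI[of _ _ "(x, 0)"]) auto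
 qed
 show ?thesis by (rule that[OF e(1) c1 c2 c3 c4 c5])
qed

lemma flow_deriv_smoothing: "0 < \<epsilon> ==> flow_deriv (smoothing u \<epsilon>) = smoothing_deriv u \<epsilon>"
 using smoothing_has_derivative[of \<epsilon> _ 0] unfolding flow_deriv_def by (auto simp: fun_eq_iff intro!: DERIV_imp_deriv)

lemma smoothing_test_function:
 assumes \<epsilon>: "0 < \<epsilon>" and K1: "compact K1" "K1 \<subseteq> \<Omega>" "\<And>x. x \<notin> K1 ==> smoothing u \<epsilon> x = 0"
 shows "smoothing u \<epsilon> \<in> test_functions"
proof -
 note [measurable] = smoothing_measurable
 obtain B where B: "0 \<le> B" "\<And>x. \<bar>u x\<bar> \<le> B" using u_bounded by blast
 have sub: "closure {x \<in> \<Omega>. smoothing u \<epsilon> x \<noteq> 0} \<subseteq> K1" using K1 by (intro closure_minimal compact_imp_closed) auto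
 have Bd: "\<bar>smoothing_deriv u \<epsilon> x\<bar> \<le> 2 * B / \<epsilon>" for x
 proof -
  have "\<bar>u x - u (\<Phi> x (- \<epsilon>))\<bar> \<le> 2 * B" using B(2)[of x] B(2)[of "\<Phi> x (- \<epsilon>)"] by linarith
  then show ?thesis using \<epsilon> by (simp add: smoothing_deriv_def divide_right_mono)
 qed
 show ?thesis unfolding test_functions_def mem_Collect_eq flow_deriv_smoothing[OF \<epsilon>]
 proof (intro conjI ballI)
  show "bounded (smoothing u \<epsilon> ` \<Omega>)" "bounded (smoothing_deriv u \<epsilon> ` \<Omega>)"
   using smoothing_bound[OF \<epsilon> B] Bd by (auto simp: bounded_iff)
  show "compact (closure {x \<in> \<Omega>. smoothing u \<epsilon> x \<noteq> 0})"
   using compact_Int_closed[OF K1(1) closed_closure, of "{x \<in> \<Omega>. smoothing u \<epsilon> x \<noteq> 0}"] sub by (simp add: Int_absorb1)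
  show "closure {x \<in> \<Omega>. smoothing u \<epsilon> x \<noteq> 0} \<subseteq> \<Omega>" using sub K1 by auto
  show "(\<lambda>s. smoothing u \<epsilon> (\<Phi> x s)) C1_differentiable_on {s. - tau (- 1) x < ereal s \<and> ereal s < tau 1 x}" for x
   unfolding C1_differentiable_on_def
  proof (intro exI[of _ "\<lambda>t. smoothing_deriv u \<epsilon> (\<Phi> x t)"] conjI ballI)
   show "((\<lambda>s. smoothing u \<epsilon> (\<Phi> x s)) has_vector_derivative smoothing_deriv u \<epsilon> (\<Phi> x t)) (at t)" for t
    using smoothing_has_derivative[OF \<epsilon>] by (simp add: has_real_derivative_iff_has_vector_derivative)
   show "continuous_on {s. - tau (- 1) x < ereal s \<and> ereal s < tau 1 x} (\<lambda>t. smoothing_deriv u \<epsilon> (\<Phi> x t))"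
    unfolding smoothing_deriv_def flow_add
    using \<epsilon> by (intro continuous_intros u_orbit_continuous continuous_on_compose2[OF cu]) auto
  qed
 qed (auto intro: measurable_restrict_space1)
qed

text \<open>The support is a compact subset of \<Omega>, so the function is zero near the boundary
  end of each chord and both traces vanish.\<close>

lemma smoothing_D0:
 assumes \<epsilon>: "0 < \<epsilon>" and K1: "compact K1" "K1 \<subseteq> \<Omega>" "\<And>x. x \<notin> K1 ==> smoothing u \<epsilon> x = 0"
  "\<And>x. x \<notin> K1 ==> smoothing_deriv u \<epsilon> x = 0" shows "smoothing u \<epsilon> \<in> D0"
proof -
 note [measurable] = smoothing_measurable
 obtain B where B: "0 \<le> B" "\<And>x. \<bar>u x\<bar> \<le> B" using u_bounded by blast
 have Bd: "\<bar>- smoothing_deriv u \<epsilon> x\<bar> \<le> 2 * B / \<epsilon>" for x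
 proof -
  have "\<bar>u x - u (\<Phi> x (- \<epsilon>))\<bar> \<le> 2 * B" using B(2)[of x] B(2)[of "\<Phi> x (- \<epsilon>)"] by linarith
  then show ?thesis using \<epsilon> by (simp add: smoothing_deriv_def divide_right_mono)
 qed
 have L1: "smoothing u \<epsilon> \<in> Lp p \<mu>\<Omega>"
  by (rule bounded_compact_support_Lp[OF smoothing_measurable(1) smoothing_bound[OF \<epsilon> B] K1(1,3)])
 have L2: "(\<lambda>x. - smoothing_deriv u \<epsilon> x) \<in> Lp p \<mu>\<Omega>"
  by (rule bounded_compact_support_Lp[OF _ Bd K1(1)]) (use K1(4) in auto)
 have "mild_at (smoothing u \<epsilon>) (\<lambda>x. - smoothing_deriv u \<epsilon> x) x" for x unfolding mild_at_def decreases_by_def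
 proof (intro allI impI conjI)
  fix a b :: real assume "a \<le> b"
  have c: "continuous_on {a..b} (\<lambda>s. - smoothing_deriv u \<epsilon> (\<Phi> x s))" unfolding smoothing_deriv_def flow_add
   using \<epsilon> by (intro continuous_intros u_orbit_continuous continuous_on_compose2[OF cu]) auto
  then show "lintegrable {a..b} (\<lambda>s. - smoothing_deriv u \<epsilon> (\<Phi> x s))" by (rule borel_integrable_atLeastAtMost')
  have "(LBINT s:{a..b}. - smoothing_deriv u \<epsilon> (\<Phi> x s)) = - smoothing u \<epsilon> (\<Phi> x b) - - smoothing u \<epsilon> (\<Phi> x a)"
   unfolding set_lebesgue_integral_def by (rule integral_FTC_atLeastAtMost[OF \<open>a \<le> b\<close> _ c])
    (use DERIV_minus[OF smoothing_has_derivative[OF \<epsilon>]] in \<open>auto intro: has_vector_derivative_at_within simp: has_real_derivative_iff_has_vector_derivative\<close>)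
  then show "smoothing u \<epsilon> (\<Phi> x a) - smoothing u \<epsilon> (\<Phi> x b) = (LBINT s:{a..b}. - smoothing_deriv u \<epsilon> (\<Phi> x s))" by simp
 qed
 then have m: "mild (smoothing u \<epsilon>) (\<lambda>x. - smoothing_deriv u \<epsilon> x)" by (simp add: mild_def)
 have sm: "smoothing u \<epsilon> \<in> \<B> \<mu>\<Omega>" using L1 by (simp add: Lp_def)
 have sr: "sharp_rep (smoothing u \<epsilon>) (smoothing u \<epsilon>)"
  unfolding sharp_rep_iff using sm m mild_imp_T_max[OF L1 L2 sm _ m] by auto
 have "has_trace \<sigma> N (smoothing u \<epsilon>) (\<lambda>_. 0)" if N: "boundary_measure \<sigma> N" for \<sigma> N unfolding has_trace_def
 proof (intro conjI exI[of _ "smoothing u \<epsilon>"] sr AE_I2)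
  fix y assume "y \<in> space N"
  then have "y \<notin> K1" using Gam_space(1)[OF N] Gam_not_Omega K1(2) by auto
  have "open ((\<lambda>s. \<Phi> y (- \<sigma> * s)) -` (- K1))"
   using K1(1) by (intro open_vimage continuous_intros) (auto intro: compact_imp_closed)
  moreover have "0 \<in> (\<lambda>s. \<Phi> y (- \<sigma> * s)) -` (- K1)" using \<open>y \<notin> K1\<close> by simp
  ultimately have "\<forall>\<^sub>F s in nhds 0. s \<in> (\<lambda>s. \<Phi> y (- \<sigma> * s)) -` (- K1)" by (rule eventually_nhds_in_open)
  then have "\<forall>\<^sub>F s in at_right 0. s \<in> (\<lambda>s. \<Phi> y (- \<sigma> * s)) -` (- K1)"
   unfolding eventually_at_filter by (rule eventually_mono) simp
  then have "\<forall>\<^sub>F t in at_right 0. smoothing u \<epsilon> (\<Phi> y (- \<sigma> * t)) = 0" by eventually_elim (use K1(3) in auto)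
  then show "((\<lambda>t. smoothing u \<epsilon> (\<Phi> y (- \<sigma> * t))) ---> 0) (at_right 0)" by (rule tendsto_eventually)
 qed simp
 then show ?thesis using mu_plus mu_minus by (simp add: D0_def)
qed

lemma smoothing_approx:
 obtains v B K1 where "\<And>n::nat. v n \<in> D0" "\<And>n. v n \<in> test_functions" "\<And>n x. \<bar>v n x\<bar> \<le> B" "\<And>x. (\<lambda>n. v n x) ----> u x"
  "compact K1" "K1 \<subseteq> \<Omega>" "\<And>n x. x \<notin> K1 ==> v n x = 0" "\<And>n. v n \<in> \<B> borel" "K \<subseteq> K1" "\<And>x. \<bar>u x\<bar> \<le> B" "u \<in> \<B> borel"
proof -
 obtain B where B: "0 \<le> B" "\<And>x. \<bar>u x\<bar> \<le> B" using u_bounded by blast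
 obtain e K1 where e: "0 < e" "compact K1" "K1 \<subseteq> \<Omega>" "\<And>\<epsilon> x. 0 < \<epsilon> ==> \<epsilon> \<le> e ==> x \<notin> K1 ==> smoothing u \<epsilon> x = 0"
  "\<And>\<epsilon> x. 0 < \<epsilon> ==> \<epsilon> \<le> e ==> x \<notin> K1 ==> smoothing_deriv u \<epsilon> x = 0" "K \<subseteq> K1" using smoothing_support by metis
 have n: "0 < e / real (Suc n)" "e / real (Suc n) \<le> e" for n using e(1) by (auto simp: field_simps)
 show ?thesis
 proof (rule that[of "\<lambda>n. smoothing u (e / real (Suc n))" B K1])
  show "smoothing u (e / real (Suc n)) \<in> D0" for n by (rule smoothing_D0[OF n(1) e(2,3) e(4)[OF n] e(5)[OF n]])
  show "smoothing u (e / real (Suc n)) \<in> test_functions" for n by (rule smoothing_test_function[OF n(1) e(2,3) e(4)[OF n]])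
  show "\<bar>smoothing u (e / real (Suc n)) x\<bar> \<le> B" for n x by (rule smoothing_bound[OF n(1) B])
  show "(\<lambda>n. smoothing u (e / real (Suc n)) x) ----> u x" for x by (rule smoothing_lim[OF e(1)])
  show "smoothing u (e / real (Suc n)) x = 0" if "x \<notin> K1" for n x by (rule e(4)[OF n that])
 qed (use e B smoothing_measurable u_measurable in auto)
qed

end

section \<open>Density of \<open>D0\<close> and uniqueness of the weak derivative\<close>

lemma cutoff_functions:
 assumes K: "compact K" "K \<subseteq> \<Omega>"
 obtains u K1 where "\<And>n::nat. continuous_on UNIV (u n)" "compact K1" "K1 \<subseteq> \<Omega>" "\<And>n x. x \<notin> K1 ==> u n x = (0::real)"
  "\<And>n x. \<bar>u n x\<bar> \<le> 1" "\<And>x. (\<lambda>n. u n x) ----> ind K x" "K \<subseteq> K1"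
proof (cases "K = {}")
 case True
 then show ?thesis by (intro that[of "\<lambda>n x. 0" "{}"]) auto
next
 case False
 obtain d where d: "0 < d" "{x. infdist x K \<le> d} \<subseteq> \<Omega>"
  using compact_in_open_separated[OF False K(1) open_Omega K(2)] by metis
 define u where "u n x = max 0 (1 - real (Suc n) / d * infdist x K)" for n x
 show ?thesis
 proof (rule that[of u "{x. infdist x K \<le> d}"])
  show "continuous_on UNIV (u n)" for n unfolding u_def[abs_def] by (intro continuous_intros)
  show "compact {x. infdist x K \<le> d}" by (rule compact_infdist_le[OF False K(1) d(1)])
  show "{x. infdist x K \<le> d} \<subseteq> \<Omega>" by fact
  show "u n x = 0" if "x \<notin> {x. infdist x K \<le> d}" for n x
  proof -
   have "1 * 1 \<le> real (Suc n) * (infdist x K / d)" using that d(1) by (intro mult_mono) auto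
   then show ?thesis by (simp add: u_def)
  qed
  show "\<bar>u n x\<bar> \<le> 1" for n x unfolding u_def using d(1) infdist_nonneg[of x K] by (auto simp: abs_if max_def)
  show "K \<subseteq> {x. infdist x K \<le> d}" using d(1) by (auto simp: less_imp_le)
  fix x
  show "(\<lambda>n. u n x) ----> ind K x"
  proof (cases "x \<in> K")
   case True then show ?thesis by (simp add: u_def)
  next
   case xK: False
   then have pos: "0 < infdist x K"
    using in_closed_iff_infdist_zero[OF compact_imp_closed[OF K(1)] False, of x] infdist_nonneg[of x K] by linarith
   obtain N :: nat where N: "d / infdist x K \<le> real N" using real_arch_simple by blast
   have "\<forall>\<^sub>F n in sequentially. u n x = 0" using eventually_ge_at_top[of N]
   proof eventually_elim
    case (elim n)
    have "d / infdist x K \<le> real (Suc n)" using N elim by linarith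
    then have "1 \<le> real (Suc n) / d * infdist x K" using pos d(1) by (simp add: field_simps)
    then show ?case by (simp add: u_def)
   qed
   then show ?thesis using xK by (simp add: tendsto_eventually)
  qed
 qed
qed

lemma inner_regular: "A \<in> sets borel ==> emeasure \<mu> A = (SUP K\<in>{K. compact K \<and> K \<subseteq> A}. emeasure \<mu> K)"
 using radon by (simp add: radon_measure_def)

lemma compact_indicator_Lp: "compact K1 ==> (ind K1 :: 'a => real) \<in> Lp p \<mu>\<Omega>"
 by (rule bounded_compact_support_Lp[of _ 1 K1]) (auto simp: compact_imp_closed indicator_def)

lemma compact_dominated:
 fixes w :: "nat => 'a => real"
 assumes K: "compact K" "K \<subseteq> \<Omega>"
  and w: "\<And>n. w n \<in> \<B> borel" "\<And>n x. \<bar>w n x\<bar> \<le> B" "\<And>n x. x \<notin> K ==> w n x = 0" "\<And>x. (\<lambda>n. w n x) ----> u x"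
 shows "u \<in> Lp p \<mu>\<Omega>" "(\<lambda>n. Lp_norm p \<mu>\<Omega> (\<lambda>x. w n x - u x)) ----> 0"
  "h \<in> Lp p \<mu>\<Omega> ==> (\<lambda>n. LINT x|\<mu>. ext h x * w n x) ----> (LINT x|\<mu>. ext h x * u x)"
proof -
 have m [measurable]: "u \<in> \<B> borel" by (rule borel_measurable_LIMSEQ_real[OF w(4,1)])
 have b: "\<bar>u x\<bar> \<le> B" for x by (rule LIMSEQ_le_const2[OF tendsto_rabs[OF w(4)]]) (use w(2) in auto)
 have z: "u x = 0" if "x \<notin> K" for x using w(4)[of x] w(3)[OF that] by (simp add: LIMSEQ_const_iff)
 have B: "0 \<le> B" using b[of undefined] by linarith
 show "u \<in> Lp p \<mu>\<Omega>" by (rule bounded_compact_support_Lp[OF m b K(1) z])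
 show "(\<lambda>n. Lp_norm p \<mu>\<Omega> (\<lambda>x. w n x - u x)) ----> 0"
 proof (rule Lp_dominated[OF p0 Lp_scale(1)[OF compact_indicator_Lp[OF K(1)] p0, of "2 * B"]])
  show "AE x in \<mu>\<Omega>. \<bar>w n x - u x\<bar> \<le> \<bar>2 * B * ind K x\<bar>" for n
  proof (rule AE_I2)
   fix x show "\<bar>w n x - u x\<bar> \<le> \<bar>2 * B * ind K x\<bar>"
    using w(2)[of n x] b[of x] w(3)[of x n] z[of x] by (cases "x \<in> K") auto
  qed
 qed (use w m in \<open>auto intro: measurable_from_Omega\<close>)
 assume h: "h \<in> Lp p \<mu>\<Omega>"
 have hm [measurable]: "ext h \<in> \<B> borel" by (rule ext_measurable[OF Lp_meas[OF h]])
 show "(\<lambda>n. LINT x|\<mu>. ext h x * w n x) ----> (LINT x|\<mu>. ext h x * u x)"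
 proof (rule integral_dominated_convergence[where w="\<lambda>x. \<bar>ext h x * (B * ind K x)\<bar>"])
  show "integrable \<mu> (\<lambda>x. \<bar>ext h x * (B * ind K x)\<bar>)"
   by (intro integrable_abs Lp_Omega_integrable_on_compact[OF h K, of _ B]) (use B borel_compact[OF K(1)] in \<open>auto simp: indicator_def\<close>)
  show "AE x in \<mu>. norm (ext h x * w n x) \<le> \<bar>ext h x * (B * ind K x)\<bar>" for n
  proof (rule AE_I2)
   fix x show "norm (ext h x * w n x) \<le> \<bar>ext h x * (B * ind K x)\<bar>"
    using w(2)[of n x] w(3)[of x n] B by (cases "x \<in> K") (auto simp: abs_mult mult_left_mono)
  qed
  show "AE x in \<mu>. (\<lambda>n. ext h x * w n x) ----> ext h x * u x" using w(4) by (intro AE_I2 tendsto_intros)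
 qed (intro measurable_mu borel_measurable_times hm m w(1))+
qed

text \<open>Density of \<open>D0\<close> in the form of an induction rule. Smoothings approximate
  continuous functions of compact support, these approximate indicators of compact sets, and inner
  regularity leads to all sets of finite measure.\<close>

lemma D0_induct [consumes 1, case_names D0 add scale lim]:
 assumes f: "f \<in> Lp p \<mu>\<Omega>" and D: "\<And>f. f \<in> D0 ==> P f"
  and add: "\<And>f g. f \<in> Lp p \<mu>\<Omega> ==> g \<in> Lp p \<mu>\<Omega> ==> P f ==> P g ==> P (\<lambda>x. f x + g x)"
  and scale: "\<And>f c. f \<in> Lp p \<mu>\<Omega> ==> P f ==> P (\<lambda>x. c * f x)"
  and lim: "\<And>f g. (\<And>n. f n \<in> Lp p \<mu>\<Omega>) ==> (\<And>n. P (f n)) ==> g \<in> Lp p \<mu>\<Omega> ==>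
   (\<lambda>n. Lp_norm p \<mu>\<Omega> (\<lambda>x. f n x - g x)) ----> 0 ==> P g" shows "P f"
proof -
 have PK: "P (ind K)" if K: "compact K" "K \<subseteq> \<Omega>" for K
 proof -
  obtain u K1 where u: "\<And>n::nat. continuous_on UNIV (u n)" "compact K1" "K1 \<subseteq> \<Omega>" "\<And>n x. x \<notin> K1 ==> u n x = (0::real)"
   "\<And>n x. \<bar>u n x\<bar> \<le> 1" "\<And>x. (\<lambda>n. u n x) ----> ind K x" "K \<subseteq> K1" using cutoff_functions[OF K] by metis
  have um: "u n \<in> \<B> borel" for n by (rule borel_measurable_continuous_onI[OF u(1)])
  have Pu: "P (u n)" for n
  proof -
   obtain v B K2 where v: "\<And>m::nat. v m \<in> D0" "\<And>m x. \<bar>v m x\<bar> \<le> B" "\<And>x. (\<lambda>m. v m x) ----> u n x"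
    "compact K2" "K2 \<subseteq> \<Omega>" "\<And>m x. x \<notin> K2 ==> v m x = 0" "\<And>m. v m \<in> \<B> borel"
    using smoothing_approx[OF u(1)[of n] u(2,3) u(4)] by metis
   note c = compact_dominated[OF v(4,5,7,2,6,3)]
   show ?thesis by (rule lim[OF bounded_compact_support_Lp[OF v(7,2,4,6)] D[OF v(1)] c(1,2)])
  qed
  note c = compact_dominated[OF u(2,3) um u(5,4,6)]
  show ?thesis by (rule lim[OF bounded_compact_support_Lp[OF um u(5,2,4)] Pu c(1,2)])
 qed
 show ?thesis using f p1
 proof (induction f rule: Lp_induct)
  case (indicator A)
  let ?e = "\<lambda>n. 1 / real (Suc n)"
  let ?d = "\<lambda>n. ?e n powr (1 / p)"
  have A: "A \<in> sets borel" "A \<subseteq> \<Omega>" "emeasure \<mu> A < \<infinity>"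
   using indicator by (auto simp: sets_restrict_space emeasure_restrict_space)
  \<comment> \<open>Approximation from inside with error \<open>1 / (n + 1)\<close>. A set of
    measure zero is separated, since no value below its measure is available to feed into the
    supremum.\<close>
  have "\<exists>K. compact K \<and> K \<subseteq> A \<and> emeasure \<mu> (A - K) \<le> ennreal (?e n)" for n
  proof (cases "emeasure \<mu> A = 0")
   case True
   then show ?thesis by (intro exI[of _ "{}"]) auto
  next
   case False
   then have "emeasure \<mu> A - ennreal (?e n) < emeasure \<mu> A"
    using A(3) by (intro ennreal_between) (auto simp: zero_less_iff_neq_zero)
   then obtain K where K: "compact K" "K \<subseteq> A" "emeasure \<mu> A - ennreal (?e n) < emeasure \<mu> K"
    unfolding inner_regular[OF A(1)] less_SUP_iff by auto
   have Kb: "K \<in> sets \<mu>" using K(1) by (simp add: compact_imp_closed)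
   have "emeasure \<mu> A \<le> emeasure \<mu> K + ennreal (?e n)"
    using K(3) by (metis add.commute ennreal_minus_le_iff less_imp_le)
   then have "emeasure \<mu> (A - K) \<le> ennreal (?e n)" using mu_compact[OF K(1)] K(2) A(1) Kb
    by (subst emeasure_Diff) (auto simp: ennreal_minus_le_iff less_top)
   then show ?thesis using K by auto
  qed
  then obtain K where K: "\<And>n. compact (K n)" "\<And>n. K n \<subseteq> A" "\<And>n. emeasure \<mu> (A - K n) \<le> ennreal (?e n)" by metis
  have KL: "(ind (K n) :: 'a => real) \<in> Lp p \<mu>\<Omega>" for n by (rule compact_indicator_Lp[OF K(1)])
  have AL: "(ind A :: 'a => real) \<in> Lp p \<mu>\<Omega>" by (rule Lp_indicator[OF indicator])
  show ?case
  proof (rule lim[OF KL PK[OF K(1) order_trans[OF K(2) A(2)]] AL])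
   have n: "Lp_norm p \<mu>\<Omega> (\<lambda>x. ind (K n) x - ind A x) \<le> ?d n" for n
   proof (rule Lp_leI(2)[OF Lp_meas[OF Lp_diff[OF p1 KL AL]] _ p0])
    have "Lp_nn p \<mu>\<Omega> (\<lambda>x. ind (K n) x - ind A x) = (\<integral>\<^sup>+x. ind (A - K n) x \<partial>\<mu>)"
     unfolding nn_integral_Omega using K(2)[of n] A(2) p0 by (intro nn_integral_cong) (auto simp: indicator_def)
    also have "... = emeasure \<mu> (A - K n)"
     using A(1) K(1)[of n] by (intro nn_integral_indicator) (auto simp: compact_imp_closed)
    also have "... \<le> ennreal (?d n powr p)" using K(3)[of n] p0 by (simp add: powr_powr)
    finally show "(Lp_nn p \<mu>\<Omega> (\<lambda>x. ind (K n) x - ind A x)) \<le> ennreal (?d n powr p)" .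
   qed simp
   have l: "(\<lambda>n. ?d n) ----> 0" using p0 LIMSEQ_inverse_real_of_nat
    by (intro tendsto_zero_powrI[where b="1/p"]) (auto simp: inverse_eq_divide)
   show "(\<lambda>n. Lp_norm p \<mu>\<Omega> (\<lambda>x. ind (K n) x - ind A x)) ----> 0"
    by (rule tendsto_sandwich[OF always_eventually always_eventually tendsto_const l]) (intro allI Lp_norm_nonneg n)+
  qed
 next
  case add then show ?case by (rule assms(3))
 next
  case scale then show ?case by (rule assms(4))
 next
  case (lim f g) then show ?case by (intro assms(5)[of f g])
 qed
qed

lemma T_max_test: "(f, g) \<in> T_max_graph ==> \<psi> \<in> test_functions ==> (LINT x|\<mu>\<Omega>. g x * \<psi> x) = (LINT x|\<mu>\<Omega>. f x * flow_deriv \<psi> x)"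
 by (auto simp: T_max_graph_def)

lemma T_max_Lp: "(f, g) \<in> T_max_graph ==> f \<in> Lp p \<mu>\<Omega>" "(f, g) \<in> T_max_graph ==> g \<in> Lp p \<mu>\<Omega>"
 by (auto simp: T_max_graph_def)

lemma integral_Omega_ext: "(LINT x|\<mu>\<Omega>. h x * b x) = (LINT x|\<mu>. ext h x * b x)" for h b :: "'a => real"
 by (subst integral_restrict_space) (auto intro!: Bochner_Integration.integral_cong simp: ext_def indicator_def)

text \<open>The difference of two candidates is orthogonal to all smoothings, hence to indicators of
  compact sets. If it were positive or negative on a set of positive measure, inner regularity would
  supply a compact set contradicting this.\<close>

lemma T_max_unique:
 assumes g: "(f, g) \<in> T_max_graph" and g': "(f, g') \<in> T_max_graph" shows "AE x in \<mu>\<Omega>. g x = g' x"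
proof -
 define h where "h x = g x - g' x" for x
 have h: "h \<in> Lp p \<mu>\<Omega>" unfolding h_def using T_max_Lp(2)[OF g] T_max_Lp(2)[OF g'] by (rule Lp_diff[OF p1])
 have hm [measurable]: "ext h \<in> \<B> borel" by (rule ext_measurable[OF Lp_meas[OF h]])
 have zu: "(LINT x|\<mu>. ext h x * u x) = 0"
  if u: "continuous_on UNIV u" "compact K1" "K1 \<subseteq> \<Omega>" "\<And>x. x \<notin> K1 ==> u x = 0" for u K1
 proof -
  obtain v B K2 where v: "\<And>m::nat. v m \<in> test_functions" "\<And>m x. \<bar>v m x\<bar> \<le> B" "\<And>x. (\<lambda>m. v m x) ----> u x"
   "compact K2" "K2 \<subseteq> \<Omega>" "\<And>m x. x \<notin> K2 ==> v m x = 0" "\<And>m. v m \<in> \<B> borel" "\<And>x. \<bar>u x\<bar> \<le> B" "u \<in> \<B> borel"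
   using smoothing_approx[OF u] by metis
  have iv: "integrable \<mu> (\<lambda>x. ext k x * v m x)" if "k \<in> Lp p \<mu>\<Omega>" for m k
   by (rule Lp_Omega_integrable_on_compact[OF that v(4,5) v(7) v(2) v(6)])
  have z: "(LINT x|\<mu>. ext h x * v m x) = 0" for m
  proof -
   have "ext h x = ext g x - ext g' x" for x by (simp add: ext_def h_def)
   then have "(LINT x|\<mu>. ext h x * v m x) = (LINT x|\<mu>. ext g x * v m x) - (LINT x|\<mu>. ext g' x * v m x)"
    using iv[OF T_max_Lp(2)[OF g]] iv[OF T_max_Lp(2)[OF g']] by (simp add: left_diff_distrib)
   also have "... = 0"
    using T_max_test[OF g v(1)[of m]] T_max_test[OF g' v(1)[of m]] unfolding integral_Omega_ext[of g] integral_Omega_ext[of g'] by simp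
   finally show ?thesis .
  qed
  show ?thesis using compact_dominated(3)[OF v(4,5,7,2,6,3) h] unfolding z by (simp add: LIMSEQ_const_iff)
 qed
 have zK: "(LINT x|\<mu>. ext h x * ind K x) = 0" if K: "compact K" "K \<subseteq> \<Omega>" for K
 proof -
  obtain u K1 where u: "\<And>n::nat. continuous_on UNIV (u n)" "compact K1" "K1 \<subseteq> \<Omega>" "\<And>n x. x \<notin> K1 ==> u n x = (0::real)"
   "\<And>n x. \<bar>u n x\<bar> \<le> 1" "\<And>x. (\<lambda>n. u n x) ----> ind K x" "K \<subseteq> K1" using cutoff_functions[OF K] by metis
  have "(LINT x|\<mu>. ext h x * u m x) = 0" for m by (rule zu[OF u(1-4)])
  then show ?thesis using compact_dominated(3)[OF u(2,3) borel_measurable_continuous_onI[OF u(1)] u(5,4,6) h]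
   by (simp add: LIMSEQ_const_iff)
 qed
 have null: "emeasure \<mu> {x \<in> \<Omega>. 0 < c * h x} = 0" if c: "c = 1 \<or> c = -1" for c
 proof (rule ccontr)
  let ?A = "{x. 0 < c * ext h x}"
  have A: "?A \<in> sets borel" by measurable
  have AO: "{x \<in> \<Omega>. 0 < c * h x} = ?A" by (auto simp: ext_def)
  assume "emeasure \<mu> {x \<in> \<Omega>. 0 < c * h x} \<noteq> 0"
  then have "0 < (SUP K\<in>{K. compact K \<and> K \<subseteq> ?A}. emeasure \<mu> K)"
   unfolding AO inner_regular[OF A, symmetric] by (simp add: zero_less_iff_neq_zero)
  then obtain K where K: "compact K" "K \<subseteq> ?A" "0 < emeasure \<mu> K" unfolding less_SUP_iff by auto
  have KO: "K \<subseteq> \<Omega>" using K(2) AO by auto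
  have Kb: "K \<in> sets borel" using K by (simp add: compact_imp_closed)
  have i: "integrable \<mu> (\<lambda>x. ext h x * ind K x)"
   by (rule Lp_Omega_integrable_on_compact[OF h K(1) KO, of _ 1]) (use Kb in \<open>auto simp: indicator_def\<close>)
  have "(LINT x|\<mu>. c * (ext h x * ind K x)) = 0" using zK[OF K(1) KO] by simp
  moreover have "0 \<le> c * (ext h x * ind K x)" for x using K(2) by (cases "x \<in> K") auto
  ultimately have "AE x in \<mu>. c * (ext h x * ind K x) = 0" using i by (subst (asm) integral_nonneg_eq_0_iff_AE) auto
  then have "AE x in \<mu>. x \<notin> K" by eventually_elim (use K(2) c in \<open>auto simp: indicator_def\<close>)
  then have "emeasure \<mu> K = 0" using Kb by (subst (asm) AE_iff_measurable[of K]) auto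
  then show False using K(3) by simp
 qed
 have hs: "{x \<in> \<Omega>. 0 < c * h x} \<in> sets \<mu>" for c
 proof -
  have "{x \<in> \<Omega>. 0 < c * h x} = {x. 0 < c * ext h x}" by (auto simp: ext_def)
  also have "... \<in> sets borel" by measurable
  finally show ?thesis by simp
 qed
 have "AE x in \<mu>. x \<notin> {x \<in> \<Omega>. 0 < 1 * h x}" "AE x in \<mu>. x \<notin> {x \<in> \<Omega>. 0 < -1 * h x}"
  by (intro AE_not_in null_setsI null hs; simp)+
 then have "AE x in \<mu>. x \<in> \<Omega> --> g x = g' x" by eventually_elim (auto simp: h_def)
 then show ?thesis by (simp add: AE_Omega_iff)
qed

end

subsection \<open>Traces\<close>

lemma AE_lborel_interval_ex:
 assumes "AE s in lborel. s \<in> {a<..<b} --> P s" "a < (b::real)" obtains s where "a < s" "s < b" "P s"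
proof -
 have "\<exists>s. a < s \<and> s < b \<and> P s"
 proof (rule ccontr)
  assume "\<not> ?thesis"
  then have "AE s in lborel. s \<notin> {a<..<b}" using assms(1) by (auto elim: eventually_mono)
  then have "emeasure lborel {a<..<b} = 0" by (subst (asm) AE_iff_measurable[of "{a<..<b}"]) auto
  then show False using assms(2) by simp
 qed
 then show ?thesis using that by blast
qed

context transport_p
begin

text \<open>Invariance of \<mu> and Tonelli: almost every orbit meets a null set in a null set of
  times.\<close>

lemma AE_stay:
 assumes "AE x in \<mu>\<Omega>. P x" shows "AE x in \<mu>\<Omega>. AE s in lborel. s \<in> stay x --> P (\<Phi> x s)"
proof -
 interpret pair_sigma_finite \<mu> "lborel :: real measure" ..
 obtain Z where Z: "{x \<in> space \<mu>. \<not> (x \<in> \<Omega> --> P x)} \<subseteq> Z" "emeasure \<mu> Z = 0" "Z \<in> sets \<mu>"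
  using assms unfolding AE_Omega_iff by (rule AE_E)
 have Zs [measurable]: "Z \<in> sets borel" using Z by simp
 have m: "(\<lambda>x. \<integral>\<^sup>+s. ind Z (\<Phi> x s) \<partial>lborel) \<in> \<B> \<mu>"
  by (rule lborel.borel_measurable_nn_integral) (simp add: case_prod_unfold, measurable)
 have "(\<integral>\<^sup>+x. \<integral>\<^sup>+s. ind Z (\<Phi> x s) \<partial>lborel \<partial>\<mu>) = (\<integral>\<^sup>+s. \<integral>\<^sup>+x. ind Z (\<Phi> x s) \<partial>\<mu> \<partial>(lborel::real measure))"
  by (rule Fubini'[symmetric]) (simp add: case_prod_unfold, measurable)
 also have "... = (\<integral>\<^sup>+s. 0 \<partial>(lborel :: real measure))"
  using nn_integral_flow[of "ind Z"] Z by (intro nn_integral_cong) simp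
 finally have "(\<integral>\<^sup>+x. \<integral>\<^sup>+s. ind Z (\<Phi> x s) \<partial>lborel \<partial>\<mu>) = 0" by simp
 then have "AE x in \<mu>. (\<integral>\<^sup>+s. ind Z (\<Phi> x s) \<partial>lborel) = 0" by (subst (asm) nn_integral_0_iff_AE[OF m])
 then show ?thesis unfolding AE_Omega_iff
 proof eventually_elim
  case (elim x)
  then have "AE s in lborel. ind Z (\<Phi> x s) = (0::ennreal)" by (subst (asm) nn_integral_0_iff_AE) auto
  then show ?case
  proof (intro impI, elim eventually_mono, intro impI)
   fix s assume "x \<in> \<Omega>" "ind Z (\<Phi> x s) = (0::ennreal)" "s \<in> stay x"
   then show "P (\<Phi> x s)" using orbit_in_Omega[of x s] Z(1) by (auto simp: indicator_def split: if_splits)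
  qed
 qed
qed

text \<open>Almost every chord contains at least one good point, arbitrarily close to its boundary
  end. For properties of the whole orbit, one such point is enough.\<close>

lemma AE_Gam_ex:
 assumes N: "boundary_measure \<sigma> N" and P: "AE x in \<mu>\<Omega>. P x"
 shows "AE y in N. \<exists>s. 0 < s \<and> ereal s < tau (- \<sigma>) y \<and> P (\<Phi> y (- \<sigma> * s))"
 using AE_Gam_of_AE_Omega[OF N P] AE_space[of N]
proof eventually_elim
 case (elim y)
 then have y: "y \<in> Gam \<sigma>" using Gam_space(1)[OF N] by simp
 obtain e where e: "0 < e" "ereal e < tau (- \<sigma>) y"
  using Gam_tau_pos[OF y] ereal_dense2[of 0 "tau (-\<sigma>) y"] by (auto simp: zero_ereal_def)
 have "AE s in lborel. s \<in> {0<..<e} --> P (\<Phi> y (- \<sigma> * s))"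
  using elim(1) e(2) by (auto elim!: eventually_mono intro: less_trans[of _ "ereal e"])
 then obtain s where "0 < s" "s < e" "P (\<Phi> y (- \<sigma> * s))" using e(1) by (rule AE_lborel_interval_ex)
 then show ?case using e(2) by (intro exI[of _ s]) (auto intro: less_trans[of _ "ereal e"])
qed

text \<open>Two representatives agree at almost all times of almost every orbit, and their
  difference is constant along the orbit because their increments are integrals of the same
  derivative.\<close>

lemma sharp_rep_agree:
 assumes f: "sharp_rep f fs" and f': "sharp_rep f fs'" shows "AE x in \<mu>\<Omega>. \<forall>t\<in>stay x. fs (\<Phi> x t) = fs' (\<Phi> x t)"
proof -
 obtain g where g: "(f, g) \<in> T_max_graph" "mild fs g" and fe: "AE x in \<mu>\<Omega>. fs x = f x" using f unfolding sharp_rep_iff by blast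
 obtain g' where g': "(f, g') \<in> T_max_graph" "mild fs' g'" and fe': "AE x in \<mu>\<Omega>. fs' x = f x" using f' unfolding sharp_rep_iff by blast
 have "AE x in \<mu>\<Omega>. g x = g' x \<and> fs x = fs' x" using T_max_unique[OF g(1) g'(1)] fe fe' by eventually_elim simp
 from AE_stay[OF this] g(2)[unfolded mild_def] g'(2)[unfolded mild_def] AE_space[of \<mu>\<Omega>]
 show ?thesis
 proof eventually_elim
  case (elim x)
  then have x: "x \<in> \<Omega>" by simp
  have "0 < min (tau 1 x) (tau (-1) x)" using tau_pos[OF x] by simp
  then obtain e where e: "0 < e" "ereal e < min (tau 1 x) (tau (-1) x)"
   using ereal_dense2[of 0 "min (tau 1 x) (tau (-1) x)"] by (auto simp: zero_ereal_def)
  have "{0<..<e} \<subseteq> stay x"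
  proof
   fix s assume "s \<in> {0<..<e}"
   moreover have "e \<in> stay x" using e tau_pos[OF x, of "-1"] unfolding stay_def
    by (auto simp: ereal_uminus_less_reorder intro: less_trans[of _ 0])
   ultimately show "s \<in> stay x" using stay_interval[OF zero_in_stay[OF x], of e s] by auto
  qed
  then have "AE s in lborel. s \<in> {0<..<e} --> fs (\<Phi> x s) = fs' (\<Phi> x s) \<and> s \<in> stay x"
   using elim(1) by (auto elim!: eventually_mono)
  then obtain s where s: "fs (\<Phi> x s) = fs' (\<Phi> x s)" "s \<in> stay x" using e(1) by (rule AE_lborel_interval_ex) blast
  show ?case
  proof
   fix t assume t: "t \<in> stay x"
   have eq: "fs (\<Phi> x a) - fs (\<Phi> x b) = fs' (\<Phi> x a) - fs' (\<Phi> x b)"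
    if a: "a \<in> stay x" and b: "b \<in> stay x" and ab: "a \<le> b" for a b
   proof -
    have d: "decreases_by (\<lambda>s. fs (\<Phi> x s)) (\<lambda>s. g (\<Phi> x s)) a b" "decreases_by (\<lambda>s. fs' (\<Phi> x s)) (\<lambda>s. g' (\<Phi> x s)) a b"
     using elim a b ab unfolding mild_at_def by auto
    have "(LBINT s:{a..b}. g (\<Phi> x s)) = (LBINT s:{a..b}. g' (\<Phi> x s))" unfolding set_lebesgue_integral_def
    proof (rule integral_cong_AE)
     show "AE s in lborel. ind {a..b} s *\<^sub>R g (\<Phi> x s) = ind {a..b} s *\<^sub>R g' (\<Phi> x s)"
      using elim(1) by eventually_elim (use stay_interval[OF a b] in \<open>auto simp: indicator_def\<close>)
    qed (use d in \<open>auto simp: decreases_by_def set_integrable_def\<close>)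
    then show ?thesis using d by (simp add: decreases_by_def)
   qed
   show "fs (\<Phi> x t) = fs' (\<Phi> x t)" using eq[OF s(2) t] eq[OF t s(2)] s(1) by (cases "s \<le> t") auto
  qed
 qed
qed

lemma Gam_orbit_param:
 assumes \<sigma>: "\<sigma> = 1 \<or> \<sigma> = -1" and y: "y \<in> Gam \<sigma>" and s: "0 < s" "ereal s < tau (- \<sigma>) y"
  and t: "0 < t" "ereal t < tau (- \<sigma>) y"
 shows "\<sigma> * (s - t) \<in> stay (\<Phi> y (- \<sigma> * s))" "\<Phi> (\<Phi> y (- \<sigma> * s)) (\<sigma> * (s - t)) = \<Phi> y (- \<sigma> * t)"
proof -
 note o = Gam_orbit[OF y s]
 show "\<sigma> * (s - t) \<in> stay (\<Phi> y (- \<sigma> * s))" using \<sigma> o(2,4) s t unfolding stay_def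
  by (cases "tau (- \<sigma>) y") (auto simp: ereal_uminus_less_reorder)
 show "\<Phi> (\<Phi> y (- \<sigma> * s)) (\<sigma> * (s - t)) = \<Phi> y (- \<sigma> * t)" by (simp add: flow_add algebra_simps)
qed

text \<open>The trace may be computed with any chosen representative, since two of them coincide on
  almost every chord.\<close>

lemma has_trace_iff:
 assumes N: "boundary_measure \<sigma> N" and \<sigma>: "\<sigma> = 1 \<or> \<sigma> = -1" and f: "sharp_rep f fs" shows "has_trace \<sigma> N f b \<longleftrightarrow> b \<in> \<B> N \<and>
  (AE y in N. ((\<lambda>t. fs (\<Phi> y (- \<sigma> * t))) ---> b y) (at_right 0))"
proof
 let ?f = "\<lambda>y t. fs (\<Phi> y (- \<sigma> * t))"
 assume "has_trace \<sigma> N f b"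
 then obtain fs' where f': "sharp_rep f fs'" and b: "b \<in> \<B> N"
  and l: "AE y in N. ((\<lambda>t. fs' (\<Phi> y (- \<sigma> * t))) ---> b y) (at_right 0)" unfolding has_trace_def by blast
 have "AE y in N. (?f y ---> b y) (at_right 0)"
  using l AE_Gam_ex[OF N sharp_rep_agree[OF f f']] AE_space[of N]
 proof eventually_elim
  case (elim y)
  then have y: "y \<in> Gam \<sigma>" using Gam_space(1)[OF N] by simp
  from elim obtain s where s: "0 < s" "ereal s < tau (- \<sigma>) y"
   "\<And>t. t \<in> stay (\<Phi> y (- \<sigma> * s)) ==> fs (\<Phi> (\<Phi> y (- \<sigma> * s)) t) = fs' (\<Phi> (\<Phi> y (- \<sigma> * s)) t)" by blast
  have "\<forall>\<^sub>F t in at_right 0. fs' (\<Phi> y (- \<sigma> * t)) = fs (\<Phi> y (- \<sigma> * t))" unfolding eventually_at_right_field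
  proof (intro exI[of _ s] conjI s(1) allI impI)
   fix t assume "0 < t" "t < s"
   then have t: "0 < t" "ereal t < tau (- \<sigma>) y" using s(2) by (auto intro: less_trans[of _ "ereal s"])
   show "fs' (\<Phi> y (- \<sigma> * t)) = fs (\<Phi> y (- \<sigma> * t))"
    using s(3)[OF Gam_orbit_param(1)[OF \<sigma> y s(1,2) t]] Gam_orbit_param(2)[OF \<sigma> y s(1,2) t] by simp
  qed
  then show ?case using elim(1) by (rule Lim_transform_eventually[rotated])
 qed
 with b show "b \<in> \<B> N \<and> (AE y in N. (?f y ---> b y) (at_right 0))" by blast
next
 assume "b \<in> \<B> N \<and> (AE y in N. ((\<lambda>t. fs (\<Phi> y (- \<sigma> * t))) ---> b y) (at_right 0))"
 then show "has_trace \<sigma> N f b" unfolding has_trace_def using f by blast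
qed

lemma trace_unique:
 assumes N: "boundary_measure \<sigma> N" and \<sigma>: "\<sigma> = 1 \<or> \<sigma> = -1" and b: "has_trace \<sigma> N f b" and b': "has_trace \<sigma> N f b'"
 shows "AE y in N. b y = b' y"
proof -
 obtain fs where fs: "sharp_rep f fs" using b unfolding has_trace_def by blast
 have "AE y in N. ((\<lambda>t. fs (\<Phi> y (- \<sigma> * t))) ---> b y) (at_right 0)" "AE y in N. ((\<lambda>t. fs (\<Phi> y (- \<sigma> * t))) ---> b' y) (at_right 0)"
  using b b' unfolding has_trace_iff[OF N \<sigma> fs] by auto
 then show ?thesis by eventually_elim (rule tendsto_unique[OF trivial_limit_at_right_real])
qed

lemma T_max_cong:
 assumes "(f, g) \<in> T_max_graph" "AE x in \<mu>\<Omega>. f x = f' x" "AE x in \<mu>\<Omega>. g x = g' x" and m: "f' \<in> \<B> \<mu>\<Omega>" "g' \<in> \<B> \<mu>\<Omega>"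
 shows "(f', g') \<in> T_max_graph" unfolding T_max_graph_def
proof (intro CollectI case_prodI conjI ballI)
 note L = T_max_Lp[OF assms(1)]
 show "f' \<in> Lp p \<mu>\<Omega>" by (rule Lp_cong_AE[OF L(1) assms(2) m(1)])
 show "g' \<in> Lp p \<mu>\<Omega>" by (rule Lp_cong_AE[OF L(2) assms(3) m(2)])
 fix \<psi> assume psi: "\<psi> \<in> test_functions"
 then have pm: "\<psi> \<in> \<B> \<mu>\<Omega>" "flow_deriv \<psi> \<in> \<B> \<mu>\<Omega>"
  using sets_restrict_space_cong[OF sets_mu] by (auto simp: test_functions_def cong: measurable_cong_sets)
 have "(LINT x|\<mu>\<Omega>. g' x * \<psi> x) = (LINT x|\<mu>\<Omega>. g x * \<psi> x)"
  using assms(3) L m pm by (intro integral_cong_AE) (auto simp: Lp_def)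
 also have "... = (LINT x|\<mu>\<Omega>. f x * flow_deriv \<psi> x)" by (rule T_max_test[OF assms(1) psi])
 also have "... = (LINT x|\<mu>\<Omega>. f' x * flow_deriv \<psi> x)"
  using assms(2) L m pm by (intro integral_cong_AE) (auto simp: Lp_def)
 finally show "(LINT x|\<mu>\<Omega>. g' x * \<psi> x) = (LINT x|\<mu>\<Omega>. f' x * flow_deriv \<psi> x)" .
qed

lemma sharp_rep_cong:
 assumes "sharp_rep f fs" "AE x in \<mu>\<Omega>. f x = f' x" "f' \<in> \<B> \<mu>\<Omega>" shows "sharp_rep f' fs"
proof -
 obtain g where g: "(f, g) \<in> T_max_graph" "mild fs g" and fe: "AE x in \<mu>\<Omega>. fs x = f x" and m: "fs \<in> \<B> \<mu>\<Omega>"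
  using assms(1) unfolding sharp_rep_iff by blast
 have "(f', g) \<in> T_max_graph" using T_max_Lp(2)[OF g(1)] by (intro T_max_cong[OF g(1) assms(2) _ assms(3)]) (auto simp: Lp_def)
 moreover have "AE x in \<mu>\<Omega>. fs x = f' x" using fe assms(2) by eventually_elim simp
 ultimately show ?thesis unfolding sharp_rep_iff using m g(2) by blast
qed

lemma has_trace_cong:
 assumes "has_trace \<sigma> N f b" "AE x in \<mu>\<Omega>. f x = f' x" "f' \<in> \<B> \<mu>\<Omega>" shows "has_trace \<sigma> N f' b"
 using assms sharp_rep_cong unfolding has_trace_def by blast

text \<open>Replaces the derivative hidden in \<open>sharp_rep\<close> by any other representative:
  the two differ on a null set of times only.\<close>

lemma sharp_rep_mild:
 assumes "sharp_rep f fs" "(f, g) \<in> T_max_graph" shows "mild fs g"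
proof -
 obtain g' where g': "(f, g') \<in> T_max_graph" "mild fs g'" using assms(1) unfolding sharp_rep_iff by blast
 from AE_stay[OF T_max_unique[OF assms(2) g'(1)]] g'(2)[unfolded mild_def] AE_stay[OF AE_space[of \<mu>\<Omega>]]
 have "AE x in \<mu>\<Omega>. mild_at fs g x" if "g \<in> \<B> \<mu>\<Omega>" using AE_space[of \<mu>\<Omega>]
 proof eventually_elim
  case (elim x)
  have gm [measurable]: "ext g \<in> \<B> borel" by (rule ext_measurable[OF that])
  show ?case unfolding mild_at_def
  proof (intro allI impI)
   fix a b assume ab: "a \<in> stay x" "b \<in> stay x" "a \<le> b"
   then have d: "decreases_by (\<lambda>s. fs (\<Phi> x s)) (\<lambda>s. g' (\<Phi> x s)) a b" using elim unfolding mild_at_def by blast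
   have ae: "AE s in lborel. ind {a..b} s *\<^sub>R g' (\<Phi> x s) = ind {a..b} s *\<^sub>R g (\<Phi> x s)"
    using elim(1) by eventually_elim (use stay_interval[OF ab(1,2)] in \<open>auto simp: indicator_def\<close>)
   have e: "ind {a..b} s *\<^sub>R g (\<Phi> x s) = ind {a..b} s *\<^sub>R ext g (\<Phi> x s)" for s
    using orbit_in_Omega[of x s] stay_interval[OF ab(1,2), of s] elim(4) by (auto simp: indicator_def ext_def)
   have m: "(\<lambda>s. ind {a..b} s *\<^sub>R g (\<Phi> x s)) \<in> \<B> lborel" unfolding e by measurable
   have m': "(\<lambda>s. ind {a..b} s *\<^sub>R g' (\<Phi> x s)) \<in> \<B> lborel" using d by (auto simp: decreases_by_def set_integrable_def)
   show "decreases_by (\<lambda>s. fs (\<Phi> x s)) (\<lambda>s. g (\<Phi> x s)) a b"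
    using d integrable_cong_AE[OF m' m ae] integral_cong_AE[OF m' m ae] unfolding decreases_by_def set_int_defs by simp
  qed
 qed
 then show ?thesis using T_max_Lp(2)[OF assms(2)] by (auto simp: mild_def Lp_def)
qed

section \<open>Integrability along chords and orbits\<close>

lemma abs_le_one_plus_powr: "\<bar>t\<bar> \<le> 1 + \<bar>t\<bar> powr p"
proof (cases "\<bar>t\<bar> \<le> 1")
 case False
 then have "\<bar>t\<bar> powr 1 \<le> \<bar>t\<bar> powr p" using p1 by (intro powr_mono) auto
 then show ?thesis using False by simp
qed (use powr_ge_zero[of "\<bar>t\<bar>" p] in linarith)

lemma set_integrable_of_powr:
 fixes h :: "real => real"
 assumes m: "(\<lambda>s. ind A s * h s) \<in> \<B> lborel" and A: "A \<in> sets lborel" "emeasure lborel A < \<infinity>"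
  and f: "(\<integral>\<^sup>+s. ind A s * ennreal (\<bar>h s\<bar> powr p) \<partial>lborel) < \<infinity>" shows "lintegrable A h"
 unfolding set_integrable_def
proof (rule integrableI_bounded)
 show "(\<lambda>s. ind A s *\<^sub>R h s) \<in> \<B> lborel" using m by simp
 have m2: "(\<lambda>s. ind A s * ennreal (\<bar>h s\<bar> powr p)) \<in> \<B> lborel"
 proof -
  have "ind A s * ennreal (\<bar>h s\<bar> powr p) = ennreal (\<bar>ind A s * h s\<bar> powr p)" for s by (simp add: indicator_def)
  then show ?thesis using m by simp
 qed
 have "(\<integral>\<^sup>+s. ennreal (norm (ind A s *\<^sub>R h s)) \<partial>lborel) \<le> (\<integral>\<^sup>+s. ind A s + ind A s * ennreal (\<bar>h s\<bar> powr p) \<partial>lborel)"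
 proof (rule nn_integral_mono)
  fix s
  have "ennreal \<bar>h s\<bar> \<le> ennreal (1 + \<bar>h s\<bar> powr p)" by (rule ennreal_leI[OF abs_le_one_plus_powr])
  then show "ennreal (norm (ind A s *\<^sub>R h s)) \<le> ind A s + ind A s * ennreal (\<bar>h s\<bar> powr p)"
   by (auto simp: indicator_def)
 qed
 also have "... = emeasure lborel A + (\<integral>\<^sup>+s. ind A s * ennreal (\<bar>h s\<bar> powr p) \<partial>lborel)"
  using A m2 by (subst nn_integral_add) auto
 also have "... < \<infinity>" using A f by simp
 finally show "(\<integral>\<^sup>+s. ennreal (norm (ind A s *\<^sub>R h s)) \<partial>lborel) < \<infinity>" .
qed

lemma nn_integral_ext_powr:
 assumes "g \<in> Lp p \<mu>\<Omega>" shows "Lp_nn p \<mu> (ext g) = (Lp_nn p \<mu>\<Omega> g)"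
 unfolding nn_integral_Omega by (intro nn_integral_cong) (auto simp: ext_def indicator_def)

text \<open>The interval reaches down to the boundary point, which is what traces need; it is cut at
  T because a chord may be infinite, and Lp then gives local integrability.\<close>

lemma AE_Gam_integrable:
 assumes N: "boundary_measure \<sigma> N" and g: "g \<in> Lp p \<mu>\<Omega>"
 shows "AE y in N. \<forall>T. lintegrable {s. 0 < s \<and> ereal s < tau (- \<sigma>) y \<and> s \<le> T} (\<lambda>s. g (\<Phi> y (- \<sigma> * s)))"
proof -
 have gm [measurable]: "ext g \<in> \<B> borel" by (rule ext_measurable[OF Lp_meas[OF g]])
 have hm: "(\<lambda>x. ennreal (\<bar>ext g x\<bar> powr p)) \<in> \<B> borel" by measurable
 have "(\<integral>\<^sup>+y. \<integral>\<^sup>+s. ind (chord \<sigma> y) s * ennreal (\<bar>ext g (\<Phi> y (- \<sigma> * s))\<bar> powr p) \<partial>lborel \<partial>N)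
  = (\<integral>\<^sup>+x. ind (Omega_fin \<sigma>) x * ennreal (\<bar>ext g x\<bar> powr p) \<partial>\<mu>)" by (rule boundary_nn[OF N hm, symmetric])
 also have "... \<le> (Lp_nn p \<mu> (ext g))" by (intro nn_integral_mono) (auto simp: indicator_def)
 also have "... < \<infinity>" unfolding nn_integral_ext_powr[OF g] using g by (simp add: Lp_iff_nn_integral)
 finally have "AE y in N. (\<integral>\<^sup>+s. ind (chord \<sigma> y) s * ennreal (\<bar>ext g (\<Phi> y (- \<sigma> * s))\<bar> powr p) \<partial>lborel) \<noteq> \<infinity>"
  by (intro nn_integral_PInf_AE[OF inner_measurable[OF N hm]]) (simp add: less_top)
 then show ?thesis
 proof eventually_elim
  case (elim y)
  show ?case
  proof
   fix T :: real
   let ?A = "{s. 0 < s \<and> ereal s < tau (- \<sigma>) y \<and> s \<le> T}"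
   have As: "?A \<in> sets lborel" by measurable
   have "emeasure lborel ?A \<le> emeasure lborel {0..T}" by (intro emeasure_mono) auto
   then have Af: "emeasure lborel ?A < \<infinity>" by (rule le_less_trans) (auto simp: emeasure_lborel_Icc_eq)
   have e: "ind ?A s * g (\<Phi> y (- \<sigma> * s)) = ind ?A s * ext g (\<Phi> y (- \<sigma> * s))" for s
    using tau_inside[of s "- \<sigma>" y] by (auto simp: indicator_def ext_def)
   have m: "(\<lambda>s. ind ?A s * g (\<Phi> y (- \<sigma> * s))) \<in> \<B> lborel" unfolding e using As by measurable
   have "(\<integral>\<^sup>+s. ind ?A s * ennreal (\<bar>g (\<Phi> y (- \<sigma> * s))\<bar> powr p) \<partial>lborel)
    \<le> (\<integral>\<^sup>+s. ind (chord \<sigma> y) s * ennreal (\<bar>ext g (\<Phi> y (- \<sigma> * s))\<bar> powr p) \<partial>lborel)"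
    using tau_inside[of _ "- \<sigma>" y] by (intro nn_integral_mono) (auto simp: indicator_def ext_def)
   also have "... < \<infinity>" using elim by (simp add: less_top)
   finally show "lintegrable ?A (\<lambda>s. g (\<Phi> y (- \<sigma> * s)))" by (rule set_integrable_of_powr[OF m As Af])
  qed
 qed
qed

lemma AE_orbit_integrable:
 assumes g: "g \<in> Lp p \<mu>\<Omega>" shows "AE x in \<mu>\<Omega>. \<forall>T. lintegrable {s. s \<in> stay x \<and> \<bar>s\<bar> \<le> T} (\<lambda>s. g (\<Phi> x s))"
proof -
 have gm [measurable]: "ext g \<in> \<B> borel" by (rule ext_measurable[OF Lp_meas[OF g]])
 interpret pair_sigma_finite \<mu> "lborel :: real measure" ..
 let ?I = "\<lambda>(n::nat) x. \<integral>\<^sup>+s. ind {-real n..real n} s * ennreal (\<bar>ext g (\<Phi> x s)\<bar> powr p) \<partial>lborel"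
 have "AE x in \<mu>. ?I n x \<noteq> \<infinity>" for n
 proof (rule nn_integral_PInf_AE)
  show "(\<lambda>x. ?I n x) \<in> \<B> \<mu>"
   by (rule lborel.borel_measurable_nn_integral) (simp add: case_prod_unfold, measurable)
  have "(\<integral>\<^sup>+x. ?I n x \<partial>\<mu>)
   = (\<integral>\<^sup>+s. \<integral>\<^sup>+x. ind {-real n..real n} s * ennreal (\<bar>ext g (\<Phi> x s)\<bar> powr p) \<partial>\<mu> \<partial>lborel)"
   by (rule Fubini'[symmetric]) (simp add: case_prod_unfold, measurable)
  also have "... = (\<integral>\<^sup>+s. (Lp_nn p \<mu> (ext g)) * ind {-real n..real n} s \<partial>lborel)"
   using nn_integral_flow[of "\<lambda>x. ennreal (\<bar>ext g x\<bar> powr p)"] by (intro nn_integral_cong) (simp add: indicator_def)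
  also have "... = (Lp_nn p \<mu> (ext g)) * emeasure lborel {-real n..real n}" by (rule nn_integral_cmult_indicator) simp
  also have "... < \<infinity>" unfolding nn_integral_ext_powr[OF g] using g by (simp add: Lp_iff_nn_integral ennreal_mult_less_top)
  finally show "(\<integral>\<^sup>+x. ?I n x \<partial>\<mu>) \<noteq> \<infinity>"
   by (simp add: less_top)
 qed
 then have "AE x in \<mu>. \<forall>n. ?I n x \<noteq> \<infinity>"
  by (simp add: AE_all_countable)
 then show ?thesis unfolding AE_Omega_iff
 proof (eventually_elim, intro impI allI)
  fix x and T :: real
  assume f: "\<forall>n. ?I n x \<noteq> \<infinity>" and x: "x \<in> \<Omega>"
  let ?A = "{s. s \<in> stay x \<and> \<bar>s\<bar> \<le> T}"
  have As: "?A \<in> sets lborel" unfolding stay_def by measurable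
  obtain n :: nat where n: "T \<le> real n" using real_arch_simple by blast
  have "emeasure lborel ?A \<le> emeasure lborel {-T..T}" by (intro emeasure_mono) auto
  then have Af: "emeasure lborel ?A < \<infinity>" by (rule le_less_trans) (auto simp: emeasure_lborel_Icc_eq)
  have e: "ind ?A s * g (\<Phi> x s) = ind ?A s * ext g (\<Phi> x s)" for s
   using orbit_in_Omega[OF x] by (auto simp: indicator_def ext_def)
  have m: "(\<lambda>s. ind ?A s * g (\<Phi> x s)) \<in> \<B> lborel" unfolding e using As by measurable
  have "(\<integral>\<^sup>+s. ind ?A s * ennreal (\<bar>g (\<Phi> x s)\<bar> powr p) \<partial>lborel)
   \<le> ?I n x"
   using orbit_in_Omega[OF x] n by (intro nn_integral_mono) (auto simp: indicator_def ext_def)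
  also have "... < \<infinity>" using f by (simp add: less_top)
  finally show "lintegrable ?A (\<lambda>s. g (\<Phi> x s))" by (rule set_integrable_of_powr[OF m As Af])
 qed
qed

text \<open>The value of a function at distance \<open>s\<close> from the boundary is its trace plus the integral of
 its derivative.\<close>

lemma trace_formula:
 assumes N: "boundary_measure \<sigma> N" and \<sigma>: "\<sigma> = 1 \<or> \<sigma> = -1" and fs: "sharp_rep f fs" and fg: "(f, g) \<in> T_max_graph"
  and b: "has_trace \<sigma> N f b" shows "AE y in N. \<forall>s. 0 < s --> ereal s < tau (- \<sigma>) y -->
  fs (\<Phi> y (- \<sigma> * s)) = b y + \<sigma> * (LBINT r:{0<..<s}. g (\<Phi> y (- \<sigma> * r)))"
proof -
 have l: "AE y in N. ((\<lambda>t. fs (\<Phi> y (- \<sigma> * t))) ---> b y) (at_right 0)"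
  using b unfolding has_trace_iff[OF N \<sigma> fs] by blast
 from l AE_Gam_ex[OF N sharp_rep_mild[OF fs fg, unfolded mild_def]] AE_space[of N] AE_Gam_integrable[OF N T_max_Lp(2)[OF fg]]
 show ?thesis
 proof eventually_elim
  case (elim y)
  then have y: "y \<in> Gam \<sigma>" using Gam_space(1)[OF N] by simp
  from elim obtain s0 where s0: "0 < s0" "ereal s0 < tau (- \<sigma>) y" "mild_at fs g (\<Phi> y (- \<sigma> * s0))" by blast
  let ?w = "\<Phi> y (- \<sigma> * s0)" and ?g = "\<lambda>r. g (\<Phi> y (- \<sigma> * r))"
  show ?case
  proof (intro allI impI)
   fix s assume s: "0 < s" "ereal s < tau (- \<sigma>) y"
   have i: "lintegrable {0<..<s} ?g"
    using less_trans[OF _ s(2), of "ereal _"] by (intro set_integrable_subset[OF spec[OF elim(4), of s]]) auto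
   let ?I = "\<lambda>t. LBINT r:{0<..<t}. ?g r" and ?f = "\<lambda>t. fs (\<Phi> y (- \<sigma> * t))"
   \<comment> \<open>Both points are described from the base point at distance s0, where the mild
     identity is known. The sign decides whether distance from the boundary runs with or against
     time.\<close>
   have seg: "?f t = ?f s - \<sigma> * (?I s - ?I t)" if t: "0 < t" "t < s" for t
   proof -
    have t': "ereal t < tau (- \<sigma>) y" using t(2) s(2) by (auto intro: less_trans[of _ "ereal s"])
    note a = Gam_orbit_param[OF \<sigma> y s0(1,2) s] and c = Gam_orbit_param[OF \<sigma> y s0(1,2) t(1) t']
    have it: "lintegrable {0<..<t} ?g" "lintegrable {t<..<s} ?g"
     using t by (intro set_integrable_subset[OF i]; auto)+
    have "?f t - ?f s = - \<sigma> * (LBINT r:{t..s}. ?g r)" using \<sigma>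
    proof
     assume s1: "\<sigma> = 1"
     have "decreases_by (\<lambda>r. fs (\<Phi> ?w r)) (\<lambda>r. g (\<Phi> ?w r)) (s0 - s) (s0 - t)"
      using s0(3) a(1) c(1) t s1 unfolding mild_at_def by simp
     moreover have "{r. s0 - r \<in> {s0 - s..s0 - t}} = {t..s}" by auto
     ultimately show ?thesis
      using s1 set_integral_reflect(2)[of s0 "{s0 - s..s0 - t}" "\<lambda>r. g (\<Phi> ?w r)"] by (simp add: decreases_by_def flow_add)
    next
     assume s1: "\<sigma> = -1"
     have "decreases_by (\<lambda>r. fs (\<Phi> ?w r)) (\<lambda>r. g (\<Phi> ?w r)) (t - s0) (s - s0)"
      using s0(3) a(1) c(1) t s1 unfolding mild_at_def by simp
     moreover have "{r. r + - s0 \<in> {t - s0..s - s0}} = {t..s}" by auto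
     ultimately show ?thesis
      using s1 set_integral_shift(2)[of "- s0" "{t - s0..s - s0}" "\<lambda>r. g (\<Phi> ?w r)"] by (simp add: decreases_by_def flow_add)
    qed
    then show ?thesis using set_integral_Ioo_combine(2)[OF it t] set_integral_Icc_Ioo(2)[OF t(2), of ?g] by (simp add: algebra_simps)
   qed
   have "(?I ---> 0) (at_right 0)"
    using set_integral_right_continuous[of 0 s ?g] i s(1) by (simp add: set_lebesgue_integral_def)
   then have "((\<lambda>t. ?f s - \<sigma> * (?I s - ?I t)) ---> ?f s - \<sigma> * (?I s - 0)) (at_right 0)" by (intro tendsto_intros)
   moreover have "((\<lambda>t. ?f s - \<sigma> * (?I s - ?I t)) ---> b y) (at_right 0)" by (rule Lim_transform_eventually[OF elim(1)])
     (unfold eventually_at_right_field, use s seg in \<open>auto intro!: exI[of _ s]\<close>)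
   ultimately have "?f s - \<sigma> * (?I s - 0) = b y" by (rule tendsto_unique[OF trivial_limit_at_right_real])
   then show "?f s = b y + \<sigma> * ?I s" by simp
  qed
 qed
qed

text \<open>\<open>boundary_passage\<close> for the indicator of a null set: passing to the opposite
  end of the chord does not charge it.\<close>

lemma AE_passage:
 assumes P: "AE y in \<mu>m. P y" shows "AE z in \<mu>p. tau (-1) z < \<infinity> --> P (exit (-1) z)"
proof -
 obtain Z where Z: "{y \<in> space \<mu>m. \<not> P y} \<subseteq> Z" "emeasure \<mu>m Z = 0" "Z \<in> sets \<mu>m" using P by (rule AE_E)
 note [measurable] = Z(3)
 have q: "(\<lambda>z. ind Z (snd z) :: ennreal) \<in> \<B> (borel \<otimes> \<mu>m)" by measurable
 have Gp: "\<And>z. z \<in> space \<mu>p ==> tau (-1) z < \<infinity> ==> exit (-1) z \<in> Gam (-1)"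
  using Gam_space(1)[OF mu_plus] exit_in_Gam_opposite[of _ 1] by simp
 note [measurable] = Gam_space(3)[OF mu_plus]
 have m: "(\<lambda>z. if tau (-1) z < \<infinity> then (ind Z (snd (rtau (-1) z, exit (-1) z)) :: ennreal) else 0) \<in> \<B> \<mu>p"
  by (rule exit_If_measurable[OF mu_minus q]) (measurable, auto intro: Gp)
 have "(\<integral>\<^sup>+y. (if tau 1 y < \<infinity> then (ind Z (snd (rtau 1 y, y)) :: ennreal) else 0) \<partial>\<mu>m) = (\<integral>\<^sup>+y. 0 \<partial>\<mu>m)"
 proof (rule nn_integral_cong_AE)
  have "AE y in \<mu>m. y \<notin> Z" using Z by (intro AE_not_in null_setsI) auto
  then show "AE y in \<mu>m. (if tau 1 y < \<infinity> then (ind Z (snd (rtau 1 y, y)) :: ennreal) else 0) = 0"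
   by eventually_elim simp
 qed
 then have "(\<integral>\<^sup>+z. (if tau (-1) z < \<infinity> then (ind Z (snd (rtau (-1) z, exit (-1) z)) :: ennreal) else 0) \<partial>\<mu>p) = 0"
  unfolding boundary_passage[OF q] by simp
 then have "AE z in \<mu>p. (if tau (-1) z < \<infinity> then (ind Z (snd (rtau (-1) z, exit (-1) z)) :: ennreal) else 0) = 0"
  by (subst (asm) nn_integral_0_iff_AE[OF m])
 then show ?thesis using AE_space[of \<mu>p]
 proof eventually_elim
  case (elim z)
  then show ?case using Z(1) Gp[of z] Gam_space(1)[OF mu_minus] by (auto simp: indicator_def split: if_splits)
 qed
qed

end

subsection \<open>The operators of the Dyson--Phillips construction\<close>

locale transport_semigroup = transport_p \<Omega> \<Phi> \<mu> \<mu>p \<mu>m p H F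
 for \<Omega> :: "'a::euclidean_space set" and \<Phi> \<mu> \<mu>p \<mu>m p H F +
 assumes H: "Lp_op p \<mu>p \<mu>m H"
  and chi_limsup: "Limsup (at_right 0) (\<lambda>\<delta>. ereal (Lp_opnorm p \<mu>p \<mu>m (\<lambda>f. H (chi \<delta> f)))) < 1"
begin

lemma chi_measurable:
 assumes [measurable]: "G \<in> \<B> (R \<otimes> \<mu>p)" shows "(\<lambda>z. if ereal \<delta> < tau (-1) (snd z) then G z else 0) \<in> \<B> (R \<otimes> \<mu>p)"
  "(\<lambda>z. if ereal \<delta> < tau (-1) (snd z) then 0 else G z) \<in> \<B> (R \<otimes> \<mu>p)"
proof -
 note [measurable] = Gam_space(4)[OF mu_plus]
 show "(\<lambda>z. if ereal \<delta> < tau (-1) (snd z) then G z else 0) \<in> \<B> (R \<otimes> \<mu>p)"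
  "(\<lambda>z. if ereal \<delta> < tau (-1) (snd z) then 0 else G z) \<in> \<B> (R \<otimes> \<mu>p)" by measurable
qed

lemma chi_eq: "z \<in> Gam 1 ==> chi \<delta> f z = (if ereal \<delta> < tau (-1) z then 0 else f z)"
 by (auto simp: chi_def indicator_def)

lemma chi_operator: "Lp_op p \<mu>p \<mu>p (chi \<delta>)"
proof (rule Lp_op_nnI[OF p1, where C=1])
 fix f :: "'a => real" assume [measurable]: "f \<in> \<B> \<mu>p"
 note [measurable] = Gam_space(3)[OF mu_plus]
 have "(\<lambda>z. if ereal \<delta> < tau (-1) z then 0 else f z) \<in> \<B> \<mu>p" by measurable
 then show "chi \<delta> f \<in> \<B> \<mu>p" by (rule measurable_cong[THEN iffD1, rotated]) (simp add: chi_eq Gam_space(1)[OF mu_plus])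
 show "Lp_nn p \<mu>p (\<lambda>y. chi \<delta> f y) \<le> ennreal (1 powr p) * (Lp_nn p \<mu>p f)"
  using p0 by (auto intro!: nn_integral_mono simp: chi_def indicator_def)
qed (auto simp: chi_def indicator_def)

lemma H_chi_operator: "Lp_op p \<mu>p \<mu>m (\<lambda>f. H (chi \<delta> f))" by (rule Lp_op_compose[OF p1 chi_operator H])

text \<open>The hypothesis on the limes superior supplies one \<delta> for which short chords
  contribute less than 1. The remaining gap is filled by making
  \<open>exp (- (\<kappa> * \<delta>))\<close> small against the norm of H.\<close>

lemma exists_rate: "\<exists>\<kappa>>0. \<exists>\<delta>>0. Lp_opnorm p \<mu>p \<mu>m (\<lambda>f. H (chi \<delta> f)) + Lp_opnorm p \<mu>p \<mu>m H * exp (- (\<kappa> * \<delta>)) < 1"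
proof -
 have "\<forall>\<^sub>F \<delta> in at_right 0. ereal (Lp_opnorm p \<mu>p \<mu>m (\<lambda>f. H (chi \<delta> f))) < 1" by (rule Limsup_lessD[OF chi_limsup])
 then obtain b :: real where "0 < b" "\<And>\<delta>. 0 < \<delta> ==> \<delta> < b ==> ereal (Lp_opnorm p \<mu>p \<mu>m (\<lambda>f. H (chi \<delta> f))) < 1"
  unfolding eventually_at_right_field by auto
 then have d: "0 < b / 2" "Lp_opnorm p \<mu>p \<mu>m (\<lambda>f. H (chi (b / 2) f)) < 1" (is "?c < 1") by (auto simp: one_ereal_def)
 let ?h = "Lp_opnorm p \<mu>p \<mu>m H"
 have h0: "0 \<le> ?h" by (rule Lp_opnorm_nonneg[OF H])
 \<comment> \<open>Chosen so that \<open>1 + x\<close>, and with it \<open>exp x\<close>, exceeds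
   \<open>?h / (1 - ?c)\<close>; the rate is then \<open>x / \<delta>\<close>.\<close>
 define x where "x = ?h / (1 - ?c) + 1"
 have x: "0 < x" using h0 d(2) by (simp add: x_def add_nonneg_pos)
 have "?h < (1 - ?c) * (1 + x)" using d(2) h0 by (simp add: x_def distrib_left)
 also have "... \<le> (1 - ?c) * exp x" using d(2) by (intro mult_left_mono exp_ge_add_one_self) auto
 finally have "?h * exp (- x) < 1 - ?c" by (simp add: exp_minus field_simps)
 then have "?c + ?h * exp (- (x / (b / 2) * (b / 2))) < 1" using d(1) by simp
 moreover have "0 < x / (b / 2)" using x d(1) by (rule divide_pos_pos)
 ultimately show ?thesis using d(1) by blast
qed

definition lam :: real where
 "lam = (SOME \<kappa>. 0 < \<kappa> \<and> (\<exists>\<delta>>0. Lp_opnorm p \<mu>p \<mu>m (\<lambda>f. H (chi \<delta> f)) + Lp_opnorm p \<mu>p \<mu>m H * exp (- (\<kappa> * \<delta>)) < 1))"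

lemma lam: "0 < lam" "\<exists>\<delta>>0. Lp_opnorm p \<mu>p \<mu>m (\<lambda>f. H (chi \<delta> f)) + Lp_opnorm p \<mu>p \<mu>m H * exp (- (lam * \<delta>)) < 1"
proof -
 have "\<exists>\<kappa>. 0 < \<kappa> \<and> (\<exists>\<delta>>0. Lp_opnorm p \<mu>p \<mu>m (\<lambda>f. H (chi \<delta> f)) + Lp_opnorm p \<mu>p \<mu>m H * exp (- (\<kappa> * \<delta>)) < 1)"
  using exists_rate by blast
 from someI_ex[OF this] show "0 < lam" "\<exists>\<delta>>0. Lp_opnorm p \<mu>p \<mu>m (\<lambda>f. H (chi \<delta> f)) + Lp_opnorm p \<mu>p \<mu>m H * exp (- (lam * \<delta>)) < 1"
  unfolding lam_def by auto
qed

text \<open>Carries the factor p, so that the norm of Lp over \<open>\<nu>\<close> is the usual norm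
  of the function damped by \<open>exp (- lam * r)\<close>. Nonpositive times have weight 0, which
  makes \<open>\<nu>\<close> finite.\<close>

definition wt :: "real => real" where "wt r = ind {0<..} r * exp (- (lam * p * r))"

definition \<nu> :: "real measure" where "\<nu> = density lborel (\<lambda>r. ennreal (wt r))"

lemma wt_measurable [measurable]: "wt \<in> \<B> borel" unfolding wt_def[abs_def] by measurable

lemma wt_nonneg [simp]: "0 \<le> wt r" and wt_pos: "0 < r ==> wt r = exp (- (lam * p * r))" and wt_0: "r \<le> 0 ==> wt r = 0"
 by (auto simp: wt_def)

lemma lamp: "0 < lam * p" using lam(1) p0 by simp

lemma sets_nu [measurable_cong, simp]: "sets \<nu> = sets borel" by (simp add: \<nu>_def)

lemma space_nu [simp]: "space \<nu> = UNIV" by (simp add: \<nu>_def)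

lemma nn_integral_exp_decay:
 assumes "0 < c" shows "(\<integral>\<^sup>+r. ennreal (exp (- (c * r))) * ind {a..} r \<partial>lborel) = ennreal (exp (- (c * a)) / c)"
proof -
 have "(\<integral>\<^sup>+r. ennreal (exp (- (c * r))) * ind {a..} r \<partial>lborel) = ennreal (0 - (- exp (- (c * a)) / c))"
 proof (rule nn_integral_FTC_atLeast)
  show "((\<lambda>r. - exp (- (c * r)) / c) has_real_derivative exp (- (c * x))) (at x)" for x
   using assms by (auto intro!: derivative_eq_intros)
  have "((\<lambda>r. - exp (- (c * r)) / c) ---> - 0 / c) at_top"
   using assms by (intro tendsto_intros filterlim_compose[OF exp_at_bot] filterlim_compose[OF filterlim_uminus_at_bot_at_top]
    filterlim_tendsto_pos_mult_at_top[OF tendsto_const] filterlim_ident) auto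
  then show "((\<lambda>r. - exp (- (c * r)) / c) ---> 0) at_top" by simp
 qed auto
 then show ?thesis by simp
qed

sublocale nu: finite_measure \<nu>
proof
 have "emeasure \<nu> (space \<nu>) = (\<integral>\<^sup>+r. ennreal (wt r) \<partial>lborel)" unfolding \<nu>_def by (subst emeasure_density) auto
 also have "... \<le> (\<integral>\<^sup>+r. ennreal (exp (- (lam * p * r))) * ind {0..} r \<partial>lborel)"
  by (intro nn_integral_mono) (auto simp: wt_def indicator_def)
 also have "... < \<infinity>" by (subst nn_integral_exp_decay[OF lamp]) simp
 finally show "emeasure \<nu> (space \<nu>) \<noteq> \<infinity>" by simp
qed

lemma AE_nu: "(AE r in \<nu>. P r) \<longleftrightarrow> (AE r in lborel. 0 < r --> P r)"
 unfolding \<nu>_def by (subst AE_density) (auto simp: wt_def indicator_def)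

lemma nn_integral_nu: "h \<in> \<B> borel ==> (\<integral>\<^sup>+r. h r \<partial>\<nu>) = (\<integral>\<^sup>+r. ennreal (wt r) * h r \<partial>lborel)"
 unfolding \<nu>_def by (subst nn_integral_density) auto

sublocale mup: sigma_finite_measure \<mu>p by (rule boundary_sigma_finite[OF mu_plus])
sublocale mum: sigma_finite_measure \<mu>m by (rule boundary_sigma_finite[OF mu_minus])

sublocale HL: operator_lift \<nu> \<mu>p \<mu>m p H by unfold_locales (use p1 H in auto)

abbreviation "\<nu>p \<equiv> \<nu> \<otimes> \<mu>p"
abbreviation "\<nu>m \<equiv> \<nu> \<otimes> \<mu>m"
abbreviation "Xp \<equiv> Lp p \<nu>p"
abbreviation "Xm \<equiv> Lp p \<nu>m"
abbreviation "X \<equiv> Lp p \<mu>\<Omega>"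
abbreviation "norm_p \<equiv> Lp_norm p \<nu>p"
abbreviation "norm_m \<equiv> Lp_norm p \<nu>m"
abbreviation "norm_X \<equiv> Lp_norm p \<mu>\<Omega>"
lemmas sigma_p = mup.sigma_finite_measure_axioms
lemmas sigma_m = mum.sigma_finite_measure_axioms

lemma ennreal_powr_measurable: "h \<in> \<B> M ==> (\<lambda>x. ennreal (\<bar>h x\<bar> powr p)) \<in> \<B> M" by measurable

lemma measurable_nu_pair: "\<B> (\<nu> \<otimes> N) = \<B> (borel \<otimes> N)"
 by (rule measurable_cong_sets) (auto intro!: sets_pair_measure_cong)

lemma nn_integral_nu_pair:
 assumes N: "sigma_finite_measure N" and h: "h \<in> \<B> (\<nu> \<otimes> N)"
 shows "(\<integral>\<^sup>+z. h z \<partial>(\<nu> \<otimes> N)) = (\<integral>\<^sup>+y. \<integral>\<^sup>+r. ennreal (wt r) * h (r, y) \<partial>lborel \<partial>N)"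
proof -
 interpret N: sigma_finite_measure N by fact
 interpret pair_sigma_finite \<nu> N ..
 have "(\<integral>\<^sup>+z. h z \<partial>(\<nu> \<otimes> N)) = (\<integral>\<^sup>+y. \<integral>\<^sup>+r. h (r, y) \<partial>\<nu> \<partial>N)" by (rule nn_integral_snd[OF h, symmetric])
 also have "... = (\<integral>\<^sup>+y. \<integral>\<^sup>+r. ennreal (wt r) * h (r, y) \<partial>lborel \<partial>N)"
 proof (intro nn_integral_cong nn_integral_nu)
  fix y assume "y \<in> space N"
  then have "(\<lambda>r. h (r, y)) \<in> \<B> \<nu>" using h by (rule measurable_Pair1[rotated])
  then show "(\<lambda>r. h (r, y)) \<in> \<B> borel" by (simp cong: measurable_cong_sets)
 qed
 finally show ?thesis .
qed

section \<open>The flux operators and their bounds\<close>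

definition out0 :: "('a => real) => real \<times> 'a => real" where
 "out0 f = (\<lambda>(r, z). if 0 < r \<and> ereal r < tau (-1) z then f (\<Phi> z (- r)) else 0)"

definition pass :: "(real \<times> 'a => real) => real \<times> 'a => real" where
 "pass v = (\<lambda>(r, z). if tau (-1) z < ereal r then v (r - rtau (-1) z, exit (-1) z) else 0)"

text \<open>The state at time t produced inside \<Omega> by the incoming flux v. The formula is that
  of \<open>pass\<close>, read at interior points instead of outgoing ones.\<close>

definition enter :: "real => (real \<times> 'a => real) => 'a => real" where
 "enter t v x = (if tau (-1) x < ereal t then v (t - rtau (-1) x, exit (-1) x) else 0)"

text \<open>The primitive in time starting at 0. It has a value at each time, whereas a flux is
  fixed only almost everywhere.\<close>

definition cumul :: "(real \<times> 'a => real) => real \<times> 'a => real" where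
 "cumul v = (\<lambda>(r, y). LBINT s:{0<..<r}. v (s, y))"

text \<open>The weight is at most 1, and \<open>boundary_nn\<close> turns the remaining integral
  over the chords into one over part of \<Omega>.\<close>

lemma out0_operator: "Lp_op p \<mu>\<Omega> \<nu>p out0"
proof (rule Lp_op_nnI[OF p1, where C=1])
 fix f :: "'a => real" assume f: "f \<in> \<B> \<mu>\<Omega>"
 note [measurable] = Gam_space(4)[OF mu_plus] Gam_space(3)[OF mu_plus] ext_measurable[OF f]
 have e: "out0 f = (\<lambda>(r, z). if 0 < r \<and> ereal r < tau (-1) z then ext f (\<Phi> z (- r)) else 0)"
  using tau_inside[of _ "-1"] by (auto simp: out0_def ext_def fun_eq_iff)
 show m: "out0 f \<in> \<B> \<nu>p" unfolding e case_prod_unfold by measurable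
 have hm: "(\<lambda>x. ennreal (\<bar>ext f x\<bar> powr p)) \<in> \<B> borel" by measurable
 have "Lp_nn p \<nu>p (out0 f) = (\<integral>\<^sup>+z. \<integral>\<^sup>+r. ennreal (wt r) * ennreal (\<bar>out0 f (r, z)\<bar> powr p) \<partial>lborel \<partial>\<mu>p)"
  by (rule nn_integral_nu_pair[OF sigma_p ennreal_powr_measurable[OF m]])
 also have "... \<le> (\<integral>\<^sup>+z. \<integral>\<^sup>+r. ind {s. 0 < s \<and> ereal s < tau (- 1) z} r * ennreal (\<bar>ext f (\<Phi> z (- 1 * r))\<bar> powr p) \<partial>lborel \<partial>\<mu>p)"
 proof (intro nn_integral_mono)
  fix z r
  have "wt r \<le> 1" using lamp by (auto simp: wt_def indicator_def mult_nonneg_nonneg less_imp_le)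
  then show "ennreal (wt r) * ennreal (\<bar>out0 f (r, z)\<bar> powr p) \<le> ind {s. 0 < s \<and> ereal s < tau (- 1) z} r * ennreal (\<bar>ext f (\<Phi> z (- 1 * r))\<bar> powr p)"
   unfolding e by (auto simp: indicator_def ennreal_mult[symmetric] mult_left_le_one_le intro!: ennreal_leI)
 qed
 also have "... = (\<integral>\<^sup>+x. ind (Omega_fin 1) x * ennreal (\<bar>ext f x\<bar> powr p) \<partial>\<mu>)"
  by (rule boundary_nn[OF mu_plus hm, symmetric])
 also have "... \<le> (Lp_nn p \<mu>\<Omega> f)"
  unfolding nn_integral_Omega by (intro nn_integral_mono) (auto simp: indicator_def ext_def)
 finally show "Lp_nn p \<nu>p (out0 f) \<le> ennreal (1 powr p) * (Lp_nn p \<mu>\<Omega> f)" by simp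
qed (auto simp: out0_def)

lemma nn_integral_shift_nonneg:
 fixes h :: "real => ennreal"
 assumes [measurable]: "h \<in> \<B> borel"
 shows "(\<integral>\<^sup>+r. h (r - c) \<partial>lborel) = (\<integral>\<^sup>+r. h r \<partial>lborel)" "(\<integral>\<^sup>+r. h (c - r) \<partial>lborel) = (\<integral>\<^sup>+r. h r \<partial>lborel)"
 using nn_integral_real_affine[of h 1 "- c"] nn_integral_real_affine[of h "- 1" c] by (auto simp: algebra_simps)

lemma pass_measurable:
 assumes "v \<in> \<B> \<nu>m" shows "pass v \<in> \<B> \<nu>p" unfolding pass_def case_prod_unfold
proof (rule exit_If_measurable[OF mu_minus])
 note [measurable] = Gam_space(4)[OF mu_plus]
 show "v \<in> \<B> (borel \<otimes> \<mu>m)" using assms by (simp add: measurable_nu_pair)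
 show "snd \<in> \<nu>p \<rightarrow>\<^sub>M borel" by measurable
 show "(\<lambda>x. fst x - rtau (-1) (snd x)) \<in> \<B> \<nu>p" by measurable
 show "Measurable.pred \<nu>p (\<lambda>x. tau (-1) (snd x) < ereal (fst x))" by measurable
 show "exit (-1) (snd x) \<in> Gam (-1)" if "x \<in> space \<nu>p" "tau (-1) (snd x) < ereal (fst x)" for x
 proof -
  have "tau (-1) (snd x) < \<infinity>" using that(2) by (cases "tau (-1) (snd x)") auto
  then show ?thesis
   using that(1) Gam_space(1)[OF mu_plus] exit_in_Gam_opposite[of "snd x" 1] by (auto simp: space_pair_measure)
 qed
qed

text \<open>A shift in time by the chord length l multiplies the weight by
  \<open>exp (- (lam * p * l))\<close>, and \<open>boundary_passage\<close> carries the remaining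
  integral from the outgoing to the incoming boundary. Only chords longer than \<delta> are
  counted.\<close>

lemma pass_nn_bound:
 assumes v: "v \<in> \<B> \<nu>m" and \<delta>: "0 \<le> \<delta>" shows "(Lp_nn p \<nu>p (\<lambda>z. if ereal \<delta> < tau (-1) (snd z) then pass v z else 0))
  \<le> ennreal (exp (- (lam * \<delta>)) powr p) * (Lp_nn p \<nu>m v)"
proof -
 let ?w = "\<lambda>r y. ennreal (wt r) * ennreal (\<bar>v (r, y)\<bar> powr p)" and ?e = "ennreal (exp (- (lam * \<delta>)) powr p)"
 let ?p = "\<lambda>r z. ennreal (\<bar>if ereal \<delta> < tau (-1) (snd (r, z)) then pass v (r, z) else 0\<bar> powr p)" and ?E = "\<lambda>l. ennreal (exp (- (lam * p * l)))"
 have vb [measurable]: "v \<in> \<B> (borel \<otimes> \<mu>m)" using v by (simp add: measurable_nu_pair)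
 define Q where "Q y = (\<integral>\<^sup>+r. ?w r y \<partial>lborel)" for y
 have Qm [measurable]: "Q \<in> \<B> \<mu>m"
  unfolding Q_def by (rule lborel.borel_measurable_nn_integral) (simp add: case_prod_unfold, measurable)
 \<comment> \<open>Separates the factor that depends on the chord length from the time integral at
   the entry point, the form to which \<open>boundary_passage\<close> applies.\<close>
 define q where "q = (\<lambda>(l, y). ennreal (if \<delta> < l then exp (- (lam * p * l)) else 0) * Q y)"
 let ?q = "\<lambda>z. if tau (-1) z < \<infinity> then q (rtau (-1) z, exit (-1) z) else 0"
 have qm: "q \<in> \<B> (borel \<otimes> \<mu>m)" unfolding q_def case_prod_unfold by measurable
 have "(Lp_nn p \<nu>p (\<lambda>z. if ereal \<delta> < tau (-1) (snd z) then pass v z else 0))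
  = (\<integral>\<^sup>+z. \<integral>\<^sup>+r. ennreal (wt r) * ?p r z \<partial>lborel \<partial>\<mu>p)"
  by (rule nn_integral_nu_pair[OF sigma_p ennreal_powr_measurable[OF chi_measurable(1)[OF pass_measurable[OF v]]]])
 also have "... = (\<integral>\<^sup>+z. ?q z \<partial>\<mu>p)"
 proof (rule nn_integral_cong)
  fix z assume "z \<in> space \<mu>p"
  then have z: "z \<in> Gam 1" using Gam_space(1)[OF mu_plus] by simp
  show "(\<integral>\<^sup>+r. ennreal (wt r) * ?p r z \<partial>lborel)
   = ?q z"
  proof (cases "tau (-1) z")
   case (real l)
   have l: "0 < l" and eG: "exit (-1) z \<in> space \<mu>m" using Gam_opposite[of z 1 l] z real Gam_space(1)[OF mu_minus] by auto
   let ?y = "exit (-1) z"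
   have vm [measurable]: "(\<lambda>r. v (r, ?y)) \<in> \<B> borel" by (rule measurable_Pair1[OF vb eG])
   show ?thesis
   proof (cases "\<delta> < l")
    case True
    have pt: "ennreal (wt r) * ?p r z
     = ?E l * ?w (r - l) ?y" for r
    proof (cases "l < r")
     case True
     have "wt r = exp (- (lam * p * l)) * wt (r - l)"
      using True l by (simp add: wt_pos exp_add[symmetric] algebra_simps)
     then show ?thesis using True \<open>\<delta> < l\<close> real by (simp add: pass_def ennreal_mult mult.assoc)
    qed (use real in \<open>auto simp: pass_def wt_0\<close>)
    have "(\<integral>\<^sup>+r. ?E l * ?w (r - l) ?y \<partial>lborel)
     = ?E l * (\<integral>\<^sup>+r. ?w (r - l) ?y \<partial>lborel)"
     by (rule nn_integral_cmult) measurable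
    also have "(\<integral>\<^sup>+r. ?w (r - l) ?y \<partial>lborel) = Q ?y"
     unfolding Q_def by (rule nn_integral_shift_nonneg(1)[of "\<lambda>r. ?w r ?y"]) measurable
    finally show ?thesis unfolding pt using True real by (simp add: q_def)
   next
    case False
    then show ?thesis using real by (simp add: q_def)
   qed
  next
   case PInf
   then show ?thesis by (simp add: pass_def)
  qed (use tau_nonneg[of "-1" z] in auto)
 qed
 also have "... = (\<integral>\<^sup>+y. (if tau 1 y < \<infinity> then q (rtau 1 y, y) else 0) \<partial>\<mu>m)"
  by (rule boundary_passage[OF qm])
 also have "... \<le> (\<integral>\<^sup>+y. ?e * Q y \<partial>\<mu>m)"
 proof (rule nn_integral_mono)
  fix y
  have le: "(if \<delta> < l then exp (- (lam * p * l)) else 0) \<le> exp (- (lam * \<delta>)) powr p" for l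
  proof -
   have "exp (- (lam * \<delta>)) powr p = exp (- (lam * p * \<delta>))" by (simp add: powr_def)
   moreover have "lam * p * \<delta> \<le> lam * p * l" if "\<delta> < l" using lamp that by (intro mult_left_mono) auto
   ultimately show ?thesis by simp
  qed
  show "(if tau 1 y < \<infinity> then q (rtau 1 y, y) else 0) \<le> ?e * Q y"
   using mult_right_mono[OF ennreal_leI[OF le], of "Q y" "rtau 1 y"] by (auto simp: q_def)
 qed
 also have "... = ?e * (\<integral>\<^sup>+y. Q y \<partial>\<mu>m)" by (rule nn_integral_cmult) measurable
 also have "(\<integral>\<^sup>+y. Q y \<partial>\<mu>m) = (Lp_nn p \<nu>m v)"
  unfolding Q_def by (rule nn_integral_nu_pair[OF sigma_m ennreal_powr_measurable[OF v], symmetric])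
 finally show ?thesis .
qed

lemma pass_operator: "Lp_op p \<nu>m \<nu>p pass" and pass_norm: "v \<in> Xm ==> norm_p (pass v) \<le> norm_m v"
proof -
 have b: "Lp_nn p \<nu>p (pass v) \<le> ennreal (1 powr p) * (Lp_nn p \<nu>m v)"
  if v: "v \<in> \<B> \<nu>m" for v
 proof -
  have "Lp_nn p \<nu>p (pass v) = (Lp_nn p \<nu>p (\<lambda>z. if ereal 0 < tau (-1) (snd z) then pass v z else 0))"
  proof (rule nn_integral_cong)
   fix z assume "z \<in> space \<nu>p"
   then have "0 < tau (-1) (snd z)" using Gam_tau_pos[of "snd z" 1] Gam_space(1)[OF mu_plus] by (auto simp: space_pair_measure)
   then show "ennreal (\<bar>pass v z\<bar> powr p) = ennreal (\<bar>if ereal 0 < tau (-1) (snd z) then pass v z else 0\<bar> powr p)"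
    by (simp add: zero_ereal_def)
  qed
  then show ?thesis using pass_nn_bound[OF v order_refl] by simp
 qed
 show "Lp_op p \<nu>m \<nu>p pass" by (rule Lp_op_nnI(1)[OF p1 zero_le_one pass_measurable b]) (auto simp: pass_def)
 show "v \<in> Xm ==> norm_p (pass v) \<le> norm_m v"
 proof -
  assume v: "v \<in> Xm"
  have "norm_p (pass v) \<le> 1 * norm_m v"
   by (rule Lp_op_nnI(2)[OF p1 zero_le_one pass_measurable b _ _ v]) (auto simp: pass_def)
  then show ?thesis by simp
 qed
qed

lemma enter_measurable:
 assumes "v \<in> \<B> \<nu>m" shows "enter t v \<in> \<B> \<mu>\<Omega>" unfolding enter_def[abs_def]
proof (rule exit_If_measurable[OF mu_minus])
 show "v \<in> \<B> (borel \<otimes> \<mu>m)" using assms by (simp add: measurable_nu_pair)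
 show "(\<lambda>x. t - rtau (-1) x) \<in> \<B> \<mu>\<Omega>" by (rule measurable_from_Omega) measurable
 show "Measurable.pred \<mu>\<Omega> (\<lambda>x. tau (-1) x < ereal t)" by (rule measurable_from_Omega) measurable
 show "exit (-1) x \<in> Gam (-1)" if "x \<in> space \<mu>\<Omega>" "tau (-1) x < ereal t" for x
  using that by (intro exit_in_Gam') (auto intro: less_trans)
qed measurable

text \<open>The change of variables behind the bound on \<open>enter\<close>, in a form that also transfers null sets.\<close>

lemma enter_nn:
 fixes q :: "real \<times> 'a => ennreal"
 assumes q: "q \<in> \<B> \<nu>m"
 shows "(\<integral>\<^sup>+x. (if tau (-1) x < ereal t then q (t - rtau (-1) x, exit (-1) x) else 0) \<partial>\<mu>\<Omega>)
  \<le> ennreal (exp (lam * p * t)) * (\<integral>\<^sup>+z. q z \<partial>\<nu>m)"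
proof -
 let ?q = "\<lambda>x. if tau (-1) x < ereal t then q (t - rtau (-1) x, exit (-1) x) else 0"
 let ?e = "ennreal (exp (lam * p * t))" and ?Q = "\<lambda>y. \<integral>\<^sup>+r. ennreal (wt r) * q (r, y) \<partial>lborel"
 have qb [measurable]: "q \<in> \<B> (borel \<otimes> \<mu>m)" using q by (simp add: measurable_nu_pair)
 define q' where "q' = (\<lambda>(s, y). if s < t then q (t - s, y) else 0)"
 have q': "q' \<in> \<B> (borel \<otimes> \<mu>m)" unfolding q'_def case_prod_unfold by measurable
 have "(\<integral>\<^sup>+x. ?q x \<partial>\<mu>\<Omega>)
  = (\<integral>\<^sup>+x. (if tau (-1) x < \<infinity> then q' (rtau (-1) x, exit (-1) x) else 0) \<partial>\<mu>\<Omega>)"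
 proof (rule nn_integral_cong)
  fix x
  show "?q x
   = (if tau (-1) x < \<infinity> then q' (rtau (-1) x, exit (-1) x) else 0)"
   using tau_nonneg[of "-1" x] by (cases "tau (-1) x") (auto simp: q'_def)
 qed
 also have "... = (\<integral>\<^sup>+y. \<integral>\<^sup>+s. ind (chord (-1) y) s * q' (s, y) \<partial>lborel \<partial>\<mu>m)"
  by (rule boundary_coordinates[OF mu_minus q'])
 also have "... \<le> (\<integral>\<^sup>+y. ?e * ?Q y \<partial>\<mu>m)"
 proof (rule nn_integral_mono)
  fix y assume y: "y \<in> space \<mu>m"
  have qm [measurable]: "(\<lambda>r. q (r, y)) \<in> \<B> borel" by (rule measurable_Pair1[OF qb y])
  have "(\<integral>\<^sup>+s. ind (chord (-1) y) s * q' (s, y) \<partial>lborel)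
   \<le> (\<integral>\<^sup>+s. ?e * (ennreal (wt (t - s)) * q (t - s, y)) \<partial>lborel)"
  proof (rule nn_integral_mono)
   fix s
   \<comment> \<open>Between 0 and t the weight \<open>wt (t - s)\<close> is at least
     \<open>exp (- (lam * p * t))\<close>; this is the source of the exponential in the
     bound.\<close>
   have "1 \<le> ?e * ennreal (wt (t - s))" if "0 < s" "s < t"
   proof -
    have "0 \<le> lam * p * s" using lam(1) p0 that(1) by simp
    then have "1 \<le> exp (lam * p * t) * wt (t - s)" using that by (simp add: wt_pos exp_add[symmetric] algebra_simps)
    then show ?thesis by (simp add: ennreal_mult[symmetric])
   qed
   then have "q (t - s, y) \<le> ?e * ennreal (wt (t - s)) * q (t - s, y)" if "0 < s" "s < t"
    using that mult_right_mono[of 1 "?e * ennreal (wt (t - s))" "q (t - s, y)"] by simp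
   then show "ind (chord (-1) y) s * q' (s, y) \<le> ?e * (ennreal (wt (t - s)) * q (t - s, y))"
    by (auto simp: indicator_def q'_def mult.assoc)
  qed
  also have "... = ?e * (\<integral>\<^sup>+s. ennreal (wt (t - s)) * q (t - s, y) \<partial>lborel)"
   by (rule nn_integral_cmult) measurable
  also have "(\<integral>\<^sup>+s. ennreal (wt (t - s)) * q (t - s, y) \<partial>lborel) = ?Q y"
   by (rule nn_integral_shift_nonneg(2)[of "\<lambda>r. ennreal (wt r) * q (r, y)"]) measurable
  finally show "(\<integral>\<^sup>+s. ind (chord (-1) y) s * q' (s, y) \<partial>lborel)
   \<le> ?e * ?Q y" .
 qed
 also have "... = ?e * (\<integral>\<^sup>+y. ?Q y \<partial>\<mu>m)"
  by (rule nn_integral_cmult, rule lborel.borel_measurable_nn_integral) (simp add: case_prod_unfold, measurable)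
 also have "(\<integral>\<^sup>+y. ?Q y \<partial>\<mu>m) = (\<integral>\<^sup>+z. q z \<partial>\<nu>m)"
  by (rule nn_integral_nu_pair[OF sigma_m q, symmetric])
 finally show ?thesis .
qed

lemma enter_operator: "Lp_op p \<nu>m \<mu>\<Omega> (enter t)"
 and enter_norm: "v \<in> Xm ==> norm_X (enter t v) \<le> exp (lam * t) * norm_m v"
proof -
 have b: "Lp_nn p \<mu>\<Omega> (enter t v) \<le> ennreal (exp (lam * t) powr p) * (Lp_nn p \<nu>m v)"
  if [measurable]: "v \<in> \<B> \<nu>m" for v
 proof -
  have "(Lp_nn p \<mu>\<Omega> (enter t v))
   = (\<integral>\<^sup>+x. (if tau (-1) x < ereal t then ennreal (\<bar>v (t - rtau (-1) x, exit (-1) x)\<bar> powr p) else 0) \<partial>\<mu>\<Omega>)"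
   by (intro nn_integral_cong) (auto simp: enter_def)
  also have "... \<le> ennreal (exp (lam * p * t)) * (Lp_nn p \<nu>m v)"
   by (rule enter_nn[of "\<lambda>z. ennreal (\<bar>v z\<bar> powr p)"]) measurable
  finally show ?thesis by (simp add: powr_def mult_ac)
 qed
 have e0: "0 \<le> exp (lam * t)" by simp
 show "Lp_op p \<nu>m \<mu>\<Omega> (enter t)" by (rule Lp_op_nnI(1)[OF p1 e0 enter_measurable b]) (auto simp: enter_def)
 show "v \<in> Xm ==> norm_X (enter t v) \<le> exp (lam * t) * norm_m v"
  by (rule Lp_op_nnI(2)[OF p1 e0 enter_measurable b]) (auto simp: enter_def)
qed

lemma U_zero_measurable:
 assumes f: "f \<in> \<B> \<mu>\<Omega>" and t: "0 \<le> t" shows "U_zero t f \<in> \<B> \<mu>\<Omega>"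
  and "x \<in> \<Omega> ==> U_zero t f x = (if ereal t < tau (-1) x then ext f (\<Phi> x (- t)) else 0)"
proof -
 note [measurable] = ext_measurable[OF f]
 show e: "U_zero t f x = (if ereal t < tau (-1) x then ext f (\<Phi> x (- t)) else 0)" if x: "x \<in> \<Omega>" for x
 proof (cases "t = 0")
  case True then show ?thesis using x by (simp add: U_zero_def ext_def)
 next
  case False
  then show ?thesis using tau_inside[of t "-1" x] t by (auto simp: U_zero_def ext_def)
 qed
 have "(\<lambda>x. if ereal t < tau (-1) x then ext f (\<Phi> x (- t)) else 0) \<in> \<B> \<mu>\<Omega>" by (rule measurable_from_Omega) measurable
 then show "U_zero t f \<in> \<B> \<mu>\<Omega>" by (rule measurable_cong[THEN iffD1, rotated]) (simp add: e)
qed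

lemma U_zero_operator: "0 \<le> t ==> Lp_op p \<mu>\<Omega> \<mu>\<Omega> (U_zero t)"
 and U_zero_norm: "0 \<le> t ==> f \<in> X ==> norm_X (U_zero t f) \<le> norm_X f"
proof -
 have b: "Lp_nn p \<mu>\<Omega> (U_zero t f) \<le> ennreal (1 powr p) * (Lp_nn p \<mu>\<Omega> f)"
  if f: "f \<in> \<B> \<mu>\<Omega>" and t: "0 \<le> t" for f t
 proof -
  note [measurable] = ext_measurable[OF f]
  have "Lp_nn p \<mu>\<Omega> (U_zero t f) \<le> (Lp_nn p \<mu> (\<lambda>x. ext f (\<Phi> x (- t))))" unfolding nn_integral_Omega
   by (intro nn_integral_mono) (auto simp: indicator_def U_zero_measurable(2)[OF f t])
  also have "... = (Lp_nn p \<mu> (ext f))" by (rule nn_integral_flow) measurable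
  also have "... = (Lp_nn p \<mu>\<Omega> f)"
   unfolding nn_integral_Omega by (intro nn_integral_cong) (auto simp: ext_def indicator_def)
  finally show ?thesis by simp
 qed
 show "Lp_op p \<mu>\<Omega> \<mu>\<Omega> (U_zero t)" if t: "0 \<le> t"
  by (rule Lp_op_nnI(1)[OF p1 zero_le_one U_zero_measurable(1)[OF _ t] b[OF _ t]]) (auto simp: U_zero_def)
 show "norm_X (U_zero t f) \<le> norm_X f" if t: "0 \<le> t" and f: "f \<in> X"
 proof -
  have "norm_X (U_zero t f) \<le> 1 * norm_X f"
   by (rule Lp_op_nnI(2)[OF p1 zero_le_one U_zero_measurable(1)[OF _ t] b[OF _ t] _ _ f]) (auto simp: U_zero_def)
  then show ?thesis by simp
 qed
qed

definition loop :: "(real \<times> 'a => real) => real \<times> 'a => real" where "loop v = HL.lift (pass v)"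

lemma loop_operator: "Lp_op p \<nu>m \<nu>m loop"
 unfolding loop_def[abs_def] by (rule Lp_op_compose[OF p1 pass_operator HL.lift_operator])

lemma loop_contraction:
 obtains q where "0 \<le> q" "q < 1" "\<And>v. v \<in> Xm ==> norm_m (loop v) \<le> q * norm_m v"
proof -
 obtain \<delta> where \<delta>: "0 < \<delta>" "Lp_opnorm p \<mu>p \<mu>m (\<lambda>f. H (chi \<delta> f)) + Lp_opnorm p \<mu>p \<mu>m H * exp (- (lam * \<delta>)) < 1"
  using lam(2) by blast
 let ?e = "exp (- (lam * \<delta>))" and ?c = "Lp_opnorm p \<mu>p \<mu>m (\<lambda>f. H (chi \<delta> f))" and ?h = "Lp_opnorm p \<mu>p \<mu>m H"
 let ?q = "?c + ?h * ?e"
 have c0: "0 \<le> ?c" by (rule Lp_opnorm_nonneg[OF H_chi_operator])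
 have h0: "0 \<le> ?h" by (rule Lp_opnorm_nonneg[OF H])
 show ?thesis
 proof (rule that[of "?q"])
  show "0 \<le> ?q" using c0 h0 by simp
  show "?q < 1" by (rule \<delta>(2))
  fix v assume v: "v \<in> Xm"
  have vm: "v \<in> \<B> \<nu>m" by (rule Lp_meas[OF v])
  let ?n = "norm_m v"
  \<comment> \<open>Long chords gain from the weight and then undergo the full norm of H; for short
    ones the weight gains nothing, and \<open>H (chi \<delta> f)\<close> must provide the
    contraction.\<close>
  define far where "far z = (if ereal \<delta> < tau (-1) (snd z) then pass v z else 0)" for z
  define near where "near z = (if ereal \<delta> < tau (-1) (snd z) then 0 else pass v z)" for z
  have P: "pass v \<in> Xp" by (rule Lp_op_in[OF pass_operator v])
  have fm: "far \<in> \<B> \<nu>p" and nm: "near \<in> \<B> \<nu>p"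
   unfolding far_def near_def using chi_measurable[OF Lp_meas[OF P]] by auto
  have far: "far \<in> Xp" "norm_p far \<le> ?e * ?n"
  proof -
   have "(Lp_nn p \<nu>p far) \<le> ennreal ((?e * ?n) powr p)" using pass_nn_bound[OF vm less_imp_le[OF \<delta>(1)]]
    unfolding nn_integral_Lp_norm[OF v p0] far_def by (simp add: ennreal_mult[symmetric] powr_mult)
   then show "far \<in> Xp" "norm_p far \<le> ?e * ?n"
    using Lp_leI[OF fm, of "?e * ?n" p] p0 by auto
  qed
  have near: "near \<in> Xp" by (rule Lp_mono_AE(1)[OF P nm _ p0]) (simp add: near_def)
  have ln: "norm_m (HL.lift near) \<le> ?c * ?n"
  proof -
   have "norm_m (HL.lift near) \<le> ?c * norm_p (pass v)"
   proof (rule Lp_pair_norm_le[OF nu.sigma_finite_measure_axioms sigma_p sigma_m p0 c0 P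
      Lp_op_in[OF HL.lift_operator near]])
    show "AE r in \<nu>. Lp_norm p \<mu>m (\<lambda>y. HL.lift near (r, y)) \<le> ?c * Lp_norm p \<mu>p (\<lambda>y. pass v (r, y))"
     using HL.lift_AE[OF near] HL.slice1(1)[OF P] HL.slice2(1)[OF Lp_op_in[OF HL.lift_operator near]] HL.slice1(1)[OF near]
    proof eventually_elim
     case (elim r)
     let ?P = "\<lambda>y. pass v (r, y)"
     \<comment> \<open>At a fixed time the short-chord part is exactly the truncation
       \<open>chi \<delta>\<close> of the flux, so the operator norm in the hypothesis bounds each
       slice.\<close>
     have eq: "AE z in \<mu>p. near (r, z) = chi \<delta> ?P z"
      using AE_space[of \<mu>p] by eventually_elim (simp add: near_def chi_eq Gam_space(1)[OF mu_plus])
     have "AE y in \<mu>m. H (\<lambda>z. near (r, z)) y = H (chi \<delta> ?P) y"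
      by (rule Lp_op_cong[OF H elim(4) Lp_op_in[OF chi_operator elim(2)] eq])
     then have "AE y in \<mu>m. HL.lift near (r, y) = H (chi \<delta> ?P) y" using elim(1) by eventually_elim simp
     then have "Lp_norm p \<mu>m (\<lambda>y. HL.lift near (r, y)) = Lp_norm p \<mu>m (H (chi \<delta> ?P))"
      by (rule Lp_norm_cong_AE[OF _ Lp_meas[OF elim(3)] Lp_meas[OF Lp_op_in[OF H_chi_operator elim(2)]]])
     also have "... \<le> ?c * Lp_norm p \<mu>p ?P" by (rule Lp_norm_le_opnorm[OF p1 H_chi_operator elim(2)])
     finally show ?case .
    qed
   qed
   also have "... \<le> ?c * ?n" by (rule mult_left_mono[OF pass_norm[OF v] c0])
   finally show ?thesis .
  qed
  have lf: "norm_m (HL.lift far) \<le> ?h * (?e * ?n)"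
  proof -
   have "norm_m (HL.lift far) \<le> ?h * norm_p far"
    by (rule HL.is_lift_norm_le[OF h0 Lp_norm_le_opnorm[OF p1 H] HL.lift[OF far(1)]])
   also have "... \<le> ?h * (?e * ?n)" by (rule mult_left_mono[OF far(2) h0])
   finally show ?thesis .
  qed
  have "(\<lambda>z. near z + far z) = pass v" by (auto simp: near_def far_def)
  then have ae: "AE z in \<nu>m. loop v z = HL.lift near z + HL.lift far z"
   unfolding loop_def using Lp_op_add[OF HL.lift_operator near far(1)] by simp
  have "norm_m (loop v) = norm_m (\<lambda>z. HL.lift near z + HL.lift far z)"
   by (rule Lp_norm_cong_AE[OF ae Lp_meas[OF Lp_op_in[OF loop_operator v]]
      Lp_meas[OF Lp_add[OF p1 Lp_op_in[OF HL.lift_operator near] Lp_op_in[OF HL.lift_operator far(1)]]]])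
  also have "... \<le> norm_m (HL.lift near) + norm_m (HL.lift far)"
   by (rule Lp_norm_triangle[OF p1 Lp_op_in[OF HL.lift_operator near] Lp_op_in[OF HL.lift_operator far(1)]])
  also have "... \<le> ?q * ?n" using ln lf by (simp add: algebra_simps)
  finally show "norm_m (loop v) \<le> ?q * ?n" .
 qed
qed

subsection \<open>Integration in time\<close>

lemma cumul_measurable:
 assumes "v \<in> \<B> (\<nu> \<otimes> N)" shows "cumul v \<in> \<B> (\<nu> \<otimes> N)"
proof -
 have [measurable]: "v \<in> \<B> (borel \<otimes> N)" using assms by (simp add: measurable_nu_pair)
 moreover have "cumul v = (\<lambda>z. LBINT s. ind {s. 0 < s \<and> s < fst z} s *\<^sub>R v (s, snd z))"
  by (auto simp: cumul_def set_lebesgue_integral_def greaterThanLessThan_def greaterThan_def lessThan_def fun_eq_iff Int_def)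
 ultimately show ?thesis by (simp add: measurable_nu_pair)
qed

text \<open>Cancels the weight of \<open>\<nu>\<close> on the interval up to T. A time primitive
  thus becomes a boundedly weighted integral against \<open>\<nu>\<close>, the kind with which lifts
  commute.\<close>

definition wexp :: "real => real => real" where "wexp T s = ind {0<..<T} s * exp (lam * p * s)"

lemma wexp_measurable [measurable]: "wexp T \<in> \<B> borel" unfolding wexp_def[abs_def] by measurable

lemma wexp_bound: "\<bar>wexp T s\<bar> \<le> exp (lam * p * \<bar>T\<bar>)"
proof (cases "s \<in> {0<..<T}")
 case True
 then have "lam * p * s \<le> lam * p * \<bar>T\<bar>" using lamp by (intro mult_left_mono) auto
 then show ?thesis using True by (simp add: wexp_def)
qed (simp add: wexp_def)

lemma wt_wexp: "wt s * (wexp T s * a) = ind {0<..<T} s * a"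
 by (auto simp: wt_def wexp_def indicator_def mult.assoc[symmetric] exp_add[symmetric])

lemma slice_measurable:
 assumes "v \<in> \<B> (\<nu> \<otimes> N)" "y \<in> space N" shows "(\<lambda>s. v (s, y)) \<in> \<B> borel"
proof -
 have "v \<in> \<B> (borel \<otimes> N)" using assms(1) by (simp add: measurable_nu_pair)
 then show ?thesis using assms(2) by (rule measurable_Pair1)
qed

lemma cumul_eq_integral_nu:
 assumes v: "v \<in> \<B> (\<nu> \<otimes> N)" and y: "y \<in> space N" shows "(LINT s|\<nu>. wexp T s * v (s, y)) = cumul v (T, y)"
  and "integrable \<nu> (\<lambda>s. wexp T s * v (s, y)) \<longleftrightarrow> lintegrable {0<..<T} (\<lambda>s. v (s, y))"
proof -
 note [measurable] = slice_measurable[OF v y]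
 have "(LINT s|\<nu>. wexp T s * v (s, y)) = (LBINT s. wt s *\<^sub>R (wexp T s * v (s, y)))"
  unfolding \<nu>_def by (rule integral_density) auto
 then show "(LINT s|\<nu>. wexp T s * v (s, y)) = cumul v (T, y)" by (simp add: cumul_def set_lebesgue_integral_def wt_wexp)
 have "integrable \<nu> (\<lambda>s. wexp T s * v (s, y)) \<longleftrightarrow> integrable lborel (\<lambda>s. wt s *\<^sub>R (wexp T s * v (s, y)))"
  unfolding \<nu>_def by (rule integrable_density) auto
 then show "integrable \<nu> (\<lambda>s. wexp T s * v (s, y)) \<longleftrightarrow> lintegrable {0<..<T} (\<lambda>s. v (s, y))"
  by (simp add: set_integrable_def wt_wexp)
qed

lemma wexp_meas_nu: "wexp T \<in> \<B> \<nu>" by (simp cong: measurable_cong_sets)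

lemma cumul_integrable:
 fixes N :: "'a measure"
 assumes N: "sigma_finite_measure N" and v: "v \<in> Lp p (\<nu> \<otimes> N)"
 shows "AE y in N. \<forall>T. lintegrable {0<..<T} (\<lambda>s. v (s, y))"
proof -
 have "AE y in N. \<forall>n::nat. integrable \<nu> (\<lambda>s. wexp (real n) s * v (s, y))"
  using Lp_weighted_integral_operator(2)[OF nu.finite_measure_axioms N p1 wexp_meas_nu wexp_bound v] by (simp add: AE_all_countable)
 then show ?thesis using AE_space[of N]
 proof eventually_elim
  case (elim y)
  show ?case
  proof
   fix T :: real
   obtain n :: nat where n: "T \<le> real n" using real_arch_simple by blast
   have I: "lintegrable {0<..<real n} (\<lambda>s. v (s, y))"
    using elim cumul_eq_integral_nu(2)[OF Lp_meas[OF v]] by blast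
   show "lintegrable {0<..<T} (\<lambda>s. v (s, y))" using n by (intro set_integrable_subset[OF I]) auto
  qed
 qed
qed

lemma cumul_slice_Lp:
 assumes N: "sigma_finite_measure N" and v: "v \<in> Lp p (\<nu> \<otimes> N)"
 shows "(\<lambda>y. cumul v (T, y)) \<in> Lp p N" "AE y in N. (LINT s|\<nu>. wexp T s * v (s, y)) = cumul v (T, y)"
proof -
 show ae: "AE y in N. (LINT s|\<nu>. wexp T s * v (s, y)) = cumul v (T, y)"
  using AE_space[of N] by eventually_elim (rule cumul_eq_integral_nu(1)[OF Lp_meas[OF v]])
 have "(\<lambda>y. cumul v (T, y)) \<in> \<B> N" by (rule measurable_Pair2[OF cumul_measurable[OF Lp_meas[OF v]]]) simp
 then show "(\<lambda>y. cumul v (T, y)) \<in> Lp p N"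
  by (rule Lp_cong_AE[OF Lp_op_in[OF Lp_weighted_integral_operator(1)[OF nu.finite_measure_axioms N p1 wexp_meas_nu wexp_bound] v] ae])
qed

text \<open>\<open>lift_integral\<close> with the weight \<open>wexp T\<close>. The identity holds
  at every time T, not only at almost every one, and so H can be applied to a trace at a prescribed
  time.\<close>

lemma cumul_lift:
 assumes G: "G \<in> Xp" shows "AE y in \<mu>m. cumul (HL.lift G) (T, y) = H (\<lambda>z. cumul G (T, z)) y"
proof -
 have L: "HL.lift G \<in> Xm" by (rule Lp_op_in[OF HL.lift_operator G])
 note c1 = cumul_slice_Lp[OF sigma_p G, of T] and c2 = cumul_slice_Lp(2)[OF sigma_m L, of T]
 have W: "(\<lambda>z. LINT s|\<nu>. wexp T s * G (s, z)) \<in> Lp p \<mu>p"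
  by (rule Lp_op_in[OF HL.wint1(1)[OF wexp_meas_nu wexp_bound] G])
 show ?thesis using HL.lift_integral[OF G wexp_meas_nu wexp_bound, of T] c2 Lp_op_cong[OF H W c1]
  by eventually_elim simp
qed

text \<open>The primitive is the integral of all delayed copies \<open>v (r - s, y)\<close>. A delay
  by s multiplies the weighted norm by at most \<open>exp (- (lam * s))\<close>, which is
  integrable, and \<open>Lp_time_integral\<close> sums the copies.\<close>

lemma cumul_Lp:
 assumes N: "sigma_finite_measure N" and v: "v \<in> Lp p (\<nu> \<otimes> N)" shows "cumul v \<in> Lp p (\<nu> \<otimes> N)"
proof (rule Lp_time_integral(1)[OF p1])
 interpret N: sigma_finite_measure N by (rule N)
 interpret P: pair_sigma_finite \<nu> N ..
 note vm = Lp_meas[OF v]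
 have vb [measurable]: "v \<in> \<B> (borel \<otimes> N)" using vm by (simp add: measurable_nu_pair)
 define h where "h = (\<lambda>(s, r, y). exp (lam * s) * (if s < r then v (r - s, y) else 0))"
 define \<rho> where "\<rho> s = ind {0<..} s * exp (- (lam * s))" for s
 show "sigma_finite_measure (\<nu> \<otimes> N)" by unfold_locales
 have hm: "h \<in> \<B> (borel \<otimes> (borel \<otimes> N))" unfolding h_def case_prod_unfold by measurable
 then show "h \<in> \<B> (borel \<otimes> (\<nu> \<otimes> N))"
  by (subst measurable_cong_sets[OF sets_pair_measure_cong[OF refl sets_pair_measure_cong] refl]) auto
 show "\<rho> \<in> \<B> borel" "0 \<le> \<rho> s" for s unfolding \<rho>_def[abs_def] by simp_all
 have "(\<integral>\<^sup>+s. ennreal (\<rho> s) \<partial>lborel) = (\<integral>\<^sup>+s. ennreal (exp (- (lam * s))) * ind {0..} s \<partial>lborel)"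
  by (rule nn_integral_cong_AE) (use AE_lborel_singleton[of 0] in eventually_elim, auto simp: \<rho>_def indicator_def)
 then show "(\<integral>\<^sup>+s. ennreal (\<rho> s) \<partial>lborel) = ennreal (1 / lam)" using nn_integral_exp_decay[OF lam(1), of 0] by simp
 show "Lp_nn p (\<nu> \<otimes> N) (\<lambda>z. h (s, z)) \<le> ennreal (Lp_norm p (\<nu> \<otimes> N) v powr p)" for s
 proof -
  let ?w = "\<lambda>r y. ennreal (wt r) * ennreal (\<bar>v (r, y)\<bar> powr p)"
  have "(\<lambda>z. h (s, z)) \<in> \<B> (borel \<otimes> N)" unfolding h_def case_prod_unfold fst_conv snd_conv by measurable
  then have "Lp_nn p (\<nu> \<otimes> N) (\<lambda>z. h (s, z)) = (\<integral>\<^sup>+y. \<integral>\<^sup>+r. ennreal (wt r) * ennreal (\<bar>h (s, r, y)\<bar> powr p) \<partial>lborel \<partial>N)"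
   by (intro nn_integral_nu_pair[OF N ennreal_powr_measurable]) (simp add: measurable_nu_pair)
  also have "... \<le> (\<integral>\<^sup>+y. \<integral>\<^sup>+r. ?w r y \<partial>lborel \<partial>N)"
  proof (rule nn_integral_mono)
   fix y assume y: "y \<in> space N"
   note [measurable] = slice_measurable[OF vm y]
   have "(\<integral>\<^sup>+r. ennreal (wt r) * ennreal (\<bar>h (s, r, y)\<bar> powr p) \<partial>lborel) \<le> (\<integral>\<^sup>+r. ?w (r - s) y \<partial>lborel)"
   proof (rule nn_integral_mono)
    fix r
    have "wt r * \<bar>exp (lam * s) * v (r - s, y)\<bar> powr p \<le> wt (r - s) * \<bar>v (r - s, y)\<bar> powr p" if "s < r"
    proof -
     have "wt r * exp (lam * s) powr p \<le> wt (r - s)"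
      using that by (simp add: wt_def indicator_def powr_def exp_add[symmetric] algebra_simps)
     from mult_right_mono[OF this, of "\<bar>v (r - s, y)\<bar> powr p"] show ?thesis by (simp add: abs_mult powr_mult mult.assoc)
    qed
    then show "ennreal (wt r) * ennreal (\<bar>h (s, r, y)\<bar> powr p) \<le> ?w (r - s) y"
     using p0 by (auto simp: h_def ennreal_mult[symmetric])
   qed
   also have "... = (\<integral>\<^sup>+r. ?w r y \<partial>lborel)" by (rule nn_integral_shift_nonneg(1)) measurable
   finally show "(\<integral>\<^sup>+r. ennreal (wt r) * ennreal (\<bar>h (s, r, y)\<bar> powr p) \<partial>lborel) \<le> (\<integral>\<^sup>+r. ?w r y \<partial>lborel)" .
  qed
  also have "... = Lp_nn p (\<nu> \<otimes> N) v" by (rule nn_integral_nu_pair[OF N ennreal_powr_measurable[OF vm], symmetric])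
  finally show ?thesis by (simp add: nn_integral_Lp_norm[OF v p0])
 qed
 show "cumul v \<in> \<B> (\<nu> \<otimes> N)" by (rule cumul_measurable[OF vm])
 have "cumul v (r, y) = (LBINT s. \<rho> s * h (s, r, y))" for r y
 proof -
  have "ind {s. r - s \<in> {0<..<r}} s *\<^sub>R v (r - s, y) = \<rho> s * h (s, r, y)" for s
   by (auto simp: \<rho>_def h_def indicator_def mult.assoc[symmetric] exp_add[symmetric])
  then show ?thesis using set_integral_reflect(2)[of r "{0<..<r}" "\<lambda>s. v (s, y)"] by (simp add: cumul_def set_int_defs)
 qed
 then show "AE z in \<nu> \<otimes> N. cumul v z = (LBINT s. \<rho> s * h (s, z))" by auto
qed (use lam(1) in simp_all)

text \<open>For fixed z the passage is a delay by a constant, and delays commute with primitives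
  that start at 0.\<close>

lemma pass_cumul: "pass (cumul v) (r, z) = cumul (pass v) (r, z)"
proof (cases "tau (-1) z")
 case (real l)
 have l: "0 \<le> l" using tau_nonneg[of "-1" z] real by simp
 have "cumul (pass v) (r, z) = (LBINT s:{s. s + - l \<in> {0<..<r - l}}. v (s + - l, exit (-1) z))"
  unfolding cumul_def set_lebesgue_integral_def prod.case
  by (intro Bochner_Integration.integral_cong) (use l real in \<open>auto simp: pass_def indicator_def\<close>)
 also have "... = (LBINT s:{0<..<r - l}. v (s, exit (-1) z))"
  by (rule set_integral_shift(2)[where h="\<lambda>s. v (s, exit (-1) z)"])
 finally show ?thesis using real l by (auto simp: pass_def cumul_def set_lebesgue_integral_def)
next
 case PInf
 then show ?thesis by (simp add: pass_def cumul_def set_lebesgue_integral_def)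
qed (use tau_nonneg[of "-1" z] in auto)

lemma lift_cumul:
 assumes G: "G \<in> Xp" shows "AE z in \<nu>m. HL.lift (cumul G) z = cumul (HL.lift G) z"
proof -
 have "AE z in \<nu>m. cumul (HL.lift G) z = HL.lift (cumul G) z"
 proof (rule HL.lift_unique[OF cumul_Lp[OF sigma_p G] cumul_measurable[OF
     Lp_meas[OF Lp_op_in[OF HL.lift_operator G]]]], rule AE_I2)
  fix r show "AE y in \<mu>m. cumul (HL.lift G) (r, y) = H (\<lambda>z. cumul G (r, z)) y" by (rule cumul_lift[OF G])
 qed
 then show ?thesis by eventually_elim simp
qed

lemma loop_cumul:
 assumes v: "v \<in> Xm" shows "AE z in \<nu>m. loop (cumul v) z = cumul (loop v) z"
proof -
 have "pass (cumul v) = cumul (pass v)" by (auto simp: fun_eq_iff pass_cumul)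
 then show ?thesis unfolding loop_def using lift_cumul[OF Lp_op_in[OF pass_operator v]] by simp
qed

text \<open>\<open>enter\<close> evaluates v at one time for each point, so independence of the
  representative is not obvious. It follows from the change of variables applied to the indicator of
  the set of disagreement.\<close>

lemma enter_AE:
 assumes v: "v \<in> \<B> \<nu>m" "v' \<in> \<B> \<nu>m" and ae: "AE z in \<nu>m. v z = v' z" shows "AE x in \<mu>\<Omega>. enter t v x = enter t v' x"
proof -
 define q where "q z = (if v z = v' z then 0 else 1 :: ennreal)" for z
 have q: "q \<in> \<B> \<nu>m"
 proof -
  have [measurable]: "v \<in> \<B> (borel \<otimes> \<mu>m)" "v' \<in> \<B> (borel \<otimes> \<mu>m)" using v by (simp_all add: measurable_nu_pair)
  have "q \<in> \<B> (borel \<otimes> \<mu>m)" unfolding q_def by measurable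
  then show ?thesis by (simp add: measurable_nu_pair)
 qed
 have "(\<integral>\<^sup>+z. q z \<partial>\<nu>m) = 0" using ae by (subst nn_integral_0_iff_AE[OF q]) (auto simp: q_def)
 then have z: "(\<integral>\<^sup>+x. (if tau (-1) x < ereal t then q (t - rtau (-1) x, exit (-1) x) else 0) \<partial>\<mu>\<Omega>) = 0"
  using enter_nn[OF q, of t] by simp
 have "(\<lambda>x. if tau (-1) x < ereal t then q (t - rtau (-1) x, exit (-1) x) else 0) \<in> \<B> \<mu>\<Omega>"
 proof (rule exit_If_measurable[OF mu_minus])
  show "q \<in> \<B> (borel \<otimes> \<mu>m)" using q by (simp add: measurable_nu_pair)
  show "(\<lambda>x. t - rtau (-1) x) \<in> \<B> \<mu>\<Omega>" by (rule measurable_from_Omega) measurable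
  show "Measurable.pred \<mu>\<Omega> (\<lambda>x. tau (-1) x < ereal t)" by (rule measurable_from_Omega) measurable
  show "exit (-1) x \<in> Gam (-1)" if "x \<in> space \<mu>\<Omega>" "tau (-1) x < ereal t" for x
   using that by (intro exit_in_Gam') (auto intro: less_trans)
 qed measurable
 from z[THEN nn_integral_0_iff_AE[OF this, THEN iffD1]]
 show ?thesis by eventually_elim (auto simp: enter_def q_def split: if_splits)
qed

lemma finite_tau:
 assumes "tau \<sigma> x < \<infinity>" obtains l where "tau \<sigma> x = ereal l" "0 \<le> l"
 using assms tau_nonneg[of \<sigma> x] by (cases "tau \<sigma> x") auto

lemma exit_orbit:
 assumes "x \<in> \<Omega>" "s \<in> stay x" "tau (-1) x = ereal L"
 shows "tau (-1) (\<Phi> x s) = ereal (L + s)" "exit (-1) (\<Phi> x s) = exit (-1) x"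
proof -
 show t: "tau (-1) (\<Phi> x s) = ereal (L + s)" using tau_flow(2)[OF assms(1,2)] assms(3) by simp
 show "exit (-1) (\<Phi> x s) = exit (-1) x" unfolding exit_def t assms(3) by (simp add: flow_add)
qed

lemma enter_cumul_orbit:
 assumes "tau (-1) x = ereal L" shows "enter t (cumul v) x = (LBINT r:{0<..<t - L}. v (r, exit (-1) x))"
 using assms by (auto simp: enter_def cumul_def set_lebesgue_integral_def)

text \<open>Along an orbit the entry point is fixed, and the time of entry decreases at unit rate.
  So the primitive of v in time becomes a primitive along the orbit; where the past never leaves
  \<Omega>, everything is zero.\<close>

lemma enter_cumul_mild:
 assumes v: "v \<in> Xm" shows "mild (enter t (cumul v)) (enter t v)"
proof -
 have "AE x in \<mu>\<Omega>. tau (-1) x < \<infinity> --> (\<forall>T. lintegrable {0<..<T} (\<lambda>s. v (s, exit (-1) x)))"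
  by (rule AE_Omega_of_AE_Gam[OF mu_minus cumul_integrable[OF sigma_m v]])
 then show ?thesis unfolding mild_def using AE_space[of \<mu>\<Omega>]
 proof eventually_elim
  case (elim x)
  then have x: "x \<in> \<Omega>" by simp
  show ?case unfolding mild_at_def
  proof (intro allI impI)
   fix a b assume ab: "a \<in> stay x" "b \<in> stay x" "a \<le> b"
   show "decreases_by (\<lambda>s. enter t (cumul v) (\<Phi> x s)) (\<lambda>s. enter t v (\<Phi> x s)) a b"
   proof (cases "tau (-1) x < \<infinity>")
    case True
    then obtain L where L: "tau (-1) x = ereal L" by (rule finite_tau)
    let ?y = "exit (-1) x" and ?c = "t - L"
    let ?v = "\<lambda>r. v (r, ?y)"
    have I: "lintegrable {0<..<T} ?v" for T using elim True by blast
    have w: "enter t (cumul v) (\<Phi> x s) = (LBINT r:{0<..<?c - s}. ?v r)" if "s \<in> stay x" for s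
     using enter_cumul_orbit[OF exit_orbit(1)[OF x that L], of t v] exit_orbit(2)[OF x that L] by (simp add: algebra_simps)
    have g: "enter t v (\<Phi> x s) = (if 0 < ?c - s then ?v (?c - s) else 0)" if "s \<in> stay x" for s
     using exit_orbit[OF x that L] by (simp add: enter_def algebra_simps)
    have "lintegrable {0<..?c - a} ?v" by (rule set_integrable_subset[OF I[of "?c - a + 1"]]) auto
    from primitive_decreases_by[OF this, of "?c - b"] ab(3)
    have "decreases_by (\<lambda>s. LBINT r:{0<..<?c - s}. ?v r) (\<lambda>s. if 0 < ?c - s then ?v (?c - s) else 0) a b"
     by (subst decreases_by_reflect[where P="\<lambda>s. LBINT r:{0<..<s}. ?v r" and D="\<lambda>s. if 0 < s then ?v s else 0"]) simp
    then show ?thesis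
     by (rule decreases_by_cong[THEN iffD1, rotated 3]) (use ab w g stay_interval[OF ab(1,2)] in auto)
   next
    case False
    have z: "enter t u (\<Phi> x s) = 0" if "s \<in> stay x" for u s
     using tau_flow(2)[OF x that] False by (simp add: enter_def)
    then have zz: "ind {a..b} s *\<^sub>R enter t v (\<Phi> x s) = 0" for s
     using stay_interval[OF ab(1,2), of s] by (auto simp: indicator_def)
    show ?thesis unfolding decreases_by_def set_int_defs zz using z[OF ab(1)] z[OF ab(2)] by simp
   qed
  qed
 qed
qed

lemma has_trace_plus_cumul:
 assumes S: "sharp_rep f fs" and G: "G \<in> Xp"
  and e: "AE z in \<mu>p. \<forall>s. 0 < s --> ereal s < tau (-1) z --> fs (\<Phi> z (- s)) = cumul G (t + s, z)"
 shows "has_trace_plus f (\<lambda>z. cumul G (t, z))" unfolding has_trace_iff[OF mu_plus disjI1[OF refl] S]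
proof (intro conjI)
 show "(\<lambda>z. cumul G (t, z)) \<in> \<B> \<mu>p" by (rule measurable_Pair2[OF cumul_measurable[OF Lp_meas[OF G]]]) simp
 show "AE z in \<mu>p. ((\<lambda>s. fs (\<Phi> z (- 1 * s))) ---> cumul G (t, z)) (at_right 0)"
  using e cumul_integrable[OF sigma_p G] AE_space[of \<mu>p]
 proof eventually_elim
  case (elim z)
  then have z: "z \<in> Gam 1" using Gam_space(1)[OF mu_plus] by simp
  obtain e where e: "0 < e" "ereal e < tau (-1) z"
   using Gam_tau_pos[OF z] ereal_dense2[of 0 "tau (-1) z"] by (auto simp: zero_ereal_def)
  have l: "((\<lambda>s. cumul G (t + s, z)) ---> cumul G (t, z)) (at_right 0)"
   unfolding cumul_def prod.case using elim(2) by (intro set_integral_right_continuous[where e=1]) simp_all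
  have "\<forall>\<^sub>F s in at_right 0. cumul G (t + s, z) = fs (\<Phi> z (- 1 * s))"
   unfolding eventually_at_right_field using e(1) elim(1) less_trans[OF _ e(2), of "ereal _"] by (auto intro!: exI[of _ e])
  then show ?case by (rule Lim_transform_eventually[OF l])
 qed
qed

text \<open>What is at distance s before the outgoing point z at time t leaves there at time t + s;
  the trace is the limit as s tends to 0.\<close>

lemma enter_cumul_trace:
 assumes v: "v \<in> Xm" shows "has_trace_plus (enter t (cumul v)) (\<lambda>z. cumul (pass v) (t, z))"
proof (rule has_trace_plus_cumul[OF _ Lp_op_in[OF pass_operator v]])
 have i: "enter t (cumul v) \<in> X" "enter t v \<in> X" using Lp_op_in[OF enter_operator] cumul_Lp[OF sigma_m v] v by auto
 have "(enter t (cumul v), enter t v) \<in> T_max_graph"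
  by (rule mild_imp_T_max[OF i Lp_meas[OF i(1)] _ enter_cumul_mild[OF v]]) simp
 then show "sharp_rep (enter t (cumul v)) (enter t (cumul v))"
  unfolding sharp_rep_iff using Lp_meas[OF i(1)] enter_cumul_mild[OF v] by auto
 have "enter t (cumul v) (\<Phi> z (- s)) = cumul (pass v) (t + s, z)"
  if z: "z \<in> Gam 1" "0 < s" "ereal s < tau (-1) z" for z s
 proof (cases "tau (-1) z")
  case (real L)
  have t': "tau (-1) (\<Phi> z (- s)) = ereal (L - s)" using Gam_orbit(4)[OF z] real by simp
  then have "exit (-1) (\<Phi> z (- s)) = exit (-1) z" unfolding exit_def t' real by (simp add: flow_add)
  then show ?thesis unfolding pass_cumul[symmetric] using real t' by (simp add: enter_def pass_def algebra_simps)
 next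
  case PInf
  then show ?thesis unfolding pass_cumul[symmetric] using Gam_orbit(4)[OF z] by (simp add: enter_def pass_def)
 qed (use z in auto)
 then show "AE z in \<mu>p. \<forall>s. 0 < s --> ereal s < tau (-1) z --> enter t (cumul v) (\<Phi> z (- s)) = cumul (pass v) (t + s, z)"
  using Gam_space(1)[OF mu_plus] by (intro AE_I2) auto
qed

subsection \<open>Identification of the Dyson--Phillips iterates\<close>

lemma nu_pair_AE_eq:
 fixes A B :: "real \<times> 'b => real"
 assumes N: "sigma_finite_measure N" and m: "A \<in> \<B> (\<nu> \<otimes> N)" "B \<in> \<B> (\<nu> \<otimes> N)"
  and ae: "AE y in N. AE r in lborel. 0 < r --> A (r, y) = B (r, y)" shows "AE z in \<nu> \<otimes> N. A z = B z"
proof -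
 define q where "q z = (if A z = B z then 0 else 1 :: ennreal)" for z
 have q: "q \<in> \<B> (\<nu> \<otimes> N)"
 proof -
  have [measurable]: "A \<in> \<B> (borel \<otimes> N)" "B \<in> \<B> (borel \<otimes> N)" using m by (simp_all add: measurable_nu_pair)
  have "q \<in> \<B> (borel \<otimes> N)" unfolding q_def by measurable
  then show ?thesis by (simp add: measurable_nu_pair)
 qed
 have "(\<integral>\<^sup>+z. q z \<partial>(\<nu> \<otimes> N)) = (\<integral>\<^sup>+y. \<integral>\<^sup>+r. ennreal (wt r) * q (r, y) \<partial>lborel \<partial>N)" by (rule nn_integral_nu_pair[OF N q])
 also have "... = (\<integral>\<^sup>+y. 0 \<partial>N)"
 proof (rule nn_integral_cong_AE)
  show "AE y in N. (\<integral>\<^sup>+r. ennreal (wt r) * q (r, y) \<partial>lborel) = 0" using ae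
  proof eventually_elim
   case (elim y)
   have "(\<integral>\<^sup>+r. ennreal (wt r) * q (r, y) \<partial>lborel) = (\<integral>\<^sup>+r. 0 \<partial>(lborel :: real measure))"
    by (rule nn_integral_cong_AE) (use elim in eventually_elim, auto simp: q_def wt_def indicator_def)
   then show ?case by simp
  qed
 qed
 finally have "AE z in \<nu> \<otimes> N. q z = 0" by (simp add: nn_integral_0_iff_AE[OF q])
 then show ?thesis by eventually_elim (auto simp: q_def split: if_splits)
qed

lemma cumul_out0_before:
 assumes "ereal r \<le> tau (-1) z" shows "cumul (out0 g) (r, z) = (LBINT s:{0<..<r}. g (\<Phi> z (- s)))"
 unfolding cumul_def set_lebesgue_integral_def prod.case
proof (rule Bochner_Integration.integral_cong[OF refl])
 fix s :: real
 have "s < r ==> ereal s < tau (-1) z" using assms by (auto intro: less_le_trans[of _ "ereal r"])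
 then show "ind {0<..<r} s *\<^sub>R out0 g (s, z) = ind {0<..<r} s *\<^sub>R g (\<Phi> z (- s))" by (auto simp: indicator_def out0_def)
qed

lemma cumul_out0_after:
 assumes "tau (-1) z = ereal L" "L \<le> r" shows "cumul (out0 g) (r, z) = cumul (out0 g) (L, z)"
 unfolding cumul_def set_lebesgue_integral_def prod.case
 by (rule Bochner_Integration.integral_cong[OF refl]) (use assms in \<open>auto simp: indicator_def out0_def\<close>)

lemma cumul_pass_before:
 assumes "ereal r \<le> tau (-1) z" shows "cumul (pass v) (r, z) = 0"
 unfolding pass_cumul[symmetric] using assms by (auto simp: pass_def)

context
 fixes f fs g b c
 assumes fs: "sharp_rep f fs" and fg: "(f, g) \<in> T_max_graph" and b: "has_trace_plus f b" and c: "has_trace_minus f c"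
begin

lemma trace_plus_formula:
 "AE z in \<mu>p. \<forall>r. 0 < r --> ereal r < tau (-1) z --> fs (\<Phi> z (- r)) = b z + cumul (out0 g) (r, z)"
 using trace_formula[OF mu_plus disjI1[OF refl] fs fg b] by eventually_elim (simp add: cumul_out0_before less_imp_le)

lemma trace_minus_formula:
 "AE y in \<mu>m. \<forall>s. 0 < s --> ereal s < tau 1 y --> fs (\<Phi> y s) = c y - (LBINT r:{0<..<s}. g (\<Phi> y r))"
 using trace_formula[OF mu_minus disjI2[OF refl] fs fg c] by simp

lemma entry_tau:
 assumes "x \<in> \<Omega>" "tau (-1) x = ereal L" shows "0 < L" "ereal L < tau 1 (exit (-1) x)" "\<Phi> (exit (-1) x) r = \<Phi> x (r - L)"
proof -
 show L: "0 < L" using tau_pos[OF assms(1), of "-1"] assms(2) by simp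
 show e: "\<Phi> (exit (-1) x) r = \<Phi> x (r - L)" for r unfolding exit_def assms(2) by (simp add: flow_add algebra_simps)
 have "ereal L \<le> tau 1 (exit (-1) x)"
 proof (rule tau_geI)
  fix s assume "0 < s" "ereal s < ereal L"
  then show "\<Phi> (exit (-1) x) (1 * s) \<in> \<Omega>" using tau_inside[of "L - s" "-1" x] assms(2) e[of s] by simp
 qed
 moreover have "tau 1 (exit (-1) x) \<noteq> ereal L" using tau_outside[of 1 "exit (-1) x" L] e[of L] assms(1) by auto
 ultimately show "ereal L < tau 1 (exit (-1) x)" by (simp add: less_le)
qed

lemma trace_minus_interior:
 "AE x in \<mu>\<Omega>. \<forall>L. tau (-1) x = ereal L --> c (exit (-1) x) = fs x + (LBINT s:{0<..<L}. g (\<Phi> x (- s)))"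
 using AE_Omega_of_AE_Gam[OF mu_minus trace_minus_formula] AE_space[of \<mu>\<Omega>]
proof eventually_elim
 case (elim x)
 then have x: "x \<in> \<Omega>" by simp
 show ?case
 proof (intro allI impI)
  fix L assume L: "tau (-1) x = ereal L"
  note e = entry_tau[OF x L]
  have "fs (\<Phi> (exit (-1) x) L) = c (exit (-1) x) - (LBINT r:{0<..<L}. g (\<Phi> (exit (-1) x) r))"
   using elim L e by auto
  moreover have "(LBINT r:{0<..<L}. g (\<Phi> (exit (-1) x) r)) = (LBINT s:{0<..<L}. g (\<Phi> x (- s)))"
  proof -
   have "{s. L - s \<in> {0<..<L}} = {0<..<L}" by auto
   then show ?thesis using set_integral_reflect(2)[of L "{0<..<L}" "\<lambda>r. g (\<Phi> x (r - L))"] by (simp add: e(3))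
  qed
  ultimately show "c (exit (-1) x) = fs x + (LBINT s:{0<..<L}. g (\<Phi> x (- s)))" by (simp add: e(3))
 qed
qed

text \<open>On a chord of finite length both traces determine f inside it; elimination of f relates
  them through the integral of the derivative over the chord.\<close>

lemma trace_minus_passage: "AE z in \<mu>p. \<forall>L. tau (-1) z = ereal L --> c (exit (-1) z) = b z + cumul (out0 g) (L, z)"
 using AE_passage[OF trace_minus_formula] trace_plus_formula AE_space[of \<mu>p] AE_Gam_integrable[OF mu_plus T_max_Lp(2)[OF fg]]
proof eventually_elim
 case (elim z)
 then have z: "z \<in> Gam 1" using Gam_space(1)[OF mu_plus] by simp
 show ?case
 proof (intro allI impI)
  fix L assume L: "tau (-1) z = ereal L"
  let ?y = "exit (-1) z"
  have t: "tau 1 ?y = ereal L" "0 < L" using Gam_opposite[of z 1 L] z L by auto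
  have e: "\<Phi> ?y r = \<Phi> z (r - L)" for r unfolding exit_def L by (simp add: flow_add algebra_simps)
  \<comment> \<open>The two trace formulas hold strictly inside the chord, so they are compared at
    its midpoint.\<close>
  have 1: "fs (\<Phi> z (- (L / 2))) = c ?y - (LBINT r:{0<..<L/2}. g (\<Phi> z (r - L)))"
   using elim(1) L t e[of "L/2"] by (auto simp: e dest: spec[of _ "L/2"])
  have 2: "fs (\<Phi> z (- (L / 2))) = b z + (LBINT s:{0<..<L/2}. g (\<Phi> z (- s)))"
   using elim(2) L t by (auto simp: cumul_out0_before dest: spec[of _ "L/2"])
  have 3: "(LBINT r:{0<..<L/2}. g (\<Phi> z (r - L))) = (LBINT s:{L/2<..<L}. g (\<Phi> z (- s)))"
  proof -
   have "{s. L - s \<in> {0<..<L/2}} = {L/2<..<L}" by auto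
   then show ?thesis using set_integral_reflect(2)[of L "{0<..<L/2}" "\<lambda>r. g (\<Phi> z (r - L))"] by simp
  qed
  have "{s. 0 < s \<and> ereal s < tau (- 1) z \<and> s \<le> L} = {0<..<L}" using L by auto
  then have i: "lintegrable {0<..<L} (\<lambda>s. g (\<Phi> z (- s)))" using spec[OF elim(4), of L] by simp
  have "lintegrable {0<..<L/2} (\<lambda>s. g (\<Phi> z (- s)))" "lintegrable {L/2<..<L} (\<lambda>s. g (\<Phi> z (- s)))"
   by (rule set_integrable_subset[OF i]; use t(2) in auto)+
  from set_integral_Ioo_combine(2)[OF this] t(2)
  have "(LBINT s:{0<..<L}. g (\<Phi> z (- s))) = (LBINT s:{0<..<L/2}. g (\<Phi> z (- s))) + (LBINT s:{L/2<..<L}. g (\<Phi> z (- s)))"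
   by simp
  then show "c ?y = b z + cumul (out0 g) (L, z)" using 1 2 3 L by (simp add: cumul_out0_before)
 qed
qed

text \<open>The integrated form of the flux balance: the outgoing flux of f with incoming flux
  \<open>c + cumul v\<close> starts from b and has as time derivative the outgoing flux of g with
  incoming flux v. It is used with zero traces for \<open>D0\<close> and with \<open>c = H b\<close>
  for the domain of \<open>T_H_graph\<close>.\<close>

lemma outgoing_flux_eq:
 assumes v: "v \<in> \<B> \<nu>m" shows "AE z in \<nu>p. b (snd z) + (cumul (out0 g) z + cumul (pass v) z)
  = out0 f z + pass (\<lambda>z. c (snd z) + cumul v z) z"
proof (rule nu_pair_AE_eq[OF sigma_p])
 have bm: "b \<in> \<B> \<mu>p" "c \<in> \<B> \<mu>m" using b c by (auto simp: has_trace_def)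
 have o: "out0 g \<in> \<B> \<nu>p" "out0 f \<in> \<B> \<nu>p" using Lp_op_in[OF out0_operator] T_max_Lp[OF fg] Lp_meas by blast+
 show "(\<lambda>z. b (snd z) + (cumul (out0 g) z + cumul (pass v) z)) \<in> \<B> \<nu>p"
  by (intro borel_measurable_add measurable_compose[OF measurable_snd bm(1)] cumul_measurable pass_measurable o v)
 show "(\<lambda>z. out0 f z + pass (\<lambda>z. c (snd z) + cumul v z) z) \<in> \<B> \<nu>p"
  by (intro borel_measurable_add measurable_compose[OF measurable_snd bm(2)] cumul_measurable pass_measurable o v)
 have "AE x in \<mu>\<Omega>. fs x = f x" using fs unfolding sharp_rep_iff by blast
 from AE_Gam_of_AE_Omega[OF mu_plus this] trace_plus_formula trace_minus_passage
 show "AE z in \<mu>p. AE r in lborel. 0 < r --> b (snd (r, z)) + (cumul (out0 g) (r, z) + cumul (pass v) (r, z))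
  = out0 f (r, z) + pass (\<lambda>z. c (snd z) + cumul v z) (r, z)"
 proof eventually_elim
  case (elim z)
  \<comment> \<open>The instant at which r equals the chord length is left out: there neither
    \<open>out0\<close> nor \<open>pass\<close> contributes, while the left-hand side need not
    vanish.\<close>
  from elim(1) AE_lborel_singleton[of "rtau (-1) z"]
  show ?case
  proof (eventually_elim, intro impI)
   fix r :: real
   assume f: "0 < r --> ereal r < tau (- 1) z --> fs (\<Phi> z (- 1 * r)) = f (\<Phi> z (- 1 * r))"
    and ne: "r \<noteq> rtau (- 1) z" and r: "0 < r"
   show "b (snd (r, z)) + (cumul (out0 g) (r, z) + cumul (pass v) (r, z))
    = out0 f (r, z) + pass (\<lambda>z. c (snd z) + cumul v z) (r, z)"
   proof (cases "ereal r < tau (-1) z")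
    case True
    then have "out0 f (r, z) = b z + cumul (out0 g) (r, z)" using f r elim(2) by (simp add: out0_def)
    then show ?thesis using True cumul_pass_before[of r z v] by (simp add: pass_def less_imp_le not_less)
   next
    case False
    then have "tau (-1) z < \<infinity>" by (cases "tau (-1) z") auto
    then obtain L where L: "tau (-1) z = ereal L" "0 \<le> L" by (rule finite_tau)
    have Lr: "L < r" using False L ne by simp
    have "cumul (pass v) (r, z) = cumul v (r - L, exit (-1) z)"
     unfolding pass_cumul[symmetric] using L Lr by (simp add: pass_def)
    moreover have "c (exit (-1) z) = b z + cumul (out0 g) (r, z)"
     using elim(3) L Lr cumul_out0_after[OF L(1), of r g] by simp
    ultimately show ?thesis using L Lr by (simp add: out0_def pass_def)
   qed
  qed
 qed
qed

end

lemma D0E: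
 assumes "f \<in> D0"
 obtains fs g where "sharp_rep f fs" "(f, g) \<in> T_max_graph" "has_trace_plus f (\<lambda>_. 0)" "has_trace_minus f (\<lambda>_. 0)"
proof -
 have t: "has_trace_plus f (\<lambda>_. 0)" "has_trace_minus f (\<lambda>_. 0)" using assms by (auto simp: D0_def)
 then obtain fs where fs: "sharp_rep f fs" by (auto simp: has_trace_def)
 then obtain g where "(f, g) \<in> T_max_graph" unfolding sharp_rep_iff by blast
 with fs t show ?thesis using that by blast
qed

context
 fixes f g
 assumes fD: "f \<in> D0" and fg: "(f, g) \<in> T_max_graph"
begin

lemma fg_Lp: "f \<in> X" "g \<in> X" using T_max_Lp[OF fg] by auto

lemma D0_traces: "has_trace_plus f (\<lambda>_. 0)" "has_trace_minus f (\<lambda>_. 0)" using fD by (auto simp: D0_def)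

lemma D0_out0: "AE z in \<nu>p. out0 f z = cumul (out0 g) z"
proof -
 obtain fs where fs: "sharp_rep f fs" using D0_traces(1) by (auto simp: has_trace_def)
 have p0: "pass (\<lambda>z. 0) = (\<lambda>z. 0)" "cumul (\<lambda>z. 0) = (\<lambda>z. 0)" by (auto simp: pass_def cumul_def fun_eq_iff)
 have "AE z in \<nu>p. 0 + (cumul (out0 g) z + cumul (pass (\<lambda>z. 0)) z) = out0 f z + pass (\<lambda>z. 0 + cumul (\<lambda>z. 0) z) z"
  by (rule outgoing_flux_eq[OF fs fg D0_traces]) simp
 then show ?thesis by eventually_elim (simp add: p0)
qed

text \<open>A zero incoming trace prevents a jump at the front between the transported values and
  the zero behind it, so the translate is again mild. A zero outgoing trace turns the trace into the
  bare time primitive.\<close>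

lemma U_zero_D0:
 assumes t: "0 \<le> t" shows "has_trace_plus (U_zero t f) (\<lambda>z. cumul (out0 g) (t, z))"
proof -
 obtain fs where fs: "sharp_rep f fs" using D0_traces(1) by (auto simp: has_trace_def)
 have fsm: "fs \<in> \<B> \<mu>\<Omega>" and fse: "AE x in \<mu>\<Omega>. fs x = f x" using fs unfolding sharp_rep_iff by auto
 have fsL: "fs \<in> X" by (rule Lp_cong_AE[OF fg_Lp(1) _ fsm]) (use fse in eventually_elim, simp)
 note gL = fg_Lp(2)
 have UL: "U_zero t f \<in> X" "U_zero t g \<in> X" "U_zero t fs \<in> X" using Lp_op_in[OF U_zero_operator[OF t]] fg_Lp fsL by auto
 have Ue: "AE x in \<mu>\<Omega>. U_zero t fs x = U_zero t f x" by (rule Lp_op_cong[OF U_zero_operator[OF t] fsL fg_Lp(1) fse])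
 have "AE x in \<mu>\<Omega>. tau (-1) x < \<infinity> -->
  (\<forall>s. 0 < s --> ereal s < tau 1 (exit (-1) x) --> fs (\<Phi> (exit (-1) x) s) = 0 - (LBINT r:{0<..<s}. g (\<Phi> (exit (-1) x) r)))"
  by (rule AE_Omega_of_AE_Gam[OF mu_minus trace_minus_formula[OF fs fg D0_traces]])
 moreover have "AE x in \<mu>\<Omega>. tau (-1) x < \<infinity> -->
  (\<forall>T. lintegrable {s. 0 < s \<and> ereal s < tau (- (-1)) (exit (-1) x) \<and> s \<le> T} (\<lambda>s. g (\<Phi> (exit (-1) x) (- (-1) * s))))"
  by (rule AE_Omega_of_AE_Gam[OF mu_minus AE_Gam_integrable[OF mu_minus gL]])
 ultimately have m: "mild (U_zero t fs) (U_zero t g)"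
  unfolding mild_def using sharp_rep_mild[OF fs fg, unfolded mild_def] AE_space[of \<mu>\<Omega>]
 proof eventually_elim
  case (elim x)
  then have x: "x \<in> \<Omega>" by simp
  show ?case unfolding mild_at_def
  proof (intro allI impI)
   fix a d assume ad: "a \<in> stay x" "d \<in> stay x" "a \<le> d"
   note I = stay_interval[OF ad(1,2)]
   show "decreases_by (\<lambda>s. U_zero t fs (\<Phi> x s)) (\<lambda>s. U_zero t g (\<Phi> x s)) a d"
   proof (cases "tau (-1) x < \<infinity>")
    case True
    then obtain L where L: "tau (-1) x = ereal L" by (rule finite_tau)
    let ?y = "exit (-1) x" and ?c = "L - t"
    note e = entry_tau(3)[OF fs fg D0_traces x L]
    have t1: "ereal (s + L) < tau 1 ?y" if "s \<in> stay x" for s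
    proof -
     have "ereal (s + L) \<le> tau 1 ?y"
     proof (rule tau_geI)
      fix r assume "0 < r" "ereal r < ereal (s + L)"
      then have "r - L \<in> stay x" using that L unfolding stay_def by (auto intro: less_trans[of _ "ereal s"])
      then show "\<Phi> ?y (1 * r) \<in> \<Omega>" using orbit_in_Omega[OF x] e[of r] by simp
     qed
     moreover have "tau 1 ?y \<noteq> ereal (s + L)"
      using tau_outside[of 1 ?y "s + L"] e[of "s + L"] orbit_in_Omega[OF x that] by auto
     ultimately show ?thesis by (simp add: less_le)
    qed
    have U: "U_zero t h (\<Phi> x s) = (if 0 < s + ?c then h (\<Phi> ?y (s + ?c)) else 0)" if "s \<in> stay x" for h s
     using exit_orbit(1)[OF x that L] by (auto simp: U_zero_def flow_add e algebra_simps)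
    \<comment> \<open>One formula on both sides of the front: for nonpositive \<open>s + ?c\<close>
      the interval of integration is empty.\<close>
    have F: "U_zero t fs (\<Phi> x s) = - (LBINT r:{0<..<s + ?c}. g (\<Phi> ?y r))" if s: "s \<in> stay x" for s
    proof (cases "0 < s + ?c")
     case pos: True
     have "ereal (s + ?c) < tau 1 ?y" using t1[OF s] t by (auto intro: le_less_trans[of _ "ereal (s + L)"])
     then show ?thesis using U[OF s, of fs] pos elim(1) True by simp
    next
     case False
     then have "{0<..<s + ?c} = {}" by auto
     then show ?thesis using U[OF s, of fs] False by (simp only: set_lebesgue_integral_def) simp
    qed
    have "ereal (d + ?c) < tau 1 ?y" using t1[OF ad(2)] t by (auto intro: le_less_trans[of _ "ereal (d + L)"])
    then have se: "{s. 0 < s \<and> ereal s < tau (- (-1)) ?y \<and> s \<le> d + ?c} = {0<..d + ?c}"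
     by (auto intro: le_less_trans[of _ "ereal (d + ?c)"])
    have "lintegrable {s. 0 < s \<and> ereal s < tau (- (-1)) ?y \<and> s \<le> d + ?c} (\<lambda>s. g (\<Phi> ?y (- (-1) * s)))"
     using elim(2) True by blast
    then have "lintegrable {0<..d + ?c} (\<lambda>s. g (\<Phi> ?y s))" unfolding se by simp
    from primitive_decreases_by[OF this, of "a + ?c"] ad(3)
    have "decreases_by (\<lambda>r. - (LBINT s:{0<..<r}. g (\<Phi> ?y s))) (\<lambda>r. if 0 < r then g (\<Phi> ?y r) else 0) (a + ?c) (d + ?c)"
     by simp
    then have "decreases_by (\<lambda>s. - (LBINT r:{0<..<s + ?c}. g (\<Phi> ?y r))) (\<lambda>s. if 0 < s + ?c then g (\<Phi> ?y (s + ?c)) else 0) a d"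
     by (rule decreases_by_shift[THEN iffD2])
    then show ?thesis by (rule decreases_by_cong[THEN iffD1, rotated 3]) (use ad F U I in auto)
   next
    case False
    then have inf: "tau (-1) x = \<infinity>" by simp
    have U: "U_zero t h (\<Phi> x s) = h (\<Phi> x (s + - t))" if "s \<in> stay x" for h s
     using tau_flow(2)[OF x that] inf by (simp add: U_zero_def flow_add)
    have "a + - t \<in> stay x" "d + - t \<in> stay x"
     using ad t inf unfolding stay_def by (auto intro: le_less_trans[of _ "ereal a"] le_less_trans[of _ "ereal d"])
    then have "decreases_by (\<lambda>s. fs (\<Phi> x s)) (\<lambda>s. g (\<Phi> x s)) (a + - t) (d + - t)"
     using elim(3) ad(3) unfolding mild_at_def by simp
    then have "decreases_by (\<lambda>s. fs (\<Phi> x (s + - t))) (\<lambda>s. g (\<Phi> x (s + - t))) a d"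
     by (rule decreases_by_shift[THEN iffD2])
    then show ?thesis by (rule decreases_by_cong[THEN iffD1, rotated 3]) (use ad U I in auto)
   qed
  qed
 qed
 have T: "(U_zero t f, U_zero t g) \<in> T_max_graph" by (rule mild_imp_T_max[OF UL(1,2) Lp_meas[OF UL(3)] Ue m])
 have S: "sharp_rep (U_zero t f) (U_zero t fs)" unfolding sharp_rep_iff using T m Ue Lp_meas[OF UL(3)] by auto
 have oL: "out0 g \<in> Xp" by (rule Lp_op_in[OF out0_operator gL])
 show ?thesis
 proof (rule has_trace_plus_cumul[OF S oL])
  show "AE z in \<mu>p. \<forall>s. 0 < s --> ereal s < tau (-1) z --> U_zero t fs (\<Phi> z (- s)) = cumul (out0 g) (t + s, z)"
   using trace_plus_formula[OF fs fg D0_traces] trace_minus_passage[OF fs fg D0_traces] AE_space[of \<mu>p]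
  proof eventually_elim
   case (elim z)
   then have z: "z \<in> Gam 1" using Gam_space(1)[OF mu_plus] by simp
   show ?case
   proof (intro allI impI)
    fix s assume s: "0 < s" "ereal s < tau (-1) z"
    note o = Gam_orbit(4)[OF z s]
    show "U_zero t fs (\<Phi> z (- s)) = cumul (out0 g) (t + s, z)"
    proof (cases "ereal (t + s) < tau (-1) z")
     case True
     then have "ereal t < tau (-1) (\<Phi> z (- s))" using o by (cases "tau (-1) z") auto
     then have "U_zero t fs (\<Phi> z (- s)) = fs (\<Phi> z (- (t + s)))" by (simp add: U_zero_def flow_add add.commute)
     then show ?thesis using spec[OF elim(1), of "t + s"] True s t by simp
    next
     case False
     then have "tau (-1) z < \<infinity>" by (cases "tau (-1) z") auto
     then obtain L where L: "tau (-1) z = ereal L" "0 \<le> L" by (rule finite_tau)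
     then have "cumul (out0 g) (t + s, z) = 0" using cumul_out0_after[OF L(1), of "t + s" g] False elim(2) by simp
     then show ?thesis using o L False by (simp add: U_zero_def)
    qed
   qed
  qed
 qed
qed

end

text \<open>The flux that enters for the (k+1)-st time. The index is one behind that of the
  Dyson--Phillips term it produces, as \<open>Uk\<close> shows.\<close>

definition vk :: "nat => ('a => real) => real \<times> 'a => real" where "vk k f = (loop ^^ k) (HL.lift (out0 f))"

definition Gk :: "nat => ('a => real) => real \<times> 'a => real" where
 "Gk k f = (case k of 0 => out0 f | Suc k => pass (vk k f))"

definition Uk :: "nat => real => ('a => real) => 'a => real" where
 "Uk k t = (case k of 0 => U_zero t | Suc k => (\<lambda>f. enter t (vk k f)))"

lemma vk_lift: "vk k f = HL.lift (Gk k f)" by (cases k) (auto simp: vk_def Gk_def loop_def)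

lemma vk_operator: "Lp_op p \<mu>\<Omega> \<nu>m (vk k)"
proof (induction k)
 case 0
 show ?case unfolding vk_def[abs_def] by simp (rule Lp_op_compose[OF p1 out0_operator HL.lift_operator])
next
 case (Suc k)
 have "vk (Suc k) = (\<lambda>f. loop (vk k f))" by (auto simp: vk_def fun_eq_iff)
 then show ?case using Lp_op_compose[OF p1 Suc loop_operator] by simp
qed

lemma Gk_Lp: "f \<in> X ==> Gk k f \<in> Xp"
 using Lp_op_in[OF out0_operator] Lp_op_in[OF pass_operator Lp_op_in[OF vk_operator]] by (cases k) (auto simp: Gk_def)

lemma Uk_operator: "0 \<le> t ==> Lp_op p \<mu>\<Omega> \<mu>\<Omega> (Uk k t)"
 using U_zero_operator Lp_op_compose[OF p1 vk_operator enter_operator] by (cases k) (auto simp: Uk_def)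

lemma vk_cumul:
 assumes fD: "f \<in> D0" and fg: "(f, g) \<in> T_max_graph" shows "AE z in \<nu>m. vk k f z = cumul (vk k g) z"
proof (induction k)
 case 0
 note L = fg_Lp[OF fD fg]
 have "AE z in \<nu>m. HL.lift (out0 f) z = HL.lift (cumul (out0 g)) z"
  by (rule Lp_op_cong[OF HL.lift_operator Lp_op_in[OF out0_operator L(1)]
     cumul_Lp[OF sigma_p Lp_op_in[OF out0_operator L(2)]] D0_out0[OF fD fg]])
 then show ?case using lift_cumul[OF Lp_op_in[OF out0_operator L(2)]] by eventually_elim (simp add: vk_def)
next
 case (Suc k)
 note L = fg_Lp[OF fD fg]
 have vg: "vk k g \<in> Xm" by (rule Lp_op_in[OF vk_operator L(2)])
 have "AE z in \<nu>m. loop (vk k f) z = loop (cumul (vk k g)) z"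
  by (rule Lp_op_cong[OF loop_operator Lp_op_in[OF vk_operator L(1)]
     cumul_Lp[OF sigma_m vg] Suc])
 then show ?case using loop_cumul[OF vg] by eventually_elim (simp add: vk_def)
qed

text \<open>The trace is carried through the induction, because the next step is meaningful only if
  the current trace exists at each time. It is a primitive of the outgoing flux of g, hence an
  element of Lp for every t.\<close>

lemma U_pre_Uk:
 assumes fD: "f \<in> D0" and fg: "(f, g) \<in> T_max_graph" and t: "0 \<le> t"
 shows "(AE x in \<mu>\<Omega>. U_pre k t f x = Uk k t f x) \<and> has_trace_plus (U_pre k t f) (\<lambda>z. cumul (Gk k g) (t, z))" using t
proof (induction k arbitrary: t)
 case 0
 then show ?case using U_zero_D0[OF fD fg] by (simp add: Uk_def Gk_def)
next
 case (Suc k)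
 note L = fg_Lp[OF fD fg]
 have vg: "vk k g \<in> Xm" by (rule Lp_op_in[OF vk_operator L(2)])
 have cv: "cumul (vk k g) \<in> Xm" by (rule cumul_Lp[OF sigma_m vg])
 have Gg: "Gk k g \<in> Xp" by (rule Gk_Lp[OF L(2)])
 let ?W = "\<lambda>r. U_pre k r f"
 \<comment> \<open>The integrated flux is an admissible jointly measurable version, so the choice
   made in \<open>U_pre\<close> is not vacuous.\<close>
 have "H_trace_version ?W (\<lambda>r y. cumul (vk k g) (r, y))" unfolding H_trace_version_def
 proof (intro conjI allI impI)
  show "(\<lambda>(r, y). cumul (vk k g) (r, y)) \<in> \<B> (borel \<otimes> \<mu>m)" using Lp_meas[OF cv] by (simp add: measurable_nu_pair)
  fix r :: real assume "0 \<le> r"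
  then show "\<exists>b\<in>Lp p \<mu>p. has_trace_plus (U_pre k r f) b \<and> (AE y in \<mu>m. cumul (vk k g) (r, y) = H b y)"
   using Suc.IH[of r] cumul_lift[OF Gg, of r] cumul_slice_Lp(1)[OF sigma_p Gg, of r]
   by (intro bexI[of _ "\<lambda>z. cumul (Gk k g) (r, z)"]) (auto simp: vk_lift)
 qed
 then have V: "H_trace_version ?W (SOME V. H_trace_version ?W V)" by (rule someI[where P="H_trace_version ?W"])
 define V where "V = (SOME V. H_trace_version ?W V)"
 have Vm: "(\<lambda>(r, y). V r y) \<in> \<B> \<nu>m" using V unfolding V_def H_trace_version_def by (simp add: measurable_nu_pair)
 \<comment> \<open>Whichever version was chosen, uniqueness of traces forces it to agree with the
   integrated flux at each nonnegative time.\<close>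
 have VH: "AE y in \<mu>m. V r y = cumul (vk k g) (r, y)" if r: "0 \<le> r" for r
 proof -
  obtain b where b: "b \<in> Lp p \<mu>p" "has_trace_plus (U_pre k r f) b" "AE y in \<mu>m. V r y = H b y"
   using V r unfolding V_def H_trace_version_def by blast
  have be: "AE z in \<mu>p. b z = cumul (Gk k g) (r, z)"
   using trace_unique[OF mu_plus disjI1[OF refl] b(2)] Suc.IH[OF r] by blast
  show ?thesis using b(3) cumul_lift[OF Gg, of r] Lp_op_cong[OF H b(1) cumul_slice_Lp(1)[OF sigma_p Gg] be]
   by eventually_elim (simp add: vk_lift)
 qed
 have "AE z in \<nu>m. (\<lambda>(r, y). V r y) z = cumul (vk k g) z"
 proof (rule HL.P2.AE_pair_measure)
  have [measurable]: "(\<lambda>(r, y). V r y) \<in> \<B> (borel \<otimes> \<mu>m)" "cumul (vk k g) \<in> \<B> (borel \<otimes> \<mu>m)"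
   using Vm Lp_meas[OF cv] by (simp_all add: measurable_nu_pair)
  moreover have "sets \<nu>m = sets (borel \<otimes> \<mu>m)" by (rule sets_pair_measure_cong) auto
  ultimately show "{z \<in> space \<nu>m. (\<lambda>(r, y). V r y) z = cumul (vk k g) z} \<in> sets \<nu>m" by (simp add: space_pair_measure)
  show "AE r in \<nu>. AE y in \<mu>m. (\<lambda>(r, y). V r y) (r, y) = cumul (vk k g) (r, y)"
   unfolding AE_nu using VH by (intro AE_I2) simp
 qed
 from enter_AE[OF Vm Lp_meas[OF cv] this, of t]
 have e1: "AE x in \<mu>\<Omega>. enter t (\<lambda>(r, y). V r y) x = enter t (cumul (vk k g)) x" .
 have Ue: "U_pre (Suc k) t f = enter t (\<lambda>(r, y). V r y)" by (auto simp: enter_def exit_def V_def fun_eq_iff)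
 have e2: "AE x in \<mu>\<Omega>. enter t (vk k f) x = enter t (cumul (vk k g)) x"
  by (rule enter_AE[OF Lp_meas[OF Lp_op_in[OF vk_operator L(1)]] Lp_meas[OF cv] vk_cumul[OF fD fg]])
 have "AE x in \<mu>\<Omega>. U_pre (Suc k) t f x = Uk (Suc k) t f x"
  unfolding Ue using e1 e2 by eventually_elim (simp add: Uk_def)
 moreover have "has_trace_plus (U_pre (Suc k) t f) (\<lambda>z. cumul (Gk (Suc k) g) (t, z))"
 proof (rule has_trace_cong[OF _ _ enter_measurable[OF Vm, of t, folded Ue]])
  show "has_trace_plus (enter t (cumul (vk k g))) (\<lambda>z. cumul (Gk (Suc k) g) (t, z))"
   using enter_cumul_trace[OF vg, of t] by (simp add: Gk_def)
  show "AE x in \<mu>\<Omega>. enter t (cumul (vk k g)) x = U_pre (Suc k) t f x" unfolding Ue using e1 by eventually_elim simp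
 qed
 ultimately show ?case by blast
qed

text \<open>Agreement on \<open>D0\<close> spreads to the whole space by density; it identifies the
  chosen bounded extension in \<open>U\<close> with the explicit operator \<open>Uk\<close>.\<close>

lemma operators_agree:
 assumes T: "Lp_op p \<mu>\<Omega> \<mu>\<Omega> T" and S: "Lp_op p \<mu>\<Omega> \<mu>\<Omega> S" and D: "\<And>f. f \<in> D0 ==> AE x in \<mu>\<Omega>. T f x = S f x" and f: "f \<in> X"
 shows "AE x in \<mu>\<Omega>. T f x = S f x" using f
proof (induction f rule: D0_induct)
 case (D0 f) then show ?case by (rule D)
next
 case (add f g)
 show ?case using add(3,4) Lp_op_add[OF T add(1,2)] Lp_op_add[OF S add(1,2)] by eventually_elim simp
next
 case (scale f c)
 show ?case using scale(2) Lp_op_scale[OF T scale(1), of c] Lp_op_scale[OF S scale(1), of c] by eventually_elim simp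
next
 case (lim f g)
 have l1: "(\<lambda>n. norm_X (\<lambda>x. T (f n) x - T g x)) ----> 0" by (rule Lp_op_lim[OF p1 T lim(1-3)])
 have l2: "(\<lambda>n. norm_X (\<lambda>x. S (f n) x - S g x)) ----> 0" by (rule Lp_op_lim[OF p1 S lim(1-3)])
 have "norm_X (\<lambda>x. T (f n) x - S g x) = norm_X (\<lambda>x. S (f n) x - S g x)" for n
 proof (rule Lp_norm_cong_AE)
  show "AE x in \<mu>\<Omega>. T (f n) x - S g x = S (f n) x - S g x" using lim(4)[of n] by eventually_elim simp
 qed (intro borel_measurable_diff Lp_meas[OF Lp_op_in[OF T lim(1)]] Lp_meas[OF Lp_op_in[OF S lim(1)]] Lp_meas[OF Lp_op_in[OF S lim(2)]])+
 then have l3: "(\<lambda>n. norm_X (\<lambda>x. T (f n) x - S g x)) ----> 0" using l2 by simp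
 show ?case by (rule Lp_lim_unique[OF p1 Lp_op_in[OF T lim(1)] Lp_op_in[OF T lim(2)] Lp_op_in[OF S lim(2)] l1 l3])
qed

lemma U_Uk:
 assumes t: "0 \<le> t" shows "Lp_op p \<mu>\<Omega> \<mu>\<Omega> (U k t)" and "f \<in> X ==> AE x in \<mu>\<Omega>. U k t f x = Uk k t f x"
proof -
 have ag: "AE x in \<mu>\<Omega>. U_pre k t f x = Uk k t f x" if fD: "f \<in> D0" for f
 proof -
  obtain g where "(f, g) \<in> T_max_graph" using D0E[OF fD] by blast
  then show ?thesis using U_pre_Uk[OF fD _ t] by blast
 qed
 have P: "Lp_op p \<mu>\<Omega> \<mu>\<Omega> (U k t) \<and> (\<forall>f\<in>D0. AE x in \<mu>\<Omega>. U k t f x = U_pre k t f x)" if "k \<noteq> 0"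
 proof -
  have "Lp_op p \<mu>\<Omega> \<mu>\<Omega> (Uk k t) \<and> (\<forall>f\<in>D0. AE x in \<mu>\<Omega>. Uk k t f x = U_pre k t f x)"
  proof (intro conjI ballI Uk_operator t)
   fix f assume "f \<in> D0"
   from ag[OF this] show "AE x in \<mu>\<Omega>. Uk k t f x = U_pre k t f x" by eventually_elim simp
  qed
  then have "\<exists>T. Lp_op p \<mu>\<Omega> \<mu>\<Omega> T \<and> (\<forall>f\<in>D0. AE x in \<mu>\<Omega>. T f x = U_pre k t f x)" by blast
  from someI_ex[OF this] show ?thesis using that by (simp add: U_def)
 qed
 show U: "Lp_op p \<mu>\<Omega> \<mu>\<Omega> (U k t)" using P U_zero_operator[OF t] by (cases "k = 0") (auto simp: U_def)
 show "AE x in \<mu>\<Omega>. U k t f x = Uk k t f x" if f: "f \<in> X"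
 proof (cases "k = 0")
  case True then show ?thesis by (simp add: U_def Uk_def)
 next
  case False
  show ?thesis
  proof (rule operators_agree[OF U Uk_operator[OF t] _ f])
   fix f assume fD: "f \<in> D0"
   have "AE x in \<mu>\<Omega>. U k t f x = U_pre k t f x" using P[OF False] fD by blast
   then show "AE x in \<mu>\<Omega>. U k t f x = Uk k t f x" using ag[OF fD] by eventually_elim simp
  qed
 qed
qed

end

subsection \<open>The sum of the Dyson--Phillips series\<close>

context transport_semigroup
begin

text \<open>The incoming flux: \<open>flux f (r, y)\<close> is the value at time \<open>r\<close> and at the boundary point \<open>y\<close>.\<close>

definition flux :: "('a => real) => real \<times> 'a => real" where "flux f z = (\<Sum>k. vk k f z)"

text \<open>The explicit candidate for the sum of the series. \<open>U_H\<close>, a choice of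
  operator, agrees with it almost everywhere.\<close>

definition evol :: "real => ('a => real) => 'a => real" where "evol t f x = U_zero t f x + enter t (flux f) x"

lemma vk_bound:
 obtains q C where "0 \<le> q" "q < 1" "0 \<le> C" "\<And>k f. f \<in> X ==> norm_m (vk k f) \<le> C * q ^ k * norm_X f"
proof -
 obtain q where q: "0 \<le> q" "q < 1" "\<And>v. v \<in> Xm ==> norm_m (loop v) \<le> q * norm_m v" by (rule loop_contraction) blast
 obtain C where C: "0 \<le> C" "\<And>f. f \<in> X ==> norm_m (vk 0 f) \<le> C * norm_X f"
  using Lp_opnorm_nonneg[OF vk_operator[of 0]] Lp_norm_le_opnorm[OF p1 vk_operator[of 0]] by blast
 have "norm_m (vk k f) \<le> C * q ^ k * norm_X f" if f: "f \<in> X" for k f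
 proof (induction k)
  case 0 show ?case using C(2)[OF f] by simp
 next
  case (Suc k)
  have "norm_m (vk (Suc k) f) \<le> q * norm_m (vk k f)" using q(3)[OF Lp_op_in[OF vk_operator f]] by (simp add: vk_def)
  also have "... \<le> q * (C * q ^ k * norm_X f)" by (rule mult_left_mono[OF Suc q(1)])
  finally show ?case by (simp add: mult_ac)
 qed
 with q(1,2) C(1) show ?thesis by (rule that)
qed

lemma flux_operator: "Lp_op p \<mu>\<Omega> \<nu>m flux"
proof -
 obtain q C where q: "0 \<le> q" "q < 1" "0 \<le> C" "\<And>k f. f \<in> X ==> norm_m (vk k f) \<le> C * q ^ k * norm_X f"
  by (rule vk_bound) blast
 have sm: "summable (\<lambda>k. C * q ^ k)" using q by (intro summable_mult summable_geometric) simp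
 show ?thesis unfolding flux_def[abs_def]
  by (rule Lp_op_suminf[where c="\<lambda>k. C * q ^ k", OF p1 vk_operator]; fact q(4) sm)
qed

lemmas flux_Lp = Lp_op_in[OF flux_operator]

lemma flux_fixed_point:
 assumes f: "f \<in> X" shows "AE z in \<nu>m. flux f z = HL.lift (out0 f) z + loop (flux f) z"
proof -
 obtain q where q: "0 \<le> q" "q < 1" "\<And>v. v \<in> Xm ==> norm_m (loop v) \<le> q * norm_m v" by (rule loop_contraction) blast
 have "flux f = (\<lambda>z. \<Sum>k. (loop ^^ k) (HL.lift (out0 f)) z)" by (auto simp: flux_def vk_def fun_eq_iff)
 then show ?thesis
  using Neumann_series[OF p1 loop_operator q Lp_op_in[OF HL.lift_operator Lp_op_in[OF out0_operator f]]] by simp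
qed

text \<open>The contraction characterises the flux of f by its fixed-point equation alone; each
  later identity between fluxes is proved by checking that equation.\<close>

lemma flux_unique:
 assumes f: "f \<in> X" and v: "v \<in> Xm" "AE z in \<nu>m. v z = HL.lift (\<lambda>z. out0 f z + pass v z) z"
 shows "AE z in \<nu>m. v z = flux f z"
proof -
 obtain q where q: "0 \<le> q" "q < 1" "\<And>v. v \<in> Xm ==> norm_m (loop v) \<le> q * norm_m v" by (rule loop_contraction) blast
 have e: "AE z in \<nu>m. v z = HL.lift (out0 f) z + loop v z"
  using v(2) Lp_op_add[OF HL.lift_operator Lp_op_in[OF out0_operator f] Lp_op_in[OF pass_operator v(1)]]
  by eventually_elim (simp add: loop_def)
 show ?thesis
  by (rule contraction_fixed_point_unique[OF p1 loop_operator q(2,3) v(1) e flux_Lp[OF f] flux_fixed_point[OF f]])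
qed

definition outflux :: "('a => real) => real \<times> 'a => real" where "outflux f z = out0 f z + pass (flux f) z"

lemma outflux_Lp: "f \<in> X ==> outflux f \<in> Xp" unfolding outflux_def[abs_def]
 by (intro Lp_add[OF p1] Lp_op_in[OF out0_operator] Lp_op_in[OF pass_operator] flux_Lp)

lemma lift_outflux:
 assumes f: "f \<in> X" shows "AE z in \<nu>m. flux f z = HL.lift (outflux f) z"
 using flux_fixed_point[OF f] Lp_op_add[OF HL.lift_operator Lp_op_in[OF out0_operator f] Lp_op_in[OF pass_operator flux_Lp[OF f]]]
 unfolding outflux_def[abs_def] by eventually_elim (simp add: loop_def)

lemma evol_operator: "0 \<le> t ==> Lp_op p \<mu>\<Omega> \<mu>\<Omega> (evol t)" unfolding evol_def[abs_def]
 by (rule Lp_op_plus[OF p1 U_zero_operator Lp_op_compose[OF p1 flux_operator enter_operator]])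

lemmas evol_Lp = Lp_op_in[OF evol_operator]

lemma evol_norm:
 obtains C where "0 \<le> C" "\<And>t f. 0 \<le> t ==> f \<in> X ==> norm_X (evol t f) \<le> C * exp (lam * t) * norm_X f"
proof -
 let ?c = "Lp_opnorm p \<mu>\<Omega> \<nu>m flux"
 have c0: "0 \<le> ?c" by (rule Lp_opnorm_nonneg[OF flux_operator])
 show ?thesis
 proof (rule that[of "1 + ?c"])
  show "0 \<le> 1 + ?c" using c0 by simp
  fix t f assume t: "0 \<le> (t::real)" and f: "f \<in> X"
  have "norm_X (evol t f) \<le> norm_X (U_zero t f) + norm_X (enter t (flux f))" unfolding evol_def[abs_def]
   by (rule Lp_norm_triangle[OF p1 Lp_op_in[OF U_zero_operator[OF t] f] Lp_op_in[OF enter_operator flux_Lp[OF f]]])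
  also have "norm_X (U_zero t f) \<le> exp (lam * t) * norm_X f"
  proof -
   have "0 \<le> lam * t" using lam(1) t by simp
   then have "1 * norm_X f \<le> exp (lam * t) * norm_X f" by (intro mult_right_mono) auto
   then show ?thesis using U_zero_norm[OF t f] by simp
  qed
  also have "norm_X (enter t (flux f)) \<le> exp (lam * t) * (?c * norm_X f)"
   using order_trans[OF enter_norm[OF flux_Lp[OF f]] mult_left_mono[OF Lp_norm_le_opnorm[OF p1 flux_operator f]]] by simp
  finally show "norm_X (evol t f) \<le> (1 + ?c) * exp (lam * t) * norm_X f" by (simp add: algebra_simps)
 qed
qed

lemma Uk_Suc_norm:
 assumes v: "norm_m v \<le> b" "v \<in> Xm" shows "norm_X (enter t v) \<le> exp (lam * t) * b"
 by (rule order_trans[OF enter_norm[OF v(2)] mult_left_mono[OF v(1)]]) simp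

lemma summable_opnorm_U:
 assumes t: "0 \<le> t" shows "summable (\<lambda>k. Lp_opnorm p \<mu>\<Omega> \<mu>\<Omega> (U k t))"
proof -
 obtain q C where q: "0 \<le> q" "q < 1" "0 \<le> C" "\<And>k f. f \<in> X ==> norm_m (vk k f) \<le> C * q ^ k * norm_X f"
  by (rule vk_bound) blast
 have le: "Lp_opnorm p \<mu>\<Omega> \<mu>\<Omega> (U (Suc k) t) \<le> exp (lam * t) * C * q ^ k" for k
 proof (rule Lp_opnorm_le)
  show "0 \<le> exp (lam * t) * C * q ^ k" using q by simp
  fix f assume f: "f \<in> X"
  have "norm_X (U (Suc k) t f) = norm_X (Uk (Suc k) t f)"
   by (rule Lp_norm_cong_AE[OF U_Uk(2)[OF t f] Lp_meas[OF Lp_op_in[OF U_Uk(1)[OF t] f]]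
      Lp_meas[OF Lp_op_in[OF Uk_operator[OF t] f]]])
  also have "... \<le> exp (lam * t) * (C * q ^ k * norm_X f)"
   using Uk_Suc_norm[OF q(4)[OF f] Lp_op_in[OF vk_operator f]] by (simp add: Uk_def)
  finally show "norm_X (U (Suc k) t f) \<le> exp (lam * t) * C * q ^ k * norm_X f" by (simp add: mult_ac)
 qed
 have "summable (\<lambda>k. exp (lam * t) * C * q ^ k)" using q by (intro summable_mult summable_geometric) simp
 then have "summable (\<lambda>k. Lp_opnorm p \<mu>\<Omega> \<mu>\<Omega> (U (Suc k) t))"
  by (rule summable_comparison_test'[where N=0]) (use le Lp_opnorm_nonneg[OF U_Uk(1)[OF t]] in auto)
 then show ?thesis using summable_Suc_iff[of "\<lambda>k. Lp_opnorm p \<mu>\<Omega> \<mu>\<Omega> (U k t)"] by blast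
qed

lemma flux_tail:
 assumes q: "0 \<le> q" "q < 1" "0 \<le> C" "\<And>k f. f \<in> X ==> norm_m (vk k f) \<le> C * q ^ k * norm_X f" and f: "f \<in> X"
 shows "(\<lambda>z. flux f z - (\<Sum>k<n. vk k f z)) \<in> Xm"
  "norm_m (\<lambda>z. flux f z - (\<Sum>k<n. vk k f z)) \<le> C * q ^ n / (1 - q) * norm_X f"
proof -
 let ?d = "\<lambda>n z. flux f z - (\<Sum>k<n. vk k f z)"
 let ?n = "norm_m" and ?c = "C * norm_X f"
 have v: "vk k f \<in> Xm" for k by (rule Lp_op_in[OF vk_operator f])
 have le: "?n (vk (k + m) f) \<le> ?c * q ^ m * q ^ k" for k m using q(4)[OF f, of "k + m"] by (simp add: power_add mult_ac)
 have g: "(\<lambda>k. ?c * q ^ m * q ^ k) sums (?c * q ^ m * (1 / (1 - q)))" for m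
  using q by (intro sums_mult geometric_sums) simp
 have sm: "summable (\<lambda>k. ?n (vk (k + m) f))" for m
  by (rule summable_comparison_test'[OF sums_summable[OF g[of m]], where N=0]) (use le in auto)
 show m: "(?d n) \<in> Xm" by (rule Lp_diff[OF p1 flux_Lp[OF f] Lp_sum(1)[OF p1 v]])
 have "AE z in \<nu>m. summable (\<lambda>k. vk k f z)" using Lp_series(1)[OF p1 v, of id] sm[of 0] by simp
 then have "AE z in \<nu>m. flux f z - (\<Sum>k<n. vk k f z) = (\<Sum>k. vk (k + n) f z)"
  by eventually_elim (simp add: flux_def suminf_minus_initial_segment[where f="\<lambda>k. vk k f _"])
 then have "?n (?d n) = ?n (\<lambda>z. \<Sum>k. vk (k + n) f z)"
  by (rule Lp_norm_cong_AE[OF _ Lp_meas[OF m] Lp_meas[OF Lp_series(3)[OF p1 v sm]]])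
 also have "... \<le> (\<Sum>k. ?n (vk (k + n) f))" by (rule Lp_series(5)[OF p1 v sm])
 also have "... \<le> (\<Sum>k. ?c * q ^ n * q ^ k)" by (rule suminf_le[OF le sm sums_summable[OF g]])
 also have "... = ?c * q ^ n * (1 / (1 - q))" by (rule sums_unique[OF g, symmetric])
 finally show "?n (?d n) \<le> C * q ^ n / (1 - q) * norm_X f" by (simp add: mult_ac)
qed

text \<open>The remainder is \<open>enter\<close> applied to the tail of the flux, which is bounded
  by a geometric series.\<close>

lemma evol_partial_sums:
 assumes t: "0 \<le> t" shows "(\<lambda>n. Lp_opnorm p \<mu>\<Omega> \<mu>\<Omega> (\<lambda>f x. evol t f x - (\<Sum>k<n. U k t f x))) ----> 0"
proof -
 obtain q C where q: "0 \<le> q" "q < 1" "0 \<le> C" "\<And>k f. f \<in> X ==> norm_m (vk k f) \<le> C * q ^ k * norm_X f"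
  by (rule vk_bound) blast
 let ?D = "\<lambda>n f x. evol t f x - (\<Sum>k<n. U k t f x)"
 have D: "Lp_op p \<mu>\<Omega> \<mu>\<Omega> (?D n)" for n by (rule Lp_op_minus[OF p1 evol_operator[OF t] Lp_op_sum[OF p1 U_Uk(1)[OF t]]])
 have le: "Lp_opnorm p \<mu>\<Omega> \<mu>\<Omega> (?D (Suc n)) \<le> exp (lam * t) * C / (1 - q) * q ^ n" for n
 proof (rule Lp_opnorm_le)
  show "0 \<le> exp (lam * t) * C / (1 - q) * q ^ n" using q by simp
  fix f assume f: "f \<in> X"
  let ?w = "\<lambda>z. flux f z - (\<Sum>k<n. vk k f z)"
  note w = flux_tail[OF q f, of n]
  have "AE x in \<mu>\<Omega>. \<forall>k. U k t f x = Uk k t f x" using U_Uk(2)[OF t f] by (simp add: AE_all_countable)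
  then have "AE x in \<mu>\<Omega>. ?D (Suc n) f x = enter t ?w x"
  proof eventually_elim
   case (elim x)
   \<comment> \<open>The index shift: the zeroth term is free transport, so n + 1 terms of the
     series leave the flux without its first n terms.\<close>
   have "(\<Sum>k<Suc n. U k t f x) = U_zero t f x + (\<Sum>k<n. enter t (vk k f) x)"
    using elim by (simp add: sum.lessThan_Suc_shift Uk_def del: sum.lessThan_Suc)
   then show ?case by (simp add: evol_def enter_def)
  qed
  then have "norm_X (?D (Suc n) f) = norm_X (enter t ?w)"
   by (rule Lp_norm_cong_AE[OF _ Lp_meas[OF Lp_op_in[OF D f]] Lp_meas[OF Lp_op_in[OF enter_operator w(1)]]])
  also have "... \<le> exp (lam * t) * (C * q ^ n / (1 - q) * norm_X f)" by (rule Uk_Suc_norm[OF w(2,1)])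
  finally show "norm_X (?D (Suc n) f) \<le> exp (lam * t) * C / (1 - q) * q ^ n * norm_X f" by (simp add: mult_ac)
 qed
 have l: "(\<lambda>n. exp (lam * t) * C / (1 - q) * q ^ n) ----> 0" using q by (intro tendsto_mult_right_zero LIMSEQ_power_zero) simp
 have "(\<lambda>n. Lp_opnorm p \<mu>\<Omega> \<mu>\<Omega> (?D (Suc n))) ----> 0"
  by (rule tendsto_sandwich[OF always_eventually always_eventually tendsto_const l]) (intro allI le Lp_opnorm_nonneg D)+
 then show ?thesis by (rule LIMSEQ_imp_Suc)
qed

text \<open>Both operators are limits of the same partial sums in operator norm, hence agree on each
  f up to a null set.\<close>

lemma U_H_evol:
 assumes t: "0 \<le> t" shows "Lp_op p \<mu>\<Omega> \<mu>\<Omega> (U_H t)" and "f \<in> X ==> AE x in \<mu>\<Omega>. U_H t f x = evol t f x"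
proof -
 let ?D = "\<lambda>T n f x. T f x - (\<Sum>k<n. U k t f x)"
 let ?P = "\<lambda>T. Lp_op p \<mu>\<Omega> \<mu>\<Omega> T \<and> (\<lambda>n. Lp_opnorm p \<mu>\<Omega> \<mu>\<Omega> (?D T n)) ----> 0"
 have E: "?P (evol t)" using evol_operator[OF t] evol_partial_sums[OF t] by blast
 then have P: "?P (U_H t)" unfolding U_H_def by (rule someI[where P="?P"])
 then show U: "Lp_op p \<mu>\<Omega> \<mu>\<Omega> (U_H t)" by blast
 show "AE x in \<mu>\<Omega>. U_H t f x = evol t f x" if f: "f \<in> X"
 proof -
  have D: "Lp_op p \<mu>\<Omega> \<mu>\<Omega> (?D T n)" if "Lp_op p \<mu>\<Omega> \<mu>\<Omega> T" for T n
   by (rule Lp_op_minus[OF p1 that Lp_op_sum[OF p1 U_Uk(1)[OF t]]])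
  have s: "(\<lambda>x. \<Sum>k<n. U k t f x) \<in> X" for n by (rule Lp_op_in[OF Lp_op_sum[OF p1 U_Uk(1)[OF t]] f])
  have c: "(\<lambda>n. norm_X (\<lambda>x. (\<Sum>k<n. U k t f x) - T f x)) ----> 0" if T: "?P T" for T
  proof (rule tendsto_sandwich[OF _ _ tendsto_const])
   show "(\<lambda>n. Lp_opnorm p \<mu>\<Omega> \<mu>\<Omega> (?D T n) * norm_X f) ----> 0" using T by (intro tendsto_mult_left_zero) blast
   show "\<forall>\<^sub>F n in sequentially. norm_X (\<lambda>x. (\<Sum>k<n. U k t f x) - T f x) \<le> Lp_opnorm p \<mu>\<Omega> \<mu>\<Omega> (?D T n) * norm_X f"
    unfolding Lp_norm_minus_commute[of p \<mu>\<Omega> "\<lambda>x. \<Sum>k<_. U k t f x"]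
    using Lp_norm_le_opnorm[OF p1 D f] T by (intro always_eventually allI) blast
  qed simp
  show ?thesis by (rule Lp_lim_unique[OF p1 s Lp_op_in[OF U f] evol_Lp[OF t f] c[OF P] c[OF E]])
 qed
qed

section \<open>The semigroup law\<close>

definition shift :: "real => (real \<times> 'a => real) => real \<times> 'a => real" where "shift t v = (\<lambda>(r, y). v (r + t, y))"

lemma shift_Lp:
 assumes t: "0 \<le> t" and v: "v \<in> Xm" shows "shift t v \<in> Xm"
proof -
 let ?e = "ennreal (exp (lam * p * t))" and ?h = "\<lambda>y r. ennreal (wt r) * ennreal (\<bar>v (r, y)\<bar> powr p)"
 let ?I = "\<lambda>y. \<integral>\<^sup>+r. ?h y r \<partial>lborel"
 have vb [measurable]: "v \<in> \<B> (borel \<otimes> \<mu>m)" using Lp_meas[OF v] by (simp add: measurable_nu_pair)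
 have "shift t v \<in> \<B> (borel \<otimes> \<mu>m)" unfolding shift_def case_prod_unfold by measurable
 then have m: "shift t v \<in> \<B> \<nu>m" by (simp add: measurable_nu_pair)
 have "Lp_nn p \<nu>m (shift t v) = (\<integral>\<^sup>+y. \<integral>\<^sup>+r. ennreal (wt r) * ennreal (\<bar>v (r + t, y)\<bar> powr p) \<partial>lborel \<partial>\<mu>m)"
  using nn_integral_nu_pair[OF sigma_m ennreal_powr_measurable[OF m]] by (simp add: shift_def)
 also have "... \<le> (\<integral>\<^sup>+y. ?e * ?I y \<partial>\<mu>m)"
 proof (rule nn_integral_mono)
  fix y assume y: "y \<in> space \<mu>m"
  note [measurable] = slice_measurable[OF Lp_meas[OF v] y]
  have "ennreal (wt r) \<le> ?e * ennreal (wt (r + t))" for r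
  proof (cases "0 < r")
   case True
   then show ?thesis using t by (simp add: wt_pos ennreal_mult[symmetric] exp_add[symmetric] algebra_simps)
  qed (simp add: wt_0)
  then have "(\<integral>\<^sup>+r. ennreal (wt r) * ennreal (\<bar>v (r + t, y)\<bar> powr p) \<partial>lborel) \<le> (\<integral>\<^sup>+r. ?e * ?h y (r + t) \<partial>lborel)"
   by (intro nn_integral_mono) (simp add: mult.assoc[symmetric] mult_right_mono)
  also have "... = ?e * (\<integral>\<^sup>+r. ?h y (r + t) \<partial>lborel)" by (rule nn_integral_cmult) measurable
  also have "(\<integral>\<^sup>+r. ?h y (r + t) \<partial>lborel) = ?I y"
   using nn_integral_real_affine[of "?h y" 1 t] by (simp add: add.commute)
  finally show "(\<integral>\<^sup>+r. ennreal (wt r) * ennreal (\<bar>v (r + t, y)\<bar> powr p) \<partial>lborel) \<le> ?e * ?I y" .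
 qed
 also have "... = ?e * (\<integral>\<^sup>+y. ?I y \<partial>\<mu>m)"
  by (rule nn_integral_cmult, rule lborel.borel_measurable_nn_integral) (simp add: case_prod_unfold, measurable)
 also have "(\<integral>\<^sup>+y. ?I y \<partial>\<mu>m) = (Lp_nn p \<nu>m v)"
  by (rule nn_integral_nu_pair[OF sigma_m ennreal_powr_measurable[OF Lp_meas[OF v]], symmetric])
 also have "?e * \<dots> < \<infinity>" using v by (simp add: Lp_iff_nn_integral ennreal_mult_less_top)
 finally show ?thesis using m by (simp add: Lp_iff_nn_integral)
qed

text \<open>Going back along the orbit by r + t is going back by r and then by t; what entered
  during the last r units is read from the shifted flux. When \<open>tau (-1) x\<close> equals r,
  both terms on the right vanish by the strict inequalities, whence the exclusion.\<close>

lemma restart: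
 assumes rt: "0 \<le> r" "0 \<le> t" and ne: "tau (-1) x \<noteq> ereal r"
 shows "U_zero (r + t) f x + enter (r + t) v x = U_zero r (\<lambda>x. U_zero t f x + enter t v x) x + enter r (shift t v) x"
proof (cases "ereal r < tau (-1) x")
 case True
 have t': "tau (-1) (\<Phi> x (- r)) = tau (-1) x - ereal r" using tau_shift[OF rt(1) True] by simp
 show ?thesis
 proof (cases "tau (-1) x")
  case (real l)
  then have "exit (-1) (\<Phi> x (- r)) = exit (-1) x" unfolding exit_def t' by (simp add: flow_add)
  then show ?thesis using True real t' by (auto simp: U_zero_def enter_def flow_add algebra_simps)
 next
  case PInf
  then show ?thesis using t' by (simp add: U_zero_def enter_def flow_add algebra_simps)
 qed (use True in auto)
next
 case False
 then obtain l where l: "tau (-1) x = ereal l" "l < r" using ne tau_nonneg[of "-1" x] by (cases "tau (-1) x") auto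
 then show ?thesis using rt by (simp add: U_zero_def enter_def shift_def algebra_simps)
qed

lemma AE_nu_shift:
 assumes t: "0 \<le> t" and P: "AE r in \<nu>. P r" shows "AE r in \<nu>. P (r + t)"
proof -
 have "(\<lambda>r. r + t) = (+) t" by (auto simp: add.commute)
 then have "distr lborel borel (\<lambda>r. r + t) = lborel" using lborel_distr_plus[of t] by metis
 then have "AE r in distr lborel borel (\<lambda>r. r + t). 0 < r --> P r" using P by (simp only: AE_nu)
 then have "AE r in lborel. 0 < r + t --> P (r + t)" by (rule AE_distrD[rotated]) simp
 then show ?thesis unfolding AE_nu by eventually_elim (use t in auto)
qed

text \<open>The flux seen from time t on solves the fixed-point equation with
  \<open>evol t f\<close> as initial value, so uniqueness applies.\<close>

lemma flux_evol:
 assumes t: "0 \<le> t" and f: "f \<in> X" shows "AE z in \<nu>m. shift t (flux f) z = flux (evol t f) z"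
proof (rule flux_unique[OF evol_Lp[OF t f] shift_Lp[OF t flux_Lp[OF f]]])
 let ?v = "shift t (flux f)" and ?f = "evol t f"
 let ?G = "\<lambda>z. out0 ?f z + pass ?v z"
 have vL: "?v \<in> Xm" by (rule shift_Lp[OF t flux_Lp[OF f]])
 have G: "?G \<in> Xp" by (intro Lp_add[OF p1] Lp_op_in[OF out0_operator] Lp_op_in[OF pass_operator] vL evol_Lp[OF t f])
 have O: "outflux f \<in> Xp" by (rule outflux_Lp[OF f])
 have e: "AE z in \<nu>p. outflux f (fst z + t, snd z) = ?G z"
 proof (rule nu_pair_AE_eq[OF sigma_p _ Lp_meas[OF G]])
  have [measurable]: "outflux f \<in> \<B> (borel \<otimes> \<mu>p)" using Lp_meas[OF O] by (simp add: measurable_nu_pair)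
  then show "(\<lambda>z. outflux f (fst z + t, snd z)) \<in> \<B> \<nu>p" by (simp add: measurable_nu_pair)
  show "AE z in \<mu>p. AE r in lborel. 0 < r --> outflux f (fst (r, z) + t, snd (r, z)) = ?G (r, z)"
  proof (rule AE_I2)
   fix z
   show "AE r in lborel. 0 < r --> outflux f (fst (r, z) + t, snd (r, z)) = ?G (r, z)"
    using AE_lborel_singleton[of "rtau (-1) z"]
   proof (eventually_elim, intro impI)
    fix r assume ne: "r \<noteq> rtau (-1) z" and r: "0 < r"
    \<comment> \<open>At a boundary point the outgoing flux is given by the same formula as the
      evolution, so \<open>restart\<close> applies there too.\<close>
    have "out0 h (s, z) + pass w (s, z) = U_zero s h z + enter s w z" if "0 < s" for h s w
     using that by (auto simp: out0_def U_zero_def pass_def enter_def)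
    moreover have "tau (-1) z \<noteq> ereal r" using ne by auto
    ultimately show "outflux f (fst (r, z) + t, snd (r, z)) = ?G (r, z)"
     using restart[of r t z f "flux f"] r t unfolding outflux_def evol_def[abs_def] by auto
   qed
  qed
 qed
 show "AE z in \<nu>m. ?v z = HL.lift ?G z"
 proof (rule HL.lift_unique[OF G Lp_meas[OF vL]])
  have "AE r in \<nu>. AE y in \<mu>m. flux f (r, y) = H (\<lambda>z. outflux f (r, z)) y"
   using HL.P2.AE_pair[OF lift_outflux[OF f]] HL.lift_AE[OF O] by eventually_elim auto
  from AE_nu_shift[OF t this] AE_nu_shift[OF t HL.slice1(1)[OF O]] HL.slice1(1)[OF G] HL.P1.AE_pair[OF e]
  show "AE r in \<nu>. AE y in \<mu>m. ?v (r, y) = H (\<lambda>z. ?G (r, z)) y"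
  proof eventually_elim
   case (elim r)
   have "AE y in \<mu>m. H (\<lambda>z. outflux f (r + t, z)) y = H (\<lambda>z. ?G (r, z)) y"
    by (rule Lp_op_cong[OF H elim(2,3)]) (use elim(4) in simp)
   then show ?case using elim(1) by eventually_elim (simp add: shift_def)
  qed
 qed
qed

text \<open>A level set of the entry time meets each chord in at most one point, hence is null in
  boundary coordinates.\<close>

lemma AE_tau_ne:
 shows "AE x in \<mu>\<Omega>. tau (-1) x \<noteq> ereal s"
proof -
 define q :: "real \<times> 'a => ennreal" where "q z = ind {s} (fst z)" for z
 have q [measurable]: "q \<in> \<B> (borel \<otimes> \<mu>m)" unfolding q_def by measurable
 let ?h = "\<lambda>x. if tau (-1) x < \<infinity> then q (rtau (-1) x, exit (-1) x) else 0"
 have "(\<integral>\<^sup>+x. ?h x \<partial>\<mu>\<Omega>) = (\<integral>\<^sup>+y. \<integral>\<^sup>+r. ind (chord (-1) y) r * q (r, y) \<partial>lborel \<partial>\<mu>m)"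
  by (rule boundary_coordinates[OF mu_minus q])
 also have "... = (\<integral>\<^sup>+y. 0 \<partial>\<mu>m)"
 proof (rule nn_integral_cong)
  fix y
  have "(\<integral>\<^sup>+r. ind (chord (-1) y) r * q (r, y) \<partial>lborel) = (\<integral>\<^sup>+r. 0 \<partial>(lborel::real measure))"
   by (rule nn_integral_cong_AE) (use AE_lborel_singleton[of s] in eventually_elim, auto simp: q_def)
  then show "(\<integral>\<^sup>+r. ind (chord (-1) y) r * q (r, y) \<partial>lborel) = 0" by simp
 qed
 finally have z: "(\<integral>\<^sup>+x. ?h x \<partial>\<mu>\<Omega>) = 0" by simp
 have "?h \<in> \<B> \<mu>\<Omega>" by (rule measurable_from_Omega) (simp only: q_def fst_conv, measurable)
 from nn_integral_0_iff_AE[OF this] z have "AE x in \<mu>\<Omega>. ?h x = 0" by simp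
 then show ?thesis by eventually_elim (auto simp: q_def)
qed

lemma evol_add:
 assumes s: "0 \<le> s" and t: "0 \<le> t" and f: "f \<in> X" shows "AE x in \<mu>\<Omega>. evol (s + t) f x = evol s (evol t f) x"
 using AE_tau_ne[of s] enter_AE[OF Lp_meas[OF shift_Lp[OF t flux_Lp[OF f]]] Lp_meas[OF flux_Lp[OF evol_Lp[OF t f]]] flux_evol[OF t f], of s]
proof eventually_elim
 case (elim x)
 then show ?case using restart[OF s t elim(1), of f "flux f"] by (simp add: evol_def evol_def[abs_def])
qed

lemma evol_0: "x \<in> \<Omega> ==> evol 0 f x = f x"
 using tau_pos[of x "-1"] by (simp add: evol_def U_zero_def enter_def zero_ereal_def)

end

lemma tendsto_0_rightI:
 fixes k :: "real => real"
 assumes "\<And>t. 0 \<le> k t" "\<And>e. 0 < e ==> \<exists>d>0. \<forall>t. 0 < t --> t < d --> k t \<le> e" shows "(k ---> 0) (at_right 0)"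
proof (rule order_tendstoI)
 show "a < 0 ==> \<forall>\<^sub>F t in at_right 0. a < k t" for a using assms(1) by (intro always_eventually allI) (auto intro: less_le_trans)
 fix a :: real assume "0 < a"
 then obtain d where "0 < d" "\<And>t. 0 < t ==> t < d ==> k t \<le> a / 2" using assms(2)[of "a / 2"] by auto
 moreover have "k t < a" if "k t \<le> a / 2" for t using that \<open>0 < a\<close> by linarith
 ultimately show "\<forall>\<^sub>F t in at_right 0. k t < a" unfolding eventually_at_right_field by (intro exI[of _ d]) auto
qed

lemma tendsto_0_rightD:
 assumes "(k ---> 0) (at_right (0::real))" "0 < (e::real)" obtains d where "0 < d" "\<And>t. 0 < t ==> t < d ==> k t < e"
 using order_tendstoD(2)[OF assms] unfolding eventually_at_right_field by auto

context transport_semigroup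
begin

subsection \<open>The operator with boundary condition is contained in the generator\<close>

sublocale muO: sigma_finite_measure \<mu>\<Omega>
 by (rule sigma_finite_measure_restrict_space[OF mu.sigma_finite_measure_axioms]) simp

lemma cumul_cong:
 fixes N :: "'a measure"
 assumes N: "sigma_finite_measure N" and m: "u \<in> \<B> (\<nu> \<otimes> N)" "v \<in> \<B> (\<nu> \<otimes> N)" and ae: "AE z in \<nu> \<otimes> N. u z = v z"
 shows "AE y in N. \<forall>T. cumul u (T, y) = cumul v (T, y)"
proof -
 interpret N: sigma_finite_measure N by (rule N)
 interpret P: pair_sigma_finite \<nu> N ..
 have "{z \<in> space (\<nu> \<otimes> N). u (fst z, snd z) = v (fst z, snd z)} \<in> sets (\<nu> \<otimes> N)" using borel_measurable_eq[OF m] by simp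
 from P.AE_commute[OF this] P.AE_pair[OF ae] have "AE y in N. AE r in \<nu>. u (r, y) = v (r, y)" by blast
 then show ?thesis using AE_space[of N]
 proof eventually_elim
  case (elim y)
  show ?case
  proof
   fix T :: real
   note [measurable] = slice_measurable[OF m(1) elim(2)] slice_measurable[OF m(2) elim(2)]
   show "cumul u (T, y) = cumul v (T, y)" unfolding cumul_def prod.case set_lebesgue_integral_def
    by (rule integral_cong_AE) (measurable, use elim(1)[unfolded AE_nu] in eventually_elim, auto simp: indicator_def)
  qed
 qed
qed

lemma cumul_add:
 fixes N :: "'a measure"
 assumes N: "sigma_finite_measure N" and u: "u \<in> Lp p (\<nu> \<otimes> N)" and v: "v \<in> Lp p (\<nu> \<otimes> N)"
 shows "AE y in N. \<forall>T. cumul (\<lambda>z. u z + v z) (T, y) = cumul u (T, y) + cumul v (T, y)"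
 using cumul_integrable[OF N u] cumul_integrable[OF N v] by eventually_elim (auto simp: cumul_def)

lemma boundary_value_Lp:
 fixes N :: "'a measure"
 assumes "sigma_finite_measure N" "b \<in> Lp p N" shows "(\<lambda>z. b (snd z)) \<in> Lp p (\<nu> \<otimes> N)"
proof -
 interpret N: sigma_finite_measure N by fact
 have m: "(\<lambda>z. b (snd z)) \<in> \<B> (\<nu> \<otimes> N)" by (rule measurable_compose[OF measurable_snd Lp_meas[OF assms(2)]])
 have "Lp_nn p (\<nu> \<otimes> N) (\<lambda>z. b (snd z)) = (\<integral>\<^sup>+r. (Lp_nn p N b) \<partial>\<nu>)"
  using N.nn_integral_fst[OF ennreal_powr_measurable[OF m]] by simp
 also have "... < \<infinity>"
 proof -
  have "emeasure \<nu> UNIV < top" using nu.emeasure_finite[of UNIV] unfolding infinity_ennreal_def by (simp only: less_top)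
  then show ?thesis using assms(2) by (simp add: Lp_iff_nn_integral ennreal_mult_less_top)
 qed
 finally show ?thesis using m by (simp add: Lp_iff_nn_integral)
qed

lemma has_trace_AE:
 assumes "has_trace \<sigma> N f b" "AE y in N. b y = b' y" "b' \<in> \<B> N" shows "has_trace \<sigma> N f b'"
proof -
 obtain fs where "sharp_rep f fs" "AE y in N. ((\<lambda>t. fs (\<Phi> y (- \<sigma> * t))) ---> b y) (at_right 0)"
  using assms(1) by (auto simp: has_trace_def)
 moreover from this(2) assms(2) have "AE y in N. ((\<lambda>t. fs (\<Phi> y (- \<sigma> * t))) ---> b' y) (at_right 0)"
  by eventually_elim simp
 ultimately show ?thesis using assms(3) unfolding has_trace_def by blast
qed

lemma evol_pair_measurable:
 assumes g: "g \<in> X" shows "(\<lambda>z. if 0 < fst z then evol (fst z) g (snd z) else 0) \<in> \<B> (borel \<otimes> \<mu>\<Omega>)"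
proof -
 note [measurable] = ext_measurable[OF Lp_meas[OF g]]
 have 1: "(\<lambda>z. if 0 < fst z \<and> ereal (fst z) < tau (-1) (snd z) then ext g (\<Phi> (snd z) (- fst z)) else 0) \<in> \<B> (borel \<otimes> \<mu>\<Omega>)"
  by measurable
 have 2: "(\<lambda>z. if 0 < fst z \<and> tau (-1) (snd z) < ereal (fst z) then flux g (fst z - rtau (-1) (snd z), exit (-1) (snd z)) else 0)
  \<in> \<B> (borel \<otimes> \<mu>\<Omega>)"
 proof (rule exit_If_measurable[OF mu_minus])
  show "flux g \<in> \<B> (borel \<otimes> \<mu>m)" using Lp_meas[OF flux_Lp[OF g]] by (simp add: measurable_nu_pair)
  show "exit (-1) (snd z) \<in> Gam (-1)" if "z \<in> space (borel \<otimes> \<mu>\<Omega>)" "0 < fst z \<and> tau (-1) (snd z) < ereal (fst z)" for z :: "real \<times> 'a"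
   using that by (intro exit_in_Gam') (auto simp: space_pair_measure intro: less_trans)
 qed measurable
 from borel_measurable_add[OF 1 2] show ?thesis by (rule measurable_cong[THEN iffD1, rotated])
   (auto simp: space_pair_measure evol_def enter_def U_zero_measurable(2)[OF Lp_meas[OF g]])
qed

context
 fixes f g b
 assumes fg: "(f, g) \<in> T_max_graph" and bL: "b \<in> Lp p \<mu>p" and bt: "has_trace_plus f b" and ct: "has_trace_minus f (H b)"
begin

text \<open>For f in the domain the flux starts at \<open>H b\<close> and has time derivative
  \<open>flux g\<close>: by \<open>outgoing_flux_eq\<close> and \<open>cumul_lift\<close> this
  candidate solves the fixed-point equation of f.\<close>

lemma flux_T_H: "AE z in \<nu>m. H b (snd z) + cumul (flux g) z = flux f z"
proof -
 obtain fs where fs: "sharp_rep f fs" using bt by (auto simp: has_trace_def)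
 note L = T_max_Lp[OF fg]
 note sp = sigma_p and sm = sigma_m
 note O = Lp_op_in[OF out0_operator L(2)] and v = flux_Lp[OF L(2)]
 note Pv = Lp_op_in[OF pass_operator v]
 note HO = Lp_op_in[OF HL.lift_operator O] and HP = Lp_op_in[OF HL.lift_operator Pv]
 define w where "w z = H b (snd z) + cumul (flux g) z" for z
 have w: "w \<in> Xm" unfolding w_def[abs_def] by (intro Lp_add[OF p1] boundary_value_Lp sm cumul_Lp v Lp_op_in[OF H bL])
 let ?G = "\<lambda>z. out0 f z + pass w z"
 have G: "?G \<in> Xp" by (intro Lp_add[OF p1] Lp_op_in[OF out0_operator] Lp_op_in[OF pass_operator] w L(1))
 have e: "AE z in \<nu>p. ?G z = b (snd z) + (cumul (out0 g) z + cumul (pass (flux g)) z)"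
  using outgoing_flux_eq[OF fs fg bt ct Lp_meas[OF v]] unfolding w_def[abs_def] by eventually_elim simp
 have "AE z in \<nu>m. w z = HL.lift ?G z"
 proof (rule HL.lift_unique[OF G Lp_meas[OF w]])
  have fv: "AE z in \<nu>m. flux g z = HL.lift (out0 g) z + HL.lift (pass (flux g)) z"
   using flux_fixed_point[OF L(2)] by (simp add: loop_def)
  have cv: "AE y in \<mu>m. \<forall>T. cumul (flux g) (T, y) = cumul (HL.lift (out0 g)) (T, y) + cumul (HL.lift (pass (flux g))) (T, y)"
   using cumul_cong[OF sm Lp_meas[OF v] Lp_meas[OF Lp_add[OF p1 HO HP]] fv] cumul_add[OF sm HO HP]
   by eventually_elim simp
  show "AE r in \<nu>. AE y in \<mu>m. w (r, y) = H (\<lambda>z. ?G (r, z)) y" using HL.P1.AE_pair[OF e] HL.slice1(1)[OF G]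
  proof eventually_elim
   case (elim r)
   let ?a = "\<lambda>z. cumul (out0 g) (r, z)" and ?b = "\<lambda>z. cumul (pass (flux g)) (r, z)"
   have a: "?a \<in> Lp p \<mu>p" and b': "?b \<in> Lp p \<mu>p" by (rule cumul_slice_Lp(1)[OF sp] O Pv)+
   have ab: "(\<lambda>z. ?a z + ?b z) \<in> Lp p \<mu>p" by (rule Lp_add[OF p1 a b'])
   have "AE y in \<mu>m. H (\<lambda>z. ?G (r, z)) y = H (\<lambda>z. b z + (?a z + ?b z)) y"
    by (rule Lp_op_cong[OF H elim(2) Lp_add[OF p1 bL ab]]) (use elim(1) in simp)
   then show ?case using Lp_op_add[OF H bL ab] Lp_op_add[OF H a b'] cv cumul_lift[OF O, of r] cumul_lift[OF Pv, of r]
    by eventually_elim (simp add: w_def)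
  qed
 qed
 from flux_unique[OF L(1) w this] show ?thesis unfolding w_def .
qed

text \<open>The fundamental theorem for the semigroup, checked point by point. If the past of length
  t stays in \<Omega>, it is the mild identity. Otherwise the integral splits at the entry time l:
  the part before l and f add up to the entry trace \<open>H b\<close>, the part after l is the
  primitive of the flux of g.\<close>

lemma evol_T_H:
 assumes t: "0 < t"
 shows "AE x in \<mu>\<Omega>. lintegrable {0<..<t} (\<lambda>s. evol s g x) \<and> evol t f x - f x = (LBINT s:{0<..<t}. evol s g x)"
proof -
 obtain fs where fs: "sharp_rep f fs" using bt by (auto simp: has_trace_def)
 note L = T_max_Lp[OF fg]
 have fsm: "fs \<in> \<B> \<mu>\<Omega>" and fse: "AE x in \<mu>\<Omega>. fs x = f x" using fs unfolding sharp_rep_iff by auto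
 have fsL: "fs \<in> X" by (rule Lp_cong_AE[OF L(1) _ fsm]) (use fse in eventually_elim, simp)
 have Ue: "AE x in \<mu>\<Omega>. U_zero t fs x = U_zero t f x" using t by (intro Lp_op_cong[OF U_zero_operator fsL L(1) fse]) simp
 have wm: "(\<lambda>z. H b (snd z) + cumul (flux g) z) \<in> \<B> \<nu>m"
  by (intro borel_measurable_add cumul_measurable Lp_meas[OF flux_Lp[OF L(2)]]
    measurable_compose[OF measurable_snd Lp_meas[OF Lp_op_in[OF H bL]]])
 have Ee: "AE x in \<mu>\<Omega>. enter t (\<lambda>z. H b (snd z) + cumul (flux g) z) x = enter t (flux f) x"
  by (rule enter_AE[OF wm Lp_meas[OF flux_Lp[OF L(1)]] flux_T_H])
 have ci: "AE x in \<mu>\<Omega>. tau (-1) x < \<infinity> --> (\<forall>T. lintegrable {0<..<T} (\<lambda>s. flux g (s, exit (-1) x)))"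
  by (rule AE_Omega_of_AE_Gam[OF mu_minus cumul_integrable[OF sigma_m flux_Lp[OF L(2)]]])
 from fse Ue Ee ci sharp_rep_mild[OF fs fg, unfolded mild_def] trace_minus_interior[OF fs fg bt ct]
  AE_tau_ne[of t] AE_orbit_integrable[OF L(2)] AE_space[of \<mu>\<Omega>]
 show ?thesis
 proof eventually_elim
  case (elim x)
  then have x: "x \<in> \<Omega>" by simp
  let ?h = "\<lambda>s. g (\<Phi> x (- s))"
  have before: "evol s g x = ?h s" if "ereal s < tau (-1) x" for s
   using that by (auto simp: evol_def U_zero_def enter_def)
  show ?case
  proof (cases "ereal t < tau (-1) x")
   case True
   have "- t \<in> stay x" "0 \<in> stay x" using True t tau_pos[OF x, of 1] tau_pos[OF x, of "-1"]
    by (cases "tau (-1) x"; cases "tau 1 x"; auto simp: stay_def)+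
   then have d: "decreases_by (\<lambda>s. fs (\<Phi> x s)) (\<lambda>s. g (\<Phi> x s)) (- t) 0" using elim(5) t unfolding mild_at_def by simp
   have se: "{s. 0 - s \<in> {- t..0}} = {0..t}" by auto
   have i: "lintegrable {0..t} ?h"
    using d set_integral_reflect(1)[of 0 "{- t..0}" "\<lambda>s. g (\<Phi> x s)"] unfolding decreases_by_def se by simp
   have ii: "fs (\<Phi> x (- t)) - fs x = (LBINT s:{0..t}. ?h s)"
    using d set_integral_reflect(2)[of 0 "{- t..0}" "\<lambda>s. g (\<Phi> x s)"] unfolding decreases_by_def se by simp
   have e: "ind {0<..<t} s *\<^sub>R evol s g x = ind {0<..<t} s *\<^sub>R ?h s" for s
    using before[of s] less_trans[of "ereal s" "ereal t", OF _ True] by (auto simp: indicator_def)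
   have "evol t f x = fs (\<Phi> x (- t))" using True elim(2) by (simp add: evol_def U_zero_def enter_def)
   then show ?thesis using set_integral_Icc_Ioo[OF t, of ?h] i ii elim(1) unfolding set_int_defs e by simp
  next
   case False
   then have "tau (-1) x < \<infinity>" by (cases "tau (-1) x") auto
   then obtain l where l: "tau (-1) x = ereal l" "0 \<le> l" by (rule finite_tau)
   have lt: "0 < l" "l < t" using False elim(7) l tau_pos[OF x, of "-1"] by auto
   let ?y = "exit (-1) x"
   have e1: "ind {0<..<l} s *\<^sub>R evol s g x = ind {0<..<l} s *\<^sub>R ?h s" for s
    using before[of s] l by (auto simp: indicator_def)
   have e2: "ind {l<..<t} s *\<^sub>R evol s g x = ind {s. s + - l \<in> {0<..<t - l}} s *\<^sub>R flux g (s + - l, ?y)" for s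
    using l by (auto simp: indicator_def evol_def U_zero_def enter_def)
   have io: "lintegrable {s. 0 - s \<in> {s. s \<in> stay x \<and> \<bar>s\<bar> \<le> l}} (\<lambda>s. g (\<Phi> x (0 - s)))"
    using elim(8) set_integral_reflect(1)[of 0 "{s. s \<in> stay x \<and> \<bar>s\<bar> \<le> l}" "\<lambda>s. g (\<Phi> x s)"] by blast
   have "lintegrable {0<..<l} (\<lambda>s. g (\<Phi> x (0 - s)))"
   proof (rule set_integrable_subset[OF io])
    have "ereal r < tau 1 x" if "r < 0" for r using that tau_pos[OF x, of 1] by (auto intro: less_trans[of _ "0::ereal"])
    then show "{0<..<l} \<subseteq> {s. 0 - s \<in> {s. s \<in> stay x \<and> \<bar>s\<bar> \<le> l}}" using l by (auto simp: stay_def)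
   qed simp
   then have i1: "lintegrable {0<..<l} (\<lambda>s. evol s g x)" unfolding set_integrable_def e1 by simp
   have i2: "lintegrable {l<..<t} (\<lambda>s. evol s g x)"
    using set_integral_shift(1)[where c="-l" and A="{0<..<t - l}" and h="\<lambda>s. flux g (s, ?y)"] elim(4) l
    unfolding set_integrable_def e2 by simp
   have "(LBINT s:{l<..<t}. evol s g x) = cumul (flux g) (t - l, ?y)"
    using set_integral_shift(2)[where c="-l" and A="{0<..<t - l}" and h="\<lambda>s. flux g (s, ?y)"]
    unfolding set_lebesgue_integral_def e2 cumul_def prod.case by simp
   moreover have "(LBINT s:{0<..<l}. evol s g x) = (LBINT s:{0<..<l}. ?h s)"
    unfolding set_lebesgue_integral_def e1 ..
   moreover have "evol t f x = H b ?y + cumul (flux g) (t - l, ?y)"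
    using elim(3) l lt by (simp add: evol_def U_zero_def enter_def)
   moreover have "H b ?y = fs x + (LBINT s:{0<..<l}. ?h s)" using elim(6) l by blast
   ultimately show ?thesis using set_integral_Ioo_combine[OF i1 i2 lt] elim(1) by simp
  qed
 qed
qed

end

text \<open>The parameter c merges two uses: c = 0 yields continuity at time 0, c = 1 the derivative
  there.\<close>

lemma evol_T_H_bound:
 assumes fg: "(f, g) \<in> T_H_graph" and t: "0 < t" and B: "0 \<le> B"
  and b: "\<And>s. 0 < s ==> s < t ==> norm_X (\<lambda>x. evol s g x - c * g x) \<le> B"
 shows "norm_X (\<lambda>x. evol t f x - f x - t * (c * g x)) \<le> t * B"
proof -
 obtain a where T: "(f, g) \<in> T_max_graph" "a \<in> Lp p \<mu>p" "has_trace_plus f a" "has_trace_minus f (H a)"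
  using fg by (auto simp: T_H_graph_def)
 note L = T_max_Lp[OF T(1)]
 have cg: "(\<lambda>x. c * g x) \<in> X" by (rule Lp_scale(1)[OF L(2) p0])
 define h where "h z = (if 0 < fst z then evol (fst z) g (snd z) else 0) - c * g (snd z)" for z
 have hs: "h (s, x) = evol s g x - c * g x" if "0 < s" for s x using that by (simp add: h_def)
 show ?thesis
 proof (rule Lp_time_integral(2)[OF p1 muO.sigma_finite_measure_axioms, where \<rho>="ind {0<..<t}"])
  show "h \<in> \<B> (borel \<otimes> \<mu>\<Omega>)" unfolding h_def[abs_def]
   by (intro borel_measurable_diff evol_pair_measurable[OF L(2)] measurable_compose[OF measurable_snd Lp_meas[OF cg]])
  show "Lp_nn p \<mu>\<Omega> (\<lambda>x. h (s, x)) \<le> ennreal (B powr p)" if "0 < (ind {0<..<t} s :: real)" for s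
  proof -
   have s: "0 < s" "s < t" using that by (auto simp: indicator_def split: if_splits)
   show ?thesis unfolding hs[OF s(1)] nn_integral_Lp_norm[OF Lp_diff[OF p1 evol_Lp[OF less_imp_le[OF s(1)] L(2)] cg] p0]
    using b[OF s] p0 by (intro ennreal_leI powr_mono2) auto
  qed
  show "(\<integral>\<^sup>+s. ennreal (ind {0<..<t} s) \<partial>lborel) = ennreal t" using t by (simp add: ennreal_indicator)
  show "(\<lambda>x. evol t f x - f x - t * (c * g x)) \<in> \<B> \<mu>\<Omega>"
   using t by (intro borel_measurable_diff Lp_meas[OF evol_Lp[OF _ L(1)]] Lp_meas[OF L(1)]
     Lp_meas[OF Lp_scale(1)[OF cg p0]]) simp
  show "AE x in \<mu>\<Omega>. evol t f x - f x - t * (c * g x) = (LBINT s. ind {0<..<t} s * h (s, x))"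
   using evol_T_H[OF T t]
  proof eventually_elim
   case (elim x)
   have e: "ind {0<..<t} s *\<^sub>R h (s, x) = ind {0<..<t} s *\<^sub>R (evol s g x - c * g x)" for s
    by (auto simp: indicator_def hs)
   have i: "lintegrable {0<..<t} (\<lambda>s. c * g x)" unfolding set_integrable_def using t by simp
   have "(LBINT s:{0<..<t}. c * g x) = t * (c * g x)" unfolding set_lebesgue_integral_def using t by simp
   moreover have "(LBINT s:{0<..<t}. h (s, x)) = (LBINT s:{0<..<t}. evol s g x) - (LBINT s:{0<..<t}. c * g x)"
    using set_integral_diff(2)[OF conjunct1[OF elim] i] unfolding set_lebesgue_integral_def e .
   ultimately have "evol t f x - f x - t * (c * g x) = (LBINT s:{0<..<t}. h (s, x))" using conjunct2[OF elim] by linarith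
   then show ?case by (simp add: set_lebesgue_integral_def)
  qed
 qed (use t B in simp_all)
qed

lemma D0_T_H:
 assumes "f \<in> D0" obtains g where "(f, g) \<in> T_H_graph"
proof -
 obtain g where g: "(f, g) \<in> T_max_graph" "has_trace_plus f (\<lambda>_. 0)" "has_trace_minus f (\<lambda>_. 0)"
  using D0E[OF assms] by blast
 have "AE y in \<mu>m. 0 = H (\<lambda>_. 0) y" using Lp_op_zero[OF p0 H] by eventually_elim simp
 then have "has_trace_minus f (H (\<lambda>_. 0))" by (rule has_trace_AE[OF g(3) _ Lp_meas[OF Lp_op_in[OF H Lp_zero(1)]]])
 then have "(f, g) \<in> T_H_graph" unfolding T_H_graph_def using g by (auto intro!: bexI[of _ "\<lambda>_. 0"])
 then show ?thesis by (rule that)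
qed

text \<open>On \<open>D0\<close> the increment is an integral over an interval of length t and thus
  of order t. The bound on the operators for times up to 1 carries convergence over to
  limits.\<close>

lemma evol_continuous:
 assumes f: "f \<in> X" shows "((\<lambda>t. norm_X (\<lambda>x. evol t f x - f x)) ---> 0) (at_right 0)"
proof -
 let ?d = "\<lambda>t f x. evol t f x - f x"
 obtain C where C: "0 \<le> C" "\<And>t f. 0 \<le> t ==> f \<in> X ==> norm_X (evol t f) \<le> C * exp (lam * t) * norm_X f"
  by (rule evol_norm) blast
 define K where "K = C * exp lam"
 have K: "0 \<le> K" using C by (simp add: K_def)
 have bound: "norm_X (evol t f) \<le> K * norm_X f" if "0 \<le> t" "t \<le> 1" "f \<in> X" for t f
 proof -
  have "C * exp (lam * t) \<le> K" using that lam(1) C(1) unfolding K_def by (intro mult_left_mono) auto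
  then show ?thesis using order_trans[OF C(2)[OF that(1,3)] mult_right_mono] by simp
 qed
 have D: "Lp_op p \<mu>\<Omega> \<mu>\<Omega> (\<lambda>f x. evol t f x - f x)" if "0 \<le> t" for t
  by (rule Lp_op_minus[OF p1 evol_operator[OF that] Lp_op_id[OF p1]])
 show ?thesis using f
 proof (induction f rule: D0_induct)
  case (D0 f)
  obtain g where fg: "(f, g) \<in> T_H_graph" using D0_T_H[OF D0] by blast
  then have g: "g \<in> X" using T_max_Lp by (auto simp: T_H_graph_def)
  let ?B = "K * norm_X g"
  have B: "0 \<le> ?B" using K by simp
  have le: "norm_X (?d t f) \<le> t * ?B" if t: "0 < t" "t < 1" for t
   using evol_T_H_bound[OF fg t(1) B, of 0] bound[OF _ _ g] t by simp
  show ?case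
  proof (rule tendsto_0_rightI)
   fix e :: real assume e: "0 < e"
   show "\<exists>d>0. \<forall>t. 0 < t --> t < d --> norm_X (?d t f) \<le> e"
   proof (intro exI[of _ "min 1 (e / (?B + 1))"] conjI allI impI)
    show "0 < min 1 (e / (?B + 1))" using e B by simp
    fix t assume t: "0 < t" "t < min 1 (e / (?B + 1))"
    then have "t * (?B + 1) < e" using B by (simp add: field_simps)
    then have "t * ?B \<le> e" using t(1) by (simp add: algebra_simps)
    then show "norm_X (?d t f) \<le> e" using le[of t] t by simp
   qed
  qed simp
 next
  case (add f g)
  show ?case
  proof (rule tendsto_sandwich[OF _ _ tendsto_const])
   show "((\<lambda>t. norm_X (?d t f) + norm_X (?d t g)) ---> 0) (at_right 0)"
    using tendsto_add[OF add(3,4)] by simp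
   show "\<forall>\<^sub>F t in at_right 0. norm_X (\<lambda>x. evol t (\<lambda>x. f x + g x) x - (f x + g x))
    \<le> norm_X (?d t f) + norm_X (?d t g)"
    unfolding eventually_at_right_field using Lp_op_norm_add[OF p1 D add(1,2)] by (intro exI[of _ 1]) auto
  qed simp
 next
  case (scale f c)
  have "\<forall>\<^sub>F t in at_right 0. \<bar>c\<bar> * norm_X (?d t f) = norm_X (\<lambda>x. evol t (\<lambda>x. c * f x) x - c * f x)"
   unfolding eventually_at_right_field using Lp_op_norm_scale[OF p0 D scale(1)] by (intro exI[of _ 1]) auto
  then show ?case by (rule Lim_transform_eventually[OF tendsto_mult_right_zero[OF scale(2)]])
 next
  case (lim f g)
  show ?case
  proof (rule tendsto_0_rightI)
   fix e :: real assume e: "0 < e"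
   then have "0 < e / 2 / (K + 1)" using K by simp
   from order_tendstoD(2)[OF lim(3) this] obtain n where n: "norm_X (\<lambda>x. f n x - g x) < e / 2 / (K + 1)"
    by (auto simp: eventually_sequentially)
   have "0 < e / 2" using e by simp
   with lim(4)[of n] obtain d where d: "0 < d" "\<And>t. 0 < t ==> t < d ==> norm_X (\<lambda>x. evol t (f n) x - f n x) < e / 2"
    by (rule tendsto_0_rightD) blast
   show "\<exists>d>0. \<forall>t. 0 < t --> t < d --> norm_X (?d t g) \<le> e"
   proof (intro exI[of _ "min 1 d"] conjI allI impI)
    show "0 < min 1 d" using d by simp
    fix t :: real assume "0 < t" "t < min 1 d"
    then have t: "0 \<le> t" "t \<le> 1" "0 < t" "t < d" by auto
    let ?m = "norm_X (\<lambda>x. f n x - g x)"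
    have "norm_X (?d t g) \<le> norm_X (\<lambda>x. evol t g x - evol t (f n) x) + norm_X (\<lambda>x. evol t (f n) x - g x)"
     by (rule Lp_norm_triangle_mid[OF p1 evol_Lp[OF t(1) lim(2)] evol_Lp[OF t(1) lim(1)] lim(2)])
    also have "norm_X (\<lambda>x. evol t (f n) x - g x) \<le> norm_X (\<lambda>x. evol t (f n) x - f n x) + ?m"
     by (rule Lp_norm_triangle_mid[OF p1 evol_Lp[OF t(1) lim(1)] lim(1) lim(2)])
    also have "norm_X (\<lambda>x. evol t g x - evol t (f n) x) = norm_X (evol t (\<lambda>x. g x - f n x))"
     by (rule Lp_op_norm_diff[OF p1 evol_operator[OF t(1)] lim(2) lim(1)])
    also have "... \<le> K * ?m" unfolding Lp_norm_minus_commute[of p \<mu>\<Omega> "f n" g] by (rule bound[OF t(1,2) Lp_diff[OF p1 lim(2) lim(1)]])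
    finally have "norm_X (?d t g) \<le> (K + 1) * ?m + e / 2" using d(2)[OF t(3,4)] by (simp add: algebra_simps)
    moreover have "(K + 1) * ?m \<le> e / 2" using n K by (simp add: field_simps)
    ultimately show "norm_X (?d t g) \<le> e" by simp
   qed
  qed simp
 qed
qed

definition derivative_of :: "('a => real) => ('a => real) => bool" where
 "derivative_of f g \<longleftrightarrow> ((\<lambda>t. norm_X (\<lambda>x. (evol t f x - f x) / t - g x)) ---> 0) (at_right 0)"

text \<open>The difference quotient is the mean of \<open>evol s g\<close> over times s below t, and
  strong continuity makes this close to g.\<close>

lemma T_H_derivative:
 assumes fg: "(f, g) \<in> T_H_graph" shows "derivative_of f g" unfolding derivative_of_def
proof (rule tendsto_0_rightI)
 fix e :: real assume e: "0 < e"
 have L: "f \<in> X" "g \<in> X" using fg T_max_Lp by (auto simp: T_H_graph_def)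
 obtain d where d: "0 < d" "\<And>t. 0 < t ==> t < d ==> norm_X (\<lambda>x. evol t g x - g x) < e"
  by (rule tendsto_0_rightD[OF evol_continuous[OF L(2)] e]) blast
 show "\<exists>d>0. \<forall>t. 0 < t --> t < d --> norm_X (\<lambda>x. (evol t f x - f x) / t - g x) \<le> e"
 proof (intro exI[of _ d] conjI d(1) allI impI)
  fix t assume t: "0 < t" "t < d"
  have le: "norm_X (\<lambda>x. evol t f x - f x - t * (1 * g x)) \<le> t * e"
   using d(2) t e by (intro evol_T_H_bound[OF fg t(1)]) (auto intro: less_imp_le)
  have "(\<lambda>x. evol t f x - f x - t * (1 * g x)) \<in> X"
   using t by (intro Lp_diff[OF p1] evol_Lp L Lp_scale(1)[OF _ p0]) (auto intro: L)
  from Lp_scale(2)[OF this p0, of "1 / t"]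
  have eq: "norm_X (\<lambda>x. (evol t f x - f x) / t - g x) = norm_X (\<lambda>x. evol t f x - f x - t * (1 * g x)) / t"
   using t by (simp add: diff_divide_distrib)
  show "norm_X (\<lambda>x. (evol t f x - f x) / t - g x) \<le> e"
   unfolding eq using le t(1) by (simp only: pos_divide_le_eq mult.commute)
 qed
qed simp

end

lemma set_integrable_mult_bounded:
 fixes h \<phi> :: "'a => real"
 assumes "set_integrable M A h" "\<phi> \<in> \<B> M" "\<And>s. s \<in> A ==> \<bar>\<phi> s\<bar> \<le> B" shows "set_integrable M A (\<lambda>s. \<phi> s * h s)"
 unfolding set_integrable_def
proof (rule Bochner_Integration.integrable_bound)
 have i: "integrable M (\<lambda>s. ind A s *\<^sub>R h s)" using assms(1) by (simp add: set_integrable_def)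
 then show "integrable M (\<lambda>s. B * (ind A s *\<^sub>R h s))" by (rule integrable_mult_right)
 have "(\<lambda>s. \<phi> s * (ind A s *\<^sub>R h s)) \<in> \<B> M"
  using assms(2) borel_measurable_integrable[OF i] by (rule borel_measurable_times)
 then show "(\<lambda>s. ind A s *\<^sub>R (\<phi> s * h s)) \<in> \<B> M" by (simp add: mult.left_commute)
 show "AE s in M. norm (ind A s *\<^sub>R (\<phi> s * h s)) \<le> norm (B * (ind A s *\<^sub>R h s))"
 proof (rule AE_I2)
  fix s show "norm (ind A s *\<^sub>R (\<phi> s * h s)) \<le> norm (B * (ind A s *\<^sub>R h s))"
   using assms(3)[of s] by (cases "s \<in> A") (auto simp: abs_mult intro!: mult_right_mono)
 qed
qed

context transport_semigroup
begin

subsection \<open>The resolvent\<close>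

definition discount :: "real => real" where "discount r = exp (- (lam * p * r))"

lemma discount_add: "discount (r + s) = discount r * discount s"
 by (simp add: discount_def exp_add[symmetric] algebra_simps)

lemma discount_pos [simp]: "0 < discount r" and discount_0 [simp]: "discount 0 = 1" by (simp_all add: discount_def)

lemma discount_measurable [measurable]: "discount \<in> \<B> borel" unfolding discount_def[abs_def] by measurable

lemma LINT_nu:
 assumes "v \<in> \<B> borel" shows "(LINT r|\<nu>. v r) = (LBINT r:{0<..}. discount r * v r)"
  "integrable \<nu> v \<longleftrightarrow> lintegrable {0<..} (\<lambda>r. discount r * v r)"
proof -
 have w: "wt r *\<^sub>R v r = ind {0<..} r *\<^sub>R (discount r * v r)" for r by (simp add: wt_def discount_def)
 show "(LINT r|\<nu>. v r) = (LBINT r:{0<..}. discount r * v r)"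
  unfolding \<nu>_def set_lebesgue_integral_def w[symmetric] by (rule integral_density) (use assms in auto)
 show "integrable \<nu> v \<longleftrightarrow> lintegrable {0<..} (\<lambda>r. discount r * v r)"
  unfolding \<nu>_def set_integrable_def w[symmetric] by (rule integrable_density) (use assms in auto)
qed

definition past :: "'a => real set" where "past x = {r. 0 < r \<and> ereal r < tau (-1) x}"

text \<open>The Laplace transform of \<open>evol r u x\<close> in r at \<open>lam * p\<close>,
  written out on the orbit: the integral over the past inside \<Omega>, plus the transform of the
  incoming flux at the entry point, delayed by the time since entry.\<close>

definition res :: "('a => real) => 'a => real" where "res u x = (LBINT r:past x. discount r * u (\<Phi> x (- r)))
  + (if tau (-1) x < \<infinity> then discount (rtau (-1) x) * (LINT r|\<nu>. flux u (r, exit (-1) x)) else 0)"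

context
 fixes u
 assumes u: "u \<in> X"
begin

lemma out0_slice_measurable: "(\<lambda>r. out0 u (r, x)) \<in> \<B> borel"
proof -
 note [measurable] = ext_measurable[OF Lp_meas[OF u]]
 have "(\<lambda>r. if 0 < r \<and> ereal r < tau (-1) x then ext u (\<Phi> x (- r)) else 0) \<in> \<B> borel" by measurable
 then show ?thesis
  by (rule measurable_cong[THEN iffD1, rotated]) (use tau_inside[of _ "-1" x] in \<open>auto simp: out0_def ext_def\<close>)
qed

lemma LINT_out0: "(LINT r|\<nu>. out0 u (r, x)) = (LBINT r:past x. discount r * u (\<Phi> x (- r)))"
 "integrable \<nu> (\<lambda>r. out0 u (r, x)) \<longleftrightarrow> lintegrable (past x) (\<lambda>r. discount r * u (\<Phi> x (- r)))"
proof -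
 have e: "ind {0<..} r *\<^sub>R (discount r * out0 u (r, x)) = ind (past x) r *\<^sub>R (discount r * u (\<Phi> x (- r)))" for r
  by (auto simp: out0_def past_def indicator_def)
 show "(LINT r|\<nu>. out0 u (r, x)) = (LBINT r:past x. discount r * u (\<Phi> x (- r)))"
  "integrable \<nu> (\<lambda>r. out0 u (r, x)) \<longleftrightarrow> lintegrable (past x) (\<lambda>r. discount r * u (\<Phi> x (- r)))"
  using LINT_nu[OF out0_slice_measurable[of x]] by (simp_all only: set_int_defs e)
qed

text \<open>A delay by the chord length multiplies the Laplace transform by \<open>discount\<close>
  of that length.\<close>

lemma LINT_pass:
 assumes z: "z \<in> Gam 1" shows "(LINT r|\<nu>. pass (flux u) (r, z)) =
  (if tau (-1) z < \<infinity> then discount (rtau (-1) z) * (LINT r|\<nu>. flux u (r, exit (-1) z)) else 0)"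
proof (cases "tau (-1) z < \<infinity>")
 case True
 then obtain l where l: "tau (-1) z = ereal l" "0 \<le> l" by (rule finite_tau)
 let ?y = "exit (-1) z"
 have y: "?y \<in> space \<mu>m" using exit_in_Gam_opposite[OF z] l Gam_space(1)[OF mu_minus] by simp
 note fm = slice_measurable[OF Lp_meas[OF flux_Lp[OF u]] y]
 have pm: "(\<lambda>r. pass (flux u) (r, z)) \<in> \<B> borel"
  using z Gam_space(1)[OF mu_plus] by (intro slice_measurable[OF pass_measurable[OF Lp_meas[OF flux_Lp[OF u]]]]) simp
 have "ind {0<..} r *\<^sub>R (discount r * pass (flux u) (r, z))
  = ind {r. r + - l \<in> {0<..}} r *\<^sub>R (discount l * (discount (r + - l) * flux u (r + - l, ?y)))" for r
  using l discount_add[of l "r + - l"] by (auto simp: pass_def indicator_def)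
 then have "(LINT r|\<nu>. pass (flux u) (r, z)) = (LBINT r:{0<..}. discount l * (discount r * flux u (r, ?y)))"
  using set_integral_shift(2)[where c="-l" and A="{0<..}" and h="\<lambda>r. discount l * (discount r * flux u (r, ?y))"]
  unfolding LINT_nu(1)[OF pm] set_lebesgue_integral_def by simp
 then show ?thesis using l LINT_nu(1)[OF fm] by simp
next
 case False
 then show ?thesis by (simp add: pass_def)
qed

text \<open>Compares two points of one orbit at time distance s: the past of the later one is the
  segment between them followed by the past of the earlier one, discounted by s. It also serves
  boundary points.\<close>

lemma res_step:
 assumes i: "integrable \<nu> (\<lambda>r. out0 u (r, x))" and s: "0 < s" "ereal s < tau (-1) x"
 shows "integrable \<nu> (\<lambda>r. out0 u (r, \<Phi> x (- s)))" "lintegrable {0<..<s} (\<lambda>r. discount r * u (\<Phi> x (- r)))"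
  "res u x = (LBINT r:{0<..<s}. discount r * u (\<Phi> x (- r))) + discount s * res u (\<Phi> x (- s))"
proof -
 let ?x = "\<Phi> x (- s)" and ?k = "\<lambda>r. discount r * u (\<Phi> x (- r))"
 let ?k' = "\<lambda>r. discount r * u (\<Phi> ?x (- r))"
 have t: "tau (-1) ?x = tau (-1) x - ereal s" using tau_shift[OF less_imp_le[OF s(1)] s(2)] by simp
 have e: "exit (-1) ?x = exit (-1) x" if "tau (-1) x < \<infinity>"
  using that t tau_nonneg[of "-1" x] unfolding exit_def by (cases "tau (-1) x") (auto simp: flow_add)
 have p: "r \<in> past x \<and> s < r \<longleftrightarrow> r + - s \<in> past ?x" for r using s t by (cases "tau (-1) x") (auto simp: past_def)
 have k: "?k r = discount s * ?k' (r + - s)" for r using discount_add[of s "r + - s"] by (simp add: flow_add)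
 have i': "lintegrable (past x) ?k" using i by (simp add: LINT_out0(2))
 have sub: "{0<..<s} \<subseteq> past x" "{r. r + - s \<in> past ?x} \<subseteq> past x"
  using less_trans[OF _ s(2), of "ereal _"] p by (auto simp: past_def)
 have pm: "past x \<in> sets borel" for x unfolding past_def by measurable
 have pm': "{r. r + - s \<in> past ?x} \<in> sets lborel"
 proof -
  have "{r. r + - s \<in> past ?x} = past x \<inter> {s<..}" using p by auto
  then show ?thesis using pm[of x] by auto
 qed
 show i1: "lintegrable {0<..<s} ?k" by (rule set_integrable_subset[OF i' _ sub(1)]) simp
 have i2: "lintegrable {r. r + - s \<in> past ?x} (\<lambda>r. discount s * ?k' (r + - s))"
  using set_integrable_subset[OF i' pm' sub(2)] unfolding k .
 then have i3: "lintegrable (past ?x) (\<lambda>r. discount s * ?k' r)"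
  by (subst (asm) set_integral_shift(1)[where h="\<lambda>r. discount s * ?k' r"])
 then have "lintegrable (past ?x) ?k'" using discount_pos[of s] by simp
 then show "integrable \<nu> (\<lambda>r. out0 u (r, ?x))" by (simp add: LINT_out0(2))
 have "ind (past x) r *\<^sub>R ?k r = ind {0<..<s} r *\<^sub>R ?k r + ind {r. r + - s \<in> past ?x} r *\<^sub>R (discount s * ?k' (r + - s))
  + ind {s} r * ?k s" for r unfolding k[of r, symmetric] using p[of r] sub(1) s by (auto simp: indicator_def past_def)
 then have "(LBINT r:past x. ?k r) = (LBINT r. ind {0<..<s} r *\<^sub>R ?k r
  + ind {r. r + - s \<in> past ?x} r *\<^sub>R (discount s * ?k' (r + - s)) + ind {s} r * ?k s)"
  unfolding set_lebesgue_integral_def by simp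
 also have "... = (LBINT r:{0<..<s}. ?k r) + (LBINT r:{r. r + - s \<in> past ?x}. discount s * ?k' (r + - s))"
 proof -
  have "integrable lborel (\<lambda>r. ind {s} r * ?k s)" by (intro integrable_mult_left) simp
  then show ?thesis using i1 i2 unfolding set_int_defs by simp
 qed
 also have "(LBINT r:{r. r + - s \<in> past ?x}. discount s * ?k' (r + - s)) = discount s * (LBINT r:past ?x. ?k' r)"
  by (subst set_integral_shift(2)[where h="\<lambda>r. discount s * ?k' r"]) simp
 moreover have "discount (rtau (-1) x) = discount s * discount (rtau (-1) ?x)" if "tau (-1) x < \<infinity>"
  using that t tau_nonneg[of "-1" x] by (cases "tau (-1) x") (auto simp: discount_add[symmetric])
 moreover have "tau (-1) ?x < \<infinity> \<longleftrightarrow> tau (-1) x < \<infinity>" using t by (cases "tau (-1) x") auto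
 ultimately show "res u x = (LBINT r:{0<..<s}. ?k r) + discount s * res u ?x"
  using e by (simp add: res_def algebra_simps)
qed

lemma out0_Omega_Lp: "out0 u \<in> Lp p (\<nu> \<otimes> \<mu>\<Omega>)"
proof -
 note [measurable] = ext_measurable[OF Lp_meas[OF u]]
 have "(\<lambda>z. if 0 < fst z \<and> ereal (fst z) < tau (-1) (snd z) then ext u (\<Phi> (snd z) (- fst z)) else 0) \<in> \<B> (borel \<otimes> \<mu>\<Omega>)"
  by measurable
 then have "out0 u \<in> \<B> (borel \<otimes> \<mu>\<Omega>)"
  by (rule measurable_cong[THEN iffD1, rotated]) (use tau_inside[of _ "-1"] in \<open>auto simp: out0_def ext_def\<close>)
 then have m: "out0 u \<in> \<B> (\<nu> \<otimes> \<mu>\<Omega>)" by (simp add: measurable_nu_pair)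
 have "Lp_nn p (\<nu> \<otimes> \<mu>\<Omega>) (out0 u) = (\<integral>\<^sup>+r. (Lp_nn p \<mu>\<Omega> (\<lambda>x. out0 u (r, x))) \<partial>\<nu>)"
  by (rule muO.nn_integral_fst[OF ennreal_powr_measurable[OF m], symmetric])
 also have "... \<le> (\<integral>\<^sup>+r. ennreal (norm_X u powr p) \<partial>\<nu>)"
 proof (rule nn_integral_mono)
  fix r :: real
  show "Lp_nn p \<mu>\<Omega> (\<lambda>x. out0 u (r, x)) \<le> ennreal (norm_X u powr p)"
  proof (cases "0 < r")
   case True
   then have r: "0 \<le> r" by simp
   have e: "out0 u (r, x) = U_zero r u x" for x using True by (auto simp: out0_def U_zero_def)
   show ?thesis unfolding e
    using U_zero_norm[OF r u] p0 by (simp add: nn_integral_Lp_norm[OF Lp_op_in[OF U_zero_operator[OF r] u]] powr_mono2)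
  next
   case False then show ?thesis using p0 by (simp add: out0_def)
  qed
 qed
 also have "... < \<infinity>"
 proof -
  have "emeasure \<nu> UNIV < top" using nu.emeasure_finite[of UNIV] unfolding infinity_ennreal_def by (simp only: less_top)
  then show ?thesis by (simp add: ennreal_mult_less_top)
 qed
 finally show ?thesis using m by (simp add: Lp_iff_nn_integral)
qed

lemma one_nu: "(\<lambda>r. 1 :: real) \<in> \<B> \<nu>" by simp

lemmas out0_Omega = Lp_weighted_integral_operator[OF nu.finite_measure_axioms muO.sigma_finite_measure_axioms p1 one_nu, of 1]

lemma flux_integral_Lp: "(\<lambda>y. LINT r|\<nu>. flux u (r, y)) \<in> Lp p \<mu>m"
 using Lp_op_in[OF HL.wint2(1)[OF one_nu, of 1] flux_Lp[OF u]] by simp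

lemma res_Lp: "res u \<in> X"
proof -
 let ?c = "\<lambda>y. LINT r|\<nu>. flux u (r, y)"
 define k where "k x = (if tau (-1) x < \<infinity> then discount (rtau (-1) x) * ?c (exit (-1) x) else 0)" for x
 have [measurable]: "?c \<in> \<B> \<mu>m" by (rule Lp_meas[OF flux_integral_Lp])
 have km: "k \<in> \<B> \<mu>\<Omega>" unfolding k_def
 proof (rule exit_If_measurable[OF mu_minus, where v="\<lambda>(r, y). discount r * ?c y", simplified prod.case])
  show "(\<lambda>(r, y). discount r * ?c y) \<in> \<B> (borel \<otimes> \<mu>m)" by measurable
  show "(\<lambda>x. rtau (-1) x) \<in> \<B> \<mu>\<Omega>" by (rule measurable_from_Omega) measurable
  show "Measurable.pred \<mu>\<Omega> (\<lambda>x. tau (-1) x < \<infinity>)" by (rule measurable_from_Omega) measurable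
  show "exit (-1) x \<in> Gam (-1)" if "x \<in> space \<mu>\<Omega>" "tau (-1) x < \<infinity>" for x using that by (intro exit_in_Gam') auto
 qed measurable
 let ?q = "\<lambda>(s, y). ennreal (\<bar>discount s * ?c y\<bar> powr p)"
 have "(Lp_nn p \<mu>\<Omega> k) = (\<integral>\<^sup>+x. (if tau (-1) x < \<infinity> then ?q (rtau (-1) x, exit (-1) x) else 0) \<partial>\<mu>\<Omega>)"
  using p0 by (intro nn_integral_cong) (simp add: k_def)
 also have "... = (\<integral>\<^sup>+y. \<integral>\<^sup>+s. ind (chord (-1) y) s * ?q (s, y) \<partial>lborel \<partial>\<mu>m)"
  by (rule boundary_coordinates[OF mu_minus]) measurable
 also have "... \<le> (\<integral>\<^sup>+y. ennreal (1 / (lam * p * p)) * ennreal (\<bar>?c y\<bar> powr p) \<partial>\<mu>m)"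
 proof (rule nn_integral_mono)
  fix y
  have "(\<integral>\<^sup>+s. ind (chord (-1) y) s * ?q (s, y) \<partial>lborel)
   \<le> (\<integral>\<^sup>+s. (ennreal (exp (- (lam * p * p * s))) * ind {0..} s) * ennreal (\<bar>?c y\<bar> powr p) \<partial>lborel)"
  proof (rule nn_integral_mono)
   fix s
   \<comment> \<open>The p-th power of the discount decays at rate \<open>lam * p * p\<close>, so
     its integral is bounded even over infinite chords.\<close>
   have "\<bar>discount s * ?c y\<bar> powr p = exp (- (lam * p * p * s)) * \<bar>?c y\<bar> powr p"
    by (simp add: abs_mult powr_mult) (simp add: discount_def powr_def mult_ac)
   then show "ind (chord (-1) y) s * ?q (s, y) \<le> (ennreal (exp (- (lam * p * p * s))) * ind {0..} s) * ennreal (\<bar>?c y\<bar> powr p)"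
    by (auto simp: indicator_def ennreal_mult[symmetric])
  qed
  also have "... = (\<integral>\<^sup>+s. ennreal (exp (- (lam * p * p * s))) * ind {0..} s \<partial>lborel) * ennreal (\<bar>?c y\<bar> powr p)"
   by (rule nn_integral_multc) measurable
  also have "(\<integral>\<^sup>+s. ennreal (exp (- (lam * p * p * s))) * ind {0..} s \<partial>lborel) = ennreal (1 / (lam * p * p))"
   using nn_integral_exp_decay[of "lam * p * p" 0] lamp p0 by simp
  finally show "(\<integral>\<^sup>+s. ind (chord (-1) y) s * ?q (s, y) \<partial>lborel) \<le> ennreal (1 / (lam * p * p)) * ennreal (\<bar>?c y\<bar> powr p)" .
 qed
 also have "... = ennreal (1 / (lam * p * p)) * (Lp_nn p \<mu>m ?c)" by (rule nn_integral_cmult) measurable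
 also have "... < \<infinity>" using flux_integral_Lp by (simp add: Lp_iff_nn_integral ennreal_mult_less_top)
 finally have k: "k \<in> X" using km by (simp add: Lp_iff_nn_integral)
 have "(\<lambda>x. LINT r|\<nu>. out0 u (r, x)) \<in> X" using Lp_op_in[OF out0_Omega(1) out0_Omega_Lp] by simp
 from Lp_add[OF p1 this k] show ?thesis by (simp add: res_def[abs_def] k_def LINT_out0(1) cong: if_cong)
qed

text \<open>By \<open>res_step\<close>, \<open>res u\<close> along the orbit is the discount factor
  times a primitive; the product rule then produces the term \<open>lam * p * res u\<close>.\<close>

lemma res_mild: "mild (res u) (\<lambda>x. lam * p * res u x - u x)"
proof -
 have "AE x in \<mu>\<Omega>. integrable \<nu> (\<lambda>r. out0 u (r, x))" using out0_Omega(2)[OF _ out0_Omega_Lp] by simp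
 from AE_stay[OF this] AE_space[of \<mu>\<Omega>]
 show ?thesis unfolding mild_def
 proof eventually_elim
  case (elim x)
  then have x: "x \<in> \<Omega>" by simp
  \<comment> \<open>Integrability is known at almost every time of the orbit. Some good time lies
    just after b, and \<open>res_step\<close> hands the property down to the earlier point.\<close>
  have I: "integrable \<nu> (\<lambda>r. out0 u (r, \<Phi> x b))" if b: "b \<in> stay x" for b
  proof -
   obtain e where e: "b < e" "ereal e < tau 1 x"
    using b ereal_dense2[of "ereal b" "tau 1 x"] by (auto simp: stay_def)
   have o: "s \<in> stay x" if "s \<in> {b<..<e}" for s
    using that b e by (auto simp: stay_def intro: less_trans[of _ "ereal b"] less_trans[of _ "ereal e"])
   have "AE s in lborel. s \<in> {b<..<e} --> integrable \<nu> (\<lambda>r. out0 u (r, \<Phi> x s))"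
    using elim(1) by eventually_elim (use o in blast)
   then obtain s where "b < s" "s < e" and i: "integrable \<nu> (\<lambda>r. out0 u (r, \<Phi> x s))"
    by (rule AE_lborel_interval_ex[OF _ e(1)])
   then have s: "s \<in> {b<..<e}" by simp
   have "ereal (s - b) < tau (-1) (\<Phi> x s)"
    using b tau_flow(2)[OF x o[OF s]] by (cases "tau (-1) x") (auto simp: stay_def)
   from res_step(1)[OF i _ this] s show ?thesis by (simp add: flow_add)
  qed
  show ?case unfolding mild_at_def
  proof (intro allI impI)
   fix a b assume ab: "a \<in> stay x" "b \<in> stay x" "a \<le> b"
   \<comment> \<open>The value of \<open>res u\<close> along the orbit with the discount accumulated
     since time a removed.\<close>
   define A where "A t = res u (\<Phi> x a) + (LBINT r:{a<..<t}. discount (a - r) * u (\<Phi> x r))" for t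
   have R: "lintegrable {a<..<t} (\<lambda>r. discount (a - r) * u (\<Phi> x r)) \<and> res u (\<Phi> x t) = A t * discount (t - a)"
    if t: "a < t" "t \<le> b" for t
   proof -
    have o: "t \<in> stay x" by (rule stay_interval[OF ab(1,2)]) (use t in auto)
    have "ereal (t - a) < tau (-1) (\<Phi> x t)"
     using ab(1) tau_flow(2)[OF x o] by (cases "tau (-1) x") (auto simp: stay_def)
    note st = res_step(2,3)[OF I[OF o] _ this]
    have se: "{r. t - r \<in> {a<..<t}} = {0<..<t - a}" by auto
    have d: "discount r * u (\<Phi> (\<Phi> x t) (- r)) = discount (t - a) * (discount (a - (t - r)) * u (\<Phi> x (t - r)))" for r
     using discount_add[of "t - a" "a - (t - r)"] by (simp add: flow_add)
    note rf = set_integral_reflect[of t "{a<..<t}" "\<lambda>r. discount (t - a) * (discount (a - r) * u (\<Phi> x r))", unfolded se]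
    have "lintegrable {a<..<t} (\<lambda>r. discount (t - a) * (discount (a - r) * u (\<Phi> x r)))"
     using st(1) t(1) rf(1) unfolding d by simp
    then have i: "lintegrable {a<..<t} (\<lambda>r. discount (a - r) * u (\<Phi> x r))"
     using discount_pos[of "t - a"] by simp
    have "res u (\<Phi> x t) = (LBINT r:{a<..<t}. discount (t - a) * (discount (a - r) * u (\<Phi> x r))) + discount (t - a) * res u (\<Phi> x a)"
     using st(2) t(1) rf(2) unfolding d by (simp add: flow_add)
    then show ?thesis using i unfolding set_integral_mult_right
     by (simp add: A_def distrib_right mult.commute[of "discount (t - a)"])
   qed
   have R': "res u (\<Phi> x t) = A t * discount (t - a)" if t: "a \<le> t" "t \<le> b" for t
    using R[of t] t by (cases "a = t") (auto simp: A_def set_lebesgue_integral_def)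
   have dA: "decreases_by A (\<lambda>r. - (discount (a - r) * u (\<Phi> x r))) a t" if t: "a \<le> t" "t \<le> b" for t
   proof (cases "a = t")
    case True
    have "(\<lambda>r. ind {a..t} r *\<^sub>R - (discount (a - r) * u (\<Phi> x r))) = (\<lambda>r. ind {a} r * - u (\<Phi> x a))"
     using True by (auto simp: indicator_def)
    moreover have "integrable lborel (\<lambda>r. ind {a} r * - u (\<Phi> x a))" by (intro integrable_mult_left) simp
    ultimately show ?thesis using True unfolding decreases_by_def set_int_defs by simp
   next
    case False
    then have at: "a < t" using t by simp
    note c = set_integral_Icc_Ioo[OF at, of "\<lambda>r. discount (a - r) * u (\<Phi> x r)"]
    have i: "lintegrable {a..t} (\<lambda>r. discount (a - r) * u (\<Phi> x r))" using R[OF at t(2)] c(1) by blast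
    then show ?thesis unfolding decreases_by_def A_def c(2) using set_integral_uminus[OF i] by (simp add: set_int_defs)
   qed
   have "decreases_by (\<lambda>t. A t * discount (t - a)) (\<lambda>t. - (discount (a - t) * u (\<Phi> x t)) * discount (t - a) - A t * (- (lam * p) * discount (t - a))) a b"
   proof (rule decreases_by_product[OF ab(3) dA])
    show "((\<lambda>t. discount (t - a)) has_real_derivative - (lam * p) * discount (t - a)) (at t)" for t
     unfolding discount_def by (auto intro!: derivative_eq_intros)
    show "continuous_on {a..b} (\<lambda>t. - (lam * p) * discount (t - a))" unfolding discount_def by (intro continuous_intros)
   qed
   then show "decreases_by (\<lambda>s. res u (\<Phi> x s)) (\<lambda>s. lam * p * res u (\<Phi> x s) - u (\<Phi> x s)) a b"
   proof (rule decreases_by_cong[THEN iffD1, rotated 3])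
    fix s assume s: "a \<le> s" "s \<le> b"
    show "A s * discount (s - a) = res u (\<Phi> x s)" using R'[OF s] by simp
    have "discount (a - s) * discount (s - a) = 1" by (simp add: discount_add[symmetric])
    then show "- (discount (a - s) * u (\<Phi> x s)) * discount (s - a) - A s * (- (lam * p) * discount (s - a)) = lam * p * res u (\<Phi> x s) - u (\<Phi> x s)"
     using R'[OF s] by (simp add: algebra_simps)
   qed (rule ab(3))
  qed
 qed
qed

lemma res_T_max: "(res u, \<lambda>x. lam * p * res u x - u x) \<in> T_max_graph"
 by (rule mild_imp_T_max[OF res_Lp Lp_diff[OF p1 Lp_scale(1)[OF res_Lp p0] u] Lp_meas[OF res_Lp] _ res_mild]) simp

lemma res_sharp: "sharp_rep (res u) (res u)"
 unfolding sharp_rep_iff using res_T_max Lp_meas[OF res_Lp] res_mild by auto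

text \<open>At an outgoing point the transform of the total outgoing flux is the formula of
  \<open>res\<close> itself, and \<open>res_step\<close> gives continuity up to that point.\<close>

lemma res_trace_plus: "has_trace_plus (res u) (\<lambda>z. LINT r|\<nu>. outflux u (r, z))"
 unfolding has_trace_iff[OF mu_plus disjI1[OF refl] res_sharp]
proof (intro conjI)
 note w = HL.wint1[OF one_nu, of 1]
 note oL = Lp_op_in[OF out0_operator u] and pL = Lp_op_in[OF pass_operator flux_Lp[OF u]]
 show "(\<lambda>z. LINT r|\<nu>. outflux u (r, z)) \<in> \<B> \<mu>p" using Lp_meas[OF Lp_op_in[OF w(1) outflux_Lp[OF u]]] by simp
 have "AE z in \<mu>p. integrable \<nu> (\<lambda>r. out0 u (r, z))" "AE z in \<mu>p. integrable \<nu> (\<lambda>r. pass (flux u) (r, z))"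
  using w(2)[OF _ oL] w(2)[OF _ pL] by simp_all
 then show "AE z in \<mu>p. ((\<lambda>s. res u (\<Phi> z (- 1 * s))) ---> (LINT r|\<nu>. outflux u (r, z))) (at_right 0)"
  using AE_space[of \<mu>p]
 proof eventually_elim
  case (elim z)
  then have z: "z \<in> Gam 1" using Gam_space(1)[OF mu_plus] by simp
  have b: "(LINT r|\<nu>. outflux u (r, z)) = res u z"
   using elim(1,2) unfolding outflux_def by (simp add: LINT_pass[OF z] LINT_out0(1) res_def)
  obtain e where e: "0 < e" "ereal e < tau (-1) z"
   using Gam_tau_pos[OF z] ereal_dense2[of 0 "tau (-1) z"] by (auto simp: zero_ereal_def)
  let ?k = "\<lambda>r. discount r * u (\<Phi> z (- r))"
  let ?K = "\<lambda>s. LBINT r:{0<..<s}. ?k r"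
  have "lintegrable {0<..<0 + e} ?k" using res_step(2)[OF elim(1) e] by simp
  from set_integral_right_continuous[OF this e(1)]
  have l0: "((\<lambda>s. LBINT r:{0<..<s}. ?k r) ---> 0) (at_right 0)" by (simp add: set_lebesgue_integral_def)
  have "((\<lambda>s. discount (- s) * (res u z - ?K s)) ---> exp (- (lam * p * - 0)) * (res u z - 0)) (at_right 0)"
   unfolding discount_def[of "- _"] by (intro tendsto_intros l0)
  then have l: "((\<lambda>s. discount (- s) * (res u z - ?K s)) ---> (LINT r|\<nu>. outflux u (r, z))) (at_right 0)"
   by (simp add: b)
  have "\<forall>\<^sub>F s in at_right 0. discount (- s) * (res u z - ?K s) = res u (\<Phi> z (- 1 * s))"
   unfolding eventually_at_right_field
  proof (intro exI[of _ e] conjI e(1) allI impI)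
   fix s assume s: "0 < s" "s < e"
   then have st: "ereal s < tau (- 1) z" using e(2) by (auto intro: less_trans[of _ "ereal e"])
   have "res u z = ?K s + discount s * res u (\<Phi> z (- s))" by (rule res_step(3)[OF elim(1) s(1) st])
   then have "discount (- s) * (res u z - ?K s) = discount (- s) * (discount s * res u (\<Phi> z (- s)))" by simp
   also have "... = res u (\<Phi> z (- s))" by (simp add: mult.assoc[symmetric] discount_add[symmetric])
   finally show "discount (- s) * (res u z - ?K s) = res u (\<Phi> z (- 1 * s))" by simp
  qed
  then show ?case by (rule Lim_transform_eventually[OF l])
 qed
qed

text \<open>Near the entry point the past inside \<Omega> shrinks to nothing, and only the transform
  of the incoming flux remains.\<close>

lemma res_trace_minus: "has_trace_minus (res u) (\<lambda>y. LINT r|\<nu>. flux u (r, y))"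
 unfolding has_trace_iff[OF mu_minus disjI2[OF refl] res_sharp]
proof (intro conjI)
 show "(\<lambda>y. LINT r|\<nu>. flux u (r, y)) \<in> \<B> \<mu>m" by (rule Lp_meas[OF flux_integral_Lp])
 show "AE y in \<mu>m. ((\<lambda>s. res u (\<Phi> y (- (- 1) * s))) ---> (LINT r|\<nu>. flux u (r, y))) (at_right 0)"
  using AE_Gam_integrable[OF mu_minus u] AE_space[of \<mu>m]
 proof eventually_elim
  case (elim y)
  then have y: "y \<in> Gam (-1)" using Gam_space(1)[OF mu_minus] by simp
  let ?c = "LINT r|\<nu>. flux u (r, y)"
  obtain e where e: "0 < e" "ereal e < tau 1 y"
   using Gam_tau_pos[OF y] ereal_dense2[of 0 "tau 1 y"] by (auto simp: zero_ereal_def)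
  let ?k = "\<lambda>r. discount (- r) * u (\<Phi> y r)"
  let ?K = "\<lambda>s. LBINT r:{0<..<s}. ?k r"
  have ie: "lintegrable {0<..<e} (\<lambda>r. u (\<Phi> y r))"
  proof -
   have "lintegrable {s. 0 < s \<and> ereal s < tau (- (-1)) y \<and> s \<le> e} (\<lambda>s. u (\<Phi> y (- (-1) * s)))" using elim(1) by blast
   then have "lintegrable {s. 0 < s \<and> ereal s < tau 1 y \<and> s \<le> e} (\<lambda>s. u (\<Phi> y s))" by simp
   then show ?thesis by (rule set_integrable_subset) (use e in \<open>auto intro: less_trans[of _ "ereal e"]\<close>)
  qed
  have "lintegrable {0<..<e} ?k"
  proof (rule set_integrable_mult_bounded[OF ie, where B="exp (lam * p * e)"])
   show "\<bar>discount (- s)\<bar> \<le> exp (lam * p * e)" if "s \<in> {0<..<e}" for s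
    using that lamp by (auto simp: discount_def intro!: mult_left_mono)
  qed measurable
  then have "lintegrable {0<..<0 + e} ?k" by simp
  from set_integral_right_continuous[OF this e(1)]
  have l0: "((\<lambda>s. LBINT r:{0<..<s}. ?k r) ---> 0) (at_right 0)" by (simp add: set_lebesgue_integral_def)
  have "((\<lambda>s. discount s * (?K s + ?c)) ---> exp (- (lam * p * 0)) * (0 + ?c)) (at_right 0)"
   unfolding discount_def[of "_ :: real"] by (intro tendsto_intros l0[unfolded discount_def])
  then have l: "((\<lambda>s. discount s * (?K s + ?c)) ---> ?c) (at_right 0)" by simp
  have "\<forall>\<^sub>F s in at_right 0. discount s * (?K s + ?c) = res u (\<Phi> y (- (- 1) * s))"
   unfolding eventually_at_right_field
  proof (intro exI[of _ e] conjI e(1) allI impI)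
   fix s assume s: "0 < s" "s < e"
   then have st: "ereal s < tau (- (-1)) y" using e(2) by (auto intro: less_trans[of _ "ereal e"])
   note o = Gam_orbit(2,3)[OF y s(1) st, simplified]
   have pa: "past (\<Phi> y s) = {r. s - r \<in> {0<..<s}}" using o(1) by (auto simp: past_def)
   have d: "discount r * u (\<Phi> (\<Phi> y s) (- r)) = discount s * ?k (s - r)" for r
    using discount_add[of s "- (s - r)"] by (simp add: flow_add)
   have "(LBINT r:past (\<Phi> y s). discount r * u (\<Phi> (\<Phi> y s) (- r))) = discount s * ?K s"
    unfolding pa d using set_integral_reflect(2)[of s "{0<..<s}" "\<lambda>r. discount s * ?k r"] by simp
   then show "discount s * (?K s + ?c) = res u (\<Phi> y (- (- 1) * s))"
    using o by (simp add: res_def algebra_simps)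
  qed
  then show ?case by (rule Lim_transform_eventually[OF l])
 qed
qed

text \<open>The boundary condition is the fixed-point equation of the flux after Laplace transform:
  integration against \<open>\<nu>\<close> with weight 1 commutes with the lift of H.\<close>

lemma res_T_H: "(res u, \<lambda>x. lam * p * res u x - u x) \<in> T_H_graph"
proof -
 let ?b = "\<lambda>z. LINT r|\<nu>. outflux u (r, z)"
 note O = outflux_Lp[OF u]
 have b: "?b \<in> Lp p \<mu>p" using Lp_op_in[OF HL.wint1(1)[OF one_nu, of 1] O] by simp
 have "AE y in \<mu>m. (LINT r|\<nu>. flux u (r, y)) = (LINT r|\<nu>. HL.lift (outflux u) (r, y))"
  using Lp_op_cong[OF HL.wint2(1)[OF one_nu, of 1] flux_Lp[OF u] Lp_op_in[OF HL.lift_operator O] lift_outflux[OF u]] by simp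
 moreover have "AE y in \<mu>m. (LINT r|\<nu>. HL.lift (outflux u) (r, y)) = H ?b y"
  using HL.lift_integral[OF O one_nu, of 1] by simp
 ultimately have "AE y in \<mu>m. (LINT r|\<nu>. flux u (r, y)) = H ?b y" by eventually_elim simp
 from has_trace_AE[OF res_trace_minus this Lp_meas[OF Lp_op_in[OF H b]]]
 show ?thesis unfolding T_H_graph_def using res_T_max res_trace_plus b by blast
qed

end

end

context transport_semigroup
begin

subsection \<open>Identification of the generator\<close>

lemma derivative_diff:
 assumes f: "f \<in> X" and g: "g \<in> X" and f': "f' \<in> X" and g': "g' \<in> X"
  and d: "derivative_of f g" and d': "derivative_of f' g'" shows "derivative_of (\<lambda>x. f x - f' x) (\<lambda>x. g x - g' x)"
 unfolding derivative_of_def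
proof (rule tendsto_sandwich[OF _ _ tendsto_const])
 let ?q = "\<lambda>f g t x. (evol t f x - f x) / t - g x"
 show "((\<lambda>t. norm_X (?q f g t) + norm_X (?q f' g' t)) ---> 0) (at_right 0)"
  using tendsto_add[OF d[unfolded derivative_of_def] d'[unfolded derivative_of_def]] by simp
 show "\<forall>\<^sub>F t in at_right 0. norm_X (?q (\<lambda>x. f x - f' x) (\<lambda>x. g x - g' x) t) \<le> norm_X (?q f g t) + norm_X (?q f' g' t)"
  unfolding eventually_at_right_field
 proof (intro exI[of _ 1] conjI allI impI)
  fix t :: real assume "0 < t" "t < 1"
  then have t: "0 \<le> t" by simp
  have q: "?q f g t \<in> X" if "f \<in> X" "g \<in> X" for f g
   using Lp_diff[OF p1 Lp_scale(1)[OF Lp_diff[OF p1 evol_Lp[OF t that(1)] that(1)] p0, of "1 / t"] that(2)] by simp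
  have "AE x in \<mu>\<Omega>. ?q (\<lambda>x. f x - f' x) (\<lambda>x. g x - g' x) t x = ?q f g t x - ?q f' g' t x"
   using Lp_op_diff[OF p1 evol_operator[OF t] f f'] by eventually_elim (simp add: diff_divide_distrib)
  then have "norm_X (?q (\<lambda>x. f x - f' x) (\<lambda>x. g x - g' x) t) = norm_X (\<lambda>x. ?q f g t x - ?q f' g' t x)"
   by (rule Lp_norm_cong_AE[OF _ Lp_meas[OF q[OF Lp_diff[OF p1 f f'] Lp_diff[OF p1 g g']]] Lp_meas[OF Lp_diff[OF p1 q[OF f g] q[OF f' g']]]])
  also have "... \<le> norm_X (?q f g t) + norm_X (?q f' g' t)" by (rule Lp_norm_triangle_diff[OF p1 q[OF f g] q[OF f' g']])
  finally show "norm_X (?q (\<lambda>x. f x - f' x) (\<lambda>x. g x - g' x) t) \<le> norm_X (?q f g t) + norm_X (?q f' g' t)" .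
 qed simp
qed simp

text \<open>An eigenvector for the eigenvalue \<open>\<kappa>\<close> would satisfy \<open>evol t d = exp (\<kappa> * t) * d\<close>, which contradicts
 the growth bound \<open>exp (lam * t)\<close>. The errors of \<open>n\<close> steps of length \<open>t / n\<close> add up to \<open>o(1)\<close>.\<close>

lemma no_eigenvector:
 assumes d: "d \<in> X" and \<kappa>: "lam < \<kappa>" and ev: "derivative_of d (\<lambda>x. \<kappa> * d x)" shows "AE x in \<mu>\<Omega>. d x = 0"
proof -
 obtain C where C: "0 \<le> C" "\<And>t f. 0 \<le> t ==> f \<in> X ==> norm_X (evol t f) \<le> C * exp (lam * t) * norm_X f"
  by (rule evol_norm) blast
 \<comment> \<open>Constant in t for a genuine eigenvector; the proof shows this from the derivative
   at 0 alone.\<close>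
 define w where "w t x = exp (- (\<kappa> * t)) * evol t d x" for t x
 have w: "w t \<in> X" if "0 \<le> t" for t unfolding w_def[abs_def] by (rule Lp_scale(1)[OF evol_Lp[OF that d] p0])
 have cd: "(\<lambda>x. c * d x) \<in> X" for c by (rule Lp_scale(1)[OF d p0])
 have wn: "exp (- (\<kappa> * t)) * norm_X (evol t f) \<le> C * exp ((lam - \<kappa>) * t) * norm_X f" if "0 \<le> t" "f \<in> X" for t f
  using mult_left_mono[OF C(2)[OF that], of "exp (- (\<kappa> * t))"] by (simp add: exp_diff exp_minus field_simps left_diff_distrib)
 have step: "norm_X (\<lambda>x. w (real m * h) x - d x) \<le> real m * (C * norm_X (\<lambda>x. w h x - d x))" if h: "0 \<le> h" for m h
 proof (induction m)
  case 0
  have "norm_X (\<lambda>x. w 0 x - d x) = norm_X (\<lambda>x. 0)"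
   by (rule Lp_norm_cong_AE) (use AE_space[of \<mu>\<Omega>] in \<open>auto simp: w_def evol_0 intro!: borel_measurable_diff Lp_meas[OF evol_Lp[OF _ d]] Lp_meas[OF d]\<close>)
  then show ?case by simp
 next
  case (Suc m)
  let ?m = "real m * h" and ?d = "\<lambda>x. w h x - d x"
  have s: "real (Suc m) * h = ?m + h" and m0: "0 \<le> ?m" and mh: "0 \<le> ?m + h" using h by (simp_all add: algebra_simps)
  have dL: "?d \<in> X" by (rule Lp_diff[OF p1 w[OF h] d])
  have "norm_X (\<lambda>x. w (?m + h) x - w ?m x) = norm_X (\<lambda>x. exp (- (\<kappa> * ?m)) * evol ?m ?d x)"
  proof (rule Lp_norm_cong_AE)
   show "AE x in \<mu>\<Omega>. w (?m + h) x - w ?m x = exp (- (\<kappa> * ?m)) * evol ?m ?d x"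
    using evol_add[OF m0 h d] Lp_op_diff[OF p1 evol_operator[OF m0] w[OF h] d]
     Lp_op_scale[OF evol_operator[OF m0] evol_Lp[OF h d], of "exp (- (\<kappa> * h))"]
   proof eventually_elim
    case (elim x)
    have "exp (- (\<kappa> * (?m + h))) = exp (- (\<kappa> * ?m)) * exp (- (\<kappa> * h))" by (simp add: exp_add[symmetric] algebra_simps)
    then show ?case using elim unfolding w_def by (simp add: right_diff_distrib mult.assoc)
   qed
  qed (intro borel_measurable_diff Lp_meas[OF w[OF mh]] Lp_meas[OF w[OF m0]] Lp_meas[OF Lp_scale(1)[OF evol_Lp[OF m0 dL] p0]])+
  also have "... = exp (- (\<kappa> * ?m)) * norm_X (evol ?m ?d)" by (simp add: Lp_scale(2)[OF evol_Lp[OF m0 dL] p0])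
  also have "... \<le> C * exp ((lam - \<kappa>) * ?m) * norm_X ?d" by (rule wn[OF m0 dL])
  also have "... \<le> C * 1 * norm_X ?d"
   using \<kappa> m0 C(1) by (intro mult_right_mono mult_left_mono) (auto simp: mult_nonpos_nonneg)
  finally have "norm_X (\<lambda>x. w (?m + h) x - w ?m x) \<le> C * norm_X ?d" by simp
  then show ?case unfolding s using Suc Lp_norm_triangle_mid[OF p1 w[OF mh] w[OF m0] d] by (simp add: algebra_simps)
 qed
 have El: "((\<lambda>h. norm_X (\<lambda>x. w h x - d x) / h) ---> 0) (at_right 0)"
 proof (rule tendsto_sandwich[OF _ _ tendsto_const])
  let ?q = "\<lambda>h x. (evol h d x - d x) / h - \<kappa> * d x" and ?e = "\<lambda>h. exp (- (\<kappa> * h))"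
  \<comment> \<open>Collects what multiplies d when the quotient of \<open>w h - d\<close> is
    expressed through the given difference quotient. It tends to
    \<open>\<kappa> - \<kappa> = 0\<close>.\<close>
  let ?c = "\<lambda>h. ?e h * \<kappa> + (?e h - 1) / h"
  have e: "((\<lambda>h. exp (- (\<kappa> * h))) has_real_derivative exp (- (\<kappa> * 0)) * (- \<kappa>)) (at 0)" by (auto intro!: derivative_eq_intros)
  then have "((\<lambda>h. (?e h - 1) / h) ---> - \<kappa>) (at 0)" by (simp add: has_field_derivative_iff)
  then have "((\<lambda>h. (?e h - 1) / h) ---> - \<kappa>) (at_right 0)" by (rule filterlim_mono) (simp_all add: at_le)
  then have "((\<lambda>h. ?e h * norm_X (?q h) + \<bar>?c h\<bar> * norm_X d) ---> exp (- (\<kappa> * 0)) * 0 + \<bar>exp (- (\<kappa> * 0)) * \<kappa> + - \<kappa>\<bar> * norm_X d) (at_right 0)"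
   using ev unfolding derivative_of_def by (intro tendsto_intros)
  then show "((\<lambda>h. ?e h * norm_X (?q h) + \<bar>?c h\<bar> * norm_X d) ---> 0) (at_right 0)" by simp
  show "\<forall>\<^sub>F h in at_right 0. norm_X (\<lambda>x. w h x - d x) / h \<le> ?e h * norm_X (?q h) + \<bar>?c h\<bar> * norm_X d"
   unfolding eventually_at_right_field
  proof (intro exI[of _ 1] conjI allI impI)
   fix h :: real assume h: "0 < h" "h < 1"
   then have h0: "0 \<le> h" by simp
   have q: "?q h \<in> X"
    using Lp_diff[OF p1 Lp_scale(1)[OF Lp_diff[OF p1 evol_Lp[OF h0 d] d] p0, of "1 / h"] cd[of \<kappa>]] by simp
   have "norm_X (\<lambda>x. w h x - d x) / h = norm_X (\<lambda>x. 1 / h * (w h x - d x))"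
    unfolding Lp_scale(2)[OF Lp_diff[OF p1 w[OF h0] d] p0] using h by simp
   also have "(\<lambda>x. 1 / h * (w h x - d x)) = (\<lambda>x. ?e h * ?q h x + ?c h * d x)"
    using h by (auto simp: w_def fun_eq_iff field_simps)
   also have "norm_X \<dots> \<le> norm_X (\<lambda>x. ?e h * ?q h x) + norm_X (\<lambda>x. ?c h * d x)"
    by (rule Lp_norm_triangle[OF p1 Lp_scale(1)[OF q p0] cd])
   also have "... = ?e h * norm_X (?q h) + \<bar>?c h\<bar> * norm_X d" by (simp add: Lp_scale(2)[OF q p0] Lp_scale(2)[OF d p0])
   finally show "norm_X (\<lambda>x. w h x - d x) / h \<le> ?e h * norm_X (?q h) + \<bar>?c h\<bar> * norm_X d" .
  qed simp
 qed (auto simp: eventually_at_right_field intro: exI[of _ 1])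
 have wd: "AE x in \<mu>\<Omega>. w t x - d x = 0" if t: "0 < t" for t
 proof -
  let ?h = "\<lambda>n. t / real (Suc n)" and ?D = "\<lambda>h. norm_X (\<lambda>x. w h x - d x)"
  have "filterlim ?h (at_right 0) sequentially" unfolding filterlim_at
  proof
   show "?h ----> 0"
    by (intro tendsto_divide_0[OF tendsto_const] filterlim_compose[OF filterlim_real_at_infinity_sequentially filterlim_Suc])
  qed (use t in \<open>intro always_eventually, auto\<close>)
  from tendsto_mult_right_zero[OF filterlim_compose[OF El this], of "t * C"]
  have l: "(\<lambda>n. t * C * (?D (?h n) / ?h n)) ----> 0" .
  have "?D t \<le> t * C * (?D (?h n) / ?h n)" for n
  proof -
   have e: "real (Suc n) * ?h n = t" by simp
   have "?D t \<le> real (Suc n) * (C * ?D (?h n))" using step[of "?h n" "Suc n"] t unfolding e by simp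
   then show ?thesis using t by (simp add: mult_ac)
  qed
  then have "?D t \<le> 0" by (intro LIMSEQ_le_const[OF l]) blast
  then have "?D t = 0" by (simp add: antisym)
  then show ?thesis using t by (simp add: Lp_norm_eq_0_iff[OF Lp_diff[OF p1 w d] p0])
 qed
 have "norm_X d \<le> C * exp ((lam - \<kappa>) * real (Suc n)) * norm_X d" for n
 proof -
  have "0 < real (Suc n)" by simp
  from wd[OF this] have "AE x in \<mu>\<Omega>. d x = w (real (Suc n)) x" by eventually_elim simp
  then have "norm_X d = norm_X (w (real (Suc n)))" by (rule Lp_norm_cong_AE[OF _ Lp_meas[OF d] Lp_meas[OF w]]) simp
  then show ?thesis using wn[OF _ d, of "real (Suc n)"] by (simp add: w_def[abs_def] Lp_scale(2)[OF evol_Lp[OF _ d] p0])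
 qed
 moreover have "(\<lambda>n. C * exp ((lam - \<kappa>) * real (Suc n)) * norm_X d) ----> C * 0 * norm_X d"
  using \<kappa> by (intro tendsto_intros filterlim_compose[OF exp_at_bot] filterlim_tendsto_neg_mult_at_bot[OF tendsto_const]
    filterlim_compose[OF filterlim_real_sequentially filterlim_Suc]) simp
 ultimately have "norm_X d \<le> C * 0 * norm_X d" by (intro LIMSEQ_le_const) auto
 then have "norm_X d = 0" by (simp add: antisym)
 then show ?thesis by (simp add: Lp_norm_eq_0_iff[OF d p0])
qed

lemma T_H_graph_cong:
 assumes "(f, g) \<in> T_H_graph" "AE x in \<mu>\<Omega>. f x = f' x" "AE x in \<mu>\<Omega>. g x = g' x" and m: "f' \<in> \<B> \<mu>\<Omega>" "g' \<in> \<B> \<mu>\<Omega>"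
 shows "(f', g') \<in> T_H_graph"
proof -
 obtain b where "(f, g) \<in> T_max_graph" "b \<in> Lp p \<mu>p" "has_trace_plus f b" "has_trace_minus f (H b)"
  using assms(1) by (auto simp: T_H_graph_def)
 then show ?thesis using T_max_cong[OF _ assms(2-5)] has_trace_cong[OF _ assms(2) m(1)] unfolding T_H_graph_def by blast
qed

text \<open>For a pair (f, g) of the generator, u is chosen so that both f and \<open>res u\<close>
  solve the resolvent equation at \<open>lam * p\<close>. Their difference is an eigenvector for an
  eigenvalue beyond the growth rate, hence zero.\<close>

lemma T_H_graph_eq: "T_H_graph = {(f, g). f \<in> X \<and> g \<in> X \<and> derivative_of f g}"
proof (intro equalityI subrelI)
 fix f g assume "(f, g) \<in> T_H_graph"
 then show "(f, g) \<in> {(f, g). f \<in> X \<and> g \<in> X \<and> derivative_of f g}"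
  using T_H_derivative T_max_Lp by (auto simp: T_H_graph_def)
next
 fix f g assume "(f, g) \<in> {(f, g). f \<in> X \<and> g \<in> X \<and> derivative_of f g}"
 then have f: "f \<in> X" and g: "g \<in> X" and D: "derivative_of f g" by auto
 define u where "u x = lam * p * f x - g x" for x
 have u: "u \<in> X" unfolding u_def by (rule Lp_diff[OF p1 Lp_scale(1)[OF f p0] g])
 note R = res_Lp[OF u] and T = res_T_H[OF u]
 let ?d = "\<lambda>x. f x - res u x"
 have "derivative_of ?d (\<lambda>x. g x - (lam * p * res u x - u x))"
  by (rule derivative_diff[OF f g R Lp_diff[OF p1 Lp_scale(1)[OF R p0] u] D T_H_derivative[OF T]])
 then have "derivative_of ?d (\<lambda>x. lam * p * ?d x)" by (simp add: u_def right_diff_distrib)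
 \<comment> \<open>Here \<open>1 < p\<close> enters: it places \<open>lam * p\<close> above the
   growth rate \<open>lam\<close>.\<close>
 then have z: "AE x in \<mu>\<Omega>. ?d x = 0"
  using lam(1) p_gt_1 by (intro no_eigenvector[OF Lp_diff[OF p1 f R], where \<kappa>="lam * p"]) simp_all
 have e: "AE x in \<mu>\<Omega>. res u x = f x" using z by eventually_elim simp
 have "AE x in \<mu>\<Omega>. lam * p * res u x - u x = g x" using z by eventually_elim (simp add: u_def)
 from T_H_graph_cong[OF T e this Lp_meas[OF f] Lp_meas[OF g]] show "(f, g) \<in> T_H_graph" .
qed

lemma U_H_semigroup: "C0_semigroup p \<mu>\<Omega> U_H" unfolding C0_semigroup_def
proof (intro conjI allI impI ballI)
 show "Lp_op p \<mu>\<Omega> \<mu>\<Omega> (U_H t)" if "0 \<le> t" for t by (rule U_H_evol(1)[OF that])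
 fix f assume f: "f \<in> X"
 show "AE x in \<mu>\<Omega>. U_H 0 f x = f x"
  using U_H_evol(2)[OF order_refl f] AE_space[of \<mu>\<Omega>] by eventually_elim (simp add: evol_0)
 show "AE x in \<mu>\<Omega>. U_H (s + t) f x = U_H s (U_H t f) x" if s: "0 \<le> s" and t: "0 \<le> t" for s t
 proof -
  have Uf: "U_H t f \<in> X" by (rule Lp_op_in[OF U_H_evol(1)[OF t] f])
  have "0 \<le> s + t" using s t by simp
  from U_H_evol(2)[OF this f] evol_add[OF s t f] U_H_evol(2)[OF s Uf] Lp_op_cong[OF evol_operator[OF s] Uf evol_Lp[OF t f] U_H_evol(2)[OF t f]]
  show ?thesis by eventually_elim simp
 qed
 have "\<forall>\<^sub>F t in at_right 0. norm_X (\<lambda>x. evol t f x - f x) = norm_X (\<lambda>x. U_H t f x - f x)"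
  unfolding eventually_at_right_field
 proof (intro exI[of _ 1] conjI allI impI)
  fix t :: real assume "0 < t" "t < 1"
  then have t: "0 \<le> t" by simp
  show "norm_X (\<lambda>x. evol t f x - f x) = norm_X (\<lambda>x. U_H t f x - f x)"
  proof (rule Lp_norm_cong_AE)
   show "AE x in \<mu>\<Omega>. evol t f x - f x = U_H t f x - f x" using U_H_evol(2)[OF t f] by eventually_elim simp
  qed (intro borel_measurable_diff Lp_meas[OF evol_Lp[OF t f]] Lp_meas[OF Lp_op_in[OF U_H_evol(1)[OF t] f]] Lp_meas[OF f])+
 qed simp
 then show "((\<lambda>t. norm_X (\<lambda>x. U_H t f x - f x)) ---> 0) (at_right 0)"
  by (rule Lim_transform_eventually[OF evol_continuous[OF f]])
qed

lemma U_H_generator: "generator_graph p \<mu>\<Omega> U_H = T_H_graph"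
proof -
 have "((\<lambda>t. norm_X (\<lambda>x. (U_H t f x - f x) / t - g x)) ---> 0) (at_right 0) \<longleftrightarrow> derivative_of f g"
  if f: "f \<in> X" and g: "g \<in> X" for f g unfolding derivative_of_def
 proof (rule tendsto_cong, unfold eventually_at_right_field, intro exI[of _ 1] conjI allI impI)
  fix t :: real assume "0 < t" "t < 1"
  then have t: "0 \<le> t" by simp
  show "norm_X (\<lambda>x. (U_H t f x - f x) / t - g x) = norm_X (\<lambda>x. (evol t f x - f x) / t - g x)"
  proof (rule Lp_norm_cong_AE)
   show "AE x in \<mu>\<Omega>. (U_H t f x - f x) / t - g x = (evol t f x - f x) / t - g x" using U_H_evol(2)[OF t f] by eventually_elim simp
  qed (intro borel_measurable_diff borel_measurable_divide borel_measurable_const Lp_meas[OF evol_Lp[OF t f]]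
    Lp_meas[OF Lp_op_in[OF U_H_evol(1)[OF t] f]] Lp_meas[OF f] Lp_meas[OF g])+
 qed simp
 then show ?thesis unfolding T_H_graph_eq generator_graph_def by auto
qed

end

theorem theorem5p9:
  fixes \<Omega> :: "'a::euclidean_space set"
    and F :: "'a \<Rightarrow> 'a"
    and \<Phi> :: "'a \<Rightarrow> real \<Rightarrow> 'a"
    and \<mu> \<mu>p \<mu>m :: "'a measure"
    and p :: real
    and H :: "('a \<Rightarrow> real) \<Rightarrow> ('a \<Rightarrow> real)"
  assumes "transport_setting \<Omega> \<Phi> \<mu> \<mu>p \<mu>m F"
    and "1 < p"
    and "Lp_operator p \<mu>p \<mu>m H"
    and "Limsup (at_right 0)
           (\<lambda>\<delta>. ereal (Lp_opnorm p \<mu>p \<mu>m (\<lambda>f. H (transport_data.chi \<Omega> \<Phi> \<delta> f)))) < 1"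
  shows "(\<forall>t\<ge>0. summable (\<lambda>k. Lp_opnorm p (restrict_space \<mu> \<Omega>) (restrict_space \<mu> \<Omega>)
                             (transport_data.U \<Omega> \<Phi> \<mu> \<mu>p \<mu>m p H k t))) \<and>
         C0_semigroup p (restrict_space \<mu> \<Omega>) (transport_data.U_H \<Omega> \<Phi> \<mu> \<mu>p \<mu>m p H) \<and>
         generator_graph p (restrict_space \<mu> \<Omega>) (transport_data.U_H \<Omega> \<Phi> \<mu> \<mu>p \<mu>m p H) =
           transport_data.T_H_graph \<Omega> \<Phi> \<mu> \<mu>p \<mu>m p H"
proof -
 interpret transport_semigroup \<Omega> \<Phi> \<mu> \<mu>p \<mu>m p H F
  using assms by (intro transport_semigroup.intro transport_p.intro transport_p_axioms.intro transport_semigroup_axioms.intro)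
 show ?thesis using summable_opnorm_U U_H_semigroup U_H_generator by blast
qed

end
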